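(* Let $\hbar\in\mathbb{C}\setminus\{0\}$. Then the algebra $\mathcal{A}_\hbar(C_{n+1}^+)$ (with product $\tilde\star$ and the topology described in the context) has the following properties: (i) $\mathcal{A}_\hbar(C_{n+1}^+)$ is a Hausdorff locally convex algebra. (ii) Every evaluation functional $\delta_w\colon a\mapsto a(w)$, $w\in C_{n+1}^+$, is continuous. (iii) The completion $\widehat{\mathcal{A}}_\hbar(C_{n+1}^+)$ is a Fréchet algebra. (iv) The completion $\widehat{\mathcal{A}}_\hbar(C_{n+1}^+)$ coincides with the set of those $a=\sum a_{I,J,\gamma}\mathsf{f}_{I,J,\gamma}\in\prod_{(I,J,\gamma)}\mathbb{C}\,\mathsf{f}_{I,J,\gamma}$ having sub-factorial growth with respect to $\gamma$, i.e. for all $\epsilon>0$ there is $c>0$ with $|a_{I,J,\gamma}|\le c\,(\gamma!)^\epsilon$ for all index triples $(I,J,\gamma)$. An equivalent system of seminorms is given by $\{\|\cdot\|_\epsilon\}_{0<\epsilon<1}$, where $$\|a\|_\epsilon=\sup_{(I,J,\gamma)}\frac{|a_{I,J,\gamma}|}{(\gamma!)^\epsilon}.$$ (v) As a Fréchet space $\widehat{\mathcal{A}}_\hbar(C_{n+1}^+)$ is isomorphic to a Köthe space of sub-factorial growth. It is strongly nuclear and the Schauder basis $\{\mathsf{f}_{I,J,\gamma}\}$ is absolute. (vi) The completion $\widehat{\mathcal{A}}_\hbar(C_{n+1}^+)$ can be continuously included into the continuous functions $C^0(C_{n+1}^+)$ (with the topology of locally uniform convergence), via $a\mapsto(w\m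apsto\delta_w(a))$.
   Context: Fix $n\ge1$. On $\mathbb{C}^{n+1}$ with coordinates $z^0,\dots,z^n$ let $\mathsf{g}=\mathrm{diag}(-1,1,\dots,1)$, $y(z)=|z^0|^2-|z^1|^2-\dots-|z^n|^2$, $C_{n+1}^+=\{z\in\mathbb{C}^{n+1}: y(z)>0\}$. An index triple is $(P,Q,\alpha)$ with $P,Q\in\mathbb{N}_0^n$, $\alpha\in\mathbb{N}_0$, $|P|,|Q|\le\alpha$. Put $\mathsf{e}_{P,Q,\alpha}(z)=(z^0)^{\alpha-|P|}z^P(\bar z^0)^{\alpha-|Q|}\bar z^Q$ where $z^P=(z^1)^{P_1}\cdots(z^n)^{P_n}$; these form a basis of the $\mathrm{U}(1)$-invariant polynomials in $z,\bar z$. The Wick product of polynomials is $f\star g=\sum_{r\ge0}\frac{(2\hbar)^r}{r!}\sum_{i_1,\dots,i_r,j_1,\dots,j_r=0}^n\mathsf{g}^{i_1j_1}\cdots\mathsf{g}^{i_rj_r}\frac{\partial^rf}{\partial z^{i_1}\cdots\partial z^{i_r}}\frac{\partial^rg}{\partial\bar z^{j_1}\cdots\partial\bar z^{j_r}}$; it preserves $\mathrm{U}(1)$-invariant polynomials. With the Pochhammer symbol $(x)_r=x(x+1)\cdots(x+r-1)$, let $S$ be the (injective) linear map from $\mathrm{U}(1)$-invariant polynomials to $C^\infty(C_{n+1}^+)$ with $S\mathsf{e}_{P,Q,\alpha}=(2\hbar)^\alpha\big(\tfrac{y}{2\hbar}\big)_\alpha\frac{\mathsf{e}_{P,Q,\alpha}}{y^\alpha}$,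 and $$\mathsf{f}_{P,Q,\alpha}=\frac{1}{P!\,(\alpha-|P|)!\,Q!\,(\alpha-|Q|)!}\Big(\frac{y}{2\hbar}\Big)_\alpha\frac{\mathsf{e}_{P,Q,\alpha}}{y^\alpha}.$$ $\mathcal{A}_\hbar(C_{n+1}^+)$ is the span of the (linearly independent) functions $\mathsf{f}_{P,Q,\alpha}$, with product $a\,\tilde\star\,b=S(S^{-1}a\star S^{-1}b)$. Topology: write index triples as $\tau,\sigma,\rho$, and structure constants $\mathsf{f}_\tau\tilde\star\mathsf{f}_\sigma=\sum_\rho C^\rho_{\tau\sigma}\mathsf{f}_\rho$. For formal series $a=\sum_\tau a_\tau\mathsf{f}_\tau$ define in $[0,\infty]$: $h_{0,0,\rho}(a)=|a_\rho|$, $h_{m+1,2\ell,\rho}(a)=\sum_\tau h_{m,\ell,\tau}(a)^2\sum_\sigma|C^\rho_{\tau\sigma}|$, $h_{m+1,2\ell+1,\rho}(a)=\sum_\sigma h_{m,\ell,\sigma}(a)^2\sum_\tau|C^\rho_{\tau\sigma}|$ ($m\in\mathbb{N}_0$, $0\le\ell\le2^m-1$), $\|a\|_{m,\ell,\rho}=h_{m,\ell,\rho}(a)^{1/2^m}$, and for $w\in C_{n+1}^+$, $\|a\|_{m,\ell,\delta_w}=\big(\sum_\rho|\mathsf{f}_\rho(w)|h_{m,\ell,\rho}(a)\big)^{1/2^m}$. All these are finite on $\mathcal{A}_\hbar(C_{n+1}^+)$, which carries the locally convex topology defined by all the $\|\cdot\|_{m,\ell,\rho}$ and all the $\|\cdot\|_{m,\ell,\delta_w}$,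 $w\in C_{n+1}^+$. Its completion is identified with the space of all formal series $a\in\prod_\tau\mathbb{C}\mathsf{f}_\tau$ for which all these seminorms are finite. A locally convex (Fréchet) algebra is a locally convex (Fréchet) space with continuous product. A Köthe space of sub-factorial growth is here the space of families $(a_{I,J,\gamma})$ over index triples with sub-factorial growth in $\gamma$, with the seminorms $\|\cdot\|_\epsilon$, $0<\epsilon<1$. A Schauder basis $(\mathsf{f}_\tau)$ is absolute if for each continuous seminorm $p$ there is a continuous seminorm $q$ with $\sum_\tau|a_\tau|p(\mathsf{f}_\tau)\le q(a)$ for all $a$. Strongly nuclear: for every continuous seminorm $p$ there is a continuous seminorm $q\ge p$ such that the canonical map between the associated Banach spaces (for $q$ to that for $p$) has the form $x\mapsto\sum_k\lambda_k\varphi_k(x)y_k$ with $(\lambda_k)$ rapidly decreasing and $(\varphi_k)$, $(y_k)$ bounded. *)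

theory Defs
  imports "HOL-Analysis.Analysis" "HOL-Library.Function_Algebras"
begin

section \<open>Locally convex spaces of complex-valued functions\<close>

text \<open>
  Every vector space below is a linear subspace \<open>V\<close> of some function space \<open>'x \<Rightarrow> complex\<close> with the
  pointwise operations, and carries a topology \<open>T\<close> with \<open>topspace T = V\<close>.
\<close>

definition cscale :: "complex \<Rightarrow> ('x \<Rightarrow> complex) \<Rightarrow> 'x \<Rightarrow> complex" where
  "cscale c a = (\<lambda>x. c * a x)"

interpretation cfun: vector_space "cscale :: complex \<Rightarrow> ('x \<Rightarrow> complex) \<Rightarrow> 'x \<Rightarrow> complex"
  by unfold_locales (auto simp: cscale_def fun_eq_iff algebra_simps)

definition linear_map_on :: "('x \<Rightarrow> complex) set \<Rightarrow> (('x \<Rightarrow> complex) \<Rightarrow> ('y \<Rightarrow> complex)) \<Rightarrow> bool" where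
  "linear_map_on V \<phi> \<longleftrightarrow>
     (\<forall>a\<in>V. \<forall>b\<in>V. \<phi> (a + b) = \<phi> a + \<phi> b) \<and> (\<forall>c. \<forall>a\<in>V. \<phi> (cscale c a) = cscale c (\<phi> a))"

definition seminorm_on :: "('x \<Rightarrow> complex) set \<Rightarrow> (('x \<Rightarrow> complex) \<Rightarrow> real) \<Rightarrow> bool" where
  "seminorm_on V p \<longleftrightarrow>
     (\<forall>a\<in>V. 0 \<le> p a) \<and>
     (\<forall>a\<in>V. \<forall>b\<in>V. p (a + b) \<le> p a + p b) \<and>
     (\<forall>c. \<forall>a\<in>V. p (cscale c a) = cmod c * p a)"

definition seminorm_topology ::
  "('x \<Rightarrow> complex) set \<Rightarrow> (('x \<Rightarrow> complex) \<Rightarrow> real) set \<Rightarrow> ('x \<Rightarrow> complex) topology" where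
  "seminorm_topology V P =
     topology (\<lambda>U. U \<subseteq> V \<and>
       (\<forall>a\<in>U. \<exists>F e. finite F \<and> F \<subseteq> P \<and> 0 < e \<and> {b\<in>V. \<forall>p\<in>F. p (b - a) < e} \<subseteq> U))"

lemma openin_seminorm_topology:
  "openin (seminorm_topology V P) U \<longleftrightarrow>
     U \<subseteq> V \<and> (\<forall>a\<in>U. \<exists>F e. finite F \<and> F \<subseteq> P \<and> 0 < e \<and> {b\<in>V. \<forall>p\<in>F. p (b - a) < e} \<subseteq> U)"
proof -
  let ?O = "\<lambda>U. U \<subseteq> V \<and>
    (\<forall>a\<in>U. \<exists>F e. finite F \<and> F \<subseteq> P \<and> 0 < e \<and> {b\<in>V. \<forall>p\<in>F. p (b - a) < e} \<subseteq> U)"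
  have "istopology ?O"
    unfolding istopology_def
  proof (intro conjI allI impI ballI)
    fix S T a assume S: "?O S" and T: "?O T" and a: "a \<in> S \<inter> T"
    obtain F e where F: "finite F" "F \<subseteq> P" "0 < e" "{b\<in>V. \<forall>p\<in>F. p (b - a) < e} \<subseteq> S"
      using S a by blast
    obtain G d where G: "finite G" "G \<subseteq> P" "0 < d" "{b\<in>V. \<forall>p\<in>G. p (b - a) < d} \<subseteq> T"
      using T a by blast
    have "{b\<in>V. \<forall>p\<in>F \<union> G. p (b - a) < min e d} \<subseteq> S \<inter> T"
      using F(4) G(4) by fastforce
    then show "\<exists>F e. finite F \<and> F \<subseteq> P \<and> 0 < e \<and> {b\<in>V. \<forall>p\<in>F. p (b - a) < e} \<subseteq> S \<inter> T"
      using F(1-3) G(1-3) by (intro exI[of _ "F \<union> G"] exI[of _ "min e d"]) auto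
  next
    fix K a assume K: "\<forall>S\<in>K. ?O S" and a: "a \<in> \<Union>K"
    then obtain S where S: "S \<in> K" "a \<in> S" by blast
    have "?O S"
      using K S(1) by (rule bspec)
    then obtain F e where Fe: "finite F" "F \<subseteq> P" "0 < e" "{b\<in>V. \<forall>p\<in>F. p (b - a) < e} \<subseteq> S"
      using S(2) by meson
    have "{b\<in>V. \<forall>p\<in>F. p (b - a) < e} \<subseteq> \<Union>K"
      using Fe(4) S(1) by (meson Union_upper subset_trans)
    then show "\<exists>F e. finite F \<and> F \<subseteq> P \<and> 0 < e \<and> {b\<in>V. \<forall>p\<in>F. p (b - a) < e} \<subseteq> \<Union>K"
      using Fe(1-3) by meson
  next
    fix S T assume "?O S" "?O T"
    then show "S \<inter> T \<subseteq> V" by (meson Int_lower1 subset_trans)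
  next
    fix K assume "\<forall>S\<in>K. ?O S"
    then show "\<Union>K \<subseteq> V" by (meson Union_least)
  qed
  then show ?thesis
    unfolding seminorm_topology_def by (simp add: topology_inverse')
qed

lemma topspace_seminorm_topology [simp]: "topspace (seminorm_topology V P) = V"
proof -
  have "openin (seminorm_topology V P) V"
    unfolding openin_seminorm_topology by (intro conjI ballI subset_refl exI[of _ "{}"] exI[of _ "1 :: real"]) auto
  then show ?thesis
    using openin_topspace[of "seminorm_topology V P"]
    by (meson openin_seminorm_topology openin_subset subset_antisym)
qed

definition locally_convex_space :: "('x \<Rightarrow> complex) set \<Rightarrow> ('x \<Rightarrow> complex) topology \<Rightarrow> bool" where
  "locally_convex_space V T \<longleftrightarrow>
     cfun.subspace V \<and> (\<exists>P. (\<forall>p\<in>P. seminorm_on V p) \<and> T = seminorm_topology V P)"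

definition continuous_seminorm ::
  "('x \<Rightarrow> complex) set \<Rightarrow> ('x \<Rightarrow> complex) topology \<Rightarrow> (('x \<Rightarrow> complex) \<Rightarrow> real) \<Rightarrow> bool" where
  "continuous_seminorm V T p \<longleftrightarrow> seminorm_on V p \<and> continuous_map T euclideanreal p"

definition algebra_product ::
  "('x \<Rightarrow> complex) set \<Rightarrow> (('x \<Rightarrow> complex) \<Rightarrow> ('x \<Rightarrow> complex) \<Rightarrow> 'x \<Rightarrow> complex) \<Rightarrow> bool" where
  "algebra_product V mul \<longleftrightarrow>
     (\<forall>a\<in>V. \<forall>b\<in>V. mul a b \<in> V) \<and>
     (\<forall>a\<in>V. linear_map_on V (\<lambda>b. mul a b)) \<and>
     (\<forall>b\<in>V. linear_map_on V (\<lambda>a. mul a b)) \<and>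
     (\<forall>a\<in>V. \<forall>b\<in>V. \<forall>c\<in>V. mul (mul a b) c = mul a (mul b c))"

definition locally_convex_algebra ::
  "('x \<Rightarrow> complex) set \<Rightarrow> ('x \<Rightarrow> complex) topology \<Rightarrow>
   (('x \<Rightarrow> complex) \<Rightarrow> ('x \<Rightarrow> complex) \<Rightarrow> 'x \<Rightarrow> complex) \<Rightarrow> bool" where
  "locally_convex_algebra V T mul \<longleftrightarrow>
     locally_convex_space V T \<and> algebra_product V mul \<and>
     continuous_map (prod_topology T T) T (\<lambda>(a, b). mul a b)"

definition lc_cauchy ::
  "('x \<Rightarrow> complex) set \<Rightarrow> ('x \<Rightarrow> complex) topology \<Rightarrow> (nat \<Rightarrow> 'x \<Rightarrow> complex) \<Rightarrow> bool" where
  "lc_cauchy V T s \<longleftrightarrow>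
     (\<forall>k. s k \<in> V) \<and>
     (\<forall>p. continuous_seminorm V T p \<longrightarrow> (\<forall>e>0. \<exists>N. \<forall>i\<ge>N. \<forall>j\<ge>N. p (s i - s j) < e))"

definition frechet_space :: "('x \<Rightarrow> complex) set \<Rightarrow> ('x \<Rightarrow> complex) topology \<Rightarrow> bool" where
  "frechet_space V T \<longleftrightarrow>
     cfun.subspace V \<and> Hausdorff_space T \<and>
     (\<exists>P. countable P \<and> (\<forall>p\<in>P. seminorm_on V p) \<and> T = seminorm_topology V P) \<and>
     (\<forall>s. lc_cauchy V T s \<longrightarrow> (\<exists>a. limitin T s a sequentially))"

definition frechet_algebra ::
  "('x \<Rightarrow> complex) set \<Rightarrow> ('x \<Rightarrow> complex) topology \<Rightarrow>
   (('x \<Rightarrow> complex) \<Rightarrow> ('x \<Rightarrow> complex) \<Rightarrow> 'x \<Rightarrow> complex) \<Rightarrow> bool" where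
  "frechet_algebra V T mul \<longleftrightarrow> frechet_space V T \<and> locally_convex_algebra V T mul"

definition lc_isomorphism ::
  "('x \<Rightarrow> complex) set \<Rightarrow> ('x \<Rightarrow> complex) topology \<Rightarrow> ('y \<Rightarrow> complex) topology \<Rightarrow>
   (('x \<Rightarrow> complex) \<Rightarrow> ('y \<Rightarrow> complex)) \<Rightarrow> bool" where
  "lc_isomorphism V T T' \<phi> \<longleftrightarrow> linear_map_on V \<phi> \<and> homeomorphic_map T T' \<phi>"

text \<open>A Frechet space together with a map of the following kind is a completion of \<open>(V, T)\<close>.\<close>

definition dense_embedding ::
  "('x \<Rightarrow> complex) set \<Rightarrow> ('x \<Rightarrow> complex) topology \<Rightarrow> ('y \<Rightarrow> complex) topology \<Rightarrow>
   (('x \<Rightarrow> complex) \<Rightarrow> ('y \<Rightarrow> complex)) \<Rightarrow> bool" where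
  "dense_embedding V T T' \<iota> \<longleftrightarrow>
     linear_map_on V \<iota> \<and> embedding_map T T' \<iota> \<and> T' closure_of (\<iota> ` V) = topspace T'"


section \<open>Strong nuclearity\<close>

text \<open>
  The Banach space associated with a seminorm \<open>p\<close> on \<open>V\<close> is the completion of \<open>V / ker p\<close>, that is,
  the space \<open>cauchy_seqs V p\<close> of \<open>p\<close>-Cauchy sequences modulo the kernel of \<open>lim_seminorm p\<close>, with
  the norm induced by \<open>lim_seminorm p\<close>. Everything is written on representatives; bounded functionals
  vanish on that kernel and so descend to the quotient. For \<open>p \<le> q\<close> the canonical map sends the class
  of a \<open>q\<close>-Cauchy sequence to the class of the same sequence.
\<close>

definition cauchy_seqs ::
  "('x \<Rightarrow> complex) set \<Rightarrow> (('x \<Rightarrow> complex) \<Rightarrow> real) \<Rightarrow> (nat \<Rightarrow> 'x \<Rightarrow> complex) set" where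
  "cauchy_seqs V p =
     {x. (\<forall>j. x j \<in> V) \<and> (\<forall>e>0. \<exists>N. \<forall>i\<ge>N. \<forall>j\<ge>N. p (x i - x j) < e)}"

definition lim_seminorm ::
  "(('x \<Rightarrow> complex) \<Rightarrow> real) \<Rightarrow> (nat \<Rightarrow> 'x \<Rightarrow> complex) \<Rightarrow> real" where
  "lim_seminorm p x = lim (\<lambda>j. p (x j))"

definition rapidly_decreasing :: "(nat \<Rightarrow> complex) \<Rightarrow> bool" where
  "rapidly_decreasing lam \<longleftrightarrow> (\<forall>m. \<exists>C. \<forall>k. cmod (lam k) * real (k + 1) ^ m \<le> C)"

definition bounded_functional ::
  "('x \<Rightarrow> complex) set \<Rightarrow> (('x \<Rightarrow> complex) \<Rightarrow> real) \<Rightarrow> real \<Rightarrow> ((nat \<Rightarrow> 'x \<Rightarrow> complex) \<Rightarrow> complex) \<Rightarrow> bool" where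
  "bounded_functional V q C \<phi> \<longleftrightarrow>
     (\<forall>x\<in>cauchy_seqs V q. \<forall>y\<in>cauchy_seqs V q. \<phi> (\<lambda>j. x j + y j) = \<phi> x + \<phi> y) \<and>
     (\<forall>c. \<forall>x\<in>cauchy_seqs V q. \<phi> (\<lambda>j. cscale c (x j)) = c * \<phi> x) \<and>
     (\<forall>x\<in>cauchy_seqs V q. cmod (\<phi> x) \<le> C * lim_seminorm q x)"

definition strongly_nuclear_canonical_map ::
  "('x \<Rightarrow> complex) set \<Rightarrow> (('x \<Rightarrow> complex) \<Rightarrow> real) \<Rightarrow> (('x \<Rightarrow> complex) \<Rightarrow> real) \<Rightarrow> bool" where
  "strongly_nuclear_canonical_map V q p \<longleftrightarrow>
     (\<exists>lam \<phi> y C.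
        rapidly_decreasing lam \<and>
        (\<forall>k. bounded_functional V q C (\<phi> k)) \<and>
        (\<forall>k. y k \<in> cauchy_seqs V p \<and> lim_seminorm p (y k) \<le> C) \<and>
        (\<forall>x\<in>cauchy_seqs V q.
           (\<lambda>N. lim_seminorm p (\<lambda>j. x j - (\<Sum>k<N. cscale (lam k * \<phi> k x) (y k j)))) \<longlonglongrightarrow> 0))"

definition strongly_nuclear :: "('x \<Rightarrow> complex) set \<Rightarrow> ('x \<Rightarrow> complex) topology \<Rightarrow> bool" where
  "strongly_nuclear V T \<longleftrightarrow>
     locally_convex_space V T \<and>
     (\<forall>p. continuous_seminorm V T p \<longrightarrow>
        (\<exists>q. continuous_seminorm V T q \<and> (\<forall>a\<in>V. p a \<le> q a) \<and>
             strongly_nuclear_canonical_map V q p))"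


section \<open>Absolute Schauder bases\<close>

text \<open>
  The index set carries no order, so expansions are limits over the finite subsets of the index set.
  Continuity of the coefficient functionals makes coefficients unique also for expansions that
  merely converge along some enumeration.
\<close>

definition unordered_expansion ::
  "('x \<Rightarrow> complex) topology \<Rightarrow> ('i \<Rightarrow> 'x \<Rightarrow> complex) \<Rightarrow> ('i \<Rightarrow> complex) \<Rightarrow> ('x \<Rightarrow> complex) \<Rightarrow> bool" where
  "unordered_expansion T b c a \<longleftrightarrow>
     limitin T (\<lambda>F. \<Sum>\<tau>\<in>F. cscale (c \<tau>) (b \<tau>)) a (finite_subsets_at_top UNIV)"

definition schauder_coeff ::
  "('x \<Rightarrow> complex) topology \<Rightarrow> ('i \<Rightarrow> 'x \<Rightarrow> complex) \<Rightarrow> ('x \<Rightarrow> complex) \<Rightarrow> 'i \<Rightarrow> complex" where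
  "schauder_coeff T b a = (THE c. unordered_expansion T b c a)"

definition schauder_basis ::
  "('x \<Rightarrow> complex) set \<Rightarrow> ('x \<Rightarrow> complex) topology \<Rightarrow> ('i \<Rightarrow> 'x \<Rightarrow> complex) \<Rightarrow> bool" where
  "schauder_basis V T b \<longleftrightarrow>
     (\<forall>\<tau>. b \<tau> \<in> V) \<and> (\<forall>a\<in>V. \<exists>!c. unordered_expansion T b c a) \<and>
     (\<forall>\<tau>. continuous_map T euclidean (\<lambda>a. schauder_coeff T b a \<tau>))"

definition absolute_schauder_basis ::
  "('x \<Rightarrow> complex) set \<Rightarrow> ('x \<Rightarrow> complex) topology \<Rightarrow> ('i \<Rightarrow> 'x \<Rightarrow> complex) \<Rightarrow> bool" where
  "absolute_schauder_basis V T b \<longleftrightarrow>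
     schauder_basis V T b \<and>
     (\<forall>p. continuous_seminorm V T p \<longrightarrow>
        (\<exists>q. continuous_seminorm V T q \<and>
           (\<forall>a\<in>V. (\<lambda>\<tau>. cmod (schauder_coeff T b a \<tau>) * p (b \<tau>)) summable_on UNIV \<and>
                   (\<Sum>\<^sub>\<infinity>\<tau>. cmod (schauder_coeff T b a \<tau>) * p (b \<tau>)) \<le> q a)))"


section \<open>The Wick star product on the cone\<close>

text \<open>
  With \<open>n = CARD('n)\<close>, so that \<open>n \<ge> 1\<close> is automatic, the coordinates on complex (n+1)-space are
  indexed by \<open>'n option\<close>: \<open>z $ None\<close> is $z^0$ and the \<open>z $ Some i\<close> are $z^1, \dots, z^n$.
\<close>

type_synonym 'n pt = "complex ^ ('n option)"

definition yfun :: "'n::finite pt \<Rightarrow> real" where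
  "yfun z = (cmod (z $ None))\<^sup>2 - (\<Sum>i\<in>UNIV. (cmod (z $ Some i))\<^sup>2)"

definition C_plus :: "'n::finite pt set" where
  "C_plus = {z. 0 < yfun z}"

definition gmetric :: "'n option \<Rightarrow> 'n option \<Rightarrow> complex" where
  "gmetric i j = (if i = j then (if i = None then -1 else 1) else 0)"

typedef 'n triple = "{(P :: 'n::finite \<Rightarrow> nat, Q :: 'n \<Rightarrow> nat, \<alpha> :: nat). sum P UNIV \<le> \<alpha> \<and> sum Q UNIV \<le> \<alpha>}"
  by (rule exI[of _ "(\<lambda>_. 0, \<lambda>_. 0, 0)"]) simp

definition idxP :: "'n::finite triple \<Rightarrow> 'n \<Rightarrow> nat" where
  "idxP \<tau> = fst (Rep_triple \<tau>)"

definition idxQ :: "'n::finite triple \<Rightarrow> 'n \<Rightarrow> nat" where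
  "idxQ \<tau> = fst (snd (Rep_triple \<tau>))"

definition deg :: "'n::finite triple \<Rightarrow> nat" where
  "deg \<tau> = snd (snd (Rep_triple \<tau>))"

text \<open>Polynomials in \<open>z\<close> and its conjugate are treated as functions.\<close>

definition monomial_fun :: "('n option \<Rightarrow> nat) \<times> ('n option \<Rightarrow> nat) \<Rightarrow> 'n::finite pt \<Rightarrow> complex" where
  "monomial_fun AB z = (\<Prod>i\<in>UNIV. (z $ i) ^ fst AB i) * (\<Prod>i\<in>UNIV. cnj (z $ i) ^ snd AB i)"

definition polynomials :: "('n::finite pt \<Rightarrow> complex) set" where
  "polynomials = cfun.span (range monomial_fun)"

definition invariant_polynomials :: "('n::finite pt \<Rightarrow> complex) set" where
  "invariant_polynomials = {p \<in> polynomials. \<forall>u z. cmod u = 1 \<longrightarrow> p (u *s z) = p z}"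

definition e_fun :: "'n::finite triple \<Rightarrow> 'n pt \<Rightarrow> complex" where
  "e_fun \<tau> z =
     (z $ None) ^ (deg \<tau> - sum (idxP \<tau>) UNIV) * (\<Prod>i\<in>UNIV. (z $ Some i) ^ idxP \<tau> i) *
     cnj (z $ None) ^ (deg \<tau> - sum (idxQ \<tau>) UNIV) * (\<Prod>i\<in>UNIV. cnj (z $ Some i) ^ idxQ \<tau> i)"

text \<open>Wirtinger derivatives with respect to $z^i$ and its conjugate, through the real derivative.\<close>

definition d_z :: "'n option \<Rightarrow> ('n::finite pt \<Rightarrow> complex) \<Rightarrow> 'n pt \<Rightarrow> complex" where
  "d_z i f z =
     (frechet_derivative f (at z) (axis i 1) - \<i> * frechet_derivative f (at z) (axis i \<i>)) / 2"

definition d_zbar :: "'n option \<Rightarrow> ('n::finite pt \<Rightarrow> complex) \<Rightarrow> 'n pt \<Rightarrow> complex" where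
  "d_zbar i f z =
     (frechet_derivative f (at z) (axis i 1) + \<i> * frechet_derivative f (at z) (axis i \<i>)) / 2"

definition wick ::
  "complex \<Rightarrow> ('n::finite pt \<Rightarrow> complex) \<Rightarrow> ('n pt \<Rightarrow> complex) \<Rightarrow> 'n pt \<Rightarrow> complex" where
  "wick hb f g z =
     (\<Sum>r. (2 * hb) ^ r / fact r *
        (\<Sum>is\<in>{is. length is = r}. \<Sum>js\<in>{js. length js = r}.
           (\<Prod>k<r. gmetric (is ! k) (js ! k)) * foldr d_z is f z * foldr d_zbar js g z))"

text \<open>Functions on the cone are represented by their extension by zero to the whole space.\<close>

definition S_map :: "complex \<Rightarrow> ('n::finite pt \<Rightarrow> complex) \<Rightarrow> 'n pt \<Rightarrow> complex" where
  "S_map hb p = (\<lambda>w. if w \<in> C_plus then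
     (\<Sum>\<tau> | cfun.representation (range e_fun) p (e_fun \<tau>) \<noteq> 0.
        cfun.representation (range e_fun) p (e_fun \<tau>) *
        ((2 * hb) ^ deg \<tau> * pochhammer (of_real (yfun w) / (2 * hb)) (deg \<tau>) *
         e_fun \<tau> w / of_real (yfun w) ^ deg \<tau>))
     else 0)"

definition f_fun :: "complex \<Rightarrow> 'n::finite triple \<Rightarrow> 'n pt \<Rightarrow> complex" where
  "f_fun hb \<tau> = (\<lambda>w. if w \<in> C_plus then
     1 / ((\<Prod>i\<in>UNIV. fact (idxP \<tau> i)) * fact (deg \<tau> - sum (idxP \<tau>) UNIV) *
          (\<Prod>i\<in>UNIV. fact (idxQ \<tau> i)) * fact (deg \<tau> - sum (idxQ \<tau>) UNIV)) *
     pochhammer (of_real (yfun w) / (2 * hb)) (deg \<tau>) * e_fun \<tau> w / of_real (yfun w) ^ deg \<tau>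
     else 0)"

definition A_space :: "complex \<Rightarrow> ('n::finite pt \<Rightarrow> complex) set" where
  "A_space hb = cfun.span (range (f_fun hb))"

definition f_coeff :: "complex \<Rightarrow> ('n::finite pt \<Rightarrow> complex) \<Rightarrow> 'n triple \<Rightarrow> complex" where
  "f_coeff hb a \<tau> = cfun.representation (range (f_fun hb)) a (f_fun hb \<tau>)"

definition star_tilde ::
  "complex \<Rightarrow> ('n::finite pt \<Rightarrow> complex) \<Rightarrow> ('n pt \<Rightarrow> complex) \<Rightarrow> 'n pt \<Rightarrow> complex" where
  "star_tilde hb a b =
     S_map hb (wick hb (inv_into invariant_polynomials (S_map hb) a)
                       (inv_into invariant_polynomials (S_map hb) b))"

text \<open>\<open>struct_const hb \<tau> \<sigma> \<rho>\<close> is $C^\rho_{\tau\sigma}$.\<close>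

definition struct_const ::
  "complex \<Rightarrow> 'n::finite triple \<Rightarrow> 'n triple \<Rightarrow> 'n triple \<Rightarrow> complex" where
  "struct_const hb \<tau> \<sigma> \<rho> = f_coeff hb (star_tilde hb (f_fun hb \<tau>) (f_fun hb \<sigma>)) \<rho>"


section \<open>The topology and the completion\<close>

text \<open>Formal series in the \<open>f_fun hb \<tau>\<close> are represented by their coefficient families.\<close>

primrec h_fun ::
  "complex \<Rightarrow> nat \<Rightarrow> nat \<Rightarrow> 'n::finite triple \<Rightarrow> ('n triple \<Rightarrow> complex) \<Rightarrow> ennreal" where
  "h_fun hb 0 l \<rho> a = ennreal (cmod (a \<rho>))"
| "h_fun hb (Suc m) l \<rho> a =
     (if even l
      then \<Sum>\<^sub>\<infinity>\<tau>. (h_fun hb m (l div 2) \<tau> a)\<^sup>2 * (\<Sum>\<^sub>\<infinity>\<sigma>. ennreal (cmod (struct_const hb \<tau> \<sigma> \<rho>)))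
      else \<Sum>\<^sub>\<infinity>\<sigma>. (h_fun hb m (l div 2) \<sigma> a)\<^sup>2 * (\<Sum>\<^sub>\<infinity>\<tau>. ennreal (cmod (struct_const hb \<tau> \<sigma> \<rho>))))"

text \<open>The root of order \<open>2 ^ m\<close> on $[0,\infty]$.\<close>

definition ennroot :: "nat \<Rightarrow> ennreal \<Rightarrow> ennreal" where
  "ennroot m x = (if x = \<infinity> then \<infinity> else ennreal (enn2real x powr (1 / 2 ^ m)))"

definition snorm_idx ::
  "complex \<Rightarrow> nat \<Rightarrow> nat \<Rightarrow> 'n::finite triple \<Rightarrow> ('n triple \<Rightarrow> complex) \<Rightarrow> ennreal" where
  "snorm_idx hb m l \<rho> a = ennroot m (h_fun hb m l \<rho> a)"

definition snorm_delta ::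
  "complex \<Rightarrow> nat \<Rightarrow> nat \<Rightarrow> 'n::finite pt \<Rightarrow> ('n triple \<Rightarrow> complex) \<Rightarrow> ennreal" where
  "snorm_delta hb m l w a =
     ennroot m (\<Sum>\<^sub>\<infinity>\<rho>. ennreal (cmod (f_fun hb \<rho> w)) * h_fun hb m l \<rho> a)"

definition snorms :: "complex \<Rightarrow> (('n::finite triple \<Rightarrow> complex) \<Rightarrow> ennreal) set" where
  "snorms hb =
     {snorm_idx hb m l \<rho> | m l \<rho>. l < 2 ^ m} \<union> {snorm_delta hb m l w | m l w. l < 2 ^ m \<and> w \<in> C_plus}"

definition A_top :: "complex \<Rightarrow> ('n::finite pt \<Rightarrow> complex) topology" where
  "A_top hb = seminorm_topology (A_space hb) ((\<lambda>N a. enn2real (N (f_coeff hb a))) ` snorms hb)"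

definition A_hat :: "complex \<Rightarrow> ('n::finite triple \<Rightarrow> complex) set" where
  "A_hat hb = {a. \<forall>N\<in>snorms hb. N a < \<infinity>}"

definition A_hat_top :: "complex \<Rightarrow> ('n::finite triple \<Rightarrow> complex) topology" where
  "A_hat_top hb = seminorm_topology (A_hat hb) ((\<lambda>N a. enn2real (N a)) ` snorms hb)"


section \<open>The target spaces\<close>

definition subfactorial_growth :: "('n::finite triple \<Rightarrow> complex) set" where
  "subfactorial_growth =
     {a. \<forall>\<epsilon>>0. \<exists>c>0. \<forall>\<tau>. cmod (a \<tau>) \<le> c * (fact (deg \<tau>)) powr \<epsilon>}"

definition subfactorial_norm :: "real \<Rightarrow> ('n::finite triple \<Rightarrow> complex) \<Rightarrow> real" where
  "subfactorial_norm \<epsilon> a = (SUP \<tau>. cmod (a \<tau>) / (fact (deg \<tau>)) powr \<epsilon>)"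

definition koethe_top :: "('n::finite triple \<Rightarrow> complex) topology" where
  "koethe_top = seminorm_topology subfactorial_growth (subfactorial_norm ` {0<..<1})"

definition C0_plus :: "('n::finite pt \<Rightarrow> complex) set" where
  "C0_plus = {g. continuous_on C_plus g \<and> (\<forall>w. w \<notin> C_plus \<longrightarrow> g w = 0)}"

text \<open>The cone is open, hence locally compact, so locally uniform convergence is uniform
  convergence on compact subsets.\<close>

definition C0_plus_top :: "('n::finite pt \<Rightarrow> complex) topology" where
  "C0_plus_top = seminorm_topology C0_plus
     {\<lambda>g. SUP w\<in>K. cmod (g w) | K. compact K \<and> K \<noteq> {} \<and> K \<subseteq> C_plus}"

end

theory Submission
  imports Defs "HOL-Complex_Analysis.Conformal_Mappings"
begin

text \<open>
  A triple \<open>(P, Q, \<alpha>)\<close> is the same thing as a pair of full multi-indices \<open>M, N\<close> on all \<open>n + 1\<close> coordinates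
  with \<open>|M| = |N| = \<alpha>\<close>. For the divided monomials \<open>z\<^sup>M cnj z\<^sup>N / (M! N!)\<close> a derivative lowers an exponent
  without producing a factor, and multiplication produces binomial coefficients only. After rescaling by
  \<open>(2 \<hbar>)\<^sup>-\<^sup>\<alpha>\<close> they are the preimages of the \<open>f\<^sub>\<tau>\<close> under \<open>S\<close>, so the structure constant \<open>C\<^sup>\<rho>\<^sub>\<tau>\<^sub>\<sigma>\<close> is a signed
  count of the ways to contract \<open>r\<close> factors of \<open>\<tau>\<close> and \<open>\<sigma>\<close>, divided by \<open>r!\<close>, times two products of
  binomial coefficients of \<open>\<rho>\<close> (\<open>wick_basis_product\<close>, \<open>struct_const_eq\<close>). The parameter cancels because
  every contraction lowers the degree by one. Three properties of these constants carry the theorem: they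
  vanish unless \<open>\<tau>\<close> and \<open>\<sigma>\<close> have degree at most that of \<open>\<rho>\<close>, they are bounded by a constant times
  \<open>4 ^ deg \<rho>\<close>, and the triple of degree zero is a unit.

  By the first property each coefficient of a product depends on finitely many coefficients of the
  factors. The product therefore extends to all formal series, and associativity passes from polynomials
  to series by truncation (\<open>wick_assoc\<close>, \<open>coeff_mul_assoc\<close>). By the second property, and since
  there are at most exponentially many triples of a given degree, all sums in the recursion for \<open>h\<close>
  cost only a factor exponential in the degree. Such a factor is absorbed by any positive power of the
  factorial of the degree (\<open>power_le_fact_powr\<close>). This makes the product continuous for the norms
  \<open>\<parallel>a\<parallel>\<^sub>\<epsilon>\<close> (\<open>coeff_mul_norm_bound\<close>).

  The seminorms of the completion are compared with these norms in two steps. Upwards, a bound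
  \<open>|a\<^sub>\<tau>| \<le> s (deg \<tau>)!\<close> to the power \<open>\<epsilon>\<close> is squared \<open>m\<close> times in \<open>h\<^sub>m\<close> and becomes \<open>(deg \<tau>)!\<close> to the power
  \<open>2\<^sup>m \<epsilon>\<close>; as \<open>|f\<^sub>\<rho>(w)|\<close> decays like an exponential divided by \<open>(deg \<rho>)!\<close>, the sum over \<open>\<rho>\<close> converges as
  soon as \<open>2\<^sup>m \<epsilon> < 1\<close> (\<open>snorms_upper\<close>). Downwards, the unit gives \<open>h\<^sub>m(a) \<ge> |a\<^sub>\<rho>|\<close> to the power \<open>2\<^sup>m\<close>,
  and there is a point \<open>w\<close> of the cone at which \<open>|f\<^sub>\<rho>(w)|\<close> is also bounded below by an exponential
  divided by \<open>(deg \<rho>)!\<close>. The root of order \<open>2\<^sup>m\<close> leaves an arbitrarily small power of that factorial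
  (\<open>snorms_lower\<close>). Hence the completion is the Koethe space of sub-factorial growth
  (\<open>A_hat_eq\<close>, \<open>A_hat_top_eq\<close>). Its completeness, its absolute basis and its strong nuclearity are
  statements about weighted suprema: passing from \<open>\<epsilon>\<close> to \<open>\<epsilon>/2\<close> gains the weight \<open>(deg \<tau>)!\<close> to the power
  \<open>-\<epsilon>/2\<close>, which is rapidly decreasing along an enumeration of the triples by degree
  (\<open>graded_enumeration\<close>, \<open>koethe_nuclear_map\<close>).

  Evaluation at \<open>w\<close> converges by the same decay of \<open>|f\<^sub>\<rho>(w)|\<close>, locally uniformly in \<open>w\<close>. For its
  injectivity (\<open>evaluate_injective\<close>), replace \<open>w\<close> by \<open>t w\<close> with \<open>t > 0\<close>: only the Pochhammer factors
  change. If the sum vanishes on the cone, then \<open>\<Sum>k. (x)\<^sub>k b\<^sub>k\<close>, where \<open>b\<^sub>k\<close> collects the terms of degree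
  \<open>k\<close> at \<open>w\<close>, is an entire function of \<open>x\<close> that vanishes on a ray and so everywhere. At \<open>x = -m\<close> only
  the terms with \<open>k \<le> m\<close> survive, so the \<open>b\<^sub>k\<close> vanish one after another. Each of them is, up to a power
  of \<open>y\<close>, a homogeneous polynomial, and such a polynomial is determined by its values on the open cone.
\<close>

section \<open>Topologies of directed families of seminorms\<close>

text \<open>
  A basic neighbourhood cut out by finitely many members of \<open>P\<close> with radius \<open>e\<close> contains the one cut out by
  dominating members of \<open>Q\<close> with a radius at most \<open>e / C\<close> for each of the constants \<open>C\<close>.
\<close>

lemma seminorm_topology_mono:
  assumes "\<And>p. p \<in> P \<Longrightarrow> \<exists>q\<in>Q. \<exists>C>0. \<forall>a\<in>V. p a \<le> C * q a"
    and sub: "cfun.subspace V"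
    and U: "openin (seminorm_topology V P) U"
  shows "openin (seminorm_topology V Q) U"
  unfolding openin_seminorm_topology
proof (intro conjI ballI)
  show UV: "U \<subseteq> V" using U by (simp add: openin_seminorm_topology)
  fix a assume a: "a \<in> U"
  obtain F e where F: "finite F" "F \<subseteq> P" "0 < e" "{b\<in>V. \<forall>p\<in>F. p (b - a) < e} \<subseteq> U"
    using U a unfolding openin_seminorm_topology by meson
  have "\<forall>p\<in>F. \<exists>q C. q \<in> Q \<and> C > 0 \<and> (\<forall>a\<in>V. p a \<le> C * q a)"
    using assms(1) F(2) by (meson subsetD)
  then obtain q C where qC: "\<And>p. p \<in> F \<Longrightarrow> q p \<in> Q \<and> C p > 0 \<and> (\<forall>a\<in>V. p a \<le> C p * q p a)"
    by metis
  define e' where "e' = Min (insert 1 ((\<lambda>p. e / C p) ` F))"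
  have e': "e' > 0" "\<And>p. p \<in> F \<Longrightarrow> e' \<le> e / C p"
    using F(1,3) qC by (auto simp: e'_def)
  have "{b\<in>V. \<forall>p\<in>q ` F. p (b - a) < e'} \<subseteq> U"
  proof
    fix b assume b: "b \<in> {b\<in>V. \<forall>p\<in>q ` F. p (b - a) < e'}"
    have "b - a \<in> V" using b a UV sub by (auto intro: cfun.subspace_diff)
    have "p (b - a) < e" if p: "p \<in> F" for p
    proof -
      have "q p (b - a) < e / C p" using b p e'(2)[OF p] by auto
      then have "C p * q p (b - a) < e" using qC[OF p] by (simp add: field_simps)
      then show ?thesis using qC[OF p] \<open>b - a \<in> V\<close> by (meson le_less_trans)
    qed
    then show "b \<in> U" using F(4) b by blast
  qed
  then show "\<exists>F e. finite F \<and> F \<subseteq> Q \<and> 0 < e \<and> {b\<in>V. \<forall>p\<in>F. p (b - a) < e} \<subseteq> U"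
    using F(1) qC e'(1) by (intro exI[of _ "q ` F"] exI[of _ e']) auto
qed

lemma seminorm_topology_eqI:
  assumes "cfun.subspace V"
    and "\<And>p. p \<in> P \<Longrightarrow> \<exists>q\<in>Q. \<exists>C>0. \<forall>a\<in>V. p a \<le> C * q a"
    and "\<And>q. q \<in> Q \<Longrightarrow> \<exists>p\<in>P. \<exists>C>0. \<forall>a\<in>V. q a \<le> C * p a"
  shows "seminorm_topology V P = seminorm_topology V Q"
  unfolding topology_eq using assms seminorm_topology_mono by blast

text \<open>
  In a directed family a single seminorm replaces every finite subfamily, so that balls form a base and
  continuity becomes an estimate by one seminorm. The Koethe norms are directed because they decrease in
  \<open>\<epsilon>\<close>; all topologies of the theorem are brought to this form.
\<close>

locale seminormed_space =
  fixes V :: "('x \<Rightarrow> complex) set" and P :: "(('x \<Rightarrow> complex) \<Rightarrow> real) set"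
  assumes subspace: "cfun.subspace V"
    and seminorm: "\<And>p. p \<in> P \<Longrightarrow> seminorm_on V p"
    and nonempty: "P \<noteq> {}"
    and directed: "\<And>p q. p \<in> P \<Longrightarrow> q \<in> P \<Longrightarrow> \<exists>r\<in>P. \<forall>a\<in>V. p a \<le> r a \<and> q a \<le> r a"
begin

abbreviation "T \<equiv> seminorm_topology V P"

lemma diff_in: "a \<in> V \<Longrightarrow> b \<in> V \<Longrightarrow> a - b \<in> V"
  and add_in: "a \<in> V \<Longrightarrow> b \<in> V \<Longrightarrow> a + b \<in> V"
  and zero_in: "0 \<in> V"
  and scale_in: "a \<in> V \<Longrightarrow> cscale c a \<in> V"
  using subspace by (auto intro: cfun.subspace_diff cfun.subspace_add cfun.subspace_scale cfun.subspace_0)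

lemma triangle: "p \<in> P \<Longrightarrow> a \<in> V \<Longrightarrow> b \<in> V \<Longrightarrow> p (a + b) \<le> p a + p b"
  and scale: "p \<in> P \<Longrightarrow> a \<in> V \<Longrightarrow> p (cscale c a) = cmod c * p a"
  and nonneg: "p \<in> P \<Longrightarrow> a \<in> V \<Longrightarrow> 0 \<le> p a"
  using seminorm by (auto simp: seminorm_on_def)

lemma directed_finite:
  assumes "finite F" "F \<subseteq> P"
  shows "\<exists>r\<in>P. \<forall>p\<in>F. \<forall>a\<in>V. p a \<le> r a"
  using assms
proof (induction F)
  case empty
  then show ?case using nonempty by auto
next
  case (insert p F)
  then obtain r where r: "r \<in> P" "\<forall>p\<in>F. \<forall>a\<in>V. p a \<le> r a" by auto
  obtain s where "s \<in> P" "\<forall>a\<in>V. p a \<le> s a \<and> r a \<le> s a"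
    using directed[of p r] insert r by auto
  then show ?case using r by (intro bexI[of _ s]) force+
qed

lemma openin_iff:
  "openin T U \<longleftrightarrow> U \<subseteq> V \<and> (\<forall>a\<in>U. \<exists>p\<in>P. \<exists>e>0. {b\<in>V. p (b - a) < e} \<subseteq> U)"
proof
  assume U: "openin T U"
  show "U \<subseteq> V \<and> (\<forall>a\<in>U. \<exists>p\<in>P. \<exists>e>0. {b\<in>V. p (b - a) < e} \<subseteq> U)"
  proof (intro conjI ballI)
    show UV: "U \<subseteq> V" using U by (simp add: openin_seminorm_topology)
    fix a assume a: "a \<in> U"
    obtain F e where F: "finite F" "F \<subseteq> P" "0 < e" "{b\<in>V. \<forall>p\<in>F. p (b - a) < e} \<subseteq> U"
      using U a unfolding openin_seminorm_topology by meson
    obtain r where r: "r \<in> P" "\<forall>p\<in>F. \<forall>a\<in>V. p a \<le> r a"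
      using directed_finite[OF F(1,2)] by blast
    have "{b\<in>V. r (b - a) < e} \<subseteq> {b\<in>V. \<forall>p\<in>F. p (b - a) < e}"
      using r a UV diff_in by (auto) (meson le_less_trans subsetD)
    then show "\<exists>p\<in>P. \<exists>e>0. {b\<in>V. p (b - a) < e} \<subseteq> U" using r F by blast
  qed
next
  assume R: "U \<subseteq> V \<and> (\<forall>a\<in>U. \<exists>p\<in>P. \<exists>e>0. {b\<in>V. p (b - a) < e} \<subseteq> U)"
  show "openin T U"
    unfolding openin_seminorm_topology
  proof (intro conjI ballI)
    show "U \<subseteq> V" using R by auto
    fix a assume "a \<in> U"
    then obtain p e where "p \<in> P" "e > 0" "{b\<in>V. p (b - a) < e} \<subseteq> U" using R by meson
    then show "\<exists>F e. finite F \<and> F \<subseteq> P \<and> 0 < e \<and> {b\<in>V. \<forall>p\<in>F. p (b - a) < e} \<subseteq> U"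
      by (intro exI[of _ "{p}"] exI[of _ e]) auto
  qed
qed

lemma openin_ball:
  assumes "p \<in> P" "a \<in> V"
  shows "openin T {b\<in>V. p (b - a) < e}"
  unfolding openin_iff
proof (intro conjI ballI)
  fix b assume b: "b \<in> {b\<in>V. p (b - a) < e}"
  have "{c\<in>V. p (c - b) < e - p (b - a)} \<subseteq> {b\<in>V. p (b - a) < e}"
  proof
    fix c assume c: "c \<in> {c\<in>V. p (c - b) < e - p (b - a)}"
    have "p ((c - b) + (b - a)) \<le> p (c - b) + p (b - a)"
      using assms b c by (intro triangle[OF assms(1)] diff_in) auto
    then show "c \<in> {b\<in>V. p (b - a) < e}" using c by simp
  qed
  then show "\<exists>q\<in>P. \<exists>d>0. {c\<in>V. q (c - b) < d} \<subseteq> {b\<in>V. p (b - a) < e}"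
    using assms b by (intro bexI[of _ p] exI[of _ "e - p (b - a)"]) auto
qed auto

lemma seminorm_zero: "p \<in> P \<Longrightarrow> p 0 = 0"
  using scale[of p 0 0] zero_in by (simp add: cscale_def zero_fun_def)

lemma limitin_iff:
  "limitin T s a Fl \<longleftrightarrow> a \<in> V \<and> (\<forall>p\<in>P. \<forall>e>0. eventually (\<lambda>x. s x \<in> V \<and> p (s x - a) < e) Fl)"
proof
  assume L: "limitin T s a Fl"
  have aV: "a \<in> V" using L by (simp add: limitin_def)
  show "a \<in> V \<and> (\<forall>p\<in>P. \<forall>e>0. eventually (\<lambda>x. s x \<in> V \<and> p (s x - a) < e) Fl)"
  proof (intro conjI ballI allI impI aV)
    fix p and e :: real assume p: "p \<in> P" "e > 0"
    have "a \<in> {b\<in>V. p (b - a) < e}" using aV p seminorm_zero[OF p(1)] by auto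
    then have "eventually (\<lambda>x. s x \<in> {b\<in>V. p (b - a) < e}) Fl"
      using L openin_ball[OF p(1) aV, of e] unfolding limitin_def by blast
    then show "eventually (\<lambda>x. s x \<in> V \<and> p (s x - a) < e) Fl" by simp
  qed
next
  assume R: "a \<in> V \<and> (\<forall>p\<in>P. \<forall>e>0. eventually (\<lambda>x. s x \<in> V \<and> p (s x - a) < e) Fl)"
  show "limitin T s a Fl"
    unfolding limitin_def
  proof (intro conjI allI impI)
    show "a \<in> topspace T" using R by simp
    fix U assume U: "openin T U \<and> a \<in> U"
    then obtain p e where "p \<in> P" "e > 0" "{b\<in>V. p (b - a) < e} \<subseteq> U"
      unfolding openin_iff by meson
    moreover then have "eventually (\<lambda>x. s x \<in> V \<and> p (s x - a) < e) Fl" using R by blast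
    ultimately show "eventually (\<lambda>x. s x \<in> U) Fl"
      by (auto elim!: eventually_mono)
  qed
qed

lemma continuous_map_linear:
  assumes lin: "linear_map_on V \<phi>" and W: "\<phi> ` V \<subseteq> W"
    and bound: "\<And>q. q \<in> Q \<Longrightarrow> \<exists>p\<in>P. \<exists>C>0. \<forall>a\<in>V. q (\<phi> a) \<le> C * p a"
  shows "continuous_map T (seminorm_topology W Q) \<phi>"
  unfolding continuous_map_def
proof (intro conjI allI impI)
  show "\<phi> \<in> topspace T \<rightarrow> topspace (seminorm_topology W Q)" using W by auto
  fix U assume U: "openin (seminorm_topology W Q) U"
  have diff: "\<phi> (b - a) = \<phi> b - \<phi> a" if "a \<in> V" "b \<in> V" for a b
  proof -
    have "\<phi> ((b - a) + a) = \<phi> (b - a) + \<phi> a" using lin that diff_in unfolding linear_map_on_def by blast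
    then show ?thesis by simp
  qed
  show "openin T {x \<in> topspace T. \<phi> x \<in> U}"
    unfolding openin_iff
  proof (intro conjI ballI)
    fix a assume a: "a \<in> {x \<in> topspace T. \<phi> x \<in> U}"
    then obtain F e where F: "finite F" "F \<subseteq> Q" "0 < e" "{b\<in>W. \<forall>q\<in>F. q (b - \<phi> a) < e} \<subseteq> U"
      using U unfolding openin_seminorm_topology by blast
    have "\<forall>q\<in>F. \<exists>p C. p \<in> P \<and> C > 0 \<and> (\<forall>a\<in>V. q (\<phi> a) \<le> C * p a)"
      using bound F(2) by (meson subsetD)
    then obtain p C where pC: "\<And>q. q \<in> F \<Longrightarrow> p q \<in> P \<and> C q > 0 \<and> (\<forall>a\<in>V. q (\<phi> a) \<le> C q * p q a)"
      by metis
    obtain r where r: "r \<in> P" "\<forall>s\<in>p ` F. \<forall>a\<in>V. s a \<le> r a"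
      using directed_finite[of "p ` F"] F(1) pC by auto
    define d where "d = Min (insert 1 ((\<lambda>q. e / C q) ` F))"
    have d: "d > 0" "\<And>q. q \<in> F \<Longrightarrow> d \<le> e / C q"
      using F(1,3) pC by (auto simp: d_def)
    have "{b\<in>V. r (b - a) < d} \<subseteq> {x \<in> topspace T. \<phi> x \<in> U}"
    proof
      fix b assume b: "b \<in> {b\<in>V. r (b - a) < d}"
      have ba: "b - a \<in> V" using a b diff_in by auto
      have "q (\<phi> b - \<phi> a) < e" if q: "q \<in> F" for q
      proof -
        have "p q (b - a) < e / C q" using r(2) ba b d(2)[OF q] q by fastforce
        then have "C q * p q (b - a) < e" using pC[OF q] by (simp add: field_simps)
        then have "q (\<phi> (b - a)) < e" using pC[OF q] ba by (meson le_less_trans)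
        then show ?thesis using diff a b by auto
      qed
      then have "\<phi> b \<in> U" using F(4) W b by auto
      then show "b \<in> {x \<in> topspace T. \<phi> x \<in> U}" using b by simp
    qed
    then show "\<exists>p\<in>P. \<exists>e>0. {b\<in>V. p (b - a) < e} \<subseteq> {x \<in> topspace T. \<phi> x \<in> U}"
      using r(1) d(1) by blast
  qed auto
qed

lemma continuous_map_functional:
  fixes \<phi> :: "('x \<Rightarrow> complex) \<Rightarrow> complex"
  assumes lin: "\<And>a b. a \<in> V \<Longrightarrow> b \<in> V \<Longrightarrow> \<phi> (b - a) = \<phi> b - \<phi> a"
    and p: "p \<in> P" and bound: "\<And>a. a \<in> V \<Longrightarrow> cmod (\<phi> a) \<le> C * p a"
  shows "continuous_map T euclidean \<phi>"
  unfolding continuous_map_def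
proof (intro conjI allI impI)
  show "\<phi> \<in> topspace T \<rightarrow> topspace euclidean" by auto
  fix U :: "complex set" assume U: "openin euclidean U"
  show "openin T {x \<in> topspace T. \<phi> x \<in> U}"
    unfolding openin_iff
  proof (intro conjI ballI)
    fix a assume a: "a \<in> {x \<in> topspace T. \<phi> x \<in> U}"
    then obtain e where e: "e > 0" "\<And>y. dist y (\<phi> a) < e \<Longrightarrow> y \<in> U"
      using U by (auto simp: open_dist)
    have "\<phi> b \<in> U" if b: "b \<in> V" "p (b - a) < e / (\<bar>C\<bar> + 1)" for b
    proof -
      have aV: "a \<in> V" using a by simp
      have "cmod (\<phi> b - \<phi> a) \<le> C * p (b - a)"
        using bound[OF diff_in[OF b(1) aV]] lin[OF aV b(1)] by simp
      also have "\<dots> \<le> (\<bar>C\<bar> + 1) * p (b - a)"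
        using nonneg[OF p diff_in[OF b(1) aV]] by (intro mult_right_mono) auto
      also have "\<dots> < e" using b(2) by (simp add: field_simps)
      finally show ?thesis by (intro e(2)) (simp add: dist_norm)
    qed
    then show "\<exists>p\<in>P. \<exists>e>0. {b\<in>V. p (b - a) < e} \<subseteq> {x \<in> topspace T. \<phi> x \<in> U}"
      using p e(1) by (intro bexI[of _ p] exI[of _ "e / (\<bar>C\<bar> + 1)"]) auto
  qed auto
qed

text \<open>
  Continuity at \<open>(a, b)\<close> follows from \<open>(a + x)(b + y) - ab = ay + xb + xy\<close>, where each of the three terms
  is made smaller than \<open>e / 3\<close>.
\<close>

lemma continuous_map_bilinear:
  assumes alg: "algebra_product V mul"
    and bound: "\<And>p. p \<in> P \<Longrightarrow> \<exists>q\<in>P. \<exists>C>0. \<forall>a\<in>V. \<forall>b\<in>V. p (mul a b) \<le> C * q a * q b"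
  shows "continuous_map (prod_topology T T) T (\<lambda>(a, b). mul a b)"
  unfolding continuous_map_def
proof (intro conjI allI impI)
  have mulV: "mul a b \<in> V" if "a \<in> V" "b \<in> V" for a b
    using alg that by (auto simp: algebra_product_def)
  show "(\<lambda>(a, b). mul a b) \<in> topspace (prod_topology T T) \<rightarrow> topspace T" using mulV by auto
  have add1: "mul (a + a') b = mul a b + mul a' b" if "a \<in> V" "a' \<in> V" "b \<in> V" for a a' b
    using alg that by (auto simp: algebra_product_def linear_map_on_def)
  have add2: "mul b (a + a') = mul b a + mul b a'" if "a \<in> V" "a' \<in> V" "b \<in> V" for a a' b
    using alg that by (auto simp: algebra_product_def linear_map_on_def)
  fix U assume U: "openin T U"
  show "openin (prod_topology T T) {x \<in> topspace (prod_topology T T). (case x of (a, b) \<Rightarrow> mul a b) \<in> U}"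
    unfolding openin_prod_topology_alt
  proof (intro allI impI)
    fix a b assume ab: "(a, b) \<in> {x \<in> topspace (prod_topology T T). (case x of (a, b) \<Rightarrow> mul a b) \<in> U}"
    then have aV: "a \<in> V" and bV: "b \<in> V" and abU: "mul a b \<in> U" by auto
    obtain p e where pe: "p \<in> P" "e > 0" "{c\<in>V. p (c - mul a b) < e} \<subseteq> U"
      using U abU unfolding openin_iff by meson
    obtain q C where qC: "q \<in> P" "C > 0" "\<And>a b. a \<in> V \<Longrightarrow> b \<in> V \<Longrightarrow> p (mul a b) \<le> C * q a * q b"
      using bound[OF pe(1)] by metis
    \<comment> \<open>\<open>L\<close> bounds \<open>q a\<close>, \<open>q b\<close> and also \<open>q x\<close>, which is at most \<open>d \<le> 1 \<le> L\<close>.\<close>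
    define L where "L = q a + q b + 1"
    have L: "L > 0" "q a \<le> L" "q b \<le> L" "1 \<le> L"
      using nonneg[OF qC(1)] aV bV by (auto simp: L_def add_pos_nonneg add_nonneg_pos)
    define d where "d = min 1 (e / (3 * C * L))"
    have d: "d > 0" "d \<le> 1" "d \<le> e / (3 * C * L)" using pe(2) qC(2) L by (auto simp: d_def)
    have dCL: "3 * (C * L * d) \<le> e" using d(3) qC(2) L(1) by (simp add: field_simps)
    have "mul a' b' \<in> U" if a': "a' \<in> V" "q (a' - a) < d" and b': "b' \<in> V" "q (b' - b) < d" for a' b'
    proof -
      define x where "x = a' - a"
      define y where "y = b' - b"
      have xV: "x \<in> V" and yV: "y \<in> V" using a' b' aV bV diff_in by (auto simp: x_def y_def)
      have qx: "0 \<le> q x" "q x < d" and qy: "0 \<le> q y" "q y < d"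
        using a' b' nonneg[OF qC(1)] xV yV by (auto simp: x_def y_def)
      have ax: "a' = a + x" and bx: "b' = b + y" by (auto simp: x_def y_def)
      have eq: "mul a' b' - mul a b = mul a y + (mul x b + mul x y)"
        unfolding ax bx using aV bV xV yV add_in by (simp add: add1 add2)
      have "p (mul a y + (mul x b + mul x y)) \<le> p (mul a y) + p (mul x b + mul x y)"
        using aV bV xV yV by (intro triangle[OF pe(1)] mulV add_in)
      also have "p (mul x b + mul x y) \<le> p (mul x b) + p (mul x y)"
        using aV bV xV yV by (intro triangle[OF pe(1)] mulV add_in)
      also have "p (mul a y) < C * L * d"
      proof -
        have "p (mul a y) \<le> C * q a * q y" using qC(3) aV yV by blast
        also have "\<dots> \<le> C * L * q y" using L qy qC(2) by (intro mult_right_mono mult_left_mono) auto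
        also have "\<dots> < C * L * d" using qy L qC(2) by (intro mult_strict_left_mono) auto
        finally show ?thesis .
      qed
      also have "p (mul x b) < C * L * d"
      proof -
        have "p (mul x b) \<le> C * q x * q b" using qC(3) bV xV by blast
        also have "\<dots> = C * q b * q x" by simp
        also have "\<dots> \<le> C * L * q x" using L qx qC(2) by (intro mult_right_mono mult_left_mono) auto
        also have "\<dots> < C * L * d" using qx L qC(2) by (intro mult_strict_left_mono) auto
        finally show ?thesis .
      qed
      also have "p (mul x y) < C * L * d"
      proof -
        have "p (mul x y) \<le> C * q x * q y" using qC(3) yV xV by blast
        also have "\<dots> \<le> C * L * q y" using L qx qy d qC(2) by (intro mult_right_mono mult_left_mono) auto
        also have "\<dots> < C * L * d" using qy L qC(2) by (intro mult_strict_left_mono) auto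
        finally show ?thesis .
      qed
      finally have "p (mul a' b' - mul a b) < e" using dCL unfolding eq by linarith
      then show ?thesis using pe(3) mulV a' b' by auto
    qed
    moreover have "a \<in> {a'\<in>V. q (a' - a) < d}" "b \<in> {b'\<in>V. q (b' - b) < d}"
      using aV bV d seminorm_zero[OF qC(1)] by auto
    ultimately show "\<exists>U' W. openin T U' \<and> openin T W \<and> a \<in> U' \<and> b \<in> W \<and>
        U' \<times> W \<subseteq> {x \<in> topspace (prod_topology T T). (case x of (a, b) \<Rightarrow> mul a b) \<in> U}"
      using openin_ball[OF qC(1) aV, of d] openin_ball[OF qC(1) bV, of d]
      by (intro exI[of _ "{a'\<in>V. q (a' - a) < d}"] exI[of _ "{b'\<in>V. q (b' - b) < d}"]) auto
  qed
qed

lemma continuous_seminorm_member: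
  assumes "p \<in> P" "C \<ge> 0"
  shows "continuous_seminorm V T (\<lambda>a. C * p a)"
proof -
  have sn: "seminorm_on V (\<lambda>a. C * p a)"
    using assms triangle scale nonneg
    by (auto simp: seminorm_on_def mult.left_commute simp flip: distrib_left intro!: mult_left_mono)
  have "continuous_map T euclideanreal p"
    unfolding continuous_map_def
  proof (intro conjI allI impI)
    fix U :: "real set" assume U: "openin euclidean U"
    show "openin T {x \<in> topspace T. p x \<in> U}"
      unfolding openin_iff
    proof (intro conjI ballI)
      fix a assume a: "a \<in> {x \<in> topspace T. p x \<in> U}"
      then obtain e where e: "e > 0" "\<And>y. dist y (p a) < e \<Longrightarrow> y \<in> U"
        using U by (auto simp: open_dist)
      have aV: "a \<in> V" using a by simp
      have "p b \<in> U" if b: "b \<in> V" "p (b - a) < e" for b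
      proof -
        have "p ((b - a) + a) \<le> p (b - a) + p a" by (intro triangle assms diff_in b aV)
        moreover have "p ((a - b) + b) \<le> p (a - b) + p b" by (intro triangle assms diff_in b aV)
        moreover have "p (a - b) = p (b - a)"
        proof -
          have "a - b = cscale (-1) (b - a)" by (auto simp: cscale_def)
          then show ?thesis using scale[OF assms(1) diff_in[OF b(1) aV], of "-1"] by simp
        qed
        ultimately show ?thesis using b by (intro e(2)) (simp add: dist_real_def)
      qed
      then show "\<exists>p'\<in>P. \<exists>e>0. {b\<in>V. p' (b - a) < e} \<subseteq> {x \<in> topspace T. p x \<in> U}"
        using assms(1) e(1) by (intro bexI[of _ p] exI[of _ e]) auto
    qed auto
  qed auto
  then have "continuous_map T euclideanreal (\<lambda>a. C * p a)"
    by (intro continuous_map_real_mult_left)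
  then show ?thesis using sn by (simp add: continuous_seminorm_def)
qed

text \<open>
  A continuous seminorm is less than 1 on some ball of radius \<open>e\<close> around 0, and homogeneity turns this
  into a linear bound.
\<close>

lemma continuous_seminorm_bound:
  assumes "continuous_seminorm V T p"
  shows "\<exists>q\<in>P. \<exists>C>0. \<forall>a\<in>V. p a \<le> C * q a"
proof -
  have sn: "seminorm_on V p" and cont: "continuous_map T euclideanreal p"
    using assms by (auto simp: continuous_seminorm_def)
  have p0: "p 0 = 0"
  proof -
    have "p (cscale 0 0) = cmod 0 * p 0"
      using sn zero_in unfolding seminorm_on_def by blast
    then show ?thesis by (simp add: cscale_def zero_fun_def)
  qed
  have "openin T {x \<in> topspace T. p x \<in> {..<1}}"
    by (rule openin_continuous_map_preimage[OF cont]) simp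
  moreover have "0 \<in> {x \<in> topspace T. p x \<in> {..<1}}" using p0 zero_in by simp
  ultimately obtain q e where q: "q \<in> P" "e > 0" "{b\<in>V. q (b - 0) < e} \<subseteq> {x \<in> topspace T. p x \<in> {..<1}}"
    unfolding openin_iff by blast
  have "p a \<le> (2 / e) * q a" if a: "a \<in> V" for a
  proof (rule field_le_epsilon)
    fix t :: real assume t: "t > 0"
    \<comment> \<open>The summand \<open>t\<close> keeps the scaling factor positive when \<open>q a = 0\<close>.\<close>
    define s where "s = (2 / e) * q a + t"
    have s: "s > 0" using nonneg[OF q(1) a] q(2) t by (simp add: s_def add_nonneg_pos)
    have "q (cscale (1 / s) a) = q a / s" using scale[OF q(1) a] s by (simp add: norm_divide)
    also have "\<dots> < e"
    proof -
      have "q a < e * s" using nonneg[OF q(1) a] q(2) t by (simp add: s_def field_simps add_nonneg_pos)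
      then show ?thesis using s by (simp add: field_simps)
    qed
    finally have "p (cscale (1 / s) a) < 1" using q(3) scale_in[OF a] by auto
    moreover have "p (cscale (1 / s) a) = p a / s"
      using sn a s by (simp add: seminorm_on_def norm_divide)
    ultimately show "p a \<le> (2 / e) * q a + t" using s by (simp add: field_simps s_def)
  qed
  then show ?thesis using q by (intro bexI[of _ q] exI[of _ "2 / e"]) auto
qed

lemma Hausdorff:
  assumes "\<And>a. a \<in> V \<Longrightarrow> (\<And>p. p \<in> P \<Longrightarrow> p a = 0) \<Longrightarrow> a = 0"
  shows "Hausdorff_space T"
  unfolding Hausdorff_space_def
proof (intro allI impI)
  fix a b assume ab: "a \<in> topspace T \<and> b \<in> topspace T \<and> a \<noteq> b"
  then have aV: "a \<in> V" and bV: "b \<in> V" by auto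
  have "b - a \<noteq> 0" using ab by auto
  then obtain p where p: "p \<in> P" "p (b - a) \<noteq> 0"
    using assms[OF diff_in[OF bV aV]] by blast
  define e where "e = p (b - a) / 2"
  have e: "e > 0" using p nonneg[OF p(1) diff_in[OF bV aV]] by (auto simp: e_def)
  have "disjnt {c\<in>V. p (c - a) < e} {c\<in>V. p (c - b) < e}"
    unfolding disjnt_iff
  proof (intro allI notI)
    fix c assume "c \<in> {c\<in>V. p (c - a) < e} \<and> c \<in> {c\<in>V. p (c - b) < e}"
    then have c: "c \<in> V" "p (c - a) < e" "p (c - b) < e" by auto
    have "b - c = cscale (-1) (c - b)" by (auto simp: cscale_def)
    then have "p (b - c) = p (c - b)"
      using scale[OF p(1) diff_in[OF c(1) bV], of "-1"] by simp
    moreover have "p ((b - c) + (c - a)) \<le> p (b - c) + p (c - a)"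
      by (intro triangle p diff_in c aV bV)
    ultimately show False using c by (simp add: e_def)
  qed
  then show "\<exists>U W. openin T U \<and> openin T W \<and> a \<in> U \<and> b \<in> W \<and> disjnt U W"
    using openin_ball[OF p(1) aV, of e] openin_ball[OF p(1) bV, of e] e aV bV seminorm_zero[OF p(1)]
    by (intro exI[of _ "{c\<in>V. p (c - a) < e}"] exI[of _ "{c\<in>V. p (c - b) < e}"]) auto
qed

text \<open>
  An open subset of \<open>W\<close> is the trace of the largest open set whose trace lies in it; the balls of \<open>V\<close>
  around its points belong to that open set.
\<close>

lemma subtopology_subspace:
  assumes "W \<subseteq> V"
  shows "subtopology T W = seminorm_topology W P"
  unfolding topology_eq
proof (intro allI iffI)
  fix U assume "openin (subtopology T W) U"
  then obtain O' where O: "openin T O'" "U = O' \<inter> W" by (auto simp: openin_subtopology)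
  show "openin (seminorm_topology W P) U"
    unfolding openin_seminorm_topology
  proof (intro conjI ballI)
    fix a assume "a \<in> U"
    then obtain p e where "p \<in> P" "e > 0" "{b\<in>V. p (b - a) < e} \<subseteq> O'"
      using O(1) unfolding O(2) openin_iff by blast
    then show "\<exists>F e. finite F \<and> F \<subseteq> P \<and> 0 < e \<and> {b\<in>W. \<forall>p\<in>F. p (b - a) < e} \<subseteq> U"
      using O assms by (intro exI[of _ "{p}"] exI[of _ e]) auto
  qed (use O in auto)
next
  fix U assume U: "openin (seminorm_topology W P) U"
  define O' where "O' = \<Union>{B. openin T B \<and> B \<inter> W \<subseteq> U}"
  have "openin T O'" unfolding O'_def by (intro openin_Union) auto
  moreover have "U \<subseteq> O' \<inter> W"
  proof
    fix a assume a: "a \<in> U"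
    have aW: "a \<in> W" using U a by (auto simp: openin_seminorm_topology)
    then have aV: "a \<in> V" using assms by auto
    obtain F e where F: "finite F" "F \<subseteq> P" "0 < e" "{b\<in>W. \<forall>p\<in>F. p (b - a) < e} \<subseteq> U"
      using U a unfolding openin_seminorm_topology by meson
    obtain r where r: "r \<in> P" "\<forall>p\<in>F. \<forall>a\<in>V. p a \<le> r a"
      using directed_finite[OF F(1,2)] by blast
    have "{b\<in>V. r (b - a) < e} \<inter> W \<subseteq> {b\<in>W. \<forall>p\<in>F. p (b - a) < e}"
      using r aV assms diff_in by auto (meson le_less_trans)
    then have "{b\<in>V. r (b - a) < e} \<inter> W \<subseteq> U" using F(4) by (rule subset_trans)
    then have "{b\<in>V. r (b - a) < e} \<subseteq> O'"
      unfolding O'_def using openin_ball[OF r(1) aV, of e] by (intro Union_upper) simp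
    then show "a \<in> O' \<inter> W" using aW aV seminorm_zero[OF r(1)] F(3) by auto
  qed
  moreover have "O' \<inter> W \<subseteq> U" unfolding O'_def by auto
  ultimately show "openin (subtopology T W) U"
    by (metis openin_subtopology subset_antisym)
qed

end

section \<open>Index triples and factorial estimates\<close>

text \<open>
  \<open>fullP \<tau>\<close> and \<open>fullQ \<tau>\<close> include the exponents of \<open>z\<^sup>0\<close> and of its conjugate, so that all coordinates are
  treated alike and both multi-indices have total degree \<open>deg \<tau>\<close>.
\<close>

definition fullP :: "'n::finite triple \<Rightarrow> 'n option \<Rightarrow> nat" where
  "fullP \<tau> = case_option (deg \<tau> - sum (idxP \<tau>) UNIV) (idxP \<tau>)"

definition fullQ :: "'n::finite triple \<Rightarrow> 'n option \<Rightarrow> nat" where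
  "fullQ \<tau> = case_option (deg \<tau> - sum (idxQ \<tau>) UNIV) (idxQ \<tau>)"

definition mk_triple :: "('n option \<Rightarrow> nat) \<Rightarrow> ('n option \<Rightarrow> nat) \<Rightarrow> 'n::finite triple" where
  "mk_triple A B = Abs_triple (\<lambda>j. A (Some j), \<lambda>j. B (Some j), sum A UNIV)"

lemma sum_option: "sum A (UNIV :: 'n::finite option set) = A None + (\<Sum>j\<in>UNIV. A (Some j))"
  for A :: "'n::finite option \<Rightarrow> 'a::comm_monoid_add"
  by (simp add: UNIV_option_conv sum.reindex)

lemma prod_option: "prod A (UNIV :: 'n::finite option set) = A None * (\<Prod>j\<in>UNIV. A (Some j))"
  for A :: "'n::finite option \<Rightarrow> 'a::comm_monoid_mult"
  by (simp add: UNIV_option_conv prod.reindex)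

lemma idx_le_deg: "sum (idxP \<tau>) UNIV \<le> deg \<tau>" "sum (idxQ \<tau>) UNIV \<le> deg \<tau>"
  using Rep_triple[of \<tau>] by (auto simp: idxP_def idxQ_def deg_def)

lemma sum_full [simp]: "sum (fullP \<tau>) UNIV = deg \<tau>" "sum (fullQ \<tau>) UNIV = deg \<tau>"
  using idx_le_deg[of \<tau>] by (simp_all add: sum_option fullP_def fullQ_def)

lemma triple_eqI:
  assumes "fullP \<tau> = fullP \<sigma>" "fullQ \<tau> = fullQ \<sigma>"
  shows "\<tau> = \<sigma>"
proof -
  have P: "idxP \<tau> j = idxP \<sigma> j" for j using fun_cong[OF assms(1), of "Some j"] by (simp add: fullP_def)
  have Q: "idxQ \<tau> j = idxQ \<sigma> j" for j using fun_cong[OF assms(2), of "Some j"] by (simp add: fullQ_def)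
  have "deg \<tau> = deg \<sigma>" using assms(1) sum_full(1) by metis
  then have "Rep_triple \<tau> = Rep_triple \<sigma>"
    using P Q by (auto simp: idxP_def idxQ_def deg_def prod_eq_iff)
  then show ?thesis by (simp add: Rep_triple_inject)
qed

lemma
  assumes "sum A UNIV = sum B UNIV"
  shows fullP_mk: "fullP (mk_triple A B) = A" and fullQ_mk: "fullQ (mk_triple A B) = B"
    and deg_mk: "deg (mk_triple A B) = sum A UNIV"
proof -
  have mem: "(\<lambda>j. A (Some j), \<lambda>j. B (Some j), sum A UNIV) \<in>
     {(P, Q, \<alpha>). sum P UNIV \<le> \<alpha> \<and> sum Q UNIV \<le> \<alpha>}"
    using assms sum_option[of A] sum_option[of B] by simp
  have R: "Rep_triple (mk_triple A B) = (\<lambda>j. A (Some j), \<lambda>j. B (Some j), sum A UNIV)"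
    unfolding mk_triple_def by (rule Abs_triple_inverse[OF mem])
  show "fullP (mk_triple A B) = A" "fullQ (mk_triple A B) = B" "deg (mk_triple A B) = sum A UNIV"
    using assms sum_option[of A] sum_option[of B]
    by (auto simp: fullP_def fullQ_def idxP_def idxQ_def deg_def R fun_eq_iff split: option.split)
qed

lemma full_le_deg: "fullP \<tau> i \<le> deg \<tau>" "fullQ \<tau> i \<le> deg \<tau>"
  using member_le_sum[of i UNIV "fullP \<tau>"] member_le_sum[of i UNIV "fullQ \<tau>"] by simp_all

definition degs_upto :: "nat \<Rightarrow> 'n::finite triple set" where
  "degs_upto d = {\<tau>. deg \<tau> \<le> d}"

text \<open>
  There are at most \<open>(d + 1) ^ (2 (n + 1)) \<le> (4 ^ (n + 1)) ^ d\<close> triples of degree at most \<open>d\<close>.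
\<close>

definition level_base :: "'n::finite itself \<Rightarrow> nat" where
  "level_base _ = 4 ^ CARD('n option)"

lemma power_commuting_exponents: "(x ^ m) ^ n = (x ^ n) ^ (m :: nat)" for x :: "'a::monoid_mult"
  unfolding power_mult[symmetric] by (subst mult.commute) rule

lemma card_degs_upto:
  "finite (degs_upto d :: 'n::finite triple set)"
  "card (degs_upto d :: 'n::finite triple set) \<le> level_base TYPE('n) ^ d"
proof -
  let ?B = "PiE (UNIV :: 'n option set) (\<lambda>_. {..d})"
  have inj: "inj_on (\<lambda>\<tau>. (fullP \<tau>, fullQ \<tau>)) (degs_upto d :: 'n triple set)"
    by (auto intro!: inj_onI triple_eqI)
  have sub: "(\<lambda>\<tau>. (fullP \<tau>, fullQ \<tau>)) ` (degs_upto d :: 'n triple set) \<subseteq> ?B \<times> ?B"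
    by (auto simp: degs_upto_def PiE_iff intro: order_trans[OF full_le_deg(1)] order_trans[OF full_le_deg(2)])
  have finB: "finite (?B \<times> ?B)" by (intro finite_cartesian_product finite_PiE) auto
  show "finite (degs_upto d :: 'n triple set)" by (rule inj_on_finite[OF inj sub finB])
  have cardB: "card ?B = (d + 1) ^ CARD('n option)" unfolding card_PiE[OF finite] by simp
  have "card (degs_upto d :: 'n triple set) \<le> card (?B \<times> ?B)" by (rule card_inj_on_le[OF inj sub finB])
  also have "card (?B \<times> ?B) = (d + 1) ^ (2 * CARD('n option))"
    unfolding card_cartesian_product cardB mult_2 power_add ..
  also have "\<dots> \<le> (2 ^ d) ^ (2 * CARD('n option))"
    by (intro power_mono) (auto simp: Suc_leI less_exp)
  also have "\<dots> = (2 ^ (2 * CARD('n option))) ^ d" by (rule power_commuting_exponents)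
  also have "\<dots> = level_base TYPE('n) ^ d" unfolding level_base_def power_mult by simp
  finally show "card (degs_upto d :: 'n triple set) \<le> level_base TYPE('n) ^ d" .
qed

text \<open>
  The number of a triple is its rank when triples are ordered by degree, ties being broken by an arbitrary
  injection into the natural numbers. All predecessors of \<open>\<tau>\<close> lie in \<open>degs_upto (deg \<tau>) - {\<tau>}\<close>.
\<close>

lemma graded_enumeration:
  "\<exists>idx :: 'n::finite triple \<Rightarrow> nat. inj idx \<and> (\<forall>\<tau>. idx \<tau> < level_base TYPE('n) ^ deg \<tau>)"
proof -
  have "(UNIV :: 'n triple set) = (\<Union>d. degs_upto d)" by (auto simp: degs_upto_def)
  moreover have "countable (\<Union>d. degs_upto d :: 'n triple set)"
    by (rule countable_UN) (auto intro: countable_finite card_degs_upto(1))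
  ultimately have "countable (UNIV :: 'n triple set)" by simp
  then obtain to :: "'n triple \<Rightarrow> nat" where to: "inj to" by (auto simp: countable_def)
  define before where "before = (\<lambda>\<tau>::'n triple. {\<sigma>. deg \<sigma> < deg \<tau> \<or> deg \<sigma> = deg \<tau> \<and> to \<sigma> < to \<tau>})"
  have sub: "before \<tau> \<subset> degs_upto (deg \<tau>)" for \<tau>
    by (auto simp: before_def degs_upto_def)
  have fin: "finite (before \<tau>)" for \<tau>
    using sub card_degs_upto(1) by (meson finite_subset psubset_imp_subset)
  have mono: "card (before \<tau>) < card (before \<sigma>)" if "\<tau> \<in> before \<sigma>" for \<tau> \<sigma>
    using that fin by (intro psubset_card_mono) (auto simp: before_def)
  have "inj (\<lambda>\<tau>. card (before \<tau>))"
  proof (rule injI, rule ccontr)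
    fix \<tau> \<sigma> assume eq: "card (before \<tau>) = card (before \<sigma>)" and ne: "\<tau> \<noteq> \<sigma>"
    have "to \<tau> \<noteq> to \<sigma>" using to ne by (auto dest: injD)
    then have "\<tau> \<in> before \<sigma> \<or> \<sigma> \<in> before \<tau>" by (auto simp: before_def)
    then show False using mono eq by fastforce
  qed
  moreover have "card (before \<tau>) < level_base TYPE('n) ^ deg \<tau>" for \<tau>
    using psubset_card_mono[OF card_degs_upto(1) sub, of \<tau>] card_degs_upto(2)[of "deg \<tau>"] by (meson less_le_trans)
  ultimately show ?thesis by blast
qed

text \<open>
  Factorials beat exponentials, even after raising them to a small power: take the power \<open>\<eta>\<close> of
  \<open>L ^ d / d! \<le> exp L\<close>.
\<close>

lemma power_le_fact_powr:
  fixes K \<eta> :: real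
  assumes "K \<ge> 0" "\<eta> > 0"
  shows "\<exists>c>0. \<forall>d. K ^ d \<le> c * fact d powr \<eta>"
proof -
  \<comment> \<open>\<open>K + 1\<close> in place of \<open>K\<close> keeps the base of the power positive.\<close>
  define L where "L = (K + 1) powr (1 / \<eta>)"
  have L: "L > 0" "L powr \<eta> = K + 1" using assms by (simp_all add: L_def powr_powr)
  have "K ^ d \<le> exp L powr \<eta> * fact d powr \<eta>" for d
  proof -
    have "L ^ d / fact d \<le> exp L"
    proof -
      have "(\<Sum>i\<in>{d}. L ^ i / fact i) \<le> (\<Sum>i. L ^ i / fact i)"
        using L summable_exp[of L] by (intro sum_le_suminf) (auto simp: divide_inverse mult.commute)
      then show ?thesis by (simp add: exp_def divide_inverse mult.commute)
    qed
    then have "L ^ d \<le> exp L * fact d" by (simp add: field_simps)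
    then have "(L ^ d) powr \<eta> \<le> (exp L * fact d) powr \<eta>" using L assms by (intro powr_mono2) auto
    moreover have "(L ^ d) powr \<eta> = (K + 1) ^ d"
    proof -
      have "(L ^ d) powr \<eta> = L powr (real d * \<eta>)" using L by (simp add: powr_powr flip: powr_realpow)
      also have "\<dots> = (L powr \<eta>) powr real d" by (simp add: powr_powr mult.commute)
      also have "\<dots> = (K + 1) ^ d" using assms L by (simp add: powr_realpow)
      finally show ?thesis .
    qed
    moreover have "K ^ d \<le> (K + 1) ^ d" using assms by (intro power_mono) auto
    ultimately show ?thesis by (simp add: powr_mult)
  qed
  then show ?thesis by (intro exI[of _ "exp L powr \<eta>"]) auto
qed

text \<open>
  With the enumeration by degree the factor \<open>(idx \<tau> + 1)\<^sup>2\<close> is exponential in the degree and hence absorbed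
  by the factorial, which leaves the sum of the inverse squares.
\<close>

lemma summable_on_power_fact:
  fixes K \<eta> :: real
  assumes "K \<ge> 0" "\<eta> > 0"
  shows "(\<lambda>\<tau> :: 'n::finite triple. K ^ deg \<tau> / fact (deg \<tau>) powr \<eta>) summable_on UNIV"
proof -
  obtain idx :: "'n triple \<Rightarrow> nat" where idx: "inj idx" "\<And>\<tau>. idx \<tau> < level_base TYPE('n) ^ deg \<tau>"
    using graded_enumeration by blast
  define B where "B = real (level_base TYPE('n))"
  have B: "B \<ge> 1" unfolding B_def level_base_def of_nat_power by (rule one_le_power) simp
  obtain c where c: "c > 0" "\<And>d. (K * B\<^sup>2) ^ d \<le> c * fact d powr \<eta>"
    using power_le_fact_powr[of "K * B\<^sup>2" \<eta>] assms by auto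
  have le: "K ^ deg \<tau> / fact (deg \<tau>) powr \<eta> \<le> c * (1 / (real (idx \<tau>) + 1)\<^sup>2)" for \<tau>
  proof -
    have "real (idx \<tau>) + 1 \<le> B ^ deg \<tau>"
      using of_nat_mono[OF Suc_leI[OF idx(2)[of \<tau>]], where 'a=real] by (simp add: B_def add.commute)
    then have "(real (idx \<tau>) + 1)\<^sup>2 \<le> (B ^ deg \<tau>)\<^sup>2" by (intro power_mono) auto
    then have "K ^ deg \<tau> * (real (idx \<tau>) + 1)\<^sup>2 \<le> K ^ deg \<tau> * (B ^ deg \<tau>)\<^sup>2"
      using assms by (intro mult_left_mono) auto
    also have "\<dots> = (K * B\<^sup>2) ^ deg \<tau>" by (simp add: power_mult_distrib power_mult[symmetric] mult.commute)
    also have "\<dots> \<le> c * fact (deg \<tau>) powr \<eta>" by (rule c)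
    finally show ?thesis by (simp add: field_simps)
  qed
  have "summable (\<lambda>k::nat. 1 / (real k + 1)\<^sup>2)"
    using summable_Suc_iff[of "\<lambda>k. inverse ((real k)\<^sup>2)"] inverse_power_summable[of 2, where 'a=real]
    by (simp add: divide_inverse add.commute)
  then have "(\<lambda>k::nat. 1 / (real k + 1)\<^sup>2) summable_on UNIV"
    by (subst summable_on_UNIV_nonneg_real_iff) auto
  then have "(\<lambda>k::nat. 1 / (real k + 1)\<^sup>2) summable_on range idx"
    by (rule summable_on_subset_banach) auto
  then have "((\<lambda>k::nat. 1 / (real k + 1)\<^sup>2) \<circ> idx) summable_on UNIV"
    using idx(1) by (simp add: summable_on_reindex)
  then have "(\<lambda>\<tau>. c * (1 / (real (idx \<tau>) + 1)\<^sup>2)) summable_on UNIV"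
    unfolding comp_def by (rule summable_on_cmult_right)
  then show ?thesis
    by (rule summable_on_comparison_test) (use le assms in auto)
qed

text \<open>
  A multinomial coefficient in \<open>k\<close> parts is at most exponential: split off one part at a time and bound the
  binomial coefficient by a power of 2.
\<close>

lemma fact_sum_le:
  assumes "finite S"
  shows "fact (sum A S) \<le> (2::real) ^ (card S * sum A S) * (\<Prod>i\<in>S. fact (A i))"
  using assms
proof (induction S)
  case (insert i S)
  let ?s = "sum A S"
  have "(fact (A i + ?s) :: real) = real ((A i + ?s) choose A i) * fact (A i) * fact ?s"
    using binomial_fact[of "A i" "A i + ?s", where 'a=real] by simp
  also have "\<dots> \<le> 2 ^ (A i + ?s) * fact (A i) * (2 ^ (card S * ?s) * (\<Prod>i\<in>S. fact (A i)))"
  proof (intro mult_mono insert)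
    show "real ((A i + ?s) choose A i) \<le> 2 ^ (A i + ?s)"
      using of_nat_mono[OF binomial_le_pow2[of "A i + ?s" "A i"], where 'a=real] by simp
  qed (auto intro!: mult_nonneg_nonneg prod_nonneg)
  also have "\<dots> \<le> 2 ^ (A i + ?s) * fact (A i) * (2 ^ (card S * (A i + ?s)) * (\<Prod>i\<in>S. fact (A i)))"
    by (intro mult_left_mono mult_right_mono power_increasing) (auto intro!: prod_nonneg)
  also have "\<dots> = 2 ^ (card (insert i S) * sum A (insert i S)) * (\<Prod>i\<in>insert i S. fact (A i))"
    using insert by (simp add: power_add algebra_simps)
  finally show ?case using insert by simp
qed auto

lemma prod_fact_le:
  assumes "finite S"
  shows "(\<Prod>i\<in>S. fact (A i)) \<le> (fact (sum A S) :: real)"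
  using assms
proof (induction S)
  case (insert i S)
  have "(\<Prod>j\<in>insert i S. fact (A j)) \<le> (fact (A i) :: real) * fact (sum A S)"
    using insert by (auto intro!: mult_left_mono)
  also have "\<dots> \<le> fact (A i + sum A S)"
  proof -
    have "fact (A i) * fact (sum A S) dvd (fact (A i + sum A S) :: nat)" by (rule fact_fact_dvd_fact)
    then have "fact (A i) * fact (sum A S) \<le> (fact (A i + sum A S) :: nat)" by (rule dvd_imp_le) simp
    then show ?thesis by (metis of_nat_fact of_nat_le_iff of_nat_mult)
  qed
  finally show ?case using insert by simp
qed auto

lemma norm_pochhammer_le: "cmod (pochhammer x d) \<le> (cmod x + 1) ^ d * fact d"
proof (induction d)
  case (Suc d)
  have "cmod (x + of_nat d) \<le> cmod x + real d" by (metis norm_of_nat norm_triangle_ineq)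
  also have "\<dots> \<le> (cmod x + 1) * (real d + 1)" by (simp add: algebra_simps)
  finally have "cmod (pochhammer x d) * cmod (x + of_nat d) \<le> ((cmod x + 1) ^ d * fact d) * ((cmod x + 1) * (real d + 1))"
    using Suc by (intro mult_mono) auto
  then show ?case by (simp add: pochhammer_Suc norm_mult mult_ac add.commute)
qed auto

text \<open>
  On the circle \<open>|x| = 1/2\<close> no factor \<open>x + k\<close> comes near 0: the first has modulus \<open>1/2\<close>, and for \<open>k \<ge> 1\<close>
  the modulus is at least \<open>k - 1/2 \<ge> (k + 1) / 4\<close>.
\<close>

lemma norm_pochhammer_half_ge:
  assumes "cmod x = 1 / 2"
  shows "fact d / 4 ^ d \<le> cmod (pochhammer x d)"
proof (induction d)
  case (Suc d)
  have "(real d + 1) / 4 \<le> cmod (x + of_nat d)"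
  proof (cases d)
    case (Suc k)
    have "real d \<le> cmod (x + of_nat d) + cmod x"
      using norm_triangle_ineq4[of "x + of_nat d" x] by simp
    then show ?thesis using assms Suc by simp
  qed (use assms in simp)
  then have "(fact d / 4 ^ d) * ((real d + 1) / 4) \<le> cmod (pochhammer x d) * cmod (x + of_nat d)"
    using Suc by (intro mult_mono) auto
  then show ?case by (simp add: pochhammer_Suc norm_mult mult_ac add.commute)
qed auto

text \<open>
  The divided monomials. A derivative lowers one exponent without a factor (\<open>d_z_nmono\<close>), and products
  have multinomial coefficients (\<open>nmono_mult\<close>).
\<close>

definition nmono :: "('n option \<Rightarrow> nat) \<Rightarrow> ('n option \<Rightarrow> nat) \<Rightarrow> 'n::finite pt \<Rightarrow> complex" where
  "nmono A B z = monomial_fun (A, B) z / ((\<Prod>i\<in>UNIV. fact (A i)) * (\<Prod>i\<in>UNIV. fact (B i)))"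

lemma e_fun_eq: "e_fun \<tau> = monomial_fun (fullP \<tau>, fullQ \<tau>)"
  by (rule ext) (simp add: e_fun_def monomial_fun_def prod_option fullP_def fullQ_def)

lemma f_fun_eq:
  "f_fun hb \<tau> w = (if w \<in> C_plus then pochhammer (of_real (yfun w) / (2 * hb)) (deg \<tau>) *
     (nmono (fullP \<tau>) (fullQ \<tau>) w / of_real (yfun w) ^ deg \<tau>) else 0)"
proof -
  have "(\<Prod>i\<in>UNIV. fact (fullP \<tau> i)) = (fact (deg \<tau> - sum (idxP \<tau>) UNIV) * (\<Prod>i\<in>UNIV. fact (idxP \<tau> i)) :: complex)"
    "(\<Prod>i\<in>UNIV. fact (fullQ \<tau> i)) = (fact (deg \<tau> - sum (idxQ \<tau>) UNIV) * (\<Prod>i\<in>UNIV. fact (idxQ \<tau> i)) :: complex)"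
    by (simp_all add: prod_option fullP_def fullQ_def)
  then show ?thesis by (simp add: f_fun_def nmono_def e_fun_eq mult_ac)
qed

text \<open>
  Both products of factorials are, up to an exponential, the factorial of the degree.
\<close>

lemma norm_nmono_le:
  assumes "\<And>i. cmod (w $ i) \<le> R"
  shows "cmod (nmono (fullP \<tau>) (fullQ \<tau>) (w :: 'n::finite pt)) \<le> (R\<^sup>2 * 4 ^ CARD('n option)) ^ deg \<tau> / (fact (deg \<tau>))\<^sup>2"
proof -
  have R: "R \<ge> 0" using assms[of undefined] norm_ge_zero order_trans by blast
  let ?N = "CARD('n option)"
  have fac: "fact (deg \<tau>) \<le> (2::real) ^ (?N * deg \<tau>) * (\<Prod>i\<in>UNIV. fact (fullP \<tau> i))"
    "fact (deg \<tau>) \<le> (2::real) ^ (?N * deg \<tau>) * (\<Prod>i\<in>UNIV. fact (fullQ \<tau> i))"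
    using fact_sum_le[of UNIV "fullP \<tau>"] fact_sum_le[of UNIV "fullQ \<tau>"] by simp_all
  have mon: "(\<Prod>i\<in>UNIV. cmod (w $ i) ^ A i) \<le> R ^ sum A UNIV" for A
  proof -
    have "(\<Prod>i\<in>UNIV. cmod (w $ i) ^ A i) \<le> (\<Prod>i\<in>UNIV. R ^ A i)"
      using assms by (intro prod_mono) (auto intro: power_mono)
    then show ?thesis by (simp add: power_sum)
  qed
  define p where "p = (\<Prod>i\<in>UNIV. fact (fullP \<tau> i) :: real)"
  define q where "q = (\<Prod>i\<in>UNIV. fact (fullQ \<tau> i) :: real)"
  have pq: "p > 0" "q > 0" by (auto simp: p_def q_def intro!: prod_pos)
  have "cmod (nmono (fullP \<tau>) (fullQ \<tau>) w) = cmod (monomial_fun (fullP \<tau>, fullQ \<tau>) w) / (p * q)"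
    by (simp add: nmono_def p_def q_def norm_divide norm_mult prod_norm[symmetric])
  also have "\<dots> \<le> R ^ deg \<tau> * R ^ deg \<tau> / (p * q)"
    using mon[of "fullP \<tau>"] mon[of "fullQ \<tau>"] pq R
    by (intro divide_right_mono)
       (auto simp: monomial_fun_def norm_mult prod_norm[symmetric] norm_power intro!: mult_mono prod_nonneg)
  also have "\<dots> \<le> R ^ deg \<tau> * R ^ deg \<tau> * ((2 ^ (?N * deg \<tau>))\<^sup>2 / (fact (deg \<tau>))\<^sup>2)"
  proof -
    have "(fact (deg \<tau>))\<^sup>2 \<le> (2 ^ (?N * deg \<tau>) * p) * (2 ^ (?N * deg \<tau>) * q)"
      unfolding power2_eq_square using fac pq by (intro mult_mono) (auto simp: p_def q_def)
    then have "1 / (p * q) \<le> (2 ^ (?N * deg \<tau>))\<^sup>2 / (fact (deg \<tau>))\<^sup>2"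
      using pq by (simp add: divide_simps power2_eq_square mult_ac)
    then have "R ^ deg \<tau> * R ^ deg \<tau> * (1 / (p * q)) \<le> R ^ deg \<tau> * R ^ deg \<tau> * ((2 ^ (?N * deg \<tau>))\<^sup>2 / (fact (deg \<tau>))\<^sup>2)"
      using R by (intro mult_left_mono) auto
    then show ?thesis by simp
  qed
  also have "(2 ^ (?N * deg \<tau>))\<^sup>2 = ((4::real) ^ ?N) ^ deg \<tau>"
  proof -
    have "(2 ^ (?N * deg \<tau>))\<^sup>2 = ((2::real)\<^sup>2) ^ (?N * deg \<tau>)" by (rule power_commuting_exponents)
    then show ?thesis unfolding power_mult by simp
  qed
  also have "R ^ deg \<tau> * R ^ deg \<tau> = (R\<^sup>2) ^ deg \<tau>"
    by (simp add: power2_eq_square power_mult_distrib)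
  finally show ?thesis by (simp only: power_mult_distrib times_divide_eq_right)
qed

lemma cont_yfun: "continuous_on S yfun"
  unfolding yfun_def by (intro continuous_intros)

text \<open>
  The two factorials in the denominator of the divided monomial win against the one that the Pochhammer
  symbol may contribute. Compactness bounds \<open>y\<close> from above and away from 0.
\<close>

lemma f_fun_bound:
  assumes "compact K" "K \<subseteq> (C_plus :: 'n::finite pt set)"
  shows "\<exists>L\<ge>0. \<forall>w\<in>K. \<forall>\<tau>. cmod (f_fun hb \<tau> w) \<le> L ^ deg \<tau> / fact (deg \<tau>)"
proof (cases "K = {}")
  case False
  obtain w1 where w1: "w1 \<in> K" "\<And>w. w \<in> K \<Longrightarrow> yfun w1 \<le> yfun w"
    using continuous_attains_inf[OF assms(1) False cont_yfun] by auto
  obtain w2 where w2: "w2 \<in> K" "\<And>w. w \<in> K \<Longrightarrow> yfun w \<le> yfun w2"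
    using continuous_attains_sup[OF assms(1) False cont_yfun] by auto
  obtain R where R: "\<And>w. w \<in> K \<Longrightarrow> norm w \<le> R"
    using compact_imp_bounded[OF assms(1)] by (auto simp: bounded_iff)
  have y1: "yfun w1 > 0" using w1 assms by (auto simp: C_plus_def)
  define X where "X = yfun w2 / (2 * cmod hb)"
  define L where "L = (X + 1) * (R\<^sup>2 * 4 ^ CARD('n option)) / yfun w1"
  have X: "X \<ge> 0" using w2(2)[OF w1(1)] y1 by (simp add: X_def)
  have "cmod (f_fun hb \<tau> w) \<le> L ^ deg \<tau> / fact (deg \<tau>)" if w: "w \<in> K" for w \<tau>
  proof -
    let ?d = "deg \<tau>" and ?y = "yfun w"
    have wC: "w \<in> C_plus" and y: "?y > 0" using w assms by (auto simp: C_plus_def)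
    have "cmod (w $ i) \<le> R" for i using R[OF w] Finite_Cartesian_Product.norm_nth_le[of w i] by linarith
    from norm_nmono_le[OF this] have n: "cmod (nmono (fullP \<tau>) (fullQ \<tau>) w) \<le> (R\<^sup>2 * 4 ^ CARD('n option)) ^ ?d / (fact ?d)\<^sup>2" .
    have x: "cmod (of_real ?y / (2 * hb)) \<le> X"
      using w2(2)[OF w] y by (simp add: X_def norm_divide norm_mult divide_right_mono)
    have "cmod (f_fun hb \<tau> w) = cmod (pochhammer (of_real ?y / (2 * hb)) ?d) * (cmod (nmono (fullP \<tau>) (fullQ \<tau>) w) / ?y ^ ?d)"
      using wC y by (simp add: f_fun_eq norm_mult norm_divide norm_power)
    also have "\<dots> \<le> ((X + 1) ^ ?d * fact ?d) * (((R\<^sup>2 * 4 ^ CARD('n option)) ^ ?d / (fact ?d)\<^sup>2) / yfun w1 ^ ?d)"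
    proof (intro mult_mono frac_le n)
      have "cmod (pochhammer (of_real ?y / (2 * hb)) ?d) \<le> (cmod (of_real ?y / (2 * hb)) + 1) ^ ?d * fact ?d"
        by (rule norm_pochhammer_le)
      also have "\<dots> \<le> (X + 1) ^ ?d * fact ?d"
        using x by (intro mult_right_mono power_mono) auto
      finally show "cmod (pochhammer (of_real ?y / (2 * hb)) ?d) \<le> (X + 1) ^ ?d * fact ?d" .
      show "yfun w1 ^ ?d \<le> ?y ^ ?d" using w1(2)[OF w] y1 by (intro power_mono) auto
    qed (use y y1 X in auto)
    also have "\<dots> = L ^ ?d / fact ?d"
      unfolding L_def power_mult_distrib power_divide power2_eq_square by (simp add: mult_ac)
    finally show ?thesis .
  qed
  moreover have "L \<ge> 0" using X y1 by (simp add: L_def)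
  ultimately show ?thesis by (intro exI[of _ L]) simp
qed auto

text \<open>
  The point is chosen with all coordinates of modulus at least 1, so that no monomial is small there, and
  with \<open>y = |\<hbar>|\<close>, so that \<open>y / (2 \<hbar>)\<close> has modulus \<open>1/2\<close> and the Pochhammer symbol is as large as a
  factorial.
\<close>

lemma f_fun_lower_bound:
  assumes "hb \<noteq> 0"
  shows "\<exists>w \<in> (C_plus :: 'n::finite pt set). \<exists>k>0. \<forall>\<tau>. k ^ deg \<tau> / fact (deg \<tau>) \<le> cmod (f_fun hb \<tau> w)"
proof -
  define w :: "'n pt" where
    "w = (\<chi> i. case i of None \<Rightarrow> of_real (sqrt (cmod hb + real CARD('n))) | Some _ \<Rightarrow> 1)"
  have y: "yfun w = cmod hb" by (simp add: yfun_def w_def)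
  have wC: "w \<in> C_plus" using assms by (simp add: C_plus_def y)
  have w1: "cmod (w $ i) \<ge> 1" for i
  proof (cases i)
    case None
    have "1 \<le> real CARD('n)" by (simp add: Suc_leI)
    then have "1 \<le> cmod hb + real CARD('n)" using norm_ge_zero[of hb] by linarith
    then show ?thesis using None by (simp add: w_def)
  qed (simp add: w_def)
  have mon: "cmod (monomial_fun (A, B) w) \<ge> 1" for A B
  proof -
    have "1 \<le> (\<Prod>i\<in>UNIV. cmod (w $ i) ^ A i)" "1 \<le> (\<Prod>i\<in>UNIV. cmod (w $ i) ^ B i)"
      using w1 by (auto intro!: prod_ge_1 one_le_power)
    then have "1 * 1 \<le> (\<Prod>i\<in>UNIV. cmod (w $ i) ^ A i) * (\<Prod>i\<in>UNIV. cmod (w $ i) ^ B i)" by (intro mult_mono) auto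
    then show ?thesis by (simp add: monomial_fun_def norm_mult prod_norm[symmetric] norm_power)
  qed
  have "(1 / (4 * cmod hb)) ^ deg \<tau> / fact (deg \<tau>) \<le> cmod (f_fun hb \<tau> w)" for \<tau> :: "'n triple"
  proof -
    let ?d = "deg \<tau>"
    define p where "p = (\<Prod>i\<in>UNIV. fact (fullP \<tau> i) :: real)"
    define q where "q = (\<Prod>i\<in>UNIV. fact (fullQ \<tau> i) :: real)"
    have pq: "p > 0" "q > 0" by (auto simp: p_def q_def intro!: prod_pos)
    have le: "p \<le> fact ?d" "q \<le> fact ?d"
      using prod_fact_le[of UNIV "fullP \<tau>"] prod_fact_le[of UNIV "fullQ \<tau>"] by (simp_all add: p_def q_def)
    have "cmod (nmono (fullP \<tau>) (fullQ \<tau>) w) = cmod (monomial_fun (fullP \<tau>, fullQ \<tau>) w) / (p * q)"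
      by (simp add: nmono_def p_def q_def norm_divide norm_mult prod_norm[symmetric])
    also have "\<dots> \<ge> 1 / (fact ?d * fact ?d)"
      using mon pq le by (intro frac_le mult_mono) auto
    finally have n: "1 / (fact ?d * fact ?d) \<le> cmod (nmono (fullP \<tau>) (fullQ \<tau>) w)" .
    have "cmod (of_real (yfun w) / (2 * hb)) = 1 / 2" using assms by (simp add: y norm_divide norm_mult)
    from norm_pochhammer_half_ge[OF this, of ?d]
    have "(fact ?d / 4 ^ ?d) * ((1 / (fact ?d * fact ?d)) / cmod hb ^ ?d) \<le>
       cmod (pochhammer (of_real (yfun w) / (2 * hb)) ?d) * (cmod (nmono (fullP \<tau>) (fullQ \<tau>) w) / cmod hb ^ ?d)"
      by (intro mult_mono divide_right_mono n) auto
    also have "\<dots> = cmod (f_fun hb \<tau> w)"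
      using wC by (simp add: f_fun_eq y norm_mult norm_divide norm_power)
    finally show ?thesis by (simp add: power_divide power_mult_distrib field_simps)
  qed
  then show ?thesis using wC assms by (intro bexI[of _ w] exI[of _ "1 / (4 * cmod hb)"]) auto
qed

lemma cont_f_fun: "continuous_on C_plus (f_fun hb \<tau>)"
proof -
  have mono: "continuous_on C_plus (nmono A B)" for A B :: "'a option \<Rightarrow> nat"
    unfolding nmono_def monomial_fun_def by (intro continuous_intros) (auto simp: fact_nonzero)
  have "continuous_on C_plus (\<lambda>w. pochhammer (of_real (yfun w) / (2 * hb)) (deg \<tau>) *
     (nmono (fullP \<tau>) (fullQ \<tau>) w / of_real (yfun w) ^ deg \<tau>))"
    unfolding pochhammer_prod divide_inverse
    by (intro continuous_intros mono cont_yfun) (auto simp: C_plus_def)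
  then show ?thesis by (rule continuous_on_eq) (simp add: f_fun_eq)
qed

section \<open>Wirtinger calculus on polynomials\<close>

text \<open>
  The calculus treats functions as elements of an algebra; these rules would evaluate sums and products at a
  point wherever possible, and are therefore used on demand only.
\<close>

lemmas pointwise = plus_fun_apply zero_fun_apply one_fun_apply times_fun_apply minus_apply uminus_apply

declare pointwise [simp del]

definition mon :: "('n option \<Rightarrow> nat) \<Rightarrow> 'n::finite pt \<Rightarrow> complex" where
  "mon A z = (\<Prod>j\<in>UNIV. (z $ j) ^ A j / fact (A j))"

definition conj_pt :: "'n::finite pt \<Rightarrow> 'n pt" where
  "conj_pt z = (\<chi> j. cnj (z $ j))"

definition lower :: "'i \<Rightarrow> ('i \<Rightarrow> nat) \<Rightarrow> 'i \<Rightarrow> nat" where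
  "lower i A = A(i := A i - 1)"

lemma nmono_mon: "nmono A B z = mon A z * mon B (conj_pt z)"
  by (simp add: nmono_def mon_def conj_pt_def monomial_fun_def prod_dividef)

lemma mon_deriv:
  "(mon A has_derivative (\<lambda>h. \<Sum>i\<in>UNIV. (if A i = 0 then 0 else mon (lower i A) z) * h $ i)) (at z)"
proof -
  have coord: "((\<lambda>z. z $ j) has_derivative (\<lambda>h. h $ j)) (at z)" for j
    by (rule bounded_linear_imp_has_derivative[OF bounded_linear_vec_nth])
  have fac: "((\<lambda>z. (z $ j) ^ A j / fact (A j)) has_derivative
      (\<lambda>h. (of_nat (A j) * (h $ j) * (z $ j) ^ (A j - 1)) / fact (A j))) (at z)" for j
    unfolding divide_inverse by (intro has_derivative_mult_left has_derivative_power coord)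
  have "((\<lambda>z. \<Prod>j\<in>UNIV. (z $ j) ^ A j / fact (A j)) has_derivative
     (\<lambda>h. \<Sum>i\<in>UNIV. ((of_nat (A i) * (h $ i) * (z $ i) ^ (A i - 1)) / fact (A i)) *
        (\<Prod>j\<in>UNIV - {i}. (z $ j) ^ A j / fact (A j)))) (at z)"
    by (rule has_derivative_prod) (rule fac)
  also have "(\<lambda>h. \<Sum>i\<in>UNIV. ((of_nat (A i) * (h $ i) * (z $ i) ^ (A i - 1)) / fact (A i)) *
        (\<Prod>j\<in>UNIV - {i}. (z $ j) ^ A j / fact (A j))) =
      (\<lambda>h. \<Sum>i\<in>UNIV. (if A i = 0 then 0 else mon (lower i A) z) * h $ i)"
  proof (intro ext sum.cong refl)
    fix h :: "'a pt" and i :: "'a option"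
    show "((of_nat (A i) * (h $ i) * (z $ i) ^ (A i - 1)) / fact (A i)) *
        (\<Prod>j\<in>UNIV - {i}. (z $ j) ^ A j / fact (A j)) = (if A i = 0 then 0 else mon (lower i A) z) * h $ i"
    proof (cases "A i")
      case (Suc k)
      have "mon (lower i A) z = (z $ i) ^ k / fact k * (\<Prod>j\<in>UNIV - {i}. (z $ j) ^ A j / fact (A j))"
        unfolding mon_def by (subst prod.remove[of UNIV i]) (auto simp: lower_def Suc)
      moreover have "of_nat (Suc k) / fact (Suc k) = (1 / fact k :: complex)"
        by (simp add: field_simps del: of_nat_Suc)
      then have "of_nat (Suc k) * (h $ i) * (z $ i) ^ k / fact (Suc k) = (h $ i) * ((z $ i) ^ k / fact k)"
        by (metis (no_types, lifting) mult.commute mult.left_commute mult_1 times_divide_eq_left times_divide_eq_right)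
      ultimately show ?thesis using Suc by simp
    qed simp
  qed
  finally show ?thesis by (simp only: mon_def[abs_def])
qed

text \<open>The real derivative of a function at a point, split into its complex-linear and its
  antilinear part.\<close>

definition wirtinger ::
  "('n::finite pt \<Rightarrow> complex) \<Rightarrow> 'n pt \<Rightarrow> ('n option \<Rightarrow> complex) \<Rightarrow> ('n option \<Rightarrow> complex) \<Rightarrow> bool" where
  "wirtinger f z D E \<longleftrightarrow> (f has_derivative (\<lambda>h. \<Sum>i\<in>UNIV. D i * h $ i + E i * cnj (h $ i))) (at z)"

text \<open>
  The direction \<open>axis i 1\<close> sees \<open>D i + E i\<close> and the direction \<open>axis i \<i>\<close> sees \<open>\<i> (D i - E i)\<close>.
\<close>

lemma wirtinger_unique:
  assumes "wirtinger f z D E"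
  shows "d_z i f z = D i" "d_zbar i f z = E i"
proof -
  have F: "frechet_derivative f (at z) = (\<lambda>h. \<Sum>i\<in>UNIV. D i * h $ i + E i * cnj (h $ i))"
    using frechet_derivative_at[OF assms[unfolded wirtinger_def]] by simp
  have "frechet_derivative f (at z) (axis i c) = D i * c + E i * cnj c" for c
  proof -
    have "D j * axis i c $ j + E j * cnj (axis i c $ j) = (if j = i then D i * c + E i * cnj c else 0)" for j
      by (simp add: axis_def)
    then show ?thesis unfolding F by simp
  qed
  then show "d_z i f z = D i" "d_zbar i f z = E i"
    by (auto simp: d_z_def d_zbar_def algebra_simps)
qed

lemma wirtinger_combination:
  assumes "wirtinger f z D E" "wirtinger g z D' E'"
  shows "wirtinger (cscale c f + g) z (\<lambda>i. c * D i + D' i) (\<lambda>i. c * E i + E' i)"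
proof -
  have "((\<lambda>z. c * f z + g z) has_derivative (\<lambda>h. c * (\<Sum>i\<in>UNIV. D i * h $ i + E i * cnj (h $ i)) +
     (\<Sum>i\<in>UNIV. D' i * h $ i + E' i * cnj (h $ i)))) (at z)"
    using assms unfolding wirtinger_def by (intro has_derivative_add has_derivative_mult_right)
  then show ?thesis unfolding wirtinger_def
    by (simp add: cscale_def plus_fun_def sum_distrib_left algebra_simps sum.distrib)
qed

lemma wirtinger_mult:
  assumes "wirtinger f z D E" "wirtinger g z D' E'"
  shows "wirtinger (f * g) z (\<lambda>i. D i * g z + f z * D' i) (\<lambda>i. E i * g z + f z * E' i)"
proof -
  have "((\<lambda>z. f z * g z) has_derivative (\<lambda>h. f z * (\<Sum>i\<in>UNIV. D' i * h $ i + E' i * cnj (h $ i)) +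
     (\<Sum>i\<in>UNIV. D i * h $ i + E i * cnj (h $ i)) * g z)) (at z)"
    using assms unfolding wirtinger_def by (intro has_derivative_mult)
  then show ?thesis unfolding wirtinger_def
    by (simp add: times_fun_def sum_distrib_left sum_distrib_right algebra_simps sum.distrib)
qed

lemma wirtinger_nmono:
  "wirtinger (nmono A B) z (\<lambda>i. if A i = 0 then 0 else nmono (lower i A) B z)
     (\<lambda>i. if B i = 0 then 0 else nmono A (lower i B) z)"
proof -
  have lin: "linear (conj_pt :: 'a pt \<Rightarrow> 'a pt)"
    by (rule linearI) (auto simp: conj_pt_def vec_eq_iff)
  have "(conj_pt has_derivative conj_pt) (at z)"
    using lin by (intro bounded_linear_imp_has_derivative) (simp add: linear_conv_bounded_linear)
  from has_derivative_compose[OF this mon_deriv[of B "conj_pt z"]]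
  have "((\<lambda>z. mon B (conj_pt z)) has_derivative
    (\<lambda>h. \<Sum>i\<in>UNIV. (if B i = 0 then 0 else mon (lower i B) (conj_pt z)) * cnj (h $ i))) (at z)"
    by (simp add: conj_pt_def)
  from has_derivative_mult[OF mon_deriv[of A z] this]
  have "((\<lambda>z. mon A z * mon B (conj_pt z)) has_derivative
     (\<lambda>h. mon A z * (\<Sum>i\<in>UNIV. (if B i = 0 then 0 else mon (lower i B) (conj_pt z)) * cnj (h $ i)) +
       (\<Sum>i\<in>UNIV. (if A i = 0 then 0 else mon (lower i A) z) * h $ i) * mon B (conj_pt z))) (at z)" .
  also have "(\<lambda>h. mon A z * (\<Sum>i\<in>UNIV. (if B i = 0 then 0 else mon (lower i B) (conj_pt z)) * cnj (h $ i)) +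
       (\<Sum>i\<in>UNIV. (if A i = 0 then 0 else mon (lower i A) z) * h $ i) * mon B (conj_pt z)) =
     (\<lambda>h. \<Sum>i\<in>UNIV. (if A i = 0 then 0 else nmono (lower i A) B z) * h $ i +
      (if B i = 0 then 0 else nmono A (lower i B) z) * cnj (h $ i))"
    unfolding sum_distrib_left sum_distrib_right sum.distrib[symmetric]
    by (intro ext sum.cong) (auto simp: nmono_mon)
  finally show ?thesis unfolding wirtinger_def by (simp add: nmono_mon[abs_def])
qed

lemma d_z_nmono: "d_z i (nmono A B) = (if A i = 0 then 0 else nmono (lower i A) B)"
  and d_zbar_nmono: "d_zbar i (nmono A B) = (if B i = 0 then 0 else nmono A (lower i B))"
  by (rule ext, simp add: wirtinger_unique[OF wirtinger_nmono] pointwise)+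

lemma nmono_scaled: "nmono A B = cscale (1 / ((\<Prod>i\<in>UNIV. fact (A i)) * (\<Prod>i\<in>UNIV. fact (B i)))) (monomial_fun (A, B))"
  by (simp add: fun_eq_iff nmono_def cscale_def)

lemma monomial_scaled: "monomial_fun (A, B) = cscale ((\<Prod>i\<in>UNIV. fact (A i)) * (\<Prod>i\<in>UNIV. fact (B i))) (nmono A B)"
  by (simp add: fun_eq_iff nmono_def cscale_def)

lemma nmono_poly: "nmono A B \<in> polynomials"
  unfolding nmono_scaled polynomials_def by (intro cfun.span_scale cfun.span_base) auto

lemma poly_induct [consumes 1, case_names zero step]:
  assumes "f \<in> polynomials" and "h 0"
    and "\<And>c A B g. g \<in> polynomials \<Longrightarrow> h g \<Longrightarrow> h (cscale c (nmono A B) + g)"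
  shows "h f"
proof -
  have "f \<in> polynomials \<and> h f"
    using assms(1) unfolding polynomials_def
  proof (induction rule: cfun.span_induct_alt)
    case base
    then show ?case using assms(2) by (simp add: cfun.span_zero)
  next
    case (step c x y)
    then obtain A B where x: "x = monomial_fun (A, B)" by auto
    have y: "y \<in> polynomials" "h y" using step by (auto simp: polynomials_def)
    have "cscale c x = cscale (c * ((\<Prod>i\<in>UNIV. fact (A i)) * (\<Prod>i\<in>UNIV. fact (B i)))) (nmono A B)"
      unfolding x by (subst monomial_scaled) (simp add: mult.assoc)
    then have "h (cscale c x + y)" using assms(3)[OF y] by simp
    moreover have "cscale c x + y \<in> cfun.span (range monomial_fun)"
      using step x by (intro cfun.span_add cfun.span_scale) (auto intro: cfun.span_base)
    ultimately show ?case by (simp add: polynomials_def)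
  qed
  then show ?thesis ..
qed

lemma poly_subspace: "cfun.subspace polynomials"
  unfolding polynomials_def by (rule cfun.subspace_span)

lemma poly_add: "f \<in> polynomials \<Longrightarrow> g \<in> polynomials \<Longrightarrow> f + g \<in> polynomials"
  and poly_scale: "f \<in> polynomials \<Longrightarrow> cscale c f \<in> polynomials"
  and poly_zero: "0 \<in> polynomials"
  and poly_sum: "(\<And>i. i \<in> S \<Longrightarrow> F i \<in> polynomials) \<Longrightarrow> sum F S \<in> polynomials"
  using poly_subspace
  by (auto intro: cfun.subspace_add cfun.subspace_scale cfun.subspace_0 cfun.subspace_sum)

lemma wirtinger_poly:
  assumes "f \<in> polynomials"
  shows "wirtinger f z (\<lambda>i. d_z i f z) (\<lambda>i. d_zbar i f z)"
proof -
  have "\<exists>D E. wirtinger f z D E"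
    using assms
  proof (induction rule: poly_induct)
    case zero
    show ?case by (intro exI[of _ "\<lambda>_. 0"]) (simp add: wirtinger_def zero_fun_def)
  next
    case (step c A B g)
    then show ?case using wirtinger_combination[OF wirtinger_nmono] by blast
  qed
  then obtain D E where W: "wirtinger f z D E" by blast
  have "D = (\<lambda>i. d_z i f z)" "E = (\<lambda>i. d_zbar i f z)" using wirtinger_unique[OF W] by auto
  then show ?thesis using W by simp
qed

lemma
  assumes "f \<in> polynomials" "g \<in> polynomials"
  shows d_z_combination: "d_z i (cscale c f + g) = cscale c (d_z i f) + d_z i g"
    and d_zbar_combination: "d_zbar i (cscale c f + g) = cscale c (d_zbar i f) + d_zbar i g"
    and d_z_mult: "d_z i (f * g) = d_z i f * g + f * d_z i g"
    and d_zbar_mult: "d_zbar i (f * g) = d_zbar i f * g + f * d_zbar i g"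
  using wirtinger_unique[OF wirtinger_combination[OF wirtinger_poly[OF assms(1)] wirtinger_poly[OF assms(2)]]]
    wirtinger_unique[OF wirtinger_mult[OF wirtinger_poly[OF assms(1)] wirtinger_poly[OF assms(2)]]]
  by (simp_all add: fun_eq_iff cscale_def pointwise)

lemma wirtinger_zero: "d_z i 0 = 0" "d_zbar i 0 = 0"
proof -
  have "wirtinger 0 z (\<lambda>_. 0) (\<lambda>_. 0)" for z :: "'a pt" by (simp add: wirtinger_def zero_fun_def)
  from wirtinger_unique[OF this] show "d_z i 0 = 0" "d_zbar i 0 = 0" by (simp_all add: fun_eq_iff pointwise)
qed

lemma d_z_poly: "f \<in> polynomials \<Longrightarrow> d_z i f \<in> polynomials"
  by (induction rule: poly_induct)
     (auto simp: wirtinger_zero d_z_combination nmono_poly d_z_nmono intro!: poly_add poly_scale poly_zero)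

lemma d_zbar_poly: "f \<in> polynomials \<Longrightarrow> d_zbar i f \<in> polynomials"
  by (induction rule: poly_induct)
     (auto simp: wirtinger_zero d_zbar_combination nmono_poly d_zbar_nmono intro!: poly_add poly_scale poly_zero)

lemma d_zbar_add: "f \<in> polynomials \<Longrightarrow> g \<in> polynomials \<Longrightarrow> d_zbar i (f + g) = d_zbar i f + d_zbar i g"
  using d_zbar_combination[of f g i 1] by simp

lemma d_zbar_scale: "f \<in> polynomials \<Longrightarrow> d_zbar i (cscale c f) = cscale c (d_zbar i f)"
  using d_zbar_combination[of f 0 i c] by (simp add: poly_zero wirtinger_zero)

lemma d_zbar_sum:
  assumes "finite S" "\<And>k. k \<in> S \<Longrightarrow> F k \<in> polynomials"
  shows "d_zbar i (sum F S) = (\<Sum>k\<in>S. d_zbar i (F k))"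
  using assms by (induction S) (auto simp: wirtinger_zero d_zbar_add poly_sum)

lemma lower_other: "j \<noteq> i \<Longrightarrow> lower i A j = A j"
  and lower_commute: "lower i (lower j A) = lower j (lower i A)"
  by (auto simp: lower_def fun_eq_iff)

lemma d_z_d_zbar_commute:
  assumes "f \<in> polynomials"
  shows "d_zbar i (d_z j f) = d_z j (d_zbar i f)"
  using assms
proof (induction rule: poly_induct)
  case (step c A B g)
  then show ?case
    by (simp add: d_z_combination d_zbar_combination nmono_poly d_z_poly d_zbar_poly)
       (simp add: d_z_nmono d_zbar_nmono wirtinger_zero)
qed (simp add: wirtinger_zero)

lemma d_zbar_commute:
  assumes "f \<in> polynomials"
  shows "d_zbar i (d_zbar j f) = d_zbar j (d_zbar i f)"
  using assms
proof (induction rule: poly_induct)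
  case (step c A B g)
  have "d_zbar i (d_zbar j (nmono A B)) = d_zbar j (d_zbar i (nmono A B))"
    by (cases "i = j") (auto simp: d_zbar_nmono wirtinger_zero lower_other lower_commute)
  then show ?case using step
    by (simp add: d_zbar_combination nmono_poly d_zbar_poly)
qed (simp add: wirtinger_zero)

definition multi_binom :: "('i::finite \<Rightarrow> nat) \<Rightarrow> ('i \<Rightarrow> nat) \<Rightarrow> nat" where
  "multi_binom A B = (\<Prod>i\<in>UNIV. A i choose B i)"

lemma mon_mult: "mon A z * mon B z = of_nat (multi_binom (A + B) B) * mon (A + B) z"
proof -
  have "(z $ j) ^ A j / fact (A j) * ((z $ j) ^ B j / fact (B j)) =
     of_nat ((A j + B j) choose B j) * ((z $ j) ^ (A j + B j) / fact (A j + B j))" for j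
    by (simp add: binomial_fact power_add field_simps)
  then show ?thesis by (simp add: mon_def multi_binom_def pointwise flip: prod.distrib)
qed

lemma nmono_mult:
  "nmono A B * nmono A' B' =
     cscale (of_nat (multi_binom (A + A') A') * of_nat (multi_binom (B + B') B)) (nmono (A + A') (B + B'))"
proof (rule ext)
  fix z
  have "nmono A B z * nmono A' B' z = (mon A z * mon A' z) * (mon B' (conj_pt z) * mon B (conj_pt z))"
    by (simp add: nmono_mon)
  also have "mon A z * mon A' z = of_nat (multi_binom (A + A') A') * mon (A + A') z" by (rule mon_mult)
  also have "mon B' (conj_pt z) * mon B (conj_pt z) = of_nat (multi_binom (B' + B) B) * mon (B' + B) (conj_pt z)" by (rule mon_mult)
  also have "B' + B = B + B'" by (rule add.commute)
  also have "of_nat (multi_binom (A + A') A') * mon (A + A') z * (of_nat (multi_binom (B + B') B) * mon (B + B') (conj_pt z)) = of_nat (multi_binom (A + A') A') * of_nat (multi_binom (B + B') B) * nmono (A + A') (B + B') z"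
    by (simp add: nmono_mon)
  finally show "(nmono A B * nmono A' B') z =
     cscale (of_nat (multi_binom (A + A') A') * of_nat (multi_binom (B + B') B)) (nmono (A + A') (B + B')) z"
    by (simp add: cscale_def pointwise)
qed

lemma poly_mult: "f \<in> polynomials \<Longrightarrow> g \<in> polynomials \<Longrightarrow> f * g \<in> polynomials"
proof (induction rule: poly_induct)
  case (step c A B f)
  have scale: "cscale c (x * y) = cscale c x * y" "x * cscale c y = cscale c (x * y)" for c and x y :: "'a pt \<Rightarrow> complex"
    by (simp_all add: fun_eq_iff cscale_def pointwise)
  have "nmono A B * g \<in> polynomials"
    using step(3)
  proof (induction rule: poly_induct)
    case (step d A' B' h)
    then show ?case by (simp add: distrib_left scale nmono_mult poly_add poly_scale nmono_poly)
  qed (simp add: poly_zero)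
  then show ?case using step by (simp add: distrib_right poly_add poly_scale flip: scale(1))
qed (simp add: poly_zero)

definition coord :: "'n option \<Rightarrow> 'n::finite pt \<Rightarrow> complex" where "coord i z = z $ i"
definition conj_coord :: "'n option \<Rightarrow> 'n::finite pt \<Rightarrow> complex" where "conj_coord i z = cnj (z $ i)"

lemma coord_nmono: "coord i = nmono (\<lambda>j. if j = i then 1 else 0) (\<lambda>_. 0)"
  and conj_coord_nmono: "conj_coord i = nmono (\<lambda>_. 0) (\<lambda>j. if j = i then 1 else 0)"
  and one_nmono: "1 = nmono (\<lambda>_. 0) (\<lambda>_. 0)"
proof -
  have "(\<Prod>j\<in>UNIV. f j ^ (if j = i then 1 else 0) / fact (if j = i then 1 else 0)) = f i"
    for f :: "'a option \<Rightarrow> complex"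
    by (subst prod.remove[of UNIV i]) auto
  then show "coord i = nmono (\<lambda>j. if j = i then 1 else 0) (\<lambda>_. 0)"
    "conj_coord i = nmono (\<lambda>_. 0) (\<lambda>j. if j = i then 1 else 0)"
    "1 = nmono (\<lambda>_. 0) (\<lambda>_. 0)"
    by (simp_all add: fun_eq_iff coord_def conj_coord_def nmono_mon mon_def conj_pt_def pointwise)
qed

lemma coord_poly: "coord i \<in> polynomials" and conj_coord_poly: "conj_coord i \<in> polynomials" and one_poly: "1 \<in> polynomials"
  by (simp_all add: coord_nmono conj_coord_nmono one_nmono nmono_poly)

lemma lower_unit: "lower i (\<lambda>j. if j = i then 1 else 0) = (\<lambda>_. 0)"
  by (auto simp: lower_def)

lemma d_coords:
  "d_z j (coord i) = (if i = j then 1 else 0)" "d_zbar j (coord i) = 0"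
  "d_z j (conj_coord i) = 0" "d_zbar j (conj_coord i) = (if i = j then 1 else 0)"
  by (auto simp: coord_nmono conj_coord_nmono one_nmono d_z_nmono d_zbar_nmono lower_unit)

text \<open>
  The generators \<open>z\<^sub>i\<close> and \<open>cnj z\<^sub>i\<close> act on the Wick product by simple rules (\<open>wick_coord\<close>, \<open>wick_conj_coord\<close>),
  which makes this induction the right one for associativity.
\<close>

lemma poly_induct_mult [consumes 1, case_names one coord conj_coord scale add]:
  assumes "f \<in> polynomials" and one: "h 1"
    and coord: "\<And>i g. g \<in> polynomials \<Longrightarrow> h g \<Longrightarrow> h (coord i * g)"
    and conj_coord: "\<And>i g. g \<in> polynomials \<Longrightarrow> h g \<Longrightarrow> h (conj_coord i * g)"
    and scale: "\<And>c g. g \<in> polynomials \<Longrightarrow> h g \<Longrightarrow> h (cscale c g)"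
    and add: "\<And>f g. f \<in> polynomials \<Longrightarrow> g \<in> polynomials \<Longrightarrow> h f \<Longrightarrow> h g \<Longrightarrow> h (f + g)"
  shows "h f"
proof -
  have raise: "mon A z * (z $ i) = of_nat (A i + 1) * mon (A(i := A i + 1)) z" for A i and z :: "'a pt"
  proof -
    have "mon (A(i := A i + 1)) z = (z $ i) ^ (A i + 1) / fact (A i + 1) * (\<Prod>j\<in>UNIV - {i}. (z $ j) ^ A j / fact (A j))"
      unfolding mon_def by (subst prod.remove[of UNIV i]) auto
    moreover have "mon A z = (z $ i) ^ A i / fact (A i) * (\<Prod>j\<in>UNIV - {i}. (z $ j) ^ A j / fact (A j))"
      unfolding mon_def by (subst prod.remove[of UNIV i]) auto
    moreover have "of_nat (A i + 1) / fact (A i + 1) = (1 / fact (A i) :: complex)"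
      by (simp add: divide_simps del: of_nat_Suc)
    then have "of_nat (A i + 1) * (x / fact (A i + 1)) = x / fact (A i)" for x :: complex
      by (metis (no_types) mult.commute mult.right_neutral times_divide_eq_left times_divide_eq_right)
    ultimately show ?thesis by (simp only: mult.assoc[symmetric]) (simp add: mult_ac)
  qed
  have mono: "h (nmono A B)" for A B
  proof (induction "sum A UNIV + sum B UNIV" arbitrary: A B)
    case 0
    then have "A = (\<lambda>_. 0)" "B = (\<lambda>_. 0)" by (auto simp: fun_eq_iff)
    then show ?case using one by (simp add: one_nmono)
  next
    case (Suc k)
    have dec: "sum (lower i C) UNIV + 1 = sum C UNIV" if "C i > 0" for i and C :: "'a option \<Rightarrow> nat"
      using that by (simp add: lower_def sum.remove[of UNIV i])
    have "\<exists>i. A i > 0 \<or> B i > 0"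
    proof (rule ccontr)
      assume "\<not> ?thesis"
      then show False using Suc(2) by simp
    qed
    then obtain i where "A i > 0 \<or> B i > 0" by blast
    then show ?case
    proof
      assume A: "A i > 0"
      have "nmono A B = cscale (1 / of_nat (A i)) (coord i * nmono (lower i A) B)"
      proof (rule ext)
        fix z
        have "mon (lower i A) z * z $ i = of_nat (A i) * mon A z"
          using A raise[of "lower i A" z i] by (simp add: lower_def)
        then have "mon A z = mon (lower i A) z * z $ i / of_nat (A i)" using A by simp
        then show "nmono A B z = cscale (1 / of_nat (A i)) (coord i * nmono (lower i A) B) z"
          by (simp add: nmono_mon cscale_def coord_def pointwise)
      qed
      moreover have "h (nmono (lower i A) B)"
        using Suc(2) dec[of A i, OF A] by (intro Suc(1)) simp
      ultimately show ?thesis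
        using scale[OF poly_mult[OF coord_poly nmono_poly] coord[OF nmono_poly]] by simp
    next
      assume B: "B i > 0"
      have "nmono A B = cscale (1 / of_nat (B i)) (conj_coord i * nmono A (lower i B))"
      proof (rule ext)
        fix z
        have "mon (lower i B) (conj_pt z) * cnj (z $ i) = of_nat (B i) * mon B (conj_pt z)"
          using B raise[of "lower i B" "conj_pt z" i] by (simp add: lower_def conj_pt_def)
        then have "mon B (conj_pt z) = mon (lower i B) (conj_pt z) * cnj (z $ i) / of_nat (B i)" using B by simp
        then show "nmono A B z = cscale (1 / of_nat (B i)) (conj_coord i * nmono A (lower i B)) z"
          by (simp add: nmono_mon cscale_def conj_coord_def pointwise)
      qed
      moreover have "h (nmono A (lower i B))"
        using Suc(2) dec[of B i, OF B] by (intro Suc(1)) simp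
      ultimately show ?thesis
        using scale[OF poly_mult[OF conj_coord_poly nmono_poly] conj_coord[OF nmono_poly]] by simp
    qed
  qed
  show ?thesis using assms(1)
  proof (induction rule: poly_induct)
    case zero
    have "h (cscale 0 1)" by (rule scale[OF one_poly one])
    moreover have "cscale 0 1 = (0 :: 'a pt \<Rightarrow> complex)" by simp
    ultimately show ?case by simp
  next
    case (step c A B g)
    show ?case by (rule add[OF poly_scale[OF nmono_poly] step(1) scale[OF nmono_poly mono] step(2)])
  qed
qed

section \<open>Successive contractions\<close>

text \<open>
  \<open>contract r\<close> is the \<open>r\<close>-th term of the Wick product without its numerical factor. The metric is diagonal,
  so one summation index per pair of derivatives remains, and the recursion carries out one pair at a time.
\<close>

primrec contract :: "nat \<Rightarrow> ('n::finite pt \<Rightarrow> complex) \<Rightarrow> ('n pt \<Rightarrow> complex) \<Rightarrow> 'n pt \<Rightarrow> complex" where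
  "contract 0 f g = f * g"
| "contract (Suc r) f g = (\<Sum>j\<in>UNIV. cscale (gmetric j j) (contract r (d_z j f) (d_zbar j g)))"

lemma contract_poly: "f \<in> polynomials \<Longrightarrow> g \<in> polynomials \<Longrightarrow> contract r f g \<in> polynomials"
  by (induction r arbitrary: f g) (auto intro!: poly_mult poly_sum poly_scale d_z_poly d_zbar_poly)

lemma cscale_mult_left: "cscale c f * g = cscale c (f * g)"
  and cscale_mult_right: "f * cscale c g = cscale c (f * g)"
  by (simp_all add: fun_eq_iff cscale_def pointwise)

lemma contract_left:
  assumes "f \<in> polynomials" "f' \<in> polynomials"
  shows "contract r (cscale c f + f') g = cscale c (contract r f g) + contract r f' g"
  using assms
  by (induction r arbitrary: f f' g)
     (auto simp: distrib_right cscale_mult_left d_z_combination d_z_poly cfun.scale_right_distrib sum.distrib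
        cfun.scale_sum_right mult.commute[where 'a=complex])

lemma contract_right:
  assumes "g \<in> polynomials" "g' \<in> polynomials"
  shows "contract r f (cscale c g + g') = cscale c (contract r f g) + contract r f g'"
  using assms
  by (induction r arbitrary: f g g')
     (auto simp: distrib_left cscale_mult_right d_zbar_combination d_zbar_poly cfun.scale_right_distrib sum.distrib
        cfun.scale_sum_right mult.commute[where 'a=complex])

lemma contract_zero: "contract r 0 g = 0" "contract r f 0 = 0"
  by (induction r arbitrary: f g) (simp_all add: wirtinger_zero)

text \<open>
  The first factor is differentiated holomorphically only, so a conjugate coordinate on the left passes
  through the product.
\<close>

lemma contract_zbar:
  assumes "f \<in> polynomials"
  shows "contract r (conj_coord i * f) g = conj_coord i * contract r f g"
  using assms
  by (induction r arbitrary: f g)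
     (auto simp: mult.assoc d_z_mult conj_coord_poly d_coords d_z_poly sum_distrib_left cscale_mult_right)

text \<open>
  A holomorphic coordinate on the left is hit by one of the \<open>r + 1\<close> derivatives or by none; if it is hit, the
  metric pairs that derivative with \<open>d_zbar i\<close> on the second factor.
\<close>

lemma contract_z:
  assumes "f \<in> polynomials" "g \<in> polynomials"
  shows "contract (Suc r) (coord i * f) g =
    coord i * contract (Suc r) f g + cscale (of_nat (Suc r) * gmetric i i) (contract r f (d_zbar i g))"
  using assms
proof (induction r arbitrary: f g)
  case 0
  have "contract (Suc 0) (coord i * f) g = (\<Sum>j\<in>UNIV. coord i * cscale (gmetric j j) (d_z j f * d_zbar j g) +
     (if j = i then cscale (gmetric i i) (f * d_zbar i g) else 0))"
    using 0 by (auto simp: d_z_mult coord_poly d_coords algebra_simps cscale_mult_right cfun.scale_right_distrib intro!: sum.cong)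
  then show ?case by (simp add: sum.distrib sum_distrib_left)
next
  case (Suc r)
  let ?g = "\<lambda>j. gmetric j j :: complex"
  have step: "contract (Suc r) (d_z j (coord i * f)) (d_zbar j g) =
     coord i * contract (Suc r) (d_z j f) (d_zbar j g) + cscale (of_nat (Suc r) * ?g i) (contract r (d_z j f) (d_zbar j (d_zbar i g))) +
     (if j = i then contract (Suc r) f (d_zbar i g) else 0)" for j
  proof -
    have "d_z j (coord i * f) = cscale (if j = i then 1 else 0) f + coord i * d_z j f"
      using Suc.prems by (auto simp: d_z_mult coord_poly d_coords)
    then have "contract (Suc r) (d_z j (coord i * f)) (d_zbar j g) =
        cscale (if j = i then 1 else 0) (contract (Suc r) f (d_zbar j g)) + contract (Suc r) (coord i * d_z j f) (d_zbar j g)"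
      using Suc.prems by (simp only: contract_left poly_mult coord_poly d_z_poly)
    also have "contract (Suc r) (coord i * d_z j f) (d_zbar j g) = coord i * contract (Suc r) (d_z j f) (d_zbar j g) +
        cscale (of_nat (Suc r) * ?g i) (contract r (d_z j f) (d_zbar i (d_zbar j g)))"
      using Suc.prems by (intro Suc.IH d_z_poly d_zbar_poly)
    also have "d_zbar i (d_zbar j g) = d_zbar j (d_zbar i g)" by (rule d_zbar_commute[OF Suc.prems(2)])
    finally show ?thesis by (auto simp: add.commute)
  qed
  have "contract (Suc (Suc r)) (coord i * f) g = (\<Sum>j\<in>UNIV. cscale (?g j) (contract (Suc r) (d_z j (coord i * f)) (d_zbar j g)))"
    by (rule contract.simps)
  also have "\<dots> = (\<Sum>j\<in>UNIV. coord i * cscale (?g j) (contract (Suc r) (d_z j f) (d_zbar j g))) +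
      cscale (of_nat (Suc r) * ?g i) (\<Sum>j\<in>UNIV. cscale (?g j) (contract r (d_z j f) (d_zbar j (d_zbar i g)))) +
      (\<Sum>j\<in>UNIV. if j = i then cscale (?g i) (contract (Suc r) f (d_zbar i g)) else 0)"
    unfolding step cfun.scale_right_distrib sum.distrib cfun.scale_sum_right cscale_mult_right
    by (intro arg_cong2[where f = "(+)"] sum.cong) (auto simp: mult.commute)
  also have "\<dots> = coord i * contract (Suc (Suc r)) f g + (cscale (of_nat (Suc r) * ?g i) (contract (Suc r) f (d_zbar i g)) +
      cscale (?g i) (contract (Suc r) f (d_zbar i g)))"
    unfolding contract.simps(2)[of "Suc r" f g] contract.simps(2)[of r f "d_zbar i g"] sum_distrib_left[symmetric]
    by (simp add: add.assoc del: contract.simps)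
  also have "cscale (of_nat (Suc r) * ?g i) (contract (Suc r) f (d_zbar i g)) +
      cscale (?g i) (contract (Suc r) f (d_zbar i g)) = cscale (of_nat (Suc (Suc r)) * ?g i) (contract (Suc r) f (d_zbar i g))"
    unfolding cfun.scale_left_distrib[symmetric] by (simp add: algebra_simps)
  finally show ?case .
qed

lemma contract_d_zbar:
  assumes "f \<in> polynomials" "g \<in> polynomials"
  shows "d_zbar i (contract r f g) = contract r (d_zbar i f) g + contract r f (d_zbar i g)"
  using assms
proof (induction r arbitrary: f g)
  case 0
  then show ?case by (simp add: d_zbar_mult)
next
  case (Suc r)
  have "d_zbar i (contract (Suc r) f g) = (\<Sum>j\<in>UNIV. cscale (gmetric j j) (d_zbar i (contract r (d_z j f) (d_zbar j g))))"
    using Suc.prems by (simp add: d_zbar_sum d_zbar_scale poly_scale contract_poly d_z_poly d_zbar_poly)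
  also have "\<dots> = (\<Sum>j\<in>UNIV. cscale (gmetric j j) (contract r (d_z j (d_zbar i f)) (d_zbar j g)) +
      cscale (gmetric j j) (contract r (d_z j f) (d_zbar j (d_zbar i g))))"
    using Suc by (intro sum.cong refl)
      (simp add: d_z_poly d_zbar_poly d_z_d_zbar_commute cfun.scale_right_distrib d_zbar_commute[of g i])
  finally show ?case by (simp add: sum.distrib)
qed

section \<open>Iterated derivatives and the expansion of the Wick product\<close>

lemma foldr_d_z_poly: "f \<in> polynomials \<Longrightarrow> foldr d_z is f \<in> polynomials"
  by (induction "is") (auto simp: d_z_poly)

lemma foldr_d_zbar_poly: "f \<in> polynomials \<Longrightarrow> foldr d_zbar is f \<in> polynomials"
  by (induction "is") (auto simp: d_zbar_poly)

lemma foldr_zero: "foldr d_z is 0 = 0" "foldr d_zbar is 0 = 0"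
  by (induction "is") (auto simp: wirtinger_zero)

lemma foldr_d_z_combination:
  "f \<in> polynomials \<Longrightarrow> g \<in> polynomials \<Longrightarrow> foldr d_z is (cscale c f + g) = cscale c (foldr d_z is f) + foldr d_z is g"
  by (induction "is") (auto simp: d_z_combination foldr_d_z_poly)

lemma lower_count:
  "lower i (\<lambda>j. A j - count_list is j) =
    (\<lambda>j. A j - (if i = j then count_list is j + 1 else count_list is j))"
  by (auto simp: lower_def fun_eq_iff)

text \<open>
  Only the number of occurrences of each index in the list matters, as lowering exponents is a commuting
  operation; the derivative vanishes as soon as one exponent is exhausted.
\<close>

lemma foldr_d_z_nmono:
  "foldr d_z is (nmono A B) = (if \<forall>j. count_list is j \<le> A j then nmono (\<lambda>j. A j - count_list is j) B else 0)"
proof (induction "is")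
  case (Cons i "is")
  show ?case
  proof (cases "\<forall>j. count_list is j \<le> A j")
    case True
    show ?thesis
    proof (cases "count_list is i < A i")
      case t: True
      then have "\<forall>j. count_list (i # is) j \<le> A j" using True by auto
      then show ?thesis using Cons True t by (simp add: d_z_nmono lower_count)
    next
      case False
      then have eq: "count_list is i = A i" using True by (meson le_neq_implies_less)
      then have "\<not> (\<forall>j. count_list (i # is) j \<le> A j)" by (auto intro!: exI[of _ i])
      then show ?thesis using Cons True eq by (simp add: d_z_nmono)
    qed
  next
    case False
    then have z: "foldr d_z is (nmono A B) = 0" unfolding Cons by (rule if_not_P)
    obtain j where "A j < count_list is j" using False not_le by blast
    then have "\<not> count_list (i # is) j \<le> A j" by simp
    then have n: "\<not> (\<forall>j. count_list (i # is) j \<le> A j)" by blast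
    show ?thesis unfolding if_not_P[OF n] by (simp add: z wirtinger_zero)
  qed
qed simp

lemma foldr_d_zbar_nmono:
  "foldr d_zbar is (nmono A B) = (if \<forall>j. count_list is j \<le> B j then nmono A (\<lambda>j. B j - count_list is j) else 0)"
proof (induction "is")
  case (Cons i "is")
  show ?case
  proof (cases "\<forall>j. count_list is j \<le> B j")
    case True
    show ?thesis
    proof (cases "count_list is i < B i")
      case t: True
      then have "\<forall>j. count_list (i # is) j \<le> B j" using True by auto
      then show ?thesis using Cons True t by (simp add: d_zbar_nmono lower_count)
    next
      case False
      then have eq: "count_list is i = B i" using True by (meson le_neq_implies_less)
      then have "\<not> (\<forall>j. count_list (i # is) j \<le> B j)" by (auto intro!: exI[of _ i])
      then show ?thesis using Cons True eq by (simp add: d_zbar_nmono)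
    qed
  next
    case False
    then have z: "foldr d_zbar is (nmono A B) = 0" unfolding Cons by (rule if_not_P)
    obtain j where "B j < count_list is j" using False not_le by blast
    then have "\<not> count_list (i # is) j \<le> B j" by simp
    then have n: "\<not> (\<forall>j. count_list (i # is) j \<le> B j)" by blast
    show ?thesis unfolding if_not_P[OF n] by (simp add: z wirtinger_zero)
  qed
qed simp

lemma length_count: "length is = (\<Sum>j\<in>UNIV. count_list is (j :: 'a::finite))"
  using sum_count_set[of "is" UNIV] by simp

lemma foldr_d_z_vanishes:
  assumes "f \<in> polynomials"
  shows "\<exists>N. \<forall>is. N \<le> length is \<longrightarrow> foldr d_z is f = 0"
  using assms
proof (induction rule: poly_induct)
  case zero
  then show ?case by (simp add: foldr_zero)
next
  case (step c A B g)
  obtain N where N: "\<And>is. N \<le> length is \<Longrightarrow> foldr d_z is g = 0" using step by blast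
  have "foldr d_z is (nmono A B) = 0" if "sum A UNIV < length is" for "is"
  proof -
    have "\<not> (\<forall>j. count_list is j \<le> A j)"
      using that sum_mono[of UNIV "count_list is" A] by (auto simp: length_count)
    then show ?thesis unfolding foldr_d_z_nmono by (rule if_not_P)
  qed
  then show ?case using N step
    by (intro exI[of _ "max N (Suc (sum A UNIV))"]) (simp add: foldr_d_z_combination nmono_poly)
qed

definition metric_sign :: "'n option list \<Rightarrow> complex" where
  "metric_sign is = (\<Prod>k<length is. gmetric (is ! k) (is ! k))"

lemma metric_sign_snoc: "metric_sign (is @ [j]) = metric_sign is * gmetric j j"
proof -
  have "(\<Prod>k<length is. gmetric ((is @ [j]) ! k) ((is @ [j]) ! k)) = metric_sign is"
    unfolding metric_sign_def by (intro prod.cong) (auto simp: nth_append)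
  then show ?thesis by (simp add: metric_sign_def lessThan_Suc mult.commute)
qed

lemma norm_metric_sign: "cmod (metric_sign is) = 1"
proof -
  have "cmod (gmetric i i) = 1" for i :: "'a option" by (simp add: gmetric_def)
  then show ?thesis by (simp add: metric_sign_def prod_norm[symmetric])
qed

lemma finite_lists_length: "finite {is :: 'a::finite list. length is = r}"
  using finite_lists_length_eq[of "UNIV :: 'a set" r] by simp

text \<open>
  The sum over ordered lists of indices that the definition of \<open>wick\<close> uses. The outermost step of
  \<open>contract\<close> is the innermost derivative of \<open>foldr\<close>, which is why the lists grow at their end.
\<close>

lemma contract_lists:
  "contract r f g z = (\<Sum>is\<in>{is. length is = r}. metric_sign is * foldr d_z is f z * foldr d_zbar is g z)"
proof (induction r arbitrary: f g)
  case 0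
  have "{is :: 'a option list. length is = 0} = {[]}" by auto
  then show ?case by (simp add: metric_sign_def pointwise)
next
  case (Suc r)
  let ?F = "\<lambda>is. metric_sign is * foldr d_z is f z * foldr d_zbar is g z"
  have bij: "bij_betw (\<lambda>(j, is). is @ [j]) (UNIV \<times> {is. length is = r}) {is :: 'a option list. length is = Suc r}"
  proof (rule bij_betw_imageI)
    show "(\<lambda>(j, is). is @ [j]) ` (UNIV \<times> {is. length is = r}) = {is :: 'a option list. length is = Suc r}"
    proof (intro equalityI subsetI)
      fix xs :: "'a option list" assume xs: "xs \<in> {is. length is = Suc r}"
      then have "xs = butlast xs @ [last xs]" by (metis append_butlast_last_id list.size(3) mem_Collect_eq nat.distinct(1))
      then show "xs \<in> (\<lambda>(j, is). is @ [j]) ` (UNIV \<times> {is. length is = r})"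
        using xs by (intro image_eqI[of _ _ "(last xs, butlast xs)"]) auto
    qed auto
  qed (auto simp: inj_on_def)
  have "(\<Sum>is\<in>{is. length is = Suc r}. ?F is) = (\<Sum>(j, is)\<in>UNIV \<times> {is. length is = r}. ?F (is @ [j]))"
    by (subst sum.reindex_bij_betw[OF bij, symmetric]) (simp add: case_prod_unfold)
  also have "\<dots> = (\<Sum>j\<in>UNIV. \<Sum>is\<in>{is. length is = r}. ?F (is @ [j]))"
    by (simp add: sum.cartesian_product)
  also have "\<dots> = (\<Sum>j\<in>UNIV. gmetric j j * contract r (d_z j f) (d_zbar j g) z)"
    unfolding Suc by (simp add: metric_sign_snoc sum_distrib_left mult_ac)
  also have "\<dots> = contract (Suc r) f g z"
  proof -
    have "(\<Sum>j\<in>S. cscale (gmetric j j) (contract r (d_z j f) (d_zbar j g))) z =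
        (\<Sum>j\<in>S. gmetric j j * contract r (d_z j f) (d_zbar j g) z)" if "finite S" for S
      using that by (induction S) (auto simp: pointwise cscale_def)
    then show ?thesis by simp
  qed
  finally show ?case ..
qed

text \<open>
  Off the diagonal \<open>js = is\<close> some factor of the product of metric entries vanishes.
\<close>

lemma wick_contract: "wick hb f g z = (\<Sum>r. (2 * hb) ^ r / fact r * contract r f g z)"
proof -
  have "(\<Sum>is\<in>{is. length is = r}. \<Sum>js\<in>{js. length js = r}.
           (\<Prod>k<r. gmetric (is ! k) (js ! k)) * foldr d_z is f z * foldr d_zbar js g z) = contract r f g z" for r
  proof -
    have "(\<Sum>js\<in>{js. length js = r}. (\<Prod>k<r. gmetric (is ! k) (js ! k)) * foldr d_z is f z * foldr d_zbar js g z) =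
       metric_sign is * foldr d_z is f z * foldr d_zbar is g z" if l: "length is = r" for "is" :: "'a option list"
    proof -
      have "(\<Prod>k<r. gmetric (is ! k) (js ! k) :: complex) = (if js = is then metric_sign is else 0)" if ljs: "length js = r" for js
      proof (cases "js = is")
        case False
        then obtain k where "k < r" "is ! k \<noteq> js ! k" using l ljs by (auto simp: list_eq_iff_nth_eq)
        then have "(\<Prod>k<r. gmetric (is ! k) (js ! k)) = (0 :: complex)"
          by (intro prod_zero bexI[of _ k]) (simp_all add: gmetric_def)
        then show ?thesis using False by simp
      qed (simp add: metric_sign_def l)
      then have "(\<Sum>js\<in>{js. length js = r}. (\<Prod>k<r. gmetric (is ! k) (js ! k)) * foldr d_z is f z * foldr d_zbar js g z) =
        (\<Sum>js\<in>{js. length js = r}. if js = is then metric_sign is * foldr d_z is f z * foldr d_zbar is g z else 0)"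
        by (intro sum.cong) auto
      then show ?thesis using l by (simp add: finite_lists_length)
    qed
    then show ?thesis unfolding contract_lists by (intro sum.cong) auto
  qed
  then show ?thesis by (simp add: wick_def)
qed

lemma contract_vanishes:
  assumes "f \<in> polynomials"
  shows "\<exists>N. \<forall>r\<ge>N. \<forall>g. contract r f g = 0"
proof -
  obtain N where "\<forall>is. N \<le> length is \<longrightarrow> foldr d_z is f = 0" using foldr_d_z_vanishes[OF assms] by blast
  then have "contract r f g = 0" if "r \<ge> N" for r g
    using that by (auto simp: fun_eq_iff contract_lists pointwise)
  then show ?thesis by blast
qed

lemma wick_finite:
  assumes "f \<in> polynomials"
  shows "\<exists>N0. \<forall>N\<ge>N0. \<forall>g. wick hb f g = (\<Sum>r<N. cscale ((2 * hb) ^ r / fact r) (contract r f g))"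
proof -
  obtain N0 where N0: "\<And>r g. r \<ge> N0 \<Longrightarrow> contract r f g = 0" using contract_vanishes[OF assms] by blast
  have "wick hb f g = (\<Sum>r<N. cscale ((2 * hb) ^ r / fact r) (contract r f g))" if N: "N \<ge> N0" for N g
  proof (rule ext)
    fix z
    have "wick hb f g z = (\<Sum>r<N. (2 * hb) ^ r / fact r * contract r f g z)"
      unfolding wick_contract using N0 N by (intro suminf_finite) (auto simp: pointwise)
    also have "\<dots> = (\<Sum>r<N. cscale ((2 * hb) ^ r / fact r) (contract r f g)) z"
      by (induction N) (auto simp: cscale_def pointwise)
    finally show "wick hb f g z = (\<Sum>r<N. cscale ((2 * hb) ^ r / fact r) (contract r f g)) z" .
  qed
  then show ?thesis by blast
qed

section \<open>Finite linear combinations of a free family\<close>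

text \<open>
  Coefficients are attached to indices instead of to vectors. For a free family \<open>lincomb\<close> and the coefficient
  function \<open>representation\<close> of its range are inverse to each other (\<open>representation_lincomb\<close>).
\<close>

definition finsupp :: "('i \<Rightarrow> complex) set" where
  "finsupp = {a. finite {\<tau>. a \<tau> \<noteq> 0}}"

definition lincomb :: "('i \<Rightarrow> 'x \<Rightarrow> complex) \<Rightarrow> ('i \<Rightarrow> complex) \<Rightarrow> 'x \<Rightarrow> complex" where
  "lincomb v a = (\<Sum>\<tau> | a \<tau> \<noteq> 0. cscale (a \<tau>) (v \<tau>))"

definition free_family :: "('i \<Rightarrow> 'x \<Rightarrow> complex) \<Rightarrow> bool" where
  "free_family v \<longleftrightarrow> (\<forall>a\<in>finsupp. lincomb v a = 0 \<longrightarrow> a = 0)"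

lemma lincomb_eq_sum:
  assumes "finite S" "\<And>\<tau>. a \<tau> \<noteq> 0 \<Longrightarrow> \<tau> \<in> S"
  shows "lincomb v a = (\<Sum>\<tau>\<in>S. cscale (a \<tau>) (v \<tau>))"
  unfolding lincomb_def using assms by (intro sum.mono_neutral_left) auto

lemma finsuppI: "finite S \<Longrightarrow> (\<And>\<tau>. a \<tau> \<noteq> 0 \<Longrightarrow> \<tau> \<in> S) \<Longrightarrow> a \<in> finsupp"
  unfolding finsupp_def by (auto intro: finite_subset)

lemma finsupp_subspace: "cfun.subspace finsupp"
proof (rule cfun.subspaceI)
  show "0 \<in> finsupp" by (simp add: finsupp_def pointwise)
  fix a b :: "'a \<Rightarrow> complex" and c
  assume a: "a \<in> finsupp"
  show "cscale c a \<in> finsupp" using a by (intro finsuppI[of "{\<tau>. a \<tau> \<noteq> 0}"]) (auto simp: finsupp_def cscale_def)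
  assume "b \<in> finsupp"
  then show "a + b \<in> finsupp" using a
    by (intro finsuppI[of "{\<tau>. a \<tau> \<noteq> 0} \<union> {\<tau>. b \<tau> \<noteq> 0}"]) (auto simp: finsupp_def pointwise)
qed

lemma lincomb_combination:
  assumes "a \<in> finsupp" "b \<in> finsupp"
  shows "lincomb v (cscale c a + b) = cscale c (lincomb v a) + lincomb v b"
proof -
  let ?S = "{\<tau>. a \<tau> \<noteq> 0} \<union> {\<tau>. b \<tau> \<noteq> 0}"
  have fin: "finite ?S" using assms by (auto simp: finsupp_def)
  have "lincomb v (cscale c a + b) = (\<Sum>\<tau>\<in>?S. cscale ((cscale c a + b) \<tau>) (v \<tau>))"
    by (intro lincomb_eq_sum fin) (auto simp: cscale_def pointwise)
  moreover have "lincomb v a = (\<Sum>\<tau>\<in>?S. cscale (a \<tau>) (v \<tau>))" by (intro lincomb_eq_sum fin) auto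
  moreover have "lincomb v b = (\<Sum>\<tau>\<in>?S. cscale (b \<tau>) (v \<tau>))" by (intro lincomb_eq_sum fin) auto
  moreover have "cscale ((cscale c a + b) \<tau>) (v \<tau>) = cscale c (cscale (a \<tau>) (v \<tau>)) + cscale (b \<tau>) (v \<tau>)" for \<tau>
    by (simp add: fun_eq_iff cscale_def pointwise algebra_simps)
  ultimately show ?thesis by (simp only: sum.distrib cfun.scale_sum_right)
qed

lemma lincomb_zero [simp]: "lincomb v 0 = 0"
  by (simp add: lincomb_def pointwise)

lemma lincomb_add: "a \<in> finsupp \<Longrightarrow> b \<in> finsupp \<Longrightarrow> lincomb v (a + b) = lincomb v a + lincomb v b"
  using lincomb_combination[of a b v 1] by simp

lemma finsupp_zero: "0 \<in> finsupp" by (rule cfun.subspace_0[OF finsupp_subspace])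
lemma finsupp_add: "a \<in> finsupp \<Longrightarrow> b \<in> finsupp \<Longrightarrow> a + b \<in> finsupp"
  by (rule cfun.subspace_add[OF finsupp_subspace])
lemma finsupp_diff: "a \<in> finsupp \<Longrightarrow> b \<in> finsupp \<Longrightarrow> a - b \<in> finsupp"
  by (rule cfun.subspace_diff[OF finsupp_subspace])
lemma finsupp_scale: "a \<in> finsupp \<Longrightarrow> cscale c a \<in> finsupp"
  by (rule cfun.subspace_scale[OF finsupp_subspace])

lemma lincomb_scale: "a \<in> finsupp \<Longrightarrow> lincomb v (cscale c a) = cscale c (lincomb v a)"
  using lincomb_combination[of a 0 v c] by (simp add: finsupp_zero)

lemma lincomb_diff: "a \<in> finsupp \<Longrightarrow> b \<in> finsupp \<Longrightarrow> lincomb v (a - b) = lincomb v a - lincomb v b"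
  using lincomb_combination[of b a v "-1"] by (simp add: cfun.scale_minus_left)

definition unit_fam :: "'i \<Rightarrow> 'i \<Rightarrow> complex" where
  "unit_fam \<tau> = (\<lambda>\<sigma>. if \<sigma> = \<tau> then 1 else 0)"

lemma unit_fam_finsupp: "unit_fam \<tau> \<in> finsupp"
  by (rule finsuppI[of "{\<tau>}"]) (auto simp: unit_fam_def split: if_splits)

lemma lincomb_unit_fam: "lincomb v (unit_fam \<tau>) = v \<tau>"
  by (subst lincomb_eq_sum[of "{\<tau>}"]) (auto simp: unit_fam_def split: if_splits)

lemma lincomb_scaled_family:
  assumes "\<And>\<tau>. k \<tau> \<noteq> 0"
  shows "lincomb (\<lambda>\<tau>. cscale (k \<tau>) (v \<tau>)) a = lincomb v (\<lambda>\<tau>. k \<tau> * a \<tau>)"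
  using assms unfolding lincomb_def by (simp add: mult.commute)

lemma span_eq_lincomb: "cfun.span (range v) = lincomb v ` finsupp"
proof (intro equalityI subsetI)
  fix x assume "x \<in> cfun.span (range v)"
  then show "x \<in> lincomb v ` finsupp"
  proof (induction rule: cfun.span_induct_alt)
    case base
    show ?case by (intro image_eqI[OF _ finsupp_zero]) simp
  next
    case (step c x y)
    then obtain \<tau> b where "x = v \<tau>" and b: "y = lincomb v b" "b \<in> finsupp" by blast
    then have "cscale c x + y = lincomb v (cscale c (unit_fam \<tau>) + b)"
      by (simp add: lincomb_combination unit_fam_finsupp lincomb_unit_fam)
    then show ?case by (rule image_eqI[of _ "lincomb v"]) (intro finsupp_add finsupp_scale unit_fam_finsupp b)
  qed
next
  fix x assume "x \<in> lincomb v ` finsupp"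
  then show "x \<in> cfun.span (range v)"
    unfolding lincomb_def by (auto intro!: cfun.span_sum cfun.span_scale intro: cfun.span_base)
qed

lemma free_family_inj:
  assumes "free_family v"
  shows "inj v"
proof (rule injI, rule ccontr)
  fix \<tau> \<sigma> assume eq: "v \<tau> = v \<sigma>" and ne: "\<tau> \<noteq> \<sigma>"
  have "lincomb v (unit_fam \<tau> - unit_fam \<sigma>) = 0"
    by (simp add: lincomb_diff unit_fam_finsupp lincomb_unit_fam eq)
  then have "unit_fam \<tau> - unit_fam \<sigma> = 0"
    using assms unfolding free_family_def by (blast intro: finsupp_diff unit_fam_finsupp)
  then have "unit_fam \<tau> \<tau> = unit_fam \<sigma> \<tau>" by (metis eq_iff_diff_eq_0)
  then show False using ne by (simp add: unit_fam_def)
qed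

lemma free_family_independent:
  assumes "free_family v"
  shows "cfun.independent (range v)"
  unfolding cfun.independent_explicit_module
proof (intro allI impI)
  fix t u x assume t: "finite t" "t \<subseteq> range v" "(\<Sum>x\<in>t. cscale (u x) x) = 0" "x \<in> t"
  define T where "T = v -` t"
  have T: "finite T" "v ` T = t" unfolding T_def
    using t free_family_inj[OF assms] by (auto intro: finite_vimageI)
  define a where "a = (\<lambda>\<tau>. if \<tau> \<in> T then u (v \<tau>) else 0)"
  have a: "a \<in> finsupp" by (rule finsuppI[OF T(1)]) (auto simp: a_def split: if_splits)
  have "lincomb v a = (\<Sum>\<tau>\<in>T. cscale (a \<tau>) (v \<tau>))"
    by (intro lincomb_eq_sum T) (auto simp: a_def split: if_splits)
  also have "\<dots> = (\<Sum>\<tau>\<in>T. cscale (u (v \<tau>)) (v \<tau>))" by (intro sum.cong) (auto simp: a_def)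
  also have "\<dots> = (\<Sum>x\<in>v ` T. cscale (u x) x)"
    using free_family_inj[OF assms] by (subst sum.reindex) (auto intro: inj_on_subset)
  also have "\<dots> = 0" using t(3) T(2) by simp
  finally have a0: "a = 0" using assms a by (auto simp: free_family_def)
  obtain \<tau> where \<tau>: "x = v \<tau>" "\<tau> \<in> T" using t(4) T(2) by auto
  have "a \<tau> = 0" unfolding a0 pointwise ..
  then show "u x = 0" using \<tau> by (simp add: a_def)
qed

lemma representation_lincomb:
  assumes "free_family v" "a \<in> finsupp"
  shows "cfun.representation (range v) (lincomb v a) (v \<tau>) = a \<tau>"
proof -
  note ind = free_family_independent[OF assms(1)]
  have sp: "v \<sigma> \<in> cfun.span (range v)" for \<sigma> by (rule cfun.span_base) simp
  have "cfun.representation (range v) (lincomb v a) (v \<tau>) =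
      (\<Sum>\<sigma> | a \<sigma> \<noteq> 0. cfun.representation (range v) (cscale (a \<sigma>) (v \<sigma>)) (v \<tau>))"
    unfolding lincomb_def by (subst cfun.representation_sum[OF ind]) (auto intro: cfun.span_scale sp)
  also have "\<dots> = (\<Sum>\<sigma> | a \<sigma> \<noteq> 0. if \<sigma> = \<tau> then a \<tau> else 0)"
    using free_family_inj[OF assms(1)]
    by (intro sum.cong refl)
       (auto simp: cfun.representation_scale[OF ind sp] cfun.representation_basis[OF ind] dest: injD)
  also have "\<dots> = a \<tau>" using assms(2) by (simp add: finsupp_def)
  finally show ?thesis .
qed

section \<open>Bilinearity and associativity of the Wick product\<close>

text \<open>
  A common truncation order for several first factors, so that identities between finitely many Wick
  products can be checked term by term.
\<close>

lemma wick_truncated: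
  assumes "finite S" "S \<subseteq> polynomials"
  shows "\<exists>N. \<forall>n\<ge>N. \<forall>f\<in>S. \<forall>g. wick hb f g = (\<Sum>r<n. cscale ((2 * hb) ^ r / fact r) (contract r f g))"
  using assms
proof (induction S)
  case (insert f S)
  obtain N where N: "\<forall>n\<ge>N. \<forall>f\<in>S. \<forall>g. wick hb f g = (\<Sum>r<n. cscale ((2 * hb) ^ r / fact r) (contract r f g))"
    using insert by blast
  obtain M where M: "\<forall>n\<ge>M. \<forall>g. wick hb f g = (\<Sum>r<n. cscale ((2 * hb) ^ r / fact r) (contract r f g))"
    using wick_finite[of f hb] insert by blast
  show ?case using N M by (intro exI[of _ "max N M"]) simp
qed auto

lemma wick_truncatedE:
  assumes "finite S" "S \<subseteq> polynomials"
  obtains N where "\<And>n f g. n \<ge> N \<Longrightarrow> f \<in> S \<Longrightarrow>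
    wick hb f g = (\<Sum>r<n. cscale ((2 * hb) ^ r / fact r) (contract r f g))"
  using wick_truncated[OF assms, of hb] that by blast

lemma wick_left:
  assumes "f \<in> polynomials" "f' \<in> polynomials"
  shows "wick hb (cscale c f + f') g = cscale c (wick hb f g) + wick hb f' g"
proof -
  have S: "{f, f', cscale c f + f'} \<subseteq> polynomials" using assms by (auto simp: poly_add poly_scale)
  obtain N where N: "\<And>n h g. n \<ge> N \<Longrightarrow> h \<in> {f, f', cscale c f + f'} \<Longrightarrow>
      wick hb h g = (\<Sum>r<n. cscale ((2 * hb) ^ r / fact r) (contract r h g))"
    using wick_truncatedE[OF _ S, of hb] by blast
  show ?thesis
    by (simp add: N[OF order_refl] contract_left assms cfun.scale_right_distrib sum.distrib cfun.scale_sum_right mult.commute)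
qed

lemma wick_right:
  assumes "f \<in> polynomials" "g \<in> polynomials" "g' \<in> polynomials"
  shows "wick hb f (cscale c g + g') = cscale c (wick hb f g) + wick hb f g'"
proof -
  obtain N where N: "\<And>g. wick hb f g = (\<Sum>r<N. cscale ((2 * hb) ^ r / fact r) (contract r f g))"
    using wick_finite[OF assms(1), of hb] by blast
  show ?thesis
    by (simp add: N contract_right assms cfun.scale_right_distrib sum.distrib cfun.scale_sum_right mult.commute)
qed

lemma wick_poly:
  assumes "f \<in> polynomials" "g \<in> polynomials"
  shows "wick hb f g \<in> polynomials"
proof -
  obtain N where N: "\<And>g. wick hb f g = (\<Sum>r<N. cscale ((2 * hb) ^ r / fact r) (contract r f g))"
    using wick_finite[OF assms(1), of hb] by blast
  show ?thesis unfolding N by (intro poly_sum poly_scale contract_poly assms)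
qed

lemma wick_zero_left: "wick hb 0 g = 0"
  using wick_left[OF poly_zero poly_zero, of hb 1 g] by simp

lemma wick_zero_right: "f \<in> polynomials \<Longrightarrow> wick hb f 0 = 0"
  using wick_right[OF _ poly_zero poly_zero, of f hb 1] by simp

lemma wick_add_left: "f \<in> polynomials \<Longrightarrow> f' \<in> polynomials \<Longrightarrow> wick hb (f + f') g = wick hb f g + wick hb f' g"
  using wick_left[of f f' hb 1 g] by simp

lemma wick_scale_left: "f \<in> polynomials \<Longrightarrow> wick hb (cscale c f) g = cscale c (wick hb f g)"
  using wick_left[of f 0 hb c g] by (simp add: poly_zero wick_zero_left)

lemma wick_add_right:
  "f \<in> polynomials \<Longrightarrow> g \<in> polynomials \<Longrightarrow> g' \<in> polynomials \<Longrightarrow> wick hb f (g + g') = wick hb f g + wick hb f g'"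
  using wick_right[of f g g' hb 1] by simp

lemma wick_scale_right: "f \<in> polynomials \<Longrightarrow> g \<in> polynomials \<Longrightarrow> wick hb f (cscale c g) = cscale c (wick hb f g)"
  using wick_right[of f g 0 hb c] by (simp add: poly_zero wick_zero_right)

lemma wick_one: "wick hb 1 g = g"
proof -
  obtain N where N: "\<And>n. n \<ge> N \<Longrightarrow> wick hb 1 g = (\<Sum>r<n. cscale ((2 * hb) ^ r / fact r) (contract r 1 g))"
    using wick_finite[OF one_poly, of hb] by blast
  have d1: "d_z j 1 = 0" for j :: "'a option" by (simp add: one_nmono d_z_nmono)
  have "contract (Suc r) 1 g = 0" for r by (simp add: d1 contract_zero)
  then have "(\<Sum>r<Suc N. cscale ((2 * hb) ^ r / fact r) (contract r 1 g)) = contract 0 1 g"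
    by (subst sum.lessThan_Suc_shift) (simp del: contract.simps(2))
  then show ?thesis using N[of "Suc N"] by simp
qed

lemma wick_conj_coord:
  assumes "f \<in> polynomials"
  shows "wick hb (conj_coord i * f) g = conj_coord i * wick hb f g"
proof -
  have S: "{f, conj_coord i * f} \<subseteq> polynomials" using assms by (auto simp: poly_mult conj_coord_poly)
  obtain N where N: "\<And>n h g. n \<ge> N \<Longrightarrow> h \<in> {f, conj_coord i * f} \<Longrightarrow>
      wick hb h g = (\<Sum>r<n. cscale ((2 * hb) ^ r / fact r) (contract r h g))"
    using wick_truncatedE[OF _ S, of hb] by blast
  show ?thesis by (simp add: N[OF order_refl] contract_zbar assms sum_distrib_left cscale_mult_right)
qed

lemma wick_coord:
  assumes "f \<in> polynomials" "g \<in> polynomials"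
  shows "wick hb (coord i * f) g = coord i * wick hb f g + cscale (2 * hb * gmetric i i) (wick hb f (d_zbar i g))"
proof -
  let ?c = "\<lambda>r. (2 * hb) ^ r / fact r"
  have S: "{f, coord i * f} \<subseteq> polynomials" using assms by (auto simp: poly_mult coord_poly)
  obtain N where N: "\<And>n h g. n \<ge> N \<Longrightarrow> h \<in> {f, coord i * f} \<Longrightarrow>
      wick hb h g = (\<Sum>r<n. cscale ((2 * hb) ^ r / fact r) (contract r h g))"
    using wick_truncatedE[OF _ S, of hb] by blast
  have coef: "?c (Suc r) * (of_nat (Suc r) * gmetric i i) = 2 * hb * gmetric i i * ?c r" for r
    by (simp add: field_simps del: of_nat_Suc)
  have "wick hb (coord i * f) g = cscale (?c 0) (contract 0 (coord i * f) g) + (\<Sum>r<N. cscale (?c (Suc r)) (contract (Suc r) (coord i * f) g))"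
    by (subst N[of "Suc N"]) (simp_all only: sum.lessThan_Suc_shift, auto)
  also have "\<dots> = (cscale (?c 0) (coord i * contract 0 f g) + (\<Sum>r<N. cscale (?c (Suc r)) (coord i * contract (Suc r) f g))) +
      (\<Sum>r<N. cscale (2 * hb * gmetric i i) (cscale (?c r) (contract r f (d_zbar i g))))"
    unfolding contract_z[OF assms] cfun.scale_right_distrib sum.distrib cfun.scale_scale coef
    by (simp only: contract.simps(1) mult.assoc add.assoc)
  also have "cscale (?c 0) (coord i * contract 0 f g) + (\<Sum>r<N. cscale (?c (Suc r)) (coord i * contract (Suc r) f g)) = coord i * wick hb f g"
    by (subst N[of "Suc N" f]) (simp_all only: sum.lessThan_Suc_shift distrib_left sum_distrib_left cscale_mult_right, auto)
  also have "(\<Sum>r<N. cscale (2 * hb * gmetric i i) (cscale (?c r) (contract r f (d_zbar i g)))) =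
      cscale (2 * hb * gmetric i i) (wick hb f (d_zbar i g))"
    by (subst N[of N f]) (auto simp: cfun.scale_sum_right)
  finally show ?thesis .
qed

lemma wick_d_zbar:
  assumes "f \<in> polynomials" "g \<in> polynomials"
  shows "d_zbar i (wick hb f g) = wick hb (d_zbar i f) g + wick hb f (d_zbar i g)"
proof -
  have S: "{f, d_zbar i f} \<subseteq> polynomials" using assms by (auto simp: d_zbar_poly)
  obtain N where N: "\<And>n h g. n \<ge> N \<Longrightarrow> h \<in> {f, d_zbar i f} \<Longrightarrow>
      wick hb h g = (\<Sum>r<n. cscale ((2 * hb) ^ r / fact r) (contract r h g))"
    using wick_truncatedE[OF _ S, of hb] by blast
  show ?thesis
    by (simp add: N[OF order_refl] assms d_zbar_sum poly_scale contract_poly d_zbar_scale contract_d_zbar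
        cfun.scale_right_distrib sum.distrib)
qed

text \<open>
  Induction on the first factor over its generators. The only substantial case is \<open>z\<^sub>i f\<close>: by \<open>wick_coord\<close>
  both sides reduce to the induction hypothesis for \<open>f\<close> once \<open>d_zbar i\<close> is known to be a derivation of the
  Wick product (\<open>wick_d_zbar\<close>).
\<close>

lemma wick_assoc:
  assumes "f \<in> polynomials" "g \<in> polynomials" "h \<in> polynomials"
  shows "wick hb (wick hb f g) h = wick hb f (wick hb g h)"
  using assms
proof (induction arbitrary: g h rule: poly_induct_mult)
  case one
  then show ?case by (simp add: wick_one)
next
  case (conj_coord i f)
  then show ?case by (simp add: wick_conj_coord wick_poly)
next
  case (scale c f)
  then show ?case by (simp add: wick_scale_left wick_poly)
next
  case (add f f')
  then show ?case by (simp add: wick_add_left wick_poly)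
next
  case (coord i f)
  let ?c = "2 * hb * gmetric i i"
  have p: "f \<in> polynomials" "g \<in> polynomials" "h \<in> polynomials"
    "d_zbar i g \<in> polynomials" "d_zbar i h \<in> polynomials"
    "coord i * wick hb f g \<in> polynomials" "wick hb f g \<in> polynomials" "wick hb g h \<in> polynomials"
    "wick hb f (d_zbar i g) \<in> polynomials" "wick hb (d_zbar i g) h \<in> polynomials" "wick hb g (d_zbar i h) \<in> polynomials"
    using coord by (auto simp: d_zbar_poly poly_mult wick_poly coord_poly)
  have "wick hb (wick hb (coord i * f) g) h = wick hb (coord i * wick hb f g) h + cscale ?c (wick hb (wick hb f (d_zbar i g)) h)"
    using p by (simp add: wick_coord wick_add_left poly_scale wick_scale_left)
  also have "\<dots> = coord i * wick hb (wick hb f g) h + cscale ?c (wick hb (wick hb f g) (d_zbar i h)) +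
      cscale ?c (wick hb (wick hb f (d_zbar i g)) h)"
    using p by (simp add: wick_coord)
  also have "\<dots> = coord i * wick hb f (wick hb g h) + (cscale ?c (wick hb f (wick hb g (d_zbar i h))) +
      cscale ?c (wick hb f (wick hb (d_zbar i g) h)))"
    using p coord by (simp add: add.assoc)
  also have "cscale ?c (wick hb f (wick hb g (d_zbar i h))) + cscale ?c (wick hb f (wick hb (d_zbar i g) h)) =
      cscale ?c (wick hb f (d_zbar i (wick hb g h)))"
    using p by (simp add: wick_d_zbar wick_add_right cfun.scale_right_distrib add.commute)
  also have "coord i * wick hb f (wick hb g h) + \<dots> = wick hb (coord i * f) (wick hb g h)"
    using p by (simp add: wick_coord)
  finally show ?case .
qed

section \<open>Structure constants\<close>

text \<open>
  A list names the coordinates that are contracted, in order. It contributes if its indices can be removed from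
  the holomorphic exponents of the first factor and from the conjugate exponents of the second.
\<close>

definition contractions :: "'n::finite triple \<Rightarrow> 'n triple \<Rightarrow> 'n option list set" where
  "contractions \<tau> \<sigma> = {xs. \<forall>j. count_list xs j \<le> fullP \<tau> j \<and> count_list xs j \<le> fullQ \<sigma> j}"

definition contracted :: "'n::finite triple \<Rightarrow> 'n triple \<Rightarrow> 'n option list \<Rightarrow> 'n triple" where
  "contracted \<tau> \<sigma> xs = mk_triple (\<lambda>j. (fullP \<tau> j - count_list xs j) + fullP \<sigma> j)
     (\<lambda>j. fullQ \<tau> j + (fullQ \<sigma> j - count_list xs j))"

text \<open>
  The structure constants of the Wick product in the basis \<open>wick_basis\<close>. The binomial coefficients are those of
  the product of the two divided monomials that remain after contraction.
\<close>

definition contraction_coeff :: "'n::finite triple \<Rightarrow> 'n triple \<Rightarrow> 'n triple \<Rightarrow> complex" where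
  "contraction_coeff \<tau> \<sigma> \<rho> = (\<Sum>xs | xs \<in> contractions \<tau> \<sigma> \<and> contracted \<tau> \<sigma> xs = \<rho>.
     metric_sign xs / fact (length xs) *
       of_nat (multi_binom (fullP \<rho>) (fullP \<sigma>) * multi_binom (fullQ \<rho>) (fullQ \<tau>)))"

text \<open>
  The map \<open>S\<close> sends this basis to the \<open>f\<^sub>\<tau>\<close> (\<open>S_map_lincomb\<close>), and the power of \<open>2 \<hbar>\<close> makes the structure
  constants independent of \<open>\<hbar>\<close>.
\<close>

definition wick_basis :: "complex \<Rightarrow> 'n::finite triple \<Rightarrow> 'n pt \<Rightarrow> complex" where
  "wick_basis hb \<tau> = cscale (1 / (2 * hb) ^ deg \<tau>) (nmono (fullP \<tau>) (fullQ \<tau>))"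

lemma contractions_length:
  assumes "xs \<in> contractions \<tau> \<sigma>"
  shows "length xs \<le> deg \<tau>" "length xs \<le> deg \<sigma>"
  using assms sum_mono[of UNIV "count_list xs" "fullP \<tau>"] sum_mono[of UNIV "count_list xs" "fullQ \<sigma>"]
  by (auto simp: contractions_def length_count)

lemma finite_contractions: "finite (contractions \<tau> \<sigma>)"
proof (rule finite_subset)
  show "contractions \<tau> \<sigma> \<subseteq> (\<Union>r\<le>deg \<tau>. {xs. length xs = r})" using contractions_length by auto
qed (auto intro: finite_lists_length)

lemma
  assumes "xs \<in> contractions \<tau> \<sigma>"
  shows fullP_contracted: "fullP (contracted \<tau> \<sigma> xs) = (\<lambda>j. (fullP \<tau> j - count_list xs j) + fullP \<sigma> j)"
    and fullQ_contracted: "fullQ (contracted \<tau> \<sigma> xs) = (\<lambda>j. fullQ \<tau> j + (fullQ \<sigma> j - count_list xs j))"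
    and deg_contracted: "deg (contracted \<tau> \<sigma> xs) + length xs = deg \<tau> + deg \<sigma>"
proof -
  have le: "\<And>j. count_list xs j \<le> fullP \<tau> j" "\<And>j. count_list xs j \<le> fullQ \<sigma> j"
    using assms by (auto simp: contractions_def)
  have 1: "(\<Sum>j\<in>UNIV. (fullP \<tau> j - count_list xs j) + fullP \<sigma> j) = (deg \<tau> - length xs) + deg \<sigma>"
    unfolding sum.distrib sum_subtractf_nat[OF le(1)] length_count by simp
  have 2: "(\<Sum>j\<in>UNIV. fullQ \<tau> j + (fullQ \<sigma> j - count_list xs j)) = deg \<tau> + (deg \<sigma> - length xs)"
    unfolding sum.distrib sum_subtractf_nat[OF le(2)] length_count by simp
  have eq: "(\<Sum>j\<in>UNIV. (fullP \<tau> j - count_list xs j) + fullP \<sigma> j) = (\<Sum>j\<in>UNIV. fullQ \<tau> j + (fullQ \<sigma> j - count_list xs j))"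
    using contractions_length[OF assms] unfolding 1 2 by simp
  show "fullP (contracted \<tau> \<sigma> xs) = (\<lambda>j. (fullP \<tau> j - count_list xs j) + fullP \<sigma> j)"
    "fullQ (contracted \<tau> \<sigma> xs) = (\<lambda>j. fullQ \<tau> j + (fullQ \<sigma> j - count_list xs j))"
    using fullP_mk[OF eq] fullQ_mk[OF eq] by (simp_all add: contracted_def)
  show "deg (contracted \<tau> \<sigma> xs) + length xs = deg \<tau> + deg \<sigma>"
    using deg_mk[OF eq] contractions_length[OF assms] by (simp add: contracted_def 1)
qed

text \<open>
  A contraction of length \<open>r\<close> yields degree \<open>deg \<tau> + deg \<sigma> - r\<close>, and \<open>r\<close> exceeds neither of the two
  degrees.
\<close>

lemma contraction_coeff_nonzero:
  assumes "contraction_coeff \<tau> \<sigma> \<rho> \<noteq> 0"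
  shows "deg \<tau> \<le> deg \<rho>" "deg \<sigma> \<le> deg \<rho>" "deg \<rho> \<le> deg \<tau> + deg \<sigma>"
proof -
  have "{xs. xs \<in> contractions \<tau> \<sigma> \<and> contracted \<tau> \<sigma> xs = \<rho>} \<noteq> {}"
    using assms unfolding contraction_coeff_def by (metis (no_types) sum.empty)
  then obtain xs where xs: "xs \<in> contractions \<tau> \<sigma>" "contracted \<tau> \<sigma> xs = \<rho>" by blast
  show "deg \<tau> \<le> deg \<rho>" "deg \<sigma> \<le> deg \<rho>" "deg \<rho> \<le> deg \<tau> + deg \<sigma>"
    using deg_contracted[OF xs(1)] contractions_length[OF xs(1)] xs(2) by auto
qed

lemma multi_binom_le: "multi_binom A B \<le> 2 ^ sum A UNIV"
proof -
  have "multi_binom A B \<le> (\<Prod>i\<in>UNIV. 2 ^ A i)"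
    unfolding multi_binom_def by (intro prod_mono) (simp add: binomial_le_pow2)
  then show ?thesis by (simp add: power_sum)
qed

text \<open>
  All contractions from \<open>\<tau>\<close> and \<open>\<sigma>\<close> to \<open>\<rho>\<close> have the same length \<open>r\<close>. There are at most \<open>(n + 1) ^ r\<close> of them, and
  \<open>(n + 1) ^ r / r! \<le> exp (n + 1)\<close>.
\<close>

lemma norm_contraction_coeff_le: "cmod (contraction_coeff \<tau> \<sigma> (\<rho> :: 'n::finite triple)) \<le> exp (real CARD('n option)) * 4 ^ deg \<rho>"
proof -
  let ?L = "{xs. xs \<in> contractions \<tau> \<sigma> \<and> contracted \<tau> \<sigma> xs = \<rho>}"
  let ?N = "CARD('n option)"
  define r where "r = deg \<tau> + deg \<sigma> - deg \<rho>"
  have len: "length xs = r" if "xs \<in> ?L" for xs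
    using deg_contracted[of xs \<tau> \<sigma>] that by (auto simp: r_def)
  have card: "card ?L \<le> ?N ^ r"
  proof -
    have "card ?L \<le> card {xs :: 'n option list. length xs = r}"
      using len by (intro card_mono finite_lists_length) auto
    also have "\<dots> = ?N ^ r" using card_lists_length_eq[of "UNIV :: 'n option set" r] by simp
    finally show ?thesis .
  qed
  have bin: "multi_binom (fullP \<rho>) (fullP \<sigma>) * multi_binom (fullQ \<rho>) (fullQ \<tau>) \<le> 4 ^ deg \<rho>"
  proof -
    have "multi_binom (fullP \<rho>) (fullP \<sigma>) * multi_binom (fullQ \<rho>) (fullQ \<tau>) \<le> 2 ^ deg \<rho> * 2 ^ deg \<rho>"
      using multi_binom_le[of "fullP \<rho>" "fullP \<sigma>"] multi_binom_le[of "fullQ \<rho>" "fullQ \<tau>"]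
      by (intro mult_mono) auto
    also have "\<dots> = 4 ^ deg \<rho>" by (simp flip: power_mult_distrib)
    finally show ?thesis .
  qed
  have "cmod (contraction_coeff \<tau> \<sigma> \<rho>) \<le> (\<Sum>xs\<in>?L. 1 / fact r * 4 ^ deg \<rho>)"
    unfolding contraction_coeff_def
  proof (rule order_trans[OF norm_sum sum_mono])
    fix xs assume xs: "xs \<in> ?L"
    have "real (multi_binom (fullP \<rho>) (fullP \<sigma>) * multi_binom (fullQ \<rho>) (fullQ \<tau>)) \<le> 4 ^ deg \<rho>"
      using of_nat_mono[OF bin, where 'a=real] by simp
    then have "1 / fact r * real (multi_binom (fullP \<rho>) (fullP \<sigma>) * multi_binom (fullQ \<rho>) (fullQ \<tau>)) \<le> 1 / fact r * 4 ^ deg \<rho>"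
      by (intro mult_left_mono) auto
    then show "cmod (metric_sign xs / fact (length xs) *
       of_nat (multi_binom (fullP \<rho>) (fullP \<sigma>) * multi_binom (fullQ \<rho>) (fullQ \<tau>))) \<le> 1 / fact r * 4 ^ deg \<rho>"
      using len[OF xs] unfolding norm_mult norm_divide norm_metric_sign norm_of_nat by simp
  qed
  also have "\<dots> = real (card ?L) / fact r * 4 ^ deg \<rho>" by simp
  also have "\<dots> \<le> real ?N ^ r / fact r * 4 ^ deg \<rho>"
    using of_nat_mono[OF card, where 'a=real] by (intro mult_right_mono divide_right_mono) auto
  also have "\<dots> \<le> exp (real ?N) * 4 ^ deg \<rho>"
  proof (intro mult_right_mono)
    have "(\<Sum>i\<in>{r}. real ?N ^ i / fact i) \<le> (\<Sum>i. real ?N ^ i / fact i)"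
      using summable_exp[of "real ?N"] by (intro sum_le_suminf) (auto simp: divide_inverse mult.commute)
    then show "real ?N ^ r / fact r \<le> exp (real ?N)" by (simp add: exp_def divide_inverse mult.commute)
  qed simp
  finally show ?thesis .
qed

definition zero_triple :: "'n::finite triple" where
  "zero_triple = mk_triple (\<lambda>_. 0) (\<lambda>_. 0)"

lemma zero_triple_full: "fullP zero_triple = (\<lambda>_. 0)" "fullQ zero_triple = (\<lambda>_. 0)" "deg zero_triple = 0"
  by (simp_all add: zero_triple_def fullP_mk fullQ_mk deg_mk)

lemma contraction_coeff_unit: "contraction_coeff zero_triple \<rho> \<rho> = 1" "contraction_coeff \<rho> zero_triple \<rho> = 1"
proof -
  have mb: "multi_binom A A = 1" "multi_binom A (\<lambda>_. 0) = 1" for A :: "'a option \<Rightarrow> nat"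
    by (simp_all add: multi_binom_def)
  have "contractions zero_triple \<rho> = {[]}" "contractions \<rho> zero_triple = {[]}"
    using contractions_length[of _ zero_triple \<rho>] contractions_length[of _ \<rho> zero_triple]
    by (auto simp: zero_triple_full) (auto simp: contractions_def)
  moreover have "[] \<in> contractions zero_triple \<rho>" "[] \<in> contractions \<rho> zero_triple" by (auto simp: contractions_def)
  then have "contracted zero_triple \<rho> [] = \<rho>" "contracted \<rho> zero_triple [] = \<rho>"
    by (auto intro!: triple_eqI simp: fullP_contracted fullQ_contracted zero_triple_full)
  ultimately have sets: "{xs. xs \<in> contractions zero_triple \<rho> \<and> contracted zero_triple \<rho> xs = \<rho>} = {[]}"
      "{xs. xs \<in> contractions \<rho> zero_triple \<and> contracted \<rho> zero_triple xs = \<rho>} = {[]}"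
    by auto
  show "contraction_coeff zero_triple \<rho> \<rho> = 1" "contraction_coeff \<rho> zero_triple \<rho> = 1"
    unfolding contraction_coeff_def sets by (simp_all add: zero_triple_full mb metric_sign_def)
qed

lemma wick_basis_poly: "wick_basis hb \<tau> \<in> polynomials"
  unfolding wick_basis_def by (intro poly_scale nmono_poly)

lemma sum_fun_apply: "sum F S z = (\<Sum>k\<in>S. F k z)" for F :: "'k \<Rightarrow> 'z \<Rightarrow> 'c::comm_monoid_add"
  by (induction S rule: infinite_finite_induct) (auto simp: pointwise)

text \<open>
  Each contraction turns the two divided monomials into a multiple of a third one. The powers of \<open>2 \<hbar>\<close> match
  because the contraction length is the loss of degree. The sum runs over an arbitrary finite set \<open>R\<close> that is large enough, so that
  products of several pairs can be added over a common set.
\<close>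

lemma wick_basis_product:
  fixes \<tau> \<sigma> :: "'n::finite triple"
  assumes hb: "hb \<noteq> 0" and R: "finite R" "degs_upto (deg \<tau> + deg \<sigma>) \<subseteq> R"
  shows "wick hb (wick_basis hb \<tau>) (wick_basis hb \<sigma>) = (\<Sum>\<rho>\<in>R. cscale (contraction_coeff \<tau> \<sigma> \<rho>) (wick_basis hb \<rho>))"
proof (rule ext)
  fix z
  let ?n = "\<lambda>\<tau> :: 'n triple. nmono (fullP \<tau>) (fullQ \<tau>)"
  let ?C = "contractions \<tau> \<sigma>"
  define coef where "coef = (\<lambda>xs. metric_sign xs / fact (length xs) *
       of_nat (multi_binom (fullP (contracted \<tau> \<sigma> xs)) (fullP \<sigma>) * multi_binom (fullQ (contracted \<tau> \<sigma> xs)) (fullQ \<tau>)))"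
  obtain N0 where N0: "\<And>N g. N \<ge> N0 \<Longrightarrow> wick hb (?n \<tau>) g = (\<Sum>r<N. cscale ((2 * hb) ^ r / fact r) (contract r (?n \<tau>) g))"
    using wick_finite[OF nmono_poly, of hb "fullP \<tau>" "fullQ \<tau>"] by blast
  \<comment> \<open>Contractions are at most as long as the degree of \<open>\<tau>\<close>, so all of them occur below \<open>N\<close>.\<close>
  define N where "N = max N0 (Suc (deg \<tau>))"
  have trm: "metric_sign xs * foldr d_z xs (?n \<tau>) z * foldr d_zbar xs (?n \<sigma>) z =
     (if xs \<in> ?C then fact (length xs) * (coef xs * ?n (contracted \<tau> \<sigma> xs) z) else 0)" for xs
  proof (cases "xs \<in> ?C")
    case True
    then have d: "foldr d_z xs (?n \<tau>) = nmono (\<lambda>j. fullP \<tau> j - count_list xs j) (fullQ \<tau>)"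
       "foldr d_zbar xs (?n \<sigma>) = nmono (fullP \<sigma>) (\<lambda>j. fullQ \<sigma> j - count_list xs j)"
      by (auto simp: foldr_d_z_nmono foldr_d_zbar_nmono contractions_def)
    have sums: "(\<lambda>j. fullP \<tau> j - count_list xs j) + fullP \<sigma> = fullP (contracted \<tau> \<sigma> xs)"
      "fullQ \<tau> + (\<lambda>j. fullQ \<sigma> j - count_list xs j) = fullQ (contracted \<tau> \<sigma> xs)"
      unfolding fullP_contracted[OF True] fullQ_contracted[OF True] plus_fun_def by auto
    have "nmono (\<lambda>j. fullP \<tau> j - count_list xs j) (fullQ \<tau>) z * nmono (fullP \<sigma>) (\<lambda>j. fullQ \<sigma> j - count_list xs j) z =
      of_nat (multi_binom (fullP (contracted \<tau> \<sigma> xs)) (fullP \<sigma>) * multi_binom (fullQ (contracted \<tau> \<sigma> xs)) (fullQ \<tau>)) *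
        ?n (contracted \<tau> \<sigma> xs) z"
      using fun_cong[OF nmono_mult[of "\<lambda>j. fullP \<tau> j - count_list xs j" "fullQ \<tau>" "fullP \<sigma>" "\<lambda>j. fullQ \<sigma> j - count_list xs j"], of z]
      unfolding sums by (simp add: pointwise cscale_def)
    then show ?thesis using True unfolding d by (simp add: coef_def)
  next
    case False
    then have "foldr d_z xs (?n \<tau>) = 0 \<or> foldr d_zbar xs (?n \<sigma>) = 0"
      unfolding contractions_def foldr_d_z_nmono foldr_d_zbar_nmono by auto
    then show ?thesis using False by (auto simp: pointwise)
  qed
  have contr: "contract r (?n \<tau>) (?n \<sigma>) z = (\<Sum>xs\<in>{xs \<in> ?C. length xs = r}. fact r * (coef xs * ?n (contracted \<tau> \<sigma> xs) z))" for r
  proof -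
    have "contract r (?n \<tau>) (?n \<sigma>) z = (\<Sum>xs\<in>{xs. length xs = r}. if xs \<in> ?C then fact (length xs) * (coef xs * ?n (contracted \<tau> \<sigma> xs) z) else 0)"
      unfolding contract_lists trm ..
    also have "\<dots> = (\<Sum>xs\<in>{xs \<in> ?C. length xs = r}. fact r * (coef xs * ?n (contracted \<tau> \<sigma> xs) z))"
      by (intro sum.mono_neutral_cong_right finite_lists_length) auto
    finally show ?thesis .
  qed
  have "wick hb (?n \<tau>) (?n \<sigma>) z = (\<Sum>r<N. (2 * hb) ^ r / fact r * contract r (?n \<tau>) (?n \<sigma>) z)"
    using N0[of N "?n \<sigma>"] by (simp add: N_def sum_fun_apply cscale_def)
  also have "\<dots> = (\<Sum>r<N. \<Sum>xs\<in>{xs \<in> ?C. length xs = r}. (2 * hb) ^ length xs * (coef xs * ?n (contracted \<tau> \<sigma> xs) z))"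
    unfolding contr sum_distrib_left by (intro sum.cong) auto
  also have "\<dots> = (\<Sum>xs\<in>?C. (2 * hb) ^ length xs * (coef xs * ?n (contracted \<tau> \<sigma> xs) z))"
    using contractions_length(1)[of _ \<tau> \<sigma>] by (intro sum.group finite_contractions) (force simp: N_def)+
  finally have W: "wick hb (?n \<tau>) (?n \<sigma>) z = (\<Sum>xs\<in>?C. (2 * hb) ^ length xs * (coef xs * ?n (contracted \<tau> \<sigma> xs) z))" .
  have "wick hb (wick_basis hb \<tau>) (wick_basis hb \<sigma>) z = 1 / (2 * hb) ^ deg \<tau> * (1 / (2 * hb) ^ deg \<sigma> * wick hb (?n \<tau>) (?n \<sigma>) z)"
    unfolding wick_basis_def wick_scale_left[OF nmono_poly] wick_scale_right[OF nmono_poly nmono_poly] by (simp add: cscale_def)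
  also have "\<dots> = (\<Sum>xs\<in>?C. coef xs * wick_basis hb (contracted \<tau> \<sigma> xs) z)"
    unfolding W sum_distrib_left
  proof (intro sum.cong refl)
    fix xs assume xs: "xs \<in> ?C"
    have "(2 * hb) ^ deg (contracted \<tau> \<sigma> xs) * (2 * hb) ^ length xs = (2 * hb) ^ deg \<tau> * (2 * hb) ^ deg \<sigma>"
      unfolding power_add[symmetric] deg_contracted[OF xs] ..
    moreover have "(2 * hb) ^ k \<noteq> 0" for k using hb by simp
    ultimately have "1 / (2 * hb) ^ deg \<tau> * (1 / (2 * hb) ^ deg \<sigma> * (2 * hb) ^ length xs) = 1 / (2 * hb) ^ deg (contracted \<tau> \<sigma> xs)"
      by (metis (no_types, opaque_lifting) divide_divide_eq_left div_by_1 mult.commute mult.left_neutral nonzero_divide_mult_cancel_left times_divide_eq_left times_divide_eq_right)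
    then have "(1 / (2 * hb) ^ deg \<tau> * (1 / (2 * hb) ^ deg \<sigma> * (2 * hb) ^ length xs)) * (coef xs * ?n (contracted \<tau> \<sigma> xs) z) =
       1 / (2 * hb) ^ deg (contracted \<tau> \<sigma> xs) * (coef xs * ?n (contracted \<tau> \<sigma> xs) z)" by (rule arg_cong)
    then show "1 / (2 * hb) ^ deg \<tau> * (1 / (2 * hb) ^ deg \<sigma> * ((2 * hb) ^ length xs * (coef xs * ?n (contracted \<tau> \<sigma> xs) z))) =
       coef xs * wick_basis hb (contracted \<tau> \<sigma> xs) z"
      unfolding wick_basis_def cscale_def by (simp only: mult.assoc mult.left_commute[of "coef xs"])
  qed
  also have "\<dots> = (\<Sum>\<rho>\<in>R. \<Sum>xs\<in>{xs \<in> ?C. contracted \<tau> \<sigma> xs = \<rho>}. coef xs * wick_basis hb (contracted \<tau> \<sigma> xs) z)"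
  proof (rule sum.group[symmetric, OF finite_contractions R(1)])
    show "contracted \<tau> \<sigma> ` ?C \<subseteq> R"
      using deg_contracted[of _ \<tau> \<sigma>] R(2) by (force simp: degs_upto_def)
  qed
  also have "\<dots> = (\<Sum>\<rho>\<in>R. contraction_coeff \<tau> \<sigma> \<rho> * wick_basis hb \<rho> z)"
    unfolding contraction_coeff_def sum_distrib_right by (intro sum.cong) (auto simp: coef_def)
  finally show "wick hb (wick_basis hb \<tau>) (wick_basis hb \<sigma>) z = (\<Sum>\<rho>\<in>R. cscale (contraction_coeff \<tau> \<sigma> \<rho>) (wick_basis hb \<rho>)) z"
    by (simp add: sum_fun_apply cscale_def)
qed

text \<open>
  The product of formal series. Structure constants with \<open>\<tau>\<close> or \<open>\<sigma>\<close> of larger degree than \<open>\<rho>\<close> vanish, so the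
  sum over all pairs of triples is this finite one (\<open>coeff_mul_eq_sum\<close>).
\<close>

definition coeff_mul :: "('n::finite triple \<Rightarrow> complex) \<Rightarrow> ('n triple \<Rightarrow> complex) \<Rightarrow> 'n triple \<Rightarrow> complex" where
  "coeff_mul a b \<rho> = (\<Sum>\<tau>\<in>degs_upto (deg \<rho>). \<Sum>\<sigma>\<in>degs_upto (deg \<rho>). contraction_coeff \<tau> \<sigma> \<rho> * a \<tau> * b \<sigma>)"

lemma finsupp_degs:
  assumes "a \<in> finsupp"
  shows "\<exists>d. \<forall>\<tau>. a \<tau> \<noteq> 0 \<longrightarrow> \<tau> \<in> degs_upto d"
proof -
  have "finite {\<tau>. a \<tau> \<noteq> 0}" using assms by (simp add: finsupp_def)
  then have "\<forall>\<tau>. a \<tau> \<noteq> 0 \<longrightarrow> deg \<tau> \<le> Max (deg ` {\<tau>. a \<tau> \<noteq> 0})" by auto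
  then show ?thesis by (auto simp: degs_upto_def)
qed

lemma coeff_mul_eq_sum:
  assumes "finite S" "finite S'" "\<And>\<tau>. a \<tau> \<noteq> 0 \<Longrightarrow> \<tau> \<in> S" "\<And>\<tau>. b \<tau> \<noteq> 0 \<Longrightarrow> \<tau> \<in> S'"
  shows "coeff_mul a b \<rho> = (\<Sum>\<tau>\<in>S. \<Sum>\<sigma>\<in>S'. contraction_coeff \<tau> \<sigma> \<rho> * a \<tau> * b \<sigma>)"
proof -
  let ?D = "degs_upto (deg \<rho>)"
  have "coeff_mul a b \<rho> = (\<Sum>(\<tau>, \<sigma>)\<in>?D \<times> ?D. contraction_coeff \<tau> \<sigma> \<rho> * a \<tau> * b \<sigma>)"
    by (simp add: coeff_mul_def sum.cartesian_product)
  also have "\<dots> = (\<Sum>(\<tau>, \<sigma>)\<in>(?D \<times> ?D) \<inter> (S \<times> S'). contraction_coeff \<tau> \<sigma> \<rho> * a \<tau> * b \<sigma>)"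
    using assms by (intro sum.mono_neutral_right) (auto simp: card_degs_upto)
  also have "\<dots> = (\<Sum>(\<tau>, \<sigma>)\<in>S \<times> S'. contraction_coeff \<tau> \<sigma> \<rho> * a \<tau> * b \<sigma>)"
    using assms by (intro sum.mono_neutral_left) (auto simp: degs_upto_def dest: contraction_coeff_nonzero)
  also have "\<dots> = (\<Sum>\<tau>\<in>S. \<Sum>\<sigma>\<in>S'. contraction_coeff \<tau> \<sigma> \<rho> * a \<tau> * b \<sigma>)"
    by (simp add: sum.cartesian_product)
  finally show ?thesis .
qed

lemma coeff_mul_finsupp:
  assumes "a \<in> finsupp" "b \<in> finsupp"
  shows "coeff_mul a b \<in> finsupp"
proof -
  obtain d where d: "\<forall>\<tau>. a \<tau> \<noteq> 0 \<longrightarrow> \<tau> \<in> degs_upto d" using finsupp_degs[OF assms(1)] by blast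
  obtain d' where d': "\<forall>\<tau>. b \<tau> \<noteq> 0 \<longrightarrow> \<tau> \<in> degs_upto d'" using finsupp_degs[OF assms(2)] by blast
  have "\<rho> \<in> degs_upto (d + d')" if nz: "coeff_mul a b \<rho> \<noteq> 0" for \<rho>
  proof -
    obtain \<tau> where "(\<Sum>\<sigma>\<in>degs_upto (deg \<rho>). contraction_coeff \<tau> \<sigma> \<rho> * a \<tau> * b \<sigma>) \<noteq> 0"
      using nz unfolding coeff_mul_def by (rule sum.not_neutral_contains_not_neutral)
    then obtain \<sigma> where "contraction_coeff \<tau> \<sigma> \<rho> * a \<tau> * b \<sigma> \<noteq> 0" by (rule sum.not_neutral_contains_not_neutral)
    then have "contraction_coeff \<tau> \<sigma> \<rho> \<noteq> 0" "a \<tau> \<noteq> 0" "b \<sigma> \<noteq> 0" by auto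
    then have "deg \<tau> \<le> d" "deg \<sigma> \<le> d'" "deg \<rho> \<le> deg \<tau> + deg \<sigma>"
      using d d' contraction_coeff_nonzero(3)[of \<tau> \<sigma> \<rho>] by (simp_all add: degs_upto_def)
    then show ?thesis by (simp add: degs_upto_def)
  qed
  then show ?thesis by (intro finsuppI[OF card_degs_upto(1)])
qed

lemma wick_sum_left:
  assumes "finite S" "\<And>k. k \<in> S \<Longrightarrow> F k \<in> polynomials"
  shows "wick hb (\<Sum>k\<in>S. cscale (c k) (F k)) g = (\<Sum>k\<in>S. cscale (c k) (wick hb (F k) g))"
  using assms
proof (induction S)
  case (insert k S)
  then show ?case by (simp add: wick_left poly_sum poly_scale)
qed (simp add: wick_zero_left)

lemma wick_sum_right:
  assumes "finite S" "\<And>k. k \<in> S \<Longrightarrow> F k \<in> polynomials" "f \<in> polynomials"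
  shows "wick hb f (\<Sum>k\<in>S. cscale (c k) (F k)) = (\<Sum>k\<in>S. cscale (c k) (wick hb f (F k)))"
  using assms
proof (induction S)
  case (insert k S)
  then show ?case by (simp add: wick_right poly_sum poly_scale)
qed (simp add: wick_zero_right)

lemma wick_lincomb:
  assumes hb: "hb \<noteq> 0" and a: "a \<in> finsupp" and b: "b \<in> finsupp"
  shows "wick hb (lincomb (wick_basis hb) a) (lincomb (wick_basis hb) b) = lincomb (wick_basis hb) (coeff_mul a b)"
proof -
  obtain d where d: "\<And>\<tau>. a \<tau> \<noteq> 0 \<Longrightarrow> \<tau> \<in> degs_upto d" using finsupp_degs[OF a] by blast
  obtain d' where d': "\<And>\<tau>. b \<tau> \<noteq> 0 \<Longrightarrow> \<tau> \<in> degs_upto d'" using finsupp_degs[OF b] by blast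
  obtain d'' where d'': "\<And>\<tau>. coeff_mul a b \<tau> \<noteq> 0 \<Longrightarrow> \<tau> \<in> degs_upto d''" using finsupp_degs[OF coeff_mul_finsupp[OF a b]] by blast
  define R where "R = (degs_upto (d + d' + d'') :: 'a triple set)"
  have R: "finite R" by (simp add: R_def card_degs_upto)
  note fin = card_degs_upto(1)
  have "wick hb (lincomb (wick_basis hb) a) (lincomb (wick_basis hb) b) =
     (\<Sum>\<tau>\<in>degs_upto d. cscale (a \<tau>) (\<Sum>\<sigma>\<in>degs_upto d'. cscale (b \<sigma>) (wick hb (wick_basis hb \<tau>) (wick_basis hb \<sigma>))))"
    by (subst lincomb_eq_sum[OF fin d], assumption, subst lincomb_eq_sum[OF fin d'], assumption)
       (simp add: wick_sum_left wick_sum_right fin wick_basis_poly)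
  also have "\<dots> = (\<Sum>\<tau>\<in>degs_upto d. \<Sum>\<sigma>\<in>degs_upto d'. \<Sum>\<rho>\<in>R. cscale (contraction_coeff \<tau> \<sigma> \<rho> * a \<tau> * b \<sigma>) (wick_basis hb \<rho>))"
  proof (unfold cfun.scale_sum_right, intro sum.cong refl)
    fix \<tau> \<sigma> :: "'a triple" assume "\<tau> \<in> degs_upto d" "\<sigma> \<in> degs_upto d'"
    then have sub: "degs_upto (deg \<tau> + deg \<sigma>) \<subseteq> R" by (auto simp: R_def degs_upto_def)
    show "cscale (a \<tau>) (cscale (b \<sigma>) (wick hb (wick_basis hb \<tau>) (wick_basis hb \<sigma>))) =
       (\<Sum>\<rho>\<in>R. cscale (contraction_coeff \<tau> \<sigma> \<rho> * a \<tau> * b \<sigma>) (wick_basis hb \<rho>))"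
      unfolding wick_basis_product[OF hb R sub] cfun.scale_sum_right cfun.scale_scale by (simp add: mult_ac)
  qed
  also have "\<dots> = (\<Sum>\<rho>\<in>R. \<Sum>\<tau>\<in>degs_upto d. \<Sum>\<sigma>\<in>degs_upto d'. cscale (contraction_coeff \<tau> \<sigma> \<rho> * a \<tau> * b \<sigma>) (wick_basis hb \<rho>))"
  proof -
    have "(\<Sum>\<tau>\<in>degs_upto d. \<Sum>\<sigma>\<in>degs_upto d'. \<Sum>\<rho>\<in>R. F \<tau> \<sigma> \<rho>) = (\<Sum>\<tau>\<in>degs_upto d. \<Sum>\<rho>\<in>R. \<Sum>\<sigma>\<in>degs_upto d'. F \<tau> \<sigma> \<rho>)"
      for F :: "'a triple \<Rightarrow> 'a triple \<Rightarrow> 'a triple \<Rightarrow> 'a pt \<Rightarrow> complex"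
      by (intro sum.cong refl sum.swap)
    then show ?thesis by (subst (2) sum.swap) simp
  qed
  also have "\<dots> = (\<Sum>\<rho>\<in>R. cscale (coeff_mul a b \<rho>) (wick_basis hb \<rho>))"
    by (simp add: coeff_mul_eq_sum[OF fin fin d d'] cfun.scale_sum_left)
  also have "\<dots> = lincomb (wick_basis hb) (coeff_mul a b)"
    using d'' by (intro lincomb_eq_sum[symmetric] R) (auto simp: R_def degs_upto_def dest: d'' intro: order_trans)
  finally show ?thesis .
qed

section \<open>Linear independence and invariant polynomials\<close>

lemma exists_count_list: "\<exists>xs. \<forall>j. count_list xs j = A j" for A :: "'a::finite \<Rightarrow> nat"
proof (induction "sum A UNIV" arbitrary: A)
  case 0
  then show ?case by (intro exI[of _ "[]"]) simp
next
  case (Suc k)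
  have "\<exists>i. A i > 0"
  proof (rule ccontr)
    assume "\<not> ?thesis"
    then show False using Suc(2) by simp
  qed
  then obtain i where i: "A i > 0" by blast
  have "sum (lower i A) UNIV + 1 = sum A UNIV" using i by (simp add: lower_def sum.remove[of UNIV i])
  then obtain xs where "\<And>j. count_list xs j = lower i A j" using Suc(1)[of "lower i A"] Suc(2) by auto
  then show ?case using i by (intro exI[of _ "i # xs"]) (auto simp: lower_def)
qed

definition mixed_deriv :: "'n option list \<Rightarrow> 'n option list \<Rightarrow> ('n::finite pt \<Rightarrow> complex) \<Rightarrow> 'n pt \<Rightarrow> complex" where
  "mixed_deriv xs ys f = foldr d_z xs (foldr d_zbar ys f)"

lemma foldr_d_zbar_combination:
  "f \<in> polynomials \<Longrightarrow> g \<in> polynomials \<Longrightarrow> foldr d_zbar xs (cscale c f + g) = cscale c (foldr d_zbar xs f) + foldr d_zbar xs g"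
  by (induction xs) (auto simp: d_zbar_combination foldr_d_zbar_poly)

lemma mixed_deriv_sum:
  assumes "finite S" "\<And>k. k \<in> S \<Longrightarrow> F k \<in> polynomials"
  shows "mixed_deriv xs ys (\<Sum>k\<in>S. cscale (c k) (F k)) = (\<Sum>k\<in>S. cscale (c k) (mixed_deriv xs ys (F k)))"
  using assms
proof (induction S)
  case (insert k S)
  then show ?case
    by (simp add: mixed_deriv_def foldr_d_zbar_combination foldr_d_z_combination foldr_d_zbar_poly poly_sum poly_scale)
qed (simp add: mixed_deriv_def foldr_zero)

lemma mixed_deriv_nmono:
  assumes "\<And>j. count_list xs j = A0 j" "\<And>j. count_list ys j = B0 j"
  shows "mixed_deriv xs ys (nmono A B) =
    (if (\<forall>j. A0 j \<le> A j) \<and> (\<forall>j. B0 j \<le> B j) then nmono (\<lambda>j. A j - A0 j) (\<lambda>j. B j - B0 j) else 0)"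
proof (cases "\<forall>j. B0 j \<le> B j")
  case True
  then show ?thesis using assms by (simp add: mixed_deriv_def foldr_d_zbar_nmono foldr_d_z_nmono)
next
  case False
  then have n: "\<not> (\<forall>j. count_list ys j \<le> B j)" using assms by simp
  show ?thesis using False unfolding mixed_deriv_def foldr_d_zbar_nmono if_not_P[OF n] foldr_zero by auto
qed

lemma mon_at_zero: "mon A 0 = (if A = (\<lambda>_. 0) then 1 else 0)"
proof (cases "A = (\<lambda>_. 0)")
  case False
  then obtain i where "A i \<noteq> 0" by (auto simp: fun_eq_iff)
  then have "mon A 0 = 0" unfolding mon_def by (intro prod_zero) (auto intro: bexI[of _ i])
  then show ?thesis using False by simp
qed (simp add: mon_def)

lemma nmono_at_zero: "nmono A B 0 = (if A = (\<lambda>_. 0) \<and> B = (\<lambda>_. 0) then 1 else 0)"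
proof -
  have "conj_pt 0 = (0 :: 'a pt)" by (simp add: conj_pt_def vec_eq_iff)
  then show ?thesis by (simp add: nmono_mon mon_at_zero)
qed

text \<open>
  The mixed derivative of order \<open>(A\<^sub>0, B\<^sub>0)\<close> at the origin reads off the coefficient at \<open>(A\<^sub>0, B\<^sub>0)\<close>.
\<close>

lemma free_nmono: "free_family (\<lambda>(A, B). nmono A B)"
  unfolding free_family_def
proof (intro ballI impI ext)
  fix a :: "('a option \<Rightarrow> nat) \<times> ('a option \<Rightarrow> nat) \<Rightarrow> complex"
    and AB :: "('a option \<Rightarrow> nat) \<times> ('a option \<Rightarrow> nat)"
  assume a: "a \<in> finsupp" "lincomb (\<lambda>(A, B). nmono A B) a = 0"
  obtain A0 B0 where AB: "AB = (A0, B0)" by (cases AB)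
  obtain xs where xs: "\<And>j. count_list xs j = A0 j" using exists_count_list[of A0] by blast
  obtain ys where ys: "\<And>j. count_list ys j = B0 j" using exists_count_list[of B0] by blast
  let ?S = "{\<tau>. a \<tau> \<noteq> 0}"
  have fin: "finite ?S" using a by (simp add: finsupp_def)
  have at: "mixed_deriv xs ys (nmono A B) 0 = (if (A, B) = (A0, B0) then 1 else 0)" for A B
  proof (cases "(\<forall>j. A0 j \<le> A j) \<and> (\<forall>j. B0 j \<le> B j)")
    case True
    then have "((\<lambda>j. A j - A0 j) = (\<lambda>_. 0)) = (A = A0)" "((\<lambda>j. B j - B0 j) = (\<lambda>_. 0)) = (B = B0)"
      by (auto simp: fun_eq_iff intro: le_antisym)
    then show ?thesis using True by (simp add: mixed_deriv_nmono[OF xs ys] nmono_at_zero)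
  next
    case False
    then show ?thesis unfolding mixed_deriv_nmono[OF xs ys] by (auto simp: pointwise)
  qed
  have "0 = mixed_deriv xs ys (lincomb (\<lambda>(A, B). nmono A B) a) 0"
    unfolding a(2) by (simp add: mixed_deriv_def foldr_zero pointwise)
  also have "\<dots> = (\<Sum>\<tau>\<in>?S. a \<tau> * mixed_deriv xs ys (case \<tau> of (A, B) \<Rightarrow> nmono A B) 0)"
    unfolding lincomb_def by (subst mixed_deriv_sum[OF fin]) (auto simp: nmono_poly sum_fun_apply cscale_def)
  also have "\<dots> = (\<Sum>\<tau>\<in>?S. if \<tau> = AB then a AB else 0)"
    unfolding AB by (intro sum.cong) (auto simp: at split: if_splits)
  also have "\<dots> = a AB" using fin by simp
  finally show "a AB = 0 AB" by (simp add: pointwise)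
qed

lemma free_subfamily:
  assumes v: "free_family v" and g: "inj g"
  shows "free_family (\<lambda>i. v (g i))"
  unfolding free_family_def
proof (intro ballI impI ext)
  fix a i assume a: "a \<in> finsupp" "lincomb (\<lambda>i. v (g i)) a = 0"
  define b where "b = (\<lambda>j. if j \<in> range g then a (inv g j) else 0)"
  have bg: "b (g i) = a i" for i using g by (simp add: b_def)
  have fin: "finite {i. a i \<noteq> 0}" using a by (simp add: finsupp_def)
  have supp: "b j \<noteq> 0 \<Longrightarrow> j \<in> g ` {i. a i \<noteq> 0}" for j
    using g by (auto simp: b_def split: if_splits)
  have "lincomb v b = (\<Sum>j\<in>g ` {i. a i \<noteq> 0}. cscale (b j) (v j))"
    by (rule lincomb_eq_sum[OF finite_imageI[OF fin] supp])
  also have "\<dots> = lincomb (\<lambda>i. v (g i)) a"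
    unfolding lincomb_def using g by (subst sum.reindex) (auto simp: bg intro: inj_on_subset)
  finally have "lincomb v b = 0" using a(2) by simp
  moreover have "b \<in> finsupp" by (rule finsuppI[OF finite_imageI[OF fin] supp])
  ultimately have "b = 0" using v by (simp add: free_family_def)
  then have "b (g i) = 0" by (simp add: pointwise)
  then show "a i = 0 i" using bg by (simp add: pointwise)
qed

lemma free_scaled:
  assumes v: "free_family v" and k: "\<And>i. k i \<noteq> 0"
  shows "free_family (\<lambda>i. cscale (k i) (v i))"
  unfolding free_family_def
proof (intro ballI impI ext)
  fix a i assume a: "a \<in> finsupp" "lincomb (\<lambda>i. cscale (k i) (v i)) a = 0"
  have "(\<lambda>i. k i * a i) \<in> finsupp" using a(1) by (intro finsuppI[of "{i. a i \<noteq> 0}"]) (auto simp: finsupp_def)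
  then have z: "(\<lambda>i. k i * a i) = 0"
    using v a(2) unfolding lincomb_scaled_family[of k v, OF k] free_family_def by blast
  have "k i * a i = 0" using fun_cong[OF z, of i] by (simp add: pointwise)
  then show "a i = 0 i" using k by (simp add: pointwise)
qed

definition fact_prod :: "'n::finite triple \<Rightarrow> complex" where
  "fact_prod \<tau> = (\<Prod>i\<in>UNIV. fact (fullP \<tau> i)) * (\<Prod>i\<in>UNIV. fact (fullQ \<tau> i))"

lemma fact_prod_nonzero: "fact_prod \<tau> \<noteq> 0"
  by (simp add: fact_prod_def)

lemma e_fun_nmono: "e_fun \<tau> = cscale (fact_prod \<tau>) (nmono (fullP \<tau>) (fullQ \<tau>))"
  unfolding e_fun_eq fact_prod_def by (rule monomial_scaled)

lemma free_nmono_triple: "free_family (\<lambda>\<tau> :: 'n::finite triple. nmono (fullP \<tau>) (fullQ \<tau>))"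
proof -
  have "inj (\<lambda>\<tau> :: 'n triple. (fullP \<tau>, fullQ \<tau>))" by (rule injI) (auto intro: triple_eqI)
  from free_subfamily[OF free_nmono this] show ?thesis by simp
qed

lemma free_e_fun: "free_family e_fun"
  unfolding e_fun_nmono[abs_def] by (intro free_scaled free_nmono_triple fact_prod_nonzero)

lemma free_wick_basis: "hb \<noteq> 0 \<Longrightarrow> free_family (wick_basis hb)"
  unfolding wick_basis_def[abs_def] by (intro free_scaled free_nmono_triple) simp

lemma wick_basis_e_fun: "wick_basis hb \<tau> = cscale (1 / ((2 * hb) ^ deg \<tau> * fact_prod \<tau>)) (e_fun \<tau>)"
  by (simp add: wick_basis_def e_fun_nmono fact_prod_nonzero)

text \<open>
  The factor \<open>(2 \<hbar>)\<^sup>\<alpha>\<close> in \<open>S\<close> cancels against the one in \<open>wick_basis\<close>, which leaves \<open>f\<^sub>\<tau>\<close>.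
\<close>

lemma S_map_lincomb:
  assumes hb: "hb \<noteq> 0" and a: "a \<in> finsupp"
  shows "S_map hb (lincomb (wick_basis hb) a) = lincomb (f_fun hb) a"
proof (rule ext)
  fix w :: "'a pt"
  define k where "k = (\<lambda>\<tau> :: 'a triple. 1 / ((2 * hb) ^ deg \<tau> * fact_prod \<tau>))"
  have k: "k \<tau> \<noteq> 0" for \<tau> using hb fact_prod_nonzero by (simp add: k_def)
  have ka: "(\<lambda>\<tau>. k \<tau> * a \<tau>) \<in> finsupp" using a by (intro finsuppI[of "{i. a i \<noteq> 0}"]) (auto simp: finsupp_def)
  have "wick_basis hb = (\<lambda>\<tau>. cscale (k \<tau>) (e_fun \<tau>))" by (rule ext) (simp add: k_def wick_basis_e_fun)
  then have L: "lincomb (wick_basis hb) a = lincomb e_fun (\<lambda>\<tau>. k \<tau> * a \<tau>)"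
    using lincomb_scaled_family[of k e_fun, OF k] by simp
  have R: "cfun.representation (range e_fun) (lincomb (wick_basis hb) a) (e_fun \<tau>) = k \<tau> * a \<tau>" for \<tau>
    unfolding L by (rule representation_lincomb[OF free_e_fun ka])
  show "S_map hb (lincomb (wick_basis hb) a) w = lincomb (f_fun hb) a w"
  proof (cases "w \<in> C_plus")
    case True
    have "k \<tau> * a \<tau> * ((2 * hb) ^ deg \<tau> * pochhammer (of_real (yfun w) / (2 * hb)) (deg \<tau>) *
         e_fun \<tau> w / of_real (yfun w) ^ deg \<tau>) = a \<tau> * f_fun hb \<tau> w" for \<tau>
    proof -
      have "k \<tau> * (2 * hb) ^ deg \<tau> * fact_prod \<tau> = 1" using hb fact_prod_nonzero[of \<tau>] by (simp add: k_def)
      then have "k \<tau> * a \<tau> * ((2 * hb) ^ deg \<tau> * P * (fact_prod \<tau> * M) / Y) = a \<tau> * (P * (M / Y))" for P M Y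
        by (metis (no_types, opaque_lifting) mult.assoc mult.commute mult.left_neutral times_divide_eq_right)
      then show ?thesis unfolding e_fun_nmono cscale_def f_fun_eq if_P[OF True] .
    qed
    note trm = this
    have "S_map hb (lincomb (wick_basis hb) a) w = (\<Sum>\<tau> | k \<tau> * a \<tau> \<noteq> 0. a \<tau> * f_fun hb \<tau> w)"
      unfolding S_map_def if_P[OF True] R trm ..
    also have "\<dots> = lincomb (f_fun hb) a w"
      using k by (simp add: lincomb_def sum_fun_apply cscale_def)
    finally show ?thesis .
  next
    case False
    then show ?thesis by (simp add: S_map_def lincomb_def sum_fun_apply cscale_def f_fun_eq)
  qed
qed

lemma mon_scale: "mon A (u *s z) = u ^ sum A UNIV * mon A z"
proof -
  have "(u * z $ j) ^ A j / fact (A j) = u ^ A j * ((z $ j) ^ A j / fact (A j))" for j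
    by (simp add: power_mult_distrib)
  then show ?thesis by (simp only: mon_def vector_smult_component prod.distrib power_sum)
qed

lemma nmono_scale: "nmono A B (u *s z) = u ^ sum A UNIV * cnj u ^ sum B UNIV * nmono A B z"
proof -
  have "conj_pt (u *s z) = cnj u *s conj_pt z" by (simp add: conj_pt_def vec_eq_iff)
  then show ?thesis by (simp add: nmono_mon mon_scale)
qed

text \<open>
  Comparing \<open>p (u z)\<close> with \<open>p z\<close> shows that every monomial of an invariant polynomial has as many holomorphic
  as conjugate factors.
\<close>

lemma invariant_polynomials_eq:
  assumes hb: "hb \<noteq> 0"
  shows "(invariant_polynomials :: ('n::finite pt \<Rightarrow> complex) set) = lincomb (wick_basis hb) ` finsupp"
proof (intro equalityI subsetI)
  fix p :: "'n pt \<Rightarrow> complex" assume "p \<in> lincomb (wick_basis hb) ` finsupp"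
  then obtain a where p: "p = lincomb (wick_basis hb) a" by (rule imageE)
  have "p (u *s z) = p z" if "cmod u = 1" for u z
  proof -
    have "u * cnj u = 1" using complex_norm_square[of u] that by simp
    then have "u ^ d * cnj u ^ d = 1" for d unfolding power_mult_distrib[symmetric] by simp
    then have "wick_basis hb \<tau> (u *s z) = wick_basis hb \<tau> z" for \<tau>
      by (simp add: wick_basis_def cscale_def nmono_scale)
    then show ?thesis by (simp add: p lincomb_def sum_fun_apply cscale_def)
  qed
  moreover have "p \<in> polynomials" unfolding p lincomb_def by (intro poly_sum poly_scale wick_basis_poly)
  ultimately show "p \<in> invariant_polynomials" by (simp add: invariant_polynomials_def)
next
  fix p :: "'n pt \<Rightarrow> complex" assume p: "p \<in> invariant_polynomials"
  let ?nm = "\<lambda>(A, B). nmono A B :: 'n pt \<Rightarrow> complex"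
  have poly: "p \<in> polynomials" and inv: "\<And>u z. cmod u = 1 \<Longrightarrow> p (u *s z) = p z"
    using p by (auto simp: invariant_polynomials_def)
  from poly have "p \<in> cfun.span (range ?nm)"
  proof (induction rule: poly_induct)
    case (step c A B g)
    have "nmono A B \<in> cfun.span (range ?nm)" by (rule cfun.span_base) auto
    then show ?case using step by (intro cfun.span_add cfun.span_scale)
  qed (rule cfun.span_zero)
  then obtain c where c: "c \<in> finsupp" "p = lincomb ?nm c" unfolding span_eq_lincomb by (rule imageE)
  have fin: "finite {AB. c AB \<noteq> 0}" using c by (simp add: finsupp_def)
  have bal: "sum A UNIV = sum B UNIV" if "c (A, B) \<noteq> 0" for A B
  proof (rule ccontr)
    assume ne: "sum A UNIV \<noteq> sum B UNIV"
    \<comment> \<open>This rotation changes the sign of the monomial with exponents \<open>A\<close> and \<open>B\<close>.\<close>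
    define u where "u = cis (pi / (real (sum A UNIV) - real (sum B UNIV)))"
    define f where "f = (\<lambda>(A :: 'n option \<Rightarrow> nat, B :: 'n option \<Rightarrow> nat). u ^ sum A UNIV * cnj u ^ sum B UNIV - 1)"
    have fc: "(\<lambda>AB. f AB * c AB) \<in> finsupp" using c(1) by (intro finsuppI[OF fin]) auto
    have "lincomb ?nm (\<lambda>AB. f AB * c AB) = 0"
    proof (rule ext)
      fix z
      have "lincomb ?nm (\<lambda>AB. f AB * c AB) z = (\<Sum>AB | c AB \<noteq> 0. f AB * c AB * ?nm AB z)"
        by (subst lincomb_eq_sum[OF fin]) (auto simp: sum_fun_apply cscale_def)
      also have "\<dots> = (\<Sum>AB | c AB \<noteq> 0. c AB * ?nm AB (u *s z) - c AB * ?nm AB z)"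
        by (intro sum.cong) (auto simp: f_def nmono_scale algebra_simps)
      also have "\<dots> = p (u *s z) - p z"
        by (simp add: c(2) lincomb_def sum_fun_apply cscale_def sum_subtractf)
      also have "\<dots> = 0" by (simp add: inv u_def)
      finally show "lincomb ?nm (\<lambda>AB. f AB * c AB) z = 0 z" by (simp add: pointwise)
    qed
    then have z: "(\<lambda>AB. f AB * c AB) = 0" using free_nmono fc unfolding free_family_def by blast
    have "f (A, B) * c (A, B) = 0" using fun_cong[OF z, of "(A, B)"] by (simp add: pointwise)
    then have "f (A, B) = 0" using that by simp
    moreover have "f (A, B) = -2"
    proof -
      have "real m * (pi / (real m - real n)) + real n * (- (pi / (real m - real n))) = pi" if "m \<noteq> n" for m n :: nat
        using that by (simp add: divide_simps) (simp add: algebra_simps)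
      from this[OF ne] have "u ^ sum A UNIV * cnj u ^ sum B UNIV = cis pi"
        unfolding u_def cis_cnj Complex.DeMoivre cis_mult by simp
      then show ?thesis unfolding f_def by simp
    qed
    ultimately show False by simp
  qed
  have "p \<in> cfun.span (range (wick_basis hb))"
    unfolding c(2) lincomb_def
  proof (intro cfun.span_sum cfun.span_scale)
    fix AB assume "AB \<in> {AB. c AB \<noteq> 0}"
    then obtain A B where AB: "AB = (A, B)" "sum A UNIV = sum B UNIV" using bal by (cases AB) auto
    have "?nm AB = cscale ((2 * hb) ^ sum A UNIV) (wick_basis hb (mk_triple A B))"
      using hb AB by (simp add: wick_basis_def fullP_mk fullQ_mk deg_mk)
    then show "?nm AB \<in> cfun.span (range (wick_basis hb))" by (auto intro!: cfun.span_scale intro: cfun.span_base)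
  qed
  then show "p \<in> lincomb (wick_basis hb) ` finsupp" by (simp add: span_eq_lincomb)
qed

lemma open_C_plus: "open (C_plus :: 'n::finite pt set)"
  unfolding C_plus_def by (intro open_Collect_less cont_yfun continuous_intros)

lemma C_plus_nonempty: "\<exists>w. w \<in> (C_plus :: 'n::finite pt set)"
  by (intro exI[of _ "\<chi> i. if i = None then 1 else 0"]) (simp add: C_plus_def yfun_def)

lemma wirtinger_local:
  assumes "open U" "\<And>z. z \<in> U \<Longrightarrow> f z = 0" "z \<in> U"
  shows "d_z i f z = 0" "d_zbar i f z = 0"
proof -
  have "((\<lambda>_. 0) has_derivative (\<lambda>h. \<Sum>i\<in>UNIV. 0 * h $ i + 0 * cnj (h $ i))) (at z)" by simp
  then have "wirtinger f z (\<lambda>_. 0) (\<lambda>_. 0)" unfolding wirtinger_def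
    by (rule has_derivative_transform_within_open[OF _ assms(1,3)]) (simp add: assms(2))
  from wirtinger_unique[OF this] show "d_z i f z = 0" "d_zbar i f z = 0" by auto
qed

lemma mixed_deriv_local:
  assumes "open U" "\<And>z. z \<in> U \<Longrightarrow> f z = 0" "z \<in> U"
  shows "mixed_deriv xs ys f z = 0"
proof -
  have 1: "z \<in> U \<Longrightarrow> foldr d_zbar ys f z = 0" for z
  proof (induction ys arbitrary: z)
    case (Cons i ys)
    then show ?case using wirtinger_local(2)[OF assms(1), of "foldr d_zbar ys f" z i] by simp
  qed (simp add: assms)
  have "z \<in> U \<Longrightarrow> foldr d_z xs (foldr d_zbar ys f) z = 0" for z
  proof (induction xs arbitrary: z)
    case (Cons i xs)
    then show ?case using wirtinger_local(1)[OF assms(1), of "foldr d_z xs (foldr d_zbar ys f)" z i] by simp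
  qed (simp add: 1)
  then show ?thesis using assms(3) by (simp add: mixed_deriv_def)
qed

text \<open>
  On monomials of the same total degree in \<open>z\<close> and in its conjugate, the mixed derivative with the exponents of
  \<open>\<sigma>\<close> is constant, 1 on the monomial of \<open>\<sigma>\<close> and 0 on the others. It can thus be evaluated at any
  point, in particular at one of the open cone.
\<close>

lemma homogeneous_unique:
  fixes c :: "'n::finite triple \<Rightarrow> complex"
  assumes S: "finite S" "\<And>\<tau>. \<tau> \<in> S \<Longrightarrow> deg \<tau> = d"
    and zero: "\<And>w. w \<in> C_plus \<Longrightarrow> (\<Sum>\<tau>\<in>S. c \<tau> * nmono (fullP \<tau>) (fullQ \<tau>) w) = 0"
    and \<sigma>: "\<sigma> \<in> S"
  shows "c \<sigma> = 0"
proof -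
  obtain xs where xs: "\<And>j. count_list xs j = fullP \<sigma> j" using exists_count_list[of "fullP \<sigma>"] by blast
  obtain ys where ys: "\<And>j. count_list ys j = fullQ \<sigma> j" using exists_count_list[of "fullQ \<sigma>"] by blast
  obtain w :: "'n pt" where w: "w \<in> C_plus" using C_plus_nonempty by blast
  let ?n = "\<lambda>\<tau> :: 'n triple. nmono (fullP \<tau>) (fullQ \<tau>)"
  have deriv: "mixed_deriv xs ys (?n \<tau>) w = (if \<tau> = \<sigma> then 1 else 0)" if \<tau>: "\<tau> \<in> S" for \<tau>
  proof (cases "(\<forall>j. fullP \<sigma> j \<le> fullP \<tau> j) \<and> (\<forall>j. fullQ \<sigma> j \<le> fullQ \<tau> j)")
    case True
    have same: "A = B" if "\<forall>j. A j \<le> B j" "sum A UNIV = sum B UNIV" for A B :: "'n option \<Rightarrow> nat"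
    proof (rule ext, rule ccontr)
      fix j assume "A j \<noteq> B j"
      then have "sum A UNIV < sum B UNIV" using that(1) by (intro sum_strict_mono_ex1 bexI[of _ j]) (auto simp: order.strict_iff_order)
      then show False using that(2) by simp
    qed
    have "\<tau> = \<sigma>"
      using True S(2)[OF \<tau>] S(2)[OF \<sigma>] by (intro triple_eqI same[symmetric]) auto
    moreover have "nmono (\<lambda>_. 0) (\<lambda>_. 0) w = 1" by (simp add: pointwise flip: one_nmono)
    ultimately show ?thesis by (simp add: mixed_deriv_nmono[OF xs ys])
  next
    case False
    then have "\<tau> \<noteq> \<sigma>" by auto
    then show ?thesis unfolding mixed_deriv_nmono[OF xs ys] if_not_P[OF False] by (simp add: pointwise)
  qed
  have "0 = mixed_deriv xs ys (\<Sum>\<tau>\<in>S. cscale (c \<tau>) (?n \<tau>)) w"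
    using zero w by (intro mixed_deriv_local[OF open_C_plus, symmetric]) (auto simp: sum_fun_apply cscale_def)
  also have "\<dots> = (\<Sum>\<tau>\<in>S. c \<tau> * mixed_deriv xs ys (?n \<tau>) w)"
    by (subst mixed_deriv_sum[OF S(1)]) (auto simp: nmono_poly sum_fun_apply cscale_def)
  also have "\<dots> = (\<Sum>\<tau>\<in>S. if \<tau> = \<sigma> then c \<sigma> else 0)" by (intro sum.cong) (auto simp: deriv)
  also have "\<dots> = c \<sigma>" using S(1) \<sigma> by simp
  finally show ?thesis by simp
qed

section \<open>Sequences of sub-factorial growth\<close>

lemma fact_powr_ge_1: "\<epsilon> \<ge> 0 \<Longrightarrow> 1 \<le> (fact d :: real) powr \<epsilon>"
  by (rule ge_one_powr_ge_zero) (simp_all add: fact_ge_1)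

lemma subfactorial_bdd:
  assumes "a \<in> subfactorial_growth" "\<epsilon> > 0"
  shows "bdd_above (range (\<lambda>\<tau>. cmod (a \<tau>) / fact (deg \<tau>) powr \<epsilon>))"
proof -
  obtain c where "\<And>\<tau>. cmod (a \<tau>) \<le> c * fact (deg \<tau>) powr \<epsilon>"
    using assms unfolding subfactorial_growth_def mem_Collect_eq by metis
  then show ?thesis by (intro bdd_aboveI[of _ c]) (auto simp: divide_le_eq)
qed

lemma norm_le_subfactorial_norm:
  assumes "a \<in> subfactorial_growth" "\<epsilon> > 0"
  shows "cmod (a \<tau>) \<le> subfactorial_norm \<epsilon> a * fact (deg \<tau>) powr \<epsilon>"
proof -
  have "cmod (a \<tau>) / fact (deg \<tau>) powr \<epsilon> \<le> subfactorial_norm \<epsilon> a"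
    unfolding subfactorial_norm_def using subfactorial_bdd[OF assms] by (intro cSUP_upper) auto
  then show ?thesis by (simp add: divide_le_eq)
qed

lemma subfactorial_norm_le:
  assumes "\<And>\<tau>. cmod (a \<tau>) \<le> C * fact (deg \<tau>) powr \<epsilon>"
  shows "subfactorial_norm \<epsilon> a \<le> C"
  unfolding subfactorial_norm_def using assms by (intro cSUP_least) (auto simp: divide_le_eq)

lemma subfactorial_norm_nonneg:
  fixes a :: "'n::finite triple \<Rightarrow> complex"
  assumes "a \<in> subfactorial_growth" "\<epsilon> > 0"
  shows "0 \<le> subfactorial_norm \<epsilon> a"
proof -
  have "0 \<le> subfactorial_norm \<epsilon> a * fact (deg (zero_triple :: 'n triple)) powr \<epsilon>"
    by (rule order_trans[OF norm_ge_zero norm_le_subfactorial_norm[OF assms]])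
  then show ?thesis by (simp add: zero_triple_full)
qed

lemma subfactorial_norm_antimono:
  assumes "a \<in> subfactorial_growth" "0 < \<epsilon>" "\<epsilon> \<le> \<delta>"
  shows "subfactorial_norm \<delta> a \<le> subfactorial_norm \<epsilon> a"
proof (rule subfactorial_norm_le)
  fix \<tau>
  have "cmod (a \<tau>) \<le> subfactorial_norm \<epsilon> a * fact (deg \<tau>) powr \<epsilon>"
    by (rule norm_le_subfactorial_norm[OF assms(1,2)])
  also have "\<dots> \<le> subfactorial_norm \<epsilon> a * fact (deg \<tau>) powr \<delta>"
    using assms subfactorial_norm_nonneg by (intro mult_left_mono powr_mono) (auto simp: fact_ge_1)
  finally show "cmod (a \<tau>) \<le> subfactorial_norm \<epsilon> a * fact (deg \<tau>) powr \<delta>" .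
qed

lemma subfactorial_growthI:
  assumes "\<And>\<epsilon>. \<epsilon> > 0 \<Longrightarrow> \<exists>c. \<forall>\<tau>. cmod (a \<tau>) \<le> c * fact (deg \<tau>) powr \<epsilon>"
  shows "a \<in> subfactorial_growth"
  unfolding subfactorial_growth_def
proof (intro CollectI allI impI)
  fix \<epsilon> :: real assume "\<epsilon> > 0"
  then obtain c where c: "\<And>\<tau>. cmod (a \<tau>) \<le> c * fact (deg \<tau>) powr \<epsilon>" using assms by blast
  have "cmod (a \<tau>) \<le> (\<bar>c\<bar> + 1) * fact (deg \<tau>) powr \<epsilon>" for \<tau>
    by (rule order_trans[OF c mult_right_mono]) auto
  then show "\<exists>c>0. \<forall>\<tau>. cmod (a \<tau>) \<le> c * fact (deg \<tau>) powr \<epsilon>"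
    by (intro exI[of _ "\<bar>c\<bar> + 1"]) auto
qed

lemma norm_combination_le:
  assumes "a \<in> subfactorial_growth" "b \<in> subfactorial_growth" "\<epsilon> > 0"
  shows "cmod ((cscale c a + b) \<tau>) \<le> (cmod c * subfactorial_norm \<epsilon> a + subfactorial_norm \<epsilon> b) * fact (deg \<tau>) powr \<epsilon>"
proof -
  have "cmod ((cscale c a + b) \<tau>) \<le> cmod c * cmod (a \<tau>) + cmod (b \<tau>)"
    by (simp add: cscale_def pointwise norm_triangle_le norm_mult)
  also have "\<dots> \<le> cmod c * (subfactorial_norm \<epsilon> a * fact (deg \<tau>) powr \<epsilon>) + subfactorial_norm \<epsilon> b * fact (deg \<tau>) powr \<epsilon>"
    using norm_le_subfactorial_norm[OF assms(1,3)] norm_le_subfactorial_norm[OF assms(2,3)]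
    by (intro add_mono mult_left_mono) auto
  finally show ?thesis by (simp add: algebra_simps)
qed

lemma subfactorial_zero: "0 \<in> subfactorial_growth"
  by (intro subfactorial_growthI exI[of _ 0]) (simp add: pointwise)

lemma subfactorial_combination:
  assumes "a \<in> subfactorial_growth" "b \<in> subfactorial_growth"
  shows "cscale c a + b \<in> subfactorial_growth"
  using norm_combination_le[OF assms] by (intro subfactorial_growthI) blast

lemma subfactorial_subspace: "cfun.subspace subfactorial_growth"
proof (rule cfun.subspaceI)
  fix a b :: "'n::finite triple \<Rightarrow> complex" and c
  assume a: "a \<in> subfactorial_growth"
  show "cscale c a \<in> subfactorial_growth" using subfactorial_combination[OF a subfactorial_zero, of c] by simp
  assume "b \<in> subfactorial_growth"
  then show "a + b \<in> subfactorial_growth" using subfactorial_combination[OF a, of b 1] by simp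
qed (rule subfactorial_zero)

lemma subfactorial_seminorm:
  assumes "\<epsilon> > 0"
  shows "seminorm_on subfactorial_growth (subfactorial_norm \<epsilon> :: ('n::finite triple \<Rightarrow> complex) \<Rightarrow> real)"
  unfolding seminorm_on_def
proof (intro conjI ballI allI)
  fix a b :: "'n triple \<Rightarrow> complex" and c
  assume a: "a \<in> subfactorial_growth"
  show "0 \<le> subfactorial_norm \<epsilon> a" by (rule subfactorial_norm_nonneg[OF a assms])
  show "b \<in> subfactorial_growth \<Longrightarrow> subfactorial_norm \<epsilon> (a + b) \<le> subfactorial_norm \<epsilon> a + subfactorial_norm \<epsilon> b"
    using norm_combination_le[OF a _ assms, of b 1] by (intro subfactorial_norm_le) simp
  have ca: "cscale c a \<in> subfactorial_growth" using a subfactorial_subspace by (rule cfun.subspace_scale[rotated])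
  have le: "subfactorial_norm \<epsilon> (cscale c a) \<le> cmod c * subfactorial_norm \<epsilon> a"
    using norm_le_subfactorial_norm[OF a assms]
    by (intro subfactorial_norm_le) (simp add: cscale_def norm_mult mult.assoc mult_left_mono)
  show "subfactorial_norm \<epsilon> (cscale c a) = cmod c * subfactorial_norm \<epsilon> a"
  proof (cases "c = 0")
    case True
    then show ?thesis using le subfactorial_norm_nonneg[OF ca assms] by simp
  next
    case False
    have "cmod (a \<tau>) \<le> (subfactorial_norm \<epsilon> (cscale c a) / cmod c) * fact (deg \<tau>) powr \<epsilon>" for \<tau>
      using norm_le_subfactorial_norm[OF ca assms, of \<tau>] False by (simp add: cscale_def norm_mult field_simps)
    then have "subfactorial_norm \<epsilon> a \<le> subfactorial_norm \<epsilon> (cscale c a) / cmod c" by (rule subfactorial_norm_le)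
    then show ?thesis using le False by (simp add: field_simps)
  qed
qed

lemma koethe_seminormed:
  "seminormed_space subfactorial_growth (subfactorial_norm ` {0<..<1} :: (('n::finite triple \<Rightarrow> complex) \<Rightarrow> real) set)"
proof
  fix p q :: "('n triple \<Rightarrow> complex) \<Rightarrow> real"
  assume "p \<in> subfactorial_norm ` {0<..<1}" "q \<in> subfactorial_norm ` {0<..<1}"
  then obtain \<epsilon> \<delta> where e: "p = subfactorial_norm \<epsilon>" "0 < \<epsilon>" "\<epsilon> < 1" and d: "q = subfactorial_norm \<delta>" "0 < \<delta>" "\<delta> < 1"
    by auto
  show "\<exists>r\<in>subfactorial_norm ` {0<..<1}. \<forall>a\<in>subfactorial_growth. p a \<le> r a \<and> q a \<le> r a"
    using e d by (intro bexI[of _ "subfactorial_norm (min \<epsilon> \<delta>)"]) (auto intro!: subfactorial_norm_antimono)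
next
  fix p :: "('n triple \<Rightarrow> complex) \<Rightarrow> real" assume "p \<in> subfactorial_norm ` {0<..<1}"
  then obtain \<epsilon> where "p = subfactorial_norm \<epsilon>" "0 < \<epsilon>" by auto
  then show "seminorm_on subfactorial_growth p" by (simp add: subfactorial_seminorm)
next
  show "subfactorial_norm ` {0<..<1} \<noteq> ({} :: (('n triple \<Rightarrow> complex) \<Rightarrow> real) set)"
    unfolding image_is_empty by (simp add: greaterThanLessThan_empty_iff)
qed (rule subfactorial_subspace)

lemma finsupp_subfactorial: "finsupp \<subseteq> subfactorial_growth"
proof
  fix a :: "'n::finite triple \<Rightarrow> complex" assume "a \<in> finsupp"
  then have fin: "finite {\<tau>. a \<tau> \<noteq> 0}" by (simp add: finsupp_def)
  have le: "cmod (a \<tau>) \<le> (\<Sum>\<sigma> | a \<sigma> \<noteq> 0. cmod (a \<sigma>))" for \<tau>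
  proof (cases "a \<tau> = 0")
    case False
    then show ?thesis using fin by (intro member_le_sum) auto
  qed (simp add: sum_nonneg)
  have "cmod (a \<tau>) \<le> (\<Sum>\<sigma> | a \<sigma> \<noteq> 0. cmod (a \<sigma>)) * fact (deg \<tau>) powr \<epsilon>" if "\<epsilon> > 0" for \<tau> \<epsilon>
    using mult_mono[OF le fact_powr_ge_1[of \<epsilon>], of \<tau>] that by (simp add: sum_nonneg)
  then show "a \<in> subfactorial_growth" by (intro subfactorial_growthI) blast
qed

section \<open>Evaluation\<close>

definition evaluate :: "complex \<Rightarrow> 'n::finite pt \<Rightarrow> ('n triple \<Rightarrow> complex) \<Rightarrow> complex" where
  "evaluate hb w a = (\<Sum>\<^sub>\<infinity>\<tau>. a \<tau> * f_fun hb \<tau> w)"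

text \<open>
  Evaluation at a point meets coefficients of growth \<open>(deg \<tau>)!\<close> to the power \<open>1/2\<close> and basis functions of decay
  \<open>L ^ deg \<tau> / (deg \<tau>)!\<close>, and this sum is what remains.
\<close>

definition weight_sum :: "'n::finite itself \<Rightarrow> real \<Rightarrow> real" where
  "weight_sum _ L = (\<Sum>\<^sub>\<infinity>\<tau> :: 'n triple. L ^ deg \<tau> / fact (deg \<tau>) powr (1/2))"

lemma evaluate_term_bound:
  assumes a: "a \<in> subfactorial_growth" and L: "\<And>\<tau>. cmod (f_fun hb \<tau> w) \<le> L ^ deg \<tau> / fact (deg \<tau>)"
  shows "cmod (a \<tau> * f_fun hb \<tau> w) \<le> subfactorial_norm (1/2) a * (L ^ deg \<tau> / fact (deg \<tau>) powr (1/2))"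
proof -
  have "cmod (a \<tau> * f_fun hb \<tau> w) \<le> (subfactorial_norm (1/2) a * fact (deg \<tau>) powr (1/2)) * (L ^ deg \<tau> / fact (deg \<tau>))"
    unfolding norm_mult using norm_le_subfactorial_norm[OF a, of "1/2" \<tau>] L[of \<tau>] subfactorial_norm_nonneg[OF a, of "1/2"]
    by (intro mult_mono) auto
  also have "\<dots> = subfactorial_norm (1/2) a * (L ^ deg \<tau> / fact (deg \<tau>) powr (1/2))"
  proof -
    define F where "F = (fact (deg \<tau>) :: real) powr (1/2)"
    have F: "F > 0" "fact (deg \<tau>) = F * F" by (simp_all add: F_def flip: powr_add)
    show ?thesis unfolding F_def[symmetric] unfolding F(2) using F(1) by simp
  qed
  finally show ?thesis .
qed

lemma
  fixes w :: "'n::finite pt"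
  assumes a: "a \<in> subfactorial_growth" and L: "L \<ge> 0" "\<And>\<tau>. cmod (f_fun hb \<tau> w) \<le> L ^ deg \<tau> / fact (deg \<tau>)"
  shows evaluate_summable: "(\<lambda>\<tau>. a \<tau> * f_fun hb \<tau> w) summable_on UNIV"
    and evaluate_bound: "cmod (evaluate hb w a) \<le> weight_sum TYPE('n) L * subfactorial_norm (1/2) a"
proof -
  have sum: "(\<lambda>\<tau> :: 'n triple. subfactorial_norm (1/2) a * (L ^ deg \<tau> / fact (deg \<tau>) powr (1/2))) summable_on UNIV"
    by (intro summable_on_cmult_right summable_on_power_fact L) simp
  have abs: "(\<lambda>\<tau>. cmod (a \<tau> * f_fun hb \<tau> w)) summable_on UNIV"
    by (rule summable_on_comparison_test[OF sum], rule evaluate_term_bound[OF a L(2)], simp)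
  then show "(\<lambda>\<tau>. a \<tau> * f_fun hb \<tau> w) summable_on UNIV" by (rule abs_summable_summable)
  have "cmod (evaluate hb w a) \<le> (\<Sum>\<^sub>\<infinity>\<tau>. cmod (a \<tau> * f_fun hb \<tau> w))"
    unfolding evaluate_def by (rule norm_infsum_bound[OF abs])
  also have "\<dots> \<le> (\<Sum>\<^sub>\<infinity>\<tau> :: 'n triple. subfactorial_norm (1/2) a * (L ^ deg \<tau> / fact (deg \<tau>) powr (1/2)))"
    by (rule infsum_mono[OF abs sum]) (rule evaluate_term_bound[OF a L(2)])
  also have "\<dots> = weight_sum TYPE('n) L * subfactorial_norm (1/2) a"
    unfolding weight_sum_def by (subst infsum_cmult_right) (simp_all add: summable_on_power_fact L(1) mult.commute)
  finally show "cmod (evaluate hb w a) \<le> weight_sum TYPE('n) L * subfactorial_norm (1/2) a" .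
qed

lemma f_fun_point_bound: "\<exists>L\<ge>0. \<forall>\<tau>. cmod (f_fun hb \<tau> w) \<le> L ^ deg \<tau> / fact (deg \<tau>)"
proof (cases "w \<in> C_plus")
  case True
  then show ?thesis using f_fun_bound[of "{w}" hb] by auto
qed (auto simp: f_fun_eq intro!: exI[of _ 0])

lemma evaluate_combination:
  assumes "a \<in> subfactorial_growth" "b \<in> subfactorial_growth"
  shows "evaluate hb w (cscale c a + b) = c * evaluate hb w a + evaluate hb w b"
proof -
  obtain L where L: "L \<ge> 0" "\<And>\<tau>. cmod (f_fun hb \<tau> w) \<le> L ^ deg \<tau> / fact (deg \<tau>)"
    using f_fun_point_bound[of hb w] by blast
  have "evaluate hb w (cscale c a + b) = (\<Sum>\<^sub>\<infinity>\<tau>. c * (a \<tau> * f_fun hb \<tau> w) + b \<tau> * f_fun hb \<tau> w)"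
    by (simp add: evaluate_def cscale_def pointwise algebra_simps)
  also have "\<dots> = (\<Sum>\<^sub>\<infinity>\<tau>. c * (a \<tau> * f_fun hb \<tau> w)) + (\<Sum>\<^sub>\<infinity>\<tau>. b \<tau> * f_fun hb \<tau> w)"
    by (intro infsum_add summable_on_cmult_right evaluate_summable[OF assms(1) L] evaluate_summable[OF assms(2) L])
  also have "\<dots> = c * evaluate hb w a + evaluate hb w b"
    unfolding evaluate_def by (subst infsum_cmult_right[OF evaluate_summable[OF assms(1) L]]) rule
  finally show ?thesis .
qed

lemma evaluate_finsupp:
  assumes "a \<in> finsupp"
  shows "evaluate hb w a = lincomb (f_fun hb) a w"
proof -
  have "evaluate hb w a = (\<Sum>\<^sub>\<infinity>\<tau>\<in>{\<tau>. a \<tau> \<noteq> 0}. a \<tau> * f_fun hb \<tau> w)"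
    unfolding evaluate_def by (rule infsum_cong_neutral) auto
  then show ?thesis using assms by (simp add: finsupp_def lincomb_def sum_fun_apply cscale_def)
qed

section \<open>Injectivity of the evaluation\<close>

lemma summable_power_fact:
  fixes K \<eta> :: real
  assumes "K \<ge> 0" "\<eta> > 0"
  shows "summable (\<lambda>k. K ^ k / fact k powr \<eta>)"
proof -
  obtain c where c: "c > 0" "\<And>d. (2 * K) ^ d \<le> c * fact d powr \<eta>"
    using power_le_fact_powr[of "2 * K" \<eta>] assms by auto
  have "summable (\<lambda>k. c * (1 / 2) ^ k :: real)" by (intro summable_mult summable_geometric) simp
  then show ?thesis
  proof (rule summable_comparison_test'[where N = 0])
    fix k :: nat
    have "K ^ k * 2 ^ k \<le> c * fact k powr \<eta>" using c(2)[of k] by (simp add: power_mult_distrib mult.commute)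
    then show "norm (K ^ k / fact k powr \<eta>) \<le> c * (1 / 2) ^ k"
      using assms by (simp add: field_simps)
  qed
qed

lemma yfun_scaleR: "yfun (t *\<^sub>R w) = t\<^sup>2 * yfun w"
  by (simp add: yfun_def norm_mult power_mult_distrib right_diff_distrib sum_distrib_left)

text \<open>
  The quotient of the divided monomial by \<open>y ^ deg \<tau>\<close> is homogeneous of degree 0.
\<close>

lemma f_fun_scaleR:
  assumes "w \<in> C_plus" "t > 0"
  shows "f_fun hb \<tau> (t *\<^sub>R w) = pochhammer (of_real (t\<^sup>2) * (of_real (yfun w) / (2 * hb))) (deg \<tau>) *
    (nmono (fullP \<tau>) (fullQ \<tau>) w / of_real (yfun w) ^ deg \<tau>)"
proof -
  have "t *\<^sub>R w \<in> C_plus" using assms by (simp add: C_plus_def yfun_scaleR)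
  moreover have "t *\<^sub>R w = (of_real t :: complex) *s w"
    unfolding vec_eq_iff vector_scaleR_component vector_smult_component unfolding scaleR_conv_of_real by simp
  then have "nmono (fullP \<tau>) (fullQ \<tau>) (t *\<^sub>R w) = of_real (t\<^sup>2) ^ deg \<tau> * nmono (fullP \<tau>) (fullQ \<tau>) w"
    by (simp add: nmono_scale power2_eq_square power_mult_distrib)
  moreover have "of_real (t\<^sup>2) ^ deg \<tau> \<noteq> (0 :: complex)" using assms by simp
  ultimately show ?thesis using assms
    by (simp add: f_fun_eq yfun_scaleR power_mult_distrib)
qed

text \<open>
  The series is a Newton series in \<open>x\<close>. Because of the decay of \<open>b k\<close> it defines an entire function, and this
  function vanishes on the ray through \<open>x0\<close>, hence identically. At \<open>x = -m\<close> the Pochhammer symbols with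
  \<open>k > m\<close> are 0, so that induction on \<open>m\<close> yields the coefficients.
\<close>

lemma level_series_vanishes:
  fixes b :: "nat \<Rightarrow> complex"
  assumes bound: "\<And>k. cmod (b k) \<le> C * M ^ k / fact k powr (3/2)" and CM: "C \<ge> 0" "M \<ge> 0"
    and x0: "x0 \<noteq> 0" and zero: "\<And>s. s > 0 \<Longrightarrow> (\<lambda>k. pochhammer (of_real s * x0) k * b k) sums 0"
  shows "b k = 0"
proof -
  define G where "G = (\<lambda>x. \<Sum>k. pochhammer x k * b k)"
  have "G holomorphic_on UNIV"
  proof (rule holomorphic_uniform_sequence)
    fix n :: nat
    show "(\<lambda>x. \<Sum>k<n. pochhammer x k * b k) holomorphic_on UNIV"
      unfolding pochhammer_prod by (intro holomorphic_intros)
  next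
    fix x0 :: complex
    define r where "r = cmod x0 + 1"
    have r: "r \<ge> 0" by (simp add: r_def)
    have "uniform_limit (cball x0 1) (\<lambda>n x. \<Sum>k<n. pochhammer x k * b k) G sequentially"
      unfolding G_def
    proof (rule Weierstrass_m_test)
      fix k x assume "x \<in> cball x0 1"
      then have "cmod x \<le> r" using norm_triangle_ineq2[of x x0] by (simp add: r_def dist_norm norm_minus_commute)
      then have "cmod (pochhammer x k) \<le> (r + 1) ^ k * fact k"
        by (intro order_trans[OF norm_pochhammer_le] mult_right_mono power_mono) auto
      then have "norm (pochhammer x k * b k) \<le> ((r + 1) ^ k * fact k) * (C * M ^ k / fact k powr (3/2))"
        unfolding norm_mult using bound[of k] r by (intro mult_mono) auto
      also have "fact k powr (3/2) = fact k * (fact k :: real) powr (1/2)"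
        using powr_add[of "fact k :: real" 1 "1/2"] by simp
      also have "((r + 1) ^ k * fact k) * (C * M ^ k / (fact k * fact k powr (1/2))) = C * (((r + 1) * M) ^ k / fact k powr (1/2))"
        unfolding power_mult_distrib by simp
      finally show "norm (pochhammer x k * b k) \<le> C * (((r + 1) * M) ^ k / fact k powr (1/2))" .
    next
      show "summable (\<lambda>k. C * (((r + 1) * M) ^ k / fact k powr (1/2)))"
        using CM by (intro summable_mult summable_power_fact) (auto simp: r_def)
    qed
    then show "\<exists>d>0. cball x0 d \<subseteq> UNIV \<and> uniform_limit (cball x0 d) (\<lambda>n x. \<Sum>k<n. pochhammer x k * b k) G sequentially"
      by (intro exI[of _ 1]) auto
  qed auto
  define U where "U = (\<lambda>s. of_real s * x0) ` {0<..}"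
  have "x0 islimpt U"
    unfolding islimpt_approachable
  proof (intro allI impI)
    fix e :: real assume e: "e > 0"
    define s where "s = 1 + e / (2 * cmod x0)"
    have s: "s > 1" using e x0 by (simp add: s_def)
    have "of_real s * x0 - x0 = of_real (s - 1) * x0" by (simp add: algebra_simps)
    then have "dist (of_real s * x0) x0 = (s - 1) * cmod x0" using s by (simp add: dist_norm norm_mult del: of_real_diff)
    also have "\<dots> < e" using e x0 by (simp add: s_def)
    finally have "dist (of_real s * x0) x0 < e" .
    moreover have "of_real s * x0 \<in> U" unfolding U_def using s by (intro imageI) simp
    moreover have "of_real s * x0 \<noteq> x0" using s x0 by simp
    ultimately show "\<exists>x'\<in>U. x' \<noteq> x0 \<and> dist x' x0 < e" by blast
  qed
  then have G0: "G x = 0" for x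
    using \<open>G holomorphic_on UNIV\<close> zero
    by (intro analytic_continuation[of G UNIV U x0 x]) (auto simp: U_def G_def sums_iff)
  show "b k = 0"
  proof (induction k rule: less_induct)
    case (less m)
    have "G (- of_nat m) = (\<Sum>k\<in>{m}. pochhammer (- of_nat m) k * b k)"
      unfolding G_def
    proof (rule suminf_finite)
      fix k assume "k \<notin> {m}"
      then consider "k < m" | "k > m" by fastforce
      then show "pochhammer (- of_nat m) k * b k = 0"
        by cases (auto simp: less pochhammer_of_nat_eq_0_iff)
    qed simp
    then have "pochhammer (- of_nat m) m * b m = 0" using G0 by simp
    moreover have "pochhammer (- of_nat m :: complex) m \<noteq> 0" by (simp add: pochhammer_of_nat_eq_0_iff)
    ultimately show ?case by simp
  qed
qed

text \<open>
  \<open>lev\<close> separates the degrees by means of \<open>level_series_vanishes\<close> along the ray through \<open>w\<close>; inside one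
  degree \<open>homogeneous_unique\<close> applies.
\<close>

lemma evaluate_injective:
  fixes a :: "'n::finite triple \<Rightarrow> complex"
  assumes hb: "hb \<noteq> 0" and a: "a \<in> subfactorial_growth"
    and zero: "\<And>w. w \<in> C_plus \<Longrightarrow> evaluate hb w a = 0"
  shows "a = 0"
proof (rule ext)
  fix \<sigma>
  let ?n = "\<lambda>\<tau> :: 'n triple. nmono (fullP \<tau>) (fullQ \<tau>)"
  define level where "level = (\<lambda>k. {\<tau> :: 'n triple. deg \<tau> = k})"
  have fin: "finite (level k)" for k
    by (rule finite_subset[OF _ card_degs_upto(1)[of k]]) (auto simp: level_def degs_upto_def)
  have lev: "(\<Sum>\<tau>\<in>level k. a \<tau> * ?n \<tau> w) = 0" if w: "w \<in> C_plus" for w k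
  proof -
    define y where "y = yfun w"
    have y: "y > 0" using w by (simp add: y_def C_plus_def)
    define b where "b = (\<lambda>k. \<Sum>\<tau>\<in>level k. a \<tau> * (?n \<tau> w / of_real y ^ k))"
    define A where "A = subfactorial_norm (1/2) a"
    define R where "R = (norm w)\<^sup>2 * 4 ^ CARD('n option)"
    \<comment> \<open>The coefficients grow like the power \<open>1/2\<close> of the factorial and the divided monomials decay like its
      square; the number of triples in a level enters \<open>M\<close>.\<close>
    define M where "M = real (level_base TYPE('n)) * R / y"
    have A: "A \<ge> 0" using a by (simp add: A_def subfactorial_norm_nonneg)
    have bound: "cmod (b k) \<le> A * M ^ k / fact k powr (3/2)" for k
    proof -
      have trm: "cmod (a \<tau> * (?n \<tau> w / of_real y ^ k)) \<le> A * (R / y) ^ k / fact k powr (3/2)" if \<tau>: "\<tau> \<in> level k" for \<tau>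
      proof -
        have d: "deg \<tau> = k" using \<tau> by (simp add: level_def)
        have "cmod (?n \<tau> w) \<le> R ^ k / (fact k)\<^sup>2"
          using norm_nmono_le[of w "norm w" \<tau>] Finite_Cartesian_Product.norm_nth_le[of w] by (simp add: R_def d)
        moreover have "cmod (a \<tau>) \<le> A * fact k powr (1/2)"
          using norm_le_subfactorial_norm[OF a, of "1/2" \<tau>] by (simp add: A_def d)
        ultimately have "cmod (a \<tau>) * (cmod (?n \<tau> w) / y ^ k) \<le> (A * fact k powr (1/2)) * ((R ^ k / (fact k)\<^sup>2) / y ^ k)"
          using y A by (intro mult_mono divide_right_mono) auto
        then have "cmod (a \<tau> * (?n \<tau> w / of_real y ^ k)) \<le> (A * fact k powr (1/2)) * ((R ^ k / (fact k)\<^sup>2) / y ^ k)"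
          using y by (simp only: norm_mult norm_divide norm_power norm_of_real abs_of_pos)
        also have "\<dots> = A * (R / y) ^ k / fact k powr (3/2)"
        proof -
          define F where "F = (fact k :: real) powr (1/2)"
          have "F * fact k powr (3/2) = (fact k :: real) powr 2" unfolding F_def powr_add[symmetric] by simp
          then have F: "F > 0" "(fact k)\<^sup>2 = F * fact k powr (3/2)" by (simp_all add: F_def powr_numeral)
          show ?thesis unfolding F_def[symmetric] unfolding F(2) using F(1) by (simp add: power_divide)
        qed
        finally show ?thesis .
      qed
      have "cmod (b k) \<le> real (card (level k)) * (A * (R / y) ^ k / fact k powr (3/2))"
        unfolding b_def by (rule order_trans[OF norm_sum sum_bounded_above[OF trm]])
      also have "\<dots> \<le> real (level_base TYPE('n) ^ k) * (A * (R / y) ^ k / fact k powr (3/2))"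
      proof (intro mult_right_mono of_nat_mono)
        have "card (level k) \<le> card (degs_upto k :: 'n triple set)"
          by (intro card_mono card_degs_upto) (auto simp: level_def degs_upto_def)
        then show "card (level k) \<le> level_base TYPE('n) ^ k" using card_degs_upto(2)[of k, where 'n='n] by linarith
      qed (use A y in \<open>auto simp: R_def\<close>)
      finally show ?thesis by (simp add: M_def power_divide power_mult_distrib mult_ac)
    qed
    have sums0: "(\<lambda>k. pochhammer (of_real s * (of_real y / (2 * hb))) k * b k) sums 0" if s: "s > 0" for s
    proof -
      define t where "t = sqrt s"
      have t: "t > 0" "t\<^sup>2 = s" using s by (auto simp: t_def)
      let ?w = "t *\<^sub>R w"
      have wC: "?w \<in> C_plus" using w t s by (simp add: C_plus_def yfun_scaleR)
      obtain L where L: "L \<ge> 0" "\<And>\<tau>. cmod (f_fun hb \<tau> ?w) \<le> L ^ deg \<tau> / fact (deg \<tau>)"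
        using f_fun_point_bound[of hb ?w] by blast
      have "((\<lambda>\<tau>. a \<tau> * f_fun hb \<tau> ?w) has_sum 0) UNIV"
        using has_sum_infsum[OF evaluate_summable[OF a L]] zero[OF wC] unfolding evaluate_def by simp
      then have lim: "(sum (\<lambda>\<tau>. a \<tau> * f_fun hb \<tau> ?w) \<longlongrightarrow> 0) (finite_subsets_at_top UNIV)"
        by (simp add: has_sum_def)
      have "filterlim (\<lambda>n. \<Union>k<n. level k) (finite_subsets_at_top UNIV) sequentially"
        unfolding filterlim_finite_subsets_at_top
      proof (intro allI impI)
        fix X :: "'n triple set" assume X: "finite X \<and> X \<subseteq> UNIV"
        define m where "m = Suc (Max (insert 0 (deg ` X)))"
        have "deg \<tau> < m" if "\<tau> \<in> X" for \<tau> using X that by (simp add: m_def less_Suc_eq_le)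
        then have "X \<subseteq> (\<Union>k<n. level k)" if "n \<ge> m" for n using that by (fastforce simp: level_def)
        then show "\<forall>\<^sub>F n in sequentially. finite (\<Union>k<n. level k) \<and> X \<subseteq> (\<Union>k<n. level k) \<and> (\<Union>k<n. level k) \<subseteq> UNIV"
          using fin by (intro eventually_sequentiallyI[of m]) auto
      qed
      from filterlim_compose[OF lim this]
      have "(\<lambda>n. \<Sum>\<tau>\<in>(\<Union>k<n. level k). a \<tau> * f_fun hb \<tau> ?w) \<longlonglongrightarrow> 0" .
      moreover have "(\<Sum>\<tau>\<in>(\<Union>k<n. level k). a \<tau> * f_fun hb \<tau> ?w) =
          (\<Sum>k<n. pochhammer (of_real s * (of_real y / (2 * hb))) k * b k)" for n
      proof -
        have "(\<Sum>\<tau>\<in>(\<Union>k<n. level k). a \<tau> * f_fun hb \<tau> ?w) = (\<Sum>k<n. \<Sum>\<tau>\<in>level k. a \<tau> * f_fun hb \<tau> ?w)"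
          by (rule sum.UNION_disjoint) (auto simp: fin, auto simp: level_def)
        also have "\<dots> = (\<Sum>k<n. pochhammer (of_real s * (of_real y / (2 * hb))) k * b k)"
          unfolding b_def sum_distrib_left
          by (intro sum.cong refl) (simp add: f_fun_scaleR[OF w t(1)] t(2) level_def y_def)
        finally show ?thesis .
      qed
      ultimately show ?thesis by (simp add: sums_def)
    qed
    have "b k = 0" for k
      by (rule level_series_vanishes[OF bound A _ _ sums0]) (use y hb in \<open>auto simp: M_def R_def\<close>)
    then have "(\<Sum>\<tau>\<in>level k. a \<tau> * ?n \<tau> w) / of_real y ^ k = 0"
      by (simp add: b_def sum_divide_distrib)
    then show ?thesis using y by simp
  qed
  have "a \<sigma> = 0"
    by (rule homogeneous_unique[of "level (deg \<sigma>)" "deg \<sigma>"]) (auto simp: fin lev, auto simp: level_def)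
  then show "a \<sigma> = 0 \<sigma>" by (simp add: pointwise)
qed

lemma free_f_fun:
  assumes "hb \<noteq> 0"
  shows "free_family (f_fun hb)"
  unfolding free_family_def
proof (intro ballI impI)
  fix a :: "'a triple \<Rightarrow> complex" assume a: "a \<in> finsupp" "lincomb (f_fun hb) a = 0"
  show "a = 0"
  proof (rule evaluate_injective[OF assms])
    show "a \<in> subfactorial_growth" using a(1) finsupp_subfactorial by (rule subsetD[rotated])
    show "evaluate hb w a = 0" for w
      unfolding evaluate_finsupp[OF a(1)] a(2) by (simp only: pointwise)
  qed
qed

section \<open>The product in coordinates\<close>

lemma A_space_eq: "A_space hb = lincomb (f_fun hb) ` finsupp"
  by (simp add: A_space_def span_eq_lincomb)

lemma f_coeff_lincomb:
  assumes "hb \<noteq> 0" "a \<in> finsupp"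
  shows "f_coeff hb (lincomb (f_fun hb) a) = a"
  by (rule ext) (simp add: f_coeff_def representation_lincomb[OF free_f_fun[OF assms(1)] assms(2)])

lemma lincomb_f_coeff:
  assumes "hb \<noteq> 0" "x \<in> A_space hb"
  shows "f_coeff hb x \<in> finsupp" "lincomb (f_fun hb) (f_coeff hb x) = x"
  using assms by (auto simp: A_space_eq f_coeff_lincomb)

lemma lincomb_inj:
  assumes "free_family v" "a \<in> finsupp" "b \<in> finsupp" "lincomb v a = lincomb v b"
  shows "a = b"
proof -
  have "lincomb v (a - b) = 0" using assms by (simp add: lincomb_diff)
  then have "a - b = 0" using assms unfolding free_family_def by (blast intro: finsupp_diff)
  then show ?thesis by simp
qed

lemma inv_S_map:
  fixes a :: "'n::finite triple \<Rightarrow> complex"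
  assumes hb: "hb \<noteq> 0" and a: "a \<in> finsupp"
  shows "inv_into invariant_polynomials (S_map hb) (lincomb (f_fun hb) a) = lincomb (wick_basis hb) a"
proof (rule inv_into_f_eq)
  show "inj_on (S_map hb) (invariant_polynomials :: ('n pt \<Rightarrow> complex) set)"
  proof (rule inj_onI)
    fix x y :: "'n pt \<Rightarrow> complex"
    assume xy: "x \<in> invariant_polynomials" "y \<in> invariant_polynomials" "S_map hb x = S_map hb y"
    obtain b c where b: "x = lincomb (wick_basis hb) b" "b \<in> finsupp" and c: "y = lincomb (wick_basis hb) c" "c \<in> finsupp"
      using xy(1,2) unfolding invariant_polynomials_eq[OF hb] by (elim imageE) blast
    have "lincomb (f_fun hb) b = lincomb (f_fun hb) c"
      using xy(3) unfolding b(1) c(1) S_map_lincomb[OF hb b(2)] S_map_lincomb[OF hb c(2)] .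
    then show "x = y" using lincomb_inj[OF free_f_fun[OF hb] b(2) c(2)] b c by simp
  qed
  show "lincomb (wick_basis hb) a \<in> invariant_polynomials" unfolding invariant_polynomials_eq[OF hb] using a by (rule imageI)
  show "S_map hb (lincomb (wick_basis hb) a) = lincomb (f_fun hb) a" by (rule S_map_lincomb[OF hb a])
qed

lemma star_tilde_lincomb:
  assumes hb: "hb \<noteq> 0" and a: "a \<in> finsupp" and b: "b \<in> finsupp"
  shows "star_tilde hb (lincomb (f_fun hb) a) (lincomb (f_fun hb) b) = lincomb (f_fun hb) (coeff_mul a b)"
  unfolding star_tilde_def inv_S_map[OF hb a] inv_S_map[OF hb b] wick_lincomb[OF hb a b]
  by (rule S_map_lincomb[OF hb coeff_mul_finsupp[OF a b]])

lemma coeff_mul_unit_fam: "coeff_mul (unit_fam \<tau>) (unit_fam \<sigma>) \<rho> = contraction_coeff \<tau> \<sigma> \<rho>"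
  by (subst coeff_mul_eq_sum[of "{\<tau>}" "{\<sigma>}"]) (auto simp: unit_fam_def split: if_splits)

lemma struct_const_eq:
  assumes "hb \<noteq> 0"
  shows "struct_const hb \<tau> \<sigma> \<rho> = contraction_coeff \<tau> \<sigma> \<rho>"
proof -
  have "star_tilde hb (f_fun hb \<tau>) (f_fun hb \<sigma>) = lincomb (f_fun hb) (coeff_mul (unit_fam \<tau>) (unit_fam \<sigma>))"
    using star_tilde_lincomb[OF assms unit_fam_finsupp unit_fam_finsupp, of \<tau> \<sigma>] by (simp only: lincomb_unit_fam)
  then show ?thesis
    unfolding struct_const_def by (simp only: f_coeff_lincomb[OF assms coeff_mul_finsupp[OF unit_fam_finsupp unit_fam_finsupp]] coeff_mul_unit_fam)
qed

text \<open>
  \<open>contraction_coeff\<close> does not mention \<open>\<hbar>\<close>, so associativity can be read off from the Wick product for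
  the value 1 of the parameter.
\<close>

lemma coeff_mul_assoc_finsupp:
  fixes a b c :: "'n::finite triple \<Rightarrow> complex"
  assumes "a \<in> finsupp" "b \<in> finsupp" "c \<in> finsupp"
  shows "coeff_mul (coeff_mul a b) c = coeff_mul a (coeff_mul b c)"
proof (rule lincomb_inj[OF free_wick_basis[of 1]])
  have p: "lincomb (wick_basis 1) x \<in> polynomials" for x :: "'n triple \<Rightarrow> complex"
    unfolding lincomb_def by (intro poly_sum poly_scale wick_basis_poly)
  have w: "wick 1 (lincomb (wick_basis 1) x) (lincomb (wick_basis 1) y) = lincomb (wick_basis 1) (coeff_mul x y)"
    if "x \<in> finsupp" "y \<in> finsupp" for x y :: "'n triple \<Rightarrow> complex"
    using wick_lincomb[of 1 x y] that by simp
  show "lincomb (wick_basis 1) (coeff_mul (coeff_mul a b) c) = lincomb (wick_basis 1) (coeff_mul a (coeff_mul b c))"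
    using wick_assoc[OF p p p, of 1 a b c] assms by (simp add: w coeff_mul_finsupp)
qed (auto intro: coeff_mul_finsupp assms)

definition truncate :: "nat \<Rightarrow> ('n::finite triple \<Rightarrow> complex) \<Rightarrow> 'n triple \<Rightarrow> complex" where
  "truncate d a = (\<lambda>\<tau>. if deg \<tau> \<le> d then a \<tau> else 0)"

lemma truncate_finsupp: "truncate d a \<in> finsupp"
  by (rule finsuppI[OF card_degs_upto(1)[of d]]) (auto simp: truncate_def degs_upto_def split: if_splits)

lemma coeff_mul_local:
  assumes "\<And>\<tau>. deg \<tau> \<le> deg \<rho> \<Longrightarrow> a \<tau> = a' \<tau>" "\<And>\<tau>. deg \<tau> \<le> deg \<rho> \<Longrightarrow> b \<tau> = b' \<tau>"
  shows "coeff_mul a b \<rho> = coeff_mul a' b' \<rho>"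
  unfolding coeff_mul_def using assms by (intro sum.cong refl) (auto simp: degs_upto_def)

text \<open>
  The coefficient at \<open>\<rho>\<close> of both sides only depends on coefficients of degree at most \<open>deg \<rho>\<close>.
\<close>

lemma coeff_mul_assoc:
  fixes a b c :: "'n::finite triple \<Rightarrow> complex"
  shows "coeff_mul (coeff_mul a b) c = coeff_mul a (coeff_mul b c)"
proof (rule ext)
  fix \<rho> :: "'n triple"
  let ?t = "truncate (deg \<rho>)"
  have t: "deg \<tau> \<le> deg \<rho> \<Longrightarrow> ?t x \<tau> = x \<tau>" for x \<tau> by (simp add: truncate_def)
  have "coeff_mul (coeff_mul a b) c \<rho> = coeff_mul (coeff_mul (?t a) (?t b)) (?t c) \<rho>"
    by (intro coeff_mul_local) (auto simp: t)
  also have "\<dots> = coeff_mul (?t a) (coeff_mul (?t b) (?t c)) \<rho>"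
    by (simp add: coeff_mul_assoc_finsupp truncate_finsupp)
  also have "\<dots> = coeff_mul a (coeff_mul b c) \<rho>"
    by (intro coeff_mul_local) (auto simp: t)
  finally show "coeff_mul (coeff_mul a b) c \<rho> = coeff_mul a (coeff_mul b c) \<rho>" .
qed

lemma coeff_mul_left: "coeff_mul (cscale k a + a') b = cscale k (coeff_mul a b) + coeff_mul a' b"
  by (rule ext) (simp add: coeff_mul_def cscale_def pointwise algebra_simps sum.distrib sum_distrib_left)

lemma coeff_mul_right: "coeff_mul a (cscale k b + b') = cscale k (coeff_mul a b) + coeff_mul a b'"
  by (rule ext) (simp add: coeff_mul_def cscale_def pointwise algebra_simps sum.distrib sum_distrib_left)

lemma coeff_mul_bound:
  assumes a: "\<And>\<tau>. cmod (a \<tau>) \<le> s * fact (deg \<tau>) powr \<epsilon>" and b: "\<And>\<tau>. cmod (b \<tau>) \<le> t * fact (deg \<tau>) powr \<epsilon>"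
    and st: "s \<ge> 0" "t \<ge> 0" "\<epsilon> \<ge> 0"
  shows "cmod (coeff_mul a b (\<rho> :: 'n::finite triple)) \<le>
    s * t * exp (real CARD('n option)) * (4 * (real (level_base TYPE('n)))\<^sup>2) ^ deg \<rho> * fact (deg \<rho>) powr (2 * \<epsilon>)"
proof -
  let ?d = "deg \<rho>" and ?E = "exp (real CARD('n option))" and ?B = "real (level_base TYPE('n))"
  let ?D = "degs_upto ?d :: 'n triple set"
  define F where "F = (fact ?d :: real) powr \<epsilon>"
  have F: "F \<ge> 0" "F * F = fact ?d powr (2 * \<epsilon>)" by (simp_all add: F_def flip: powr_add)
  have le: "fact (deg \<tau>) powr \<epsilon> \<le> F" if "\<tau> \<in> ?D" for \<tau>
    unfolding F_def using that st by (intro powr_mono2) (auto simp: degs_upto_def fact_mono)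
  have trm: "cmod (contraction_coeff \<tau> \<sigma> \<rho> * a \<tau> * b \<sigma>) \<le> ?E * 4 ^ ?d * (s * F) * (t * F)" if "\<tau> \<in> ?D" "\<sigma> \<in> ?D" for \<tau> \<sigma>
  proof -
    have "cmod (a \<tau>) \<le> s * F" using a[of \<tau>] mult_left_mono[OF le[OF that(1)] st(1)] by linarith
    moreover have "cmod (b \<sigma>) \<le> t * F" using b[of \<sigma>] mult_left_mono[OF le[OF that(2)] st(2)] by linarith
    ultimately show ?thesis unfolding norm_mult using st F
      by (intro mult_mono norm_contraction_coeff_le) auto
  qed
  have "cmod (coeff_mul a b \<rho>) \<le> (\<Sum>\<tau>\<in>?D. \<Sum>\<sigma>\<in>?D. ?E * 4 ^ ?d * (s * F) * (t * F))"
    unfolding coeff_mul_def by (intro order_trans[OF norm_sum sum_mono] trm)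
  also have "\<dots> = real (card ?D) * (real (card ?D) * (?E * 4 ^ ?d * (s * F) * (t * F)))" by simp
  also have "\<dots> \<le> ?B ^ ?d * (?B ^ ?d * (?E * 4 ^ ?d * (s * F) * (t * F)))"
    using of_nat_mono[OF card_degs_upto(2)[of ?d, where 'n='n], where 'a=real] st F
    by (intro mult_mono mult_nonneg_nonneg) auto
  also have "\<dots> = s * t * ?E * (4 * ?B\<^sup>2) ^ ?d * (F * F)"
    by (simp add: power_mult_distrib power2_eq_square mult_ac)
  finally show ?thesis unfolding F(2) .
qed

text \<open>
  One third of \<open>\<epsilon>\<close> is used for each factor, and the last third for the exponential in \<open>coeff_mul_bound\<close>.
\<close>

lemma coeff_mul_norm_bound:
  assumes e: "\<epsilon> > 0"
  shows "\<exists>C>0. \<forall>a\<in>subfactorial_growth. \<forall>b\<in>subfactorial_growth. \<forall>\<rho> :: 'n::finite triple.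
    cmod (coeff_mul a b \<rho>) \<le> C * subfactorial_norm (\<epsilon>/3) a * subfactorial_norm (\<epsilon>/3) b * fact (deg \<rho>) powr \<epsilon>"
proof -
  let ?E = "exp (real CARD('n option))" and ?K = "4 * (real (level_base TYPE('n)))\<^sup>2"
  obtain c where c: "c > 0" "\<And>d. ?K ^ d \<le> c * fact d powr (\<epsilon>/3)"
    using power_le_fact_powr[of ?K "\<epsilon>/3"] e by auto
  have "cmod (coeff_mul a b \<rho>) \<le> (?E * c) * subfactorial_norm (\<epsilon>/3) a * subfactorial_norm (\<epsilon>/3) b * fact (deg \<rho>) powr \<epsilon>"
    if a: "a \<in> subfactorial_growth" and b: "b \<in> subfactorial_growth" for a b and \<rho> :: "'n triple"
  proof -
    let ?s = "subfactorial_norm (\<epsilon>/3) a" and ?t = "subfactorial_norm (\<epsilon>/3) b"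
    have st: "?s \<ge> 0" "?t \<ge> 0" using a b e by (auto intro!: subfactorial_norm_nonneg)
    have "cmod (coeff_mul a b \<rho>) \<le> ?s * ?t * ?E * ?K ^ deg \<rho> * fact (deg \<rho>) powr (2 * (\<epsilon>/3))"
      using e by (intro coeff_mul_bound norm_le_subfactorial_norm a b st) auto
    also have "\<dots> \<le> ?s * ?t * ?E * (c * fact (deg \<rho>) powr (\<epsilon>/3)) * fact (deg \<rho>) powr (2 * (\<epsilon>/3))"
      using c(2)[of "deg \<rho>"] st by (intro mult_right_mono mult_left_mono) auto
    also have "\<dots> = (?E * c) * ?s * ?t * (fact (deg \<rho>) powr (\<epsilon>/3) * fact (deg \<rho>) powr (2 * (\<epsilon>/3)))"
      by (simp only: mult_ac)
    also have "fact (deg \<rho>) powr (\<epsilon>/3) * fact (deg \<rho>) powr (2 * (\<epsilon>/3)) = (fact (deg \<rho>) :: real) powr \<epsilon>"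
      by (simp flip: powr_add)
    finally show ?thesis .
  qed
  then show ?thesis using c(1) by (intro exI[of _ "?E * c"]) simp
qed

lemma coeff_mul_subfactorial:
  fixes a b :: "'n::finite triple \<Rightarrow> complex"
  assumes "a \<in> subfactorial_growth" "b \<in> subfactorial_growth"
  shows "coeff_mul a b \<in> subfactorial_growth"
proof (rule subfactorial_growthI)
  fix \<epsilon> :: real assume "\<epsilon> > 0"
  then show "\<exists>c. \<forall>\<rho>. cmod (coeff_mul a b \<rho>) \<le> c * fact (deg \<rho>) powr \<epsilon>"
    using coeff_mul_norm_bound[of \<epsilon>, where 'n='n] assms by blast
qed

section \<open>The seminorms of the completion\<close>

lemma h_fun_eq:
  assumes "hb \<noteq> 0"
  shows "h_fun hb (Suc m) l \<rho> a =
     (if even l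
      then \<Sum>\<^sub>\<infinity>\<tau>. (h_fun hb m (l div 2) \<tau> a)\<^sup>2 * (\<Sum>\<^sub>\<infinity>\<sigma>. ennreal (cmod (contraction_coeff \<tau> \<sigma> \<rho>)))
      else \<Sum>\<^sub>\<infinity>\<sigma>. (h_fun hb m (l div 2) \<sigma> a)\<^sup>2 * (\<Sum>\<^sub>\<infinity>\<tau>. ennreal (cmod (contraction_coeff \<tau> \<sigma> \<rho>))))"
  by (simp add: struct_const_eq[OF assms])

lemma infsum_ennreal_ge: "f x \<le> (\<Sum>\<^sub>\<infinity>x. f x)" for f :: "'i \<Rightarrow> ennreal"
proof -
  have "infsum f {x} \<le> infsum f UNIV"
    by (rule infsum_mono_neutral) (auto intro: nonneg_summable_on_complete)
  then show ?thesis by simp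
qed

text \<open>
  Keep only the term in which one factor is \<open>\<rho>\<close> and the other is the unit.
\<close>

lemma h_fun_lower:
  assumes "hb \<noteq> 0"
  shows "ennreal (cmod (a \<rho>) ^ 2 ^ m) \<le> h_fun hb m l \<rho> a"
proof (induction m arbitrary: l)
  case (Suc m)
  have sq: "ennreal (cmod (a \<rho>) ^ 2 ^ Suc m) \<le> (h_fun hb m k \<rho> a)\<^sup>2 * x" if "1 \<le> x" for k x
  proof -
    have "ennreal (cmod (a \<rho>) ^ 2 ^ Suc m) = (ennreal (cmod (a \<rho>) ^ 2 ^ m))\<^sup>2 * 1"
      by (simp add: ennreal_power power_mult[symmetric] mult.commute)
    also have "\<dots> \<le> (h_fun hb m k \<rho> a)\<^sup>2 * x"
      using Suc that by (intro mult_mono power_mono) auto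
    finally show ?thesis .
  qed
  have one: "1 \<le> (\<Sum>\<^sub>\<infinity>\<sigma>. ennreal (cmod (contraction_coeff \<rho> \<sigma> \<rho>)))" "1 \<le> (\<Sum>\<^sub>\<infinity>\<tau>. ennreal (cmod (contraction_coeff \<tau> \<rho> \<rho>)))"
    using infsum_ennreal_ge[of "\<lambda>\<sigma>. ennreal (cmod (contraction_coeff \<rho> \<sigma> \<rho>))" zero_triple]
      infsum_ennreal_ge[of "\<lambda>\<tau>. ennreal (cmod (contraction_coeff \<tau> \<rho> \<rho>))" zero_triple]
    by (simp_all add: contraction_coeff_unit)
  show ?case
  proof (cases "even l")
    case True
    then show ?thesis unfolding h_fun_eq[OF assms]
      using order_trans[OF sq[OF one(1), of "l div 2"] infsum_ennreal_ge[of "\<lambda>\<tau>. (h_fun hb m (l div 2) \<tau> a)\<^sup>2 * (\<Sum>\<^sub>\<infinity>\<sigma>. ennreal (cmod (contraction_coeff \<tau> \<sigma> \<rho>)))" \<rho>]]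
      by (simp only: if_True)
  next
    case False
    then show ?thesis unfolding h_fun_eq[OF assms]
      using order_trans[OF sq[OF one(2), of "l div 2"] infsum_ennreal_ge[of "\<lambda>\<sigma>. (h_fun hb m (l div 2) \<sigma> a)\<^sup>2 * (\<Sum>\<^sub>\<infinity>\<tau>. ennreal (cmod (contraction_coeff \<tau> \<sigma> \<rho>)))" \<rho>]]
      by (simp only: if_False)
  qed
qed simp

text \<open>
  The form in which the recursion for \<open>h_fun\<close> uses that products do not lower the degree: each sum is finite,
  with exponentially many terms.
\<close>

lemma graded_sum_bound:
  fixes f :: "'n::finite triple \<Rightarrow> ennreal"
  assumes "\<And>\<tau>. f \<tau> \<noteq> 0 \<Longrightarrow> deg \<tau> \<le> d" "\<And>\<tau>. deg \<tau> \<le> d \<Longrightarrow> f \<tau> \<le> ennreal x" "x \<ge> 0"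
  shows "(\<Sum>\<^sub>\<infinity>\<tau>. f \<tau>) \<le> ennreal (real (level_base TYPE('n)) ^ d * x)"
proof -
  have "(\<Sum>\<^sub>\<infinity>\<tau>. f \<tau>) = (\<Sum>\<^sub>\<infinity>\<tau>\<in>degs_upto d. f \<tau>)"
    using assms(1) by (intro infsum_cong_neutral) (auto simp: degs_upto_def)
  also have "\<dots> = (\<Sum>\<tau>\<in>degs_upto d. f \<tau>)" by (simp add: card_degs_upto)
  also have "\<dots> \<le> (\<Sum>\<tau>\<in>(degs_upto d :: 'n triple set). ennreal x)"
    using assms(2) by (intro sum_mono) (auto simp: degs_upto_def)
  also have "\<dots> = ennreal (real (card (degs_upto d :: 'n triple set)) * x)"
    using assms(3) by (simp add: ennreal_mult ennreal_of_nat_eq_real_of_nat)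
  also have "\<dots> \<le> ennreal (real (level_base TYPE('n)) ^ d * x)"
    using of_nat_mono[OF card_degs_upto(2)[of d, where 'n='n], where 'a=real] assms(3)
    by (intro ennreal_leI mult_right_mono) auto
  finally show ?thesis .
qed

lemma contraction_coeff_row_sums:
  fixes \<tau> \<rho> :: "'n::finite triple"
  defines "X \<equiv> real (level_base TYPE('n)) ^ deg \<rho> * (exp (real CARD('n option)) * 4 ^ deg \<rho>)"
  shows "(\<Sum>\<^sub>\<infinity>\<sigma>. ennreal (cmod (contraction_coeff \<tau> \<sigma> \<rho>))) \<le> ennreal X"
    and "(\<Sum>\<^sub>\<infinity>\<sigma>. ennreal (cmod (contraction_coeff \<sigma> \<tau> \<rho>))) \<le> ennreal X"
    and "deg \<rho> < deg \<tau> \<Longrightarrow> (\<Sum>\<^sub>\<infinity>\<sigma>. ennreal (cmod (contraction_coeff \<tau> \<sigma> \<rho>))) = 0"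
    and "deg \<rho> < deg \<tau> \<Longrightarrow> (\<Sum>\<^sub>\<infinity>\<sigma>. ennreal (cmod (contraction_coeff \<sigma> \<tau> \<rho>))) = 0"
proof -
  show "(\<Sum>\<^sub>\<infinity>\<sigma>. ennreal (cmod (contraction_coeff \<tau> \<sigma> \<rho>))) \<le> ennreal X" "(\<Sum>\<^sub>\<infinity>\<sigma>. ennreal (cmod (contraction_coeff \<sigma> \<tau> \<rho>))) \<le> ennreal X"
    unfolding X_def using contraction_coeff_nonzero norm_contraction_coeff_le
    by (auto intro!: graded_sum_bound ennreal_leI)
  assume d: "deg \<rho> < deg \<tau>"
  have "contraction_coeff \<tau> \<sigma> \<rho> = 0" "contraction_coeff \<sigma> \<tau> \<rho> = 0" for \<sigma>
    using contraction_coeff_nonzero(1)[of \<tau> \<sigma> \<rho>] contraction_coeff_nonzero(2)[of \<sigma> \<tau> \<rho>] d by (cases "contraction_coeff \<tau> \<sigma> \<rho> = 0", cases "contraction_coeff \<sigma> \<tau> \<rho> = 0", auto)+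
  then show "(\<Sum>\<^sub>\<infinity>\<sigma>. ennreal (cmod (contraction_coeff \<tau> \<sigma> \<rho>))) = 0" "(\<Sum>\<^sub>\<infinity>\<sigma>. ennreal (cmod (contraction_coeff \<sigma> \<tau> \<rho>))) = 0"
    by simp_all
qed

text \<open>
  Squaring doubles the exponent of the factorial at each step, while the row sums of the structure constants
  and the number of terms only increase the base \<open>K\<close> of the exponential.
\<close>

lemma h_fun_upper:
  assumes hb: "hb \<noteq> 0"
  shows "\<exists>C\<ge>0. \<exists>K\<ge>1. \<forall>l s \<epsilon>. \<forall>a \<rho> :: 'n::finite triple.
     s \<ge> 0 \<longrightarrow> \<epsilon> \<ge> 0 \<longrightarrow> (\<forall>\<tau>. cmod (a \<tau>) \<le> s * fact (deg \<tau>) powr \<epsilon>) \<longrightarrow>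
     h_fun hb m l \<rho> a \<le> ennreal (C * s ^ 2 ^ m * K ^ deg \<rho> * fact (deg \<rho>) powr (2 ^ m * \<epsilon>))"
proof (induction m)
  case 0
  have "ennreal (cmod (a \<rho>)) \<le> ennreal (1 * s ^ 2 ^ 0 * 1 ^ deg \<rho> * fact (deg \<rho>) powr (2 ^ 0 * \<epsilon>))"
    if "\<forall>\<tau>. cmod (a \<tau>) \<le> s * fact (deg \<tau>) powr \<epsilon>" for a s \<epsilon> and \<rho> :: "'n triple"
    using that by (intro ennreal_leI) simp
  then show ?case unfolding h_fun.simps by (intro exI[of _ 1] conjI order_refl) auto
next
  case (Suc m)
  obtain C K where CK: "C \<ge> 0" "K \<ge> 1" and IH: "\<And>l s \<epsilon> a (\<rho> :: 'n triple). s \<ge> 0 \<Longrightarrow> \<epsilon> \<ge> 0 \<Longrightarrow>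
     (\<forall>\<tau>. cmod (a \<tau>) \<le> s * fact (deg \<tau>) powr \<epsilon>) \<Longrightarrow>
     h_fun hb m l \<rho> a \<le> ennreal (C * s ^ 2 ^ m * K ^ deg \<rho> * fact (deg \<rho>) powr (2 ^ m * \<epsilon>))"
    using Suc by blast
  let ?E = "exp (real CARD('n option))" and ?B = "real (level_base TYPE('n))"
  have B: "?B \<ge> 1" unfolding level_base_def of_nat_power by (rule one_le_power) simp
  have "h_fun hb (Suc m) l \<rho> a \<le>
      ennreal ((C\<^sup>2 * ?E) * s ^ 2 ^ Suc m * (4 * ?B\<^sup>2 * K\<^sup>2) ^ deg \<rho> * fact (deg \<rho>) powr (2 ^ Suc m * \<epsilon>))"
    if s: "s \<ge> 0" "\<epsilon> \<ge> 0" and a: "\<forall>\<tau>. cmod (a \<tau>) \<le> s * fact (deg \<tau>) powr \<epsilon>"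
    for l s \<epsilon> a and \<rho> :: "'n triple"
  proof -
    let ?d = "deg \<rho>"
    define F where "F = (fact ?d :: real) powr (2 ^ m * \<epsilon>)"
    define X where "X = ?B ^ ?d * (?E * 4 ^ ?d)"
    \<comment> \<open>The bound for \<open>h\<^sub>m\<close> at the degree of \<open>\<rho>\<close>, valid for all smaller degrees as well.\<close>
    define Y where "Y = C * s ^ 2 ^ m * K ^ ?d * F"
    have pos: "X \<ge> 0" "Y \<ge> 0" using s CK by (auto simp: X_def Y_def F_def)
    have h: "h_fun hb m k \<tau> a \<le> ennreal Y" if "deg \<tau> \<le> ?d" for k \<tau>
    proof -
      have "C * s ^ 2 ^ m * K ^ deg \<tau> * fact (deg \<tau>) powr (2 ^ m * \<epsilon>) \<le> Y"
        unfolding Y_def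
      proof (rule mult_mono)
        show "C * s ^ 2 ^ m * K ^ deg \<tau> \<le> C * s ^ 2 ^ m * K ^ ?d"
          using that s CK by (intro mult_left_mono power_increasing) auto
        show "fact (deg \<tau>) powr (2 ^ m * \<epsilon>) \<le> F"
          unfolding F_def using that s by (intro powr_mono2 fact_mono) auto
      qed (use s CK in auto)
      then show ?thesis using order_trans[OF IH[OF s a] ennreal_leI] by blast
    qed
    have conv: "(\<Sum>\<^sub>\<infinity>\<tau>. (h_fun hb m k \<tau> a)\<^sup>2 * R \<tau>) \<le> ennreal (?B ^ ?d * (Y\<^sup>2 * X))"
      if R: "\<And>\<tau>. R \<tau> \<le> ennreal X" "\<And>\<tau>. ?d < deg \<tau> \<Longrightarrow> R \<tau> = 0" for k R
    proof (rule graded_sum_bound)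
      fix \<tau> :: "'n triple"
      show "(h_fun hb m k \<tau> a)\<^sup>2 * R \<tau> \<noteq> 0 \<Longrightarrow> deg \<tau> \<le> ?d" using R(2)[of \<tau>] by (cases "deg \<tau> \<le> ?d") auto
      assume "deg \<tau> \<le> ?d"
      then have "(h_fun hb m k \<tau> a)\<^sup>2 * R \<tau> \<le> (ennreal Y)\<^sup>2 * ennreal X"
        using h R(1) by (intro mult_mono power_mono) auto
      then show "(h_fun hb m k \<tau> a)\<^sup>2 * R \<tau> \<le> ennreal (Y\<^sup>2 * X)"
        using pos by (simp add: ennreal_power ennreal_mult)
    qed (use pos in auto)
    have eq: "?B ^ ?d * (Y\<^sup>2 * X) = (C\<^sup>2 * ?E) * s ^ 2 ^ Suc m * (4 * ?B\<^sup>2 * K\<^sup>2) ^ ?d * fact ?d powr (2 ^ Suc m * \<epsilon>)"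
    proof -
      have F2: "fact ?d powr (2 ^ Suc m * \<epsilon>) = F * F" unfolding F_def powr_add[symmetric] by (simp add: algebra_simps)
      have s2: "s ^ 2 ^ Suc m = s ^ 2 ^ m * s ^ 2 ^ m" by (simp add: mult_2 power_add)
      show ?thesis unfolding F2 s2 X_def Y_def power_mult_distrib power2_eq_square by (simp only: mult_ac)
    qed
    show ?thesis
    proof (cases "even l")
      case True
      show ?thesis unfolding h_fun_eq[OF hb] if_P[OF True] eq[symmetric]
        using contraction_coeff_row_sums[where 'n='n] by (intro conv) (auto simp: X_def)
    next
      case False
      show ?thesis unfolding h_fun_eq[OF hb] if_not_P[OF False] eq[symmetric]
        using contraction_coeff_row_sums[where 'n='n] by (intro conv) (auto simp: X_def)
    qed
  qed
  moreover have "1 \<le> 4 * ?B\<^sup>2 * K\<^sup>2"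
  proof -
    have "1 \<le> ?B\<^sup>2" "1 \<le> K\<^sup>2" using B CK by (auto intro: one_le_power)
    then have "1 * 1 \<le> ?B\<^sup>2 * K\<^sup>2" by (intro mult_mono) auto
    then show ?thesis by simp
  qed
  ultimately show ?case
    by (intro exI[of _ "C\<^sup>2 * ?E"] exI[of _ "4 * ?B\<^sup>2 * K\<^sup>2"] conjI) auto
qed

lemma powr_root_power: "t \<ge> 0 \<Longrightarrow> (t ^ 2 ^ m) powr (1 / 2 ^ m) = t" for t :: real
  by (cases "t = 0") (simp_all add: powr_powr flip: powr_realpow)

lemma ennroot_upper:
  assumes "x \<le> ennreal (C * s ^ 2 ^ m)" "C \<ge> 0" "s \<ge> 0"
  shows "ennroot m x < \<infinity>" "enn2real (ennroot m x) \<le> C powr (1 / 2 ^ m) * s"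
proof -
  have fin: "x < \<infinity>" using assms(1) by (simp add: le_less_trans[OF _ ennreal_less_top] less_top[symmetric] top_unique) (metis ennreal_neq_top top_unique)
  then have eq: "ennroot m x = ennreal (enn2real x powr (1 / 2 ^ m))" by (simp add: ennroot_def)
  then show "ennroot m x < \<infinity>" by simp
  have "enn2real x \<le> C * s ^ 2 ^ m" using assms by (intro enn2real_leI) auto
  then have "enn2real x powr (1 / 2 ^ m) \<le> (C * s ^ 2 ^ m) powr (1 / 2 ^ m)" by (intro powr_mono2) auto
  also have "\<dots> = C powr (1 / 2 ^ m) * s" using assms by (simp add: powr_mult powr_root_power)
  finally show "enn2real (ennroot m x) \<le> C powr (1 / 2 ^ m) * s" by (simp add: eq)
qed

lemma ennroot_lower:
  assumes "ennreal (c * t ^ 2 ^ m) \<le> x" "ennroot m x < \<infinity>" "c \<ge> 0" "t \<ge> 0"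
  shows "c powr (1 / 2 ^ m) * t \<le> enn2real (ennroot m x)"
proof -
  have fin: "x \<noteq> \<infinity>" using assms(2) by (auto simp: ennroot_def)
  then have eq: "ennroot m x = ennreal (enn2real x powr (1 / 2 ^ m))" by (simp add: ennroot_def)
  have "enn2real (ennreal (c * t ^ 2 ^ m)) \<le> enn2real x" using assms(1) fin by (intro enn2real_mono) (auto simp: less_top)
  then have "(c * t ^ 2 ^ m) powr (1 / 2 ^ m) \<le> enn2real x powr (1 / 2 ^ m)"
    using assms by (intro powr_mono2) auto
  moreover have "(c * t ^ 2 ^ m) powr (1 / 2 ^ m) = c powr (1 / 2 ^ m) * t"
    using assms by (simp add: powr_mult powr_root_power)
  ultimately show ?thesis by (simp add: eq)
qed

lemma infsum_ennreal_upper: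
  fixes f :: "'i \<Rightarrow> ennreal" and g :: "'i \<Rightarrow> real"
  assumes "\<And>x. f x \<le> ennreal (g x)" "\<And>x. g x \<ge> 0" "g summable_on UNIV"
  shows "(\<Sum>\<^sub>\<infinity>x. f x) \<le> ennreal (\<Sum>\<^sub>\<infinity>x. g x)"
proof (rule infsum_le_finite_sums)
  show "f summable_on UNIV" by (rule nonneg_summable_on_complete) simp
  fix F :: "'i set" assume F: "finite F" "F \<subseteq> UNIV"
  have "sum f F \<le> (\<Sum>x\<in>F. ennreal (g x))" by (intro sum_mono assms)
  also have "\<dots> = ennreal (sum g F)" using assms(2) by simp
  also have "\<dots> \<le> ennreal (infsum g UNIV)"
    using assms F by (intro ennreal_leI finite_sum_le_infsum) auto
  finally show "sum f F \<le> ennreal (infsum g UNIV)" .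
qed

text \<open>
  For the seminorms at a triple any \<open>\<epsilon>\<close> will do. For those at a point \<open>w\<close> the choice \<open>2\<^sup>m \<epsilon> = 1/2\<close> leaves half of the
  decay of \<open>f\<^sub>\<rho>(w)\<close> for the convergence of the sum.
\<close>

lemma snorms_upper:
  fixes N :: "('n::finite triple \<Rightarrow> complex) \<Rightarrow> ennreal"
  assumes hb: "hb \<noteq> 0" and N: "N \<in> snorms hb"
  shows "\<exists>\<epsilon>\<in>{0<..<1}. \<exists>C>0. \<forall>a\<in>subfactorial_growth. N a < \<infinity> \<and> enn2real (N a) \<le> C * subfactorial_norm \<epsilon> a"
proof -
  have key: "\<exists>C>0. \<forall>a\<in>subfactorial_growth. ennroot m (X a) < \<infinity> \<and> enn2real (ennroot m (X a)) \<le> C * subfactorial_norm \<epsilon> a"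
    if e: "\<epsilon> > 0" and D: "D \<ge> 0" "\<And>a. a \<in> subfactorial_growth \<Longrightarrow> X a \<le> ennreal (D * subfactorial_norm \<epsilon> a ^ 2 ^ m)"
    for X :: "('n triple \<Rightarrow> complex) \<Rightarrow> ennreal" and m \<epsilon> D
  proof (intro exI[of _ "D powr (1 / 2 ^ m) + 1"] conjI ballI)
    fix a :: "'n triple \<Rightarrow> complex" assume a: "a \<in> subfactorial_growth"
    have s: "0 \<le> subfactorial_norm \<epsilon> a" by (rule subfactorial_norm_nonneg[OF a e])
    show "ennroot m (X a) < \<infinity>" by (rule ennroot_upper(1)[OF D(2)[OF a] D(1) s])
    have "enn2real (ennroot m (X a)) \<le> D powr (1 / 2 ^ m) * subfactorial_norm \<epsilon> a"
      by (rule ennroot_upper(2)[OF D(2)[OF a] D(1) s])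
    also have "\<dots> \<le> (D powr (1 / 2 ^ m) + 1) * subfactorial_norm \<epsilon> a" using s by (intro mult_right_mono) auto
    finally show "enn2real (ennroot m (X a)) \<le> (D powr (1 / 2 ^ m) + 1) * subfactorial_norm \<epsilon> a" .
  qed (auto intro: add_nonneg_pos)
  consider (idx) m l \<rho> where "N = snorm_idx hb m l \<rho>" | (delta) m l w where "N = snorm_delta hb m l w" "w \<in> C_plus"
    using N by (auto simp: snorms_def)
  then show ?thesis
  proof cases
    case idx
    obtain C K where CK: "C \<ge> 0" "K \<ge> 1" and up: "\<And>l s \<epsilon> a (\<rho> :: 'n triple). s \<ge> 0 \<Longrightarrow> \<epsilon> \<ge> 0 \<Longrightarrow>
       (\<forall>\<tau>. cmod (a \<tau>) \<le> s * fact (deg \<tau>) powr \<epsilon>) \<Longrightarrow>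
       h_fun hb m l \<rho> a \<le> ennreal (C * s ^ 2 ^ m * K ^ deg \<rho> * fact (deg \<rho>) powr (2 ^ m * \<epsilon>))"
      using h_fun_upper[OF hb, of m, where 'n='n] by blast
    define D where "D = C * K ^ deg \<rho> * fact (deg \<rho>) powr (2 ^ m * (1/2))"
    have "\<exists>C>0. \<forall>a\<in>subfactorial_growth. ennroot m (h_fun hb m l \<rho> a) < \<infinity> \<and>
        enn2real (ennroot m (h_fun hb m l \<rho> a)) \<le> C * subfactorial_norm (1/2) a"
    proof (rule key)
      fix a :: "'n triple \<Rightarrow> complex" assume a: "a \<in> subfactorial_growth"
      have "h_fun hb m l \<rho> a \<le> ennreal (C * subfactorial_norm (1/2) a ^ 2 ^ m * K ^ deg \<rho> * fact (deg \<rho>) powr (2 ^ m * (1/2)))"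
        using norm_le_subfactorial_norm[OF a, of "1/2"] subfactorial_norm_nonneg[OF a, of "1/2"] by (intro up) auto
      then show "h_fun hb m l \<rho> a \<le> ennreal (D * subfactorial_norm (1/2) a ^ 2 ^ m)"
        by (simp add: D_def mult_ac)
    qed (use CK in \<open>auto simp: D_def\<close>)
    then show ?thesis unfolding idx snorm_idx_def by (intro bexI[of _ "1/2"]) auto
  next
    case delta
    obtain C K where CK: "C \<ge> 0" "K \<ge> 1" and up: "\<And>l s \<epsilon> a (\<rho> :: 'n triple). s \<ge> 0 \<Longrightarrow> \<epsilon> \<ge> 0 \<Longrightarrow>
       (\<forall>\<tau>. cmod (a \<tau>) \<le> s * fact (deg \<tau>) powr \<epsilon>) \<Longrightarrow>
       h_fun hb m l \<rho> a \<le> ennreal (C * s ^ 2 ^ m * K ^ deg \<rho> * fact (deg \<rho>) powr (2 ^ m * \<epsilon>))"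
      using h_fun_upper[OF hb, of m, where 'n='n] by blast
    obtain L where L: "L \<ge> 0" "\<And>\<tau>. cmod (f_fun hb \<tau> w) \<le> L ^ deg \<tau> / fact (deg \<tau>)"
      using f_fun_point_bound[of hb w] by blast
    define \<epsilon> where "\<epsilon> = (1 / 2 ^ Suc m :: real)"
    have e: "0 < \<epsilon>" "\<epsilon> < 1" "2 ^ m * \<epsilon> = 1/2"
      using one_less_power[of "2::real" "Suc m"] by (simp_all add: \<epsilon>_def)
    define D where "D = C * weight_sum TYPE('n) (L * K)"
    have "\<exists>C>0. \<forall>a\<in>subfactorial_growth. ennroot m (\<Sum>\<^sub>\<infinity>\<rho>. ennreal (cmod (f_fun hb \<rho> w)) * h_fun hb m l \<rho> a) < \<infinity> \<and>
        enn2real (ennroot m (\<Sum>\<^sub>\<infinity>\<rho>. ennreal (cmod (f_fun hb \<rho> w)) * h_fun hb m l \<rho> a)) \<le> C * subfactorial_norm \<epsilon> a"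
    proof (rule key[OF e(1)])
      show "D \<ge> 0" using CK L by (auto simp: D_def weight_sum_def intro!: mult_nonneg_nonneg infsum_nonneg)
      fix a :: "'n triple \<Rightarrow> complex" assume a: "a \<in> subfactorial_growth"
      define S where "S = C * subfactorial_norm \<epsilon> a ^ 2 ^ m"
      have S: "S \<ge> 0" using CK subfactorial_norm_nonneg[OF a e(1)] by (simp add: S_def)
      have "(\<Sum>\<^sub>\<infinity>\<rho>. ennreal (cmod (f_fun hb \<rho> w)) * h_fun hb m l \<rho> a) \<le>
          ennreal (\<Sum>\<^sub>\<infinity>\<rho> :: 'n triple. S * ((L * K) ^ deg \<rho> / fact (deg \<rho>) powr (1/2)))"
      proof (rule infsum_ennreal_upper)
        fix \<rho> :: "'n triple"
        define F where "F = (fact (deg \<rho>) :: real) powr (1/2)"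
        have F: "F > 0" "fact (deg \<rho>) = F * F" by (simp_all add: F_def flip: powr_add)
        have "h_fun hb m l \<rho> a \<le> ennreal (C * subfactorial_norm \<epsilon> a ^ 2 ^ m * K ^ deg \<rho> * fact (deg \<rho>) powr (2 ^ m * \<epsilon>))"
          using norm_le_subfactorial_norm[OF a e(1)] subfactorial_norm_nonneg[OF a e(1)] e by (intro up) auto
        then have "ennreal (cmod (f_fun hb \<rho> w)) * h_fun hb m l \<rho> a \<le>
           ennreal (L ^ deg \<rho> / fact (deg \<rho>)) * ennreal (S * K ^ deg \<rho> * F)"
          using L(2) unfolding e(3) S_def F_def by (intro mult_mono ennreal_leI) auto
        also have "\<dots> = ennreal (L ^ deg \<rho> / fact (deg \<rho>) * (S * K ^ deg \<rho> * F))"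
          using S F(1) CK L(1) by (intro ennreal_mult[symmetric]) auto
        also have "L ^ deg \<rho> / fact (deg \<rho>) * (S * K ^ deg \<rho> * F) = S * ((L * K) ^ deg \<rho> / F)"
          unfolding F(2) power_mult_distrib using F(1) by simp
        finally show "ennreal (cmod (f_fun hb \<rho> w)) * h_fun hb m l \<rho> a \<le> ennreal (S * ((L * K) ^ deg \<rho> / fact (deg \<rho>) powr (1/2)))"
          by (simp add: F_def)
        show "0 \<le> S * ((L * K) ^ deg \<rho> / fact (deg \<rho>) powr (1/2))" using S L(1) CK by simp
      next
        show "(\<lambda>\<rho> :: 'n triple. S * ((L * K) ^ deg \<rho> / fact (deg \<rho>) powr (1/2))) summable_on UNIV"
          using L CK by (intro summable_on_cmult_right summable_on_power_fact) auto
      qed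
      also have "(\<Sum>\<^sub>\<infinity>\<rho> :: 'n triple. S * ((L * K) ^ deg \<rho> / fact (deg \<rho>) powr (1/2))) = D * subfactorial_norm \<epsilon> a ^ 2 ^ m"
      proof -
        have "(\<Sum>\<^sub>\<infinity>\<rho> :: 'n triple. S * ((L * K) ^ deg \<rho> / fact (deg \<rho>) powr (1/2))) = S * weight_sum TYPE('n) (L * K)"
          unfolding weight_sum_def using L CK by (intro infsum_cmult_right summable_on_power_fact) auto
        then show ?thesis by (simp add: D_def S_def)
      qed
      finally show "(\<Sum>\<^sub>\<infinity>\<rho>. ennreal (cmod (f_fun hb \<rho> w)) * h_fun hb m l \<rho> a) \<le> ennreal (D * subfactorial_norm \<epsilon> a ^ 2 ^ m)" .
    qed
    then show ?thesis unfolding delta(1) snorm_delta_def using e by (intro bexI[of _ \<epsilon>]) auto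
  qed
qed

text \<open>
  At the point of \<open>f_fun_lower_bound\<close> the term at \<open>\<rho>\<close> alone bounds \<open>|a\<^sub>\<rho>|\<close> to the power \<open>2\<^sup>m\<close>, up to the factor
  \<open>(deg \<rho>)! / k ^ deg \<rho>\<close>. The second factorial in the proof absorbs the exponential, and
  the root of order \<open>2\<^sup>m\<close> turns both into the power \<open>2 / 2\<^sup>m < \<epsilon>\<close>.
\<close>

lemma snorms_lower:
  assumes hb: "hb \<noteq> 0" and e: "\<epsilon> > 0"
  shows "\<exists>N\<in>snorms hb. \<exists>C>0. \<forall>a :: 'n::finite triple \<Rightarrow> complex. N a < \<infinity> \<longrightarrow>
     (\<forall>\<rho>. cmod (a \<rho>) \<le> C * enn2real (N a) * fact (deg \<rho>) powr \<epsilon>)"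
proof -
  obtain w :: "'n pt" and k where w: "w \<in> C_plus" "k > 0" "\<And>\<tau>. k ^ deg \<tau> / fact (deg \<tau>) \<le> cmod (f_fun hb \<tau> w)"
    using f_fun_lower_bound[OF hb, where 'n='n] by blast
  obtain m where m: "(1 / 2 :: real) ^ m < \<epsilon> / 2" using e real_arch_pow_inv[of "\<epsilon>/2" "1/2"] by auto
  obtain c where c: "c > 0" "\<And>d. (1 / k) ^ d \<le> c * fact d powr 1" using power_le_fact_powr[of "1/k" 1] w(2) by auto
  let ?q = "1 / 2 ^ m :: real"
  let ?N = "snorm_delta hb m 0 w"
  have "cmod (a \<rho>) \<le> c powr ?q * enn2real (?N a) * fact (deg \<rho>) powr \<epsilon>" if fin: "?N a < \<infinity>" for a and \<rho> :: "'n triple"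
  proof -
    let ?d = "deg \<rho>"
    have "ennreal ((k ^ ?d / fact ?d) * cmod (a \<rho>) ^ 2 ^ m) = ennreal (k ^ ?d / fact ?d) * ennreal (cmod (a \<rho>) ^ 2 ^ m)"
      using w(2) by (intro ennreal_mult) auto
    also have "\<dots> \<le> ennreal (cmod (f_fun hb \<rho> w)) * h_fun hb m 0 \<rho> a"
      using w(3) h_fun_lower[OF hb] by (intro mult_mono ennreal_leI) auto
    also have "\<dots> \<le> (\<Sum>\<^sub>\<infinity>\<rho>. ennreal (cmod (f_fun hb \<rho> w)) * h_fun hb m 0 \<rho> a)"
      by (rule infsum_ennreal_ge)
    finally have "(k ^ ?d / fact ?d) powr ?q * cmod (a \<rho>) \<le> enn2real (?N a)"
      using fin w(2) unfolding snorm_delta_def by (intro ennroot_lower) auto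
    then have "cmod (a \<rho>) \<le> (fact ?d * (1 / k) ^ ?d) powr ?q * enn2real (?N a)"
    proof -
      assume le: "(k ^ ?d / fact ?d) powr ?q * cmod (a \<rho>) \<le> enn2real (?N a)"
      have "(fact ?d * (1 / k) ^ ?d) powr ?q * (k ^ ?d / fact ?d) powr ?q = 1"
        using w(2) by (simp add: powr_mult[symmetric] power_divide)
      then have "cmod (a \<rho>) = (fact ?d * (1 / k) ^ ?d) powr ?q * ((k ^ ?d / fact ?d) powr ?q * cmod (a \<rho>))"
        by (metis mult.assoc mult_1)
      also have "\<dots> \<le> (fact ?d * (1 / k) ^ ?d) powr ?q * enn2real (?N a)" by (intro mult_left_mono le) auto
      finally show ?thesis .
    qed
    also have "\<dots> \<le> (c * fact ?d powr 2) powr ?q * enn2real (?N a)"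
    proof (intro mult_right_mono powr_mono2)
      have "fact ?d * (1 / k) ^ ?d \<le> fact ?d * (c * fact ?d powr 1)" using c(2) by (intro mult_left_mono) auto
      then show "fact ?d * (1 / k) ^ ?d \<le> c * fact ?d powr 2" by (simp add: powr_numeral power2_eq_square mult_ac)
    qed (use w(2) in auto)
    also have "\<dots> = c powr ?q * enn2real (?N a) * fact ?d powr (2 * ?q)"
      unfolding powr_powr[symmetric] using c(1) by (simp add: powr_mult)
    also have "\<dots> \<le> c powr ?q * enn2real (?N a) * fact ?d powr \<epsilon>"
      using m by (intro mult_left_mono powr_mono) (auto simp: power_divide fact_ge_1)
    finally show ?thesis .
  qed
  moreover have "?N \<in> snorms hb"
    unfolding snorms_def using w(1) by (intro UnI2 CollectI exI[of _ m] exI[of _ 0] exI[of _ w] conjI) auto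
  ultimately show ?thesis using c(1) by (intro bexI[of _ ?N] exI[of _ "c powr ?q"]) auto
qed

lemma A_hat_eq:
  assumes hb: "hb \<noteq> 0"
  shows "(A_hat hb :: ('n::finite triple \<Rightarrow> complex) set) = subfactorial_growth"
proof (intro equalityI subsetI)
  fix a :: "'n triple \<Rightarrow> complex" assume a: "a \<in> A_hat hb"
  show "a \<in> subfactorial_growth"
  proof (rule subfactorial_growthI)
    fix \<epsilon> :: real assume "\<epsilon> > 0"
    then obtain N C where N: "N \<in> snorms hb" "C > 0"
      "\<And>a :: 'n triple \<Rightarrow> complex. N a < \<infinity> \<Longrightarrow> (\<forall>\<rho>. cmod (a \<rho>) \<le> C * enn2real (N a) * fact (deg \<rho>) powr \<epsilon>)"
      using snorms_lower[OF hb, of \<epsilon>, where 'n='n] by blast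
    have "N a < \<infinity>" using a N(1) by (simp add: A_hat_def)
    then show "\<exists>c. \<forall>\<tau>. cmod (a \<tau>) \<le> c * fact (deg \<tau>) powr \<epsilon>" using N(3) by blast
  qed
next
  fix a :: "'n triple \<Rightarrow> complex" assume a: "a \<in> subfactorial_growth"
  show "a \<in> A_hat hb" unfolding A_hat_def
  proof (intro CollectI ballI)
    fix N :: "('n triple \<Rightarrow> complex) \<Rightarrow> ennreal" assume N: "N \<in> snorms hb"
    show "N a < \<infinity>" using snorms_upper[OF hb N] a by blast
  qed
qed

section \<open>The Koethe space of sub-factorial growth\<close>

text \<open>
  Growth of a smaller order is negligible in high degrees, already by the factor \<open>2 ^ deg \<tau>\<close>.
\<close>

lemma subfactorial_tail:
  fixes X :: "'n::finite triple \<Rightarrow> complex"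
  assumes "\<And>\<tau>. cmod (X \<tau>) \<le> L * fact (deg \<tau>) powr \<delta>" "\<delta> < \<epsilon>" "e > 0"
  shows "\<exists>d. \<forall>\<tau>. d < deg \<tau> \<longrightarrow> cmod (X \<tau>) \<le> e * fact (deg \<tau>) powr \<epsilon>"
proof -
  obtain c where c: "c > 0" "\<And>d. 2 ^ d \<le> c * fact d powr (\<epsilon> - \<delta>)"
    using power_le_fact_powr[of 2 "\<epsilon> - \<delta>"] assms(2) by auto
  obtain d where d: "(\<bar>L\<bar> + 1) * c / e < 2 ^ d" using real_arch_pow[of 2] by auto
  have "cmod (X \<tau>) \<le> e * fact (deg \<tau>) powr \<epsilon>" if "d < deg \<tau>" for \<tau>
  proof -
    have "(2::real) ^ d \<le> 2 ^ deg \<tau>" using that by (intro power_increasing) auto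
    then have "(\<bar>L\<bar> + 1) * c / e \<le> c * fact (deg \<tau>) powr (\<epsilon> - \<delta>)" using d c(2)[of "deg \<tau>"] by linarith
    then have "(\<bar>L\<bar> + 1) * c \<le> c * (e * fact (deg \<tau>) powr (\<epsilon> - \<delta>))" using assms(3) by (simp add: divide_le_eq mult_ac)
    then have L: "\<bar>L\<bar> + 1 \<le> e * fact (deg \<tau>) powr (\<epsilon> - \<delta>)" using c(1) by (simp add: mult.commute)
    have "cmod (X \<tau>) \<le> (e * fact (deg \<tau>) powr (\<epsilon> - \<delta>)) * fact (deg \<tau>) powr \<delta>"
      using L by (intro order_trans[OF assms(1) mult_right_mono]) auto
    also have "\<dots> = e * fact (deg \<tau>) powr \<epsilon>" by (simp flip: powr_add)
    finally show ?thesis .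
  qed
  then show ?thesis by blast
qed

text \<open>
  This is stated for one norm because the Banach spaces in the definition of strong nuclearity are completions
  with respect to a single seminorm.
\<close>

lemma subfactorial_cauchy_limit:
  fixes s :: "nat \<Rightarrow> 'n::finite triple \<Rightarrow> complex"
  assumes s: "\<And>j. s j \<in> subfactorial_growth" and e0: "\<epsilon> > 0"
    and cauchy: "\<And>e. e > 0 \<Longrightarrow> \<exists>N. \<forall>i\<ge>N. \<forall>j\<ge>N. subfactorial_norm \<epsilon> (s i - s j) < e"
  shows "\<And>\<tau>. (\<lambda>j. s j \<tau>) \<longlonglongrightarrow> lim (\<lambda>j. s j \<tau>)"
    and "\<And>e. e > 0 \<Longrightarrow> \<exists>N. \<forall>i\<ge>N. \<forall>\<tau>. cmod (s i \<tau> - lim (\<lambda>j. s j \<tau>)) \<le> e * fact (deg \<tau>) powr \<epsilon>"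
proof -
  have pt: "cmod (s i \<tau> - s j \<tau>) \<le> subfactorial_norm \<epsilon> (s i - s j) * fact (deg \<tau>) powr \<epsilon>" for i j \<tau>
    using norm_le_subfactorial_norm[OF cfun.subspace_diff[OF subfactorial_subspace s s] e0, of i j \<tau>]
    by (simp add: pointwise)
  show lim: "(\<lambda>j. s j \<tau>) \<longlonglongrightarrow> lim (\<lambda>j. s j \<tau>)" for \<tau>
  proof -
    have "Cauchy (\<lambda>j. s j \<tau>)"
    proof (rule CauchyI)
      fix e :: real assume e: "e > 0"
      then have "e / fact (deg \<tau>) powr \<epsilon> > 0" by simp
      then obtain N where N: "\<forall>i\<ge>N. \<forall>j\<ge>N. subfactorial_norm \<epsilon> (s i - s j) < e / fact (deg \<tau>) powr \<epsilon>"
        using cauchy by blast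
      have "cmod (s i \<tau> - s j \<tau>) < e" if "i \<ge> N" "j \<ge> N" for i j
      proof -
        have "subfactorial_norm \<epsilon> (s i - s j) * fact (deg \<tau>) powr \<epsilon> < e"
          using N that by (simp add: less_divide_eq)
        then show ?thesis using pt[of i \<tau> j] by linarith
      qed
      then show "\<exists>M. \<forall>m\<ge>M. \<forall>n\<ge>M. norm (s m \<tau> - s n \<tau>) < e" by blast
    qed
    then show ?thesis by (simp add: Cauchy_convergent_iff convergent_LIMSEQ_iff)
  qed
  fix e :: real assume e: "e > 0"
  obtain N where N: "\<forall>i\<ge>N. \<forall>j\<ge>N. subfactorial_norm \<epsilon> (s i - s j) < e" using cauchy[OF e] by blast
  have "cmod (s i \<tau> - lim (\<lambda>j. s j \<tau>)) \<le> e * fact (deg \<tau>) powr \<epsilon>" if i: "i \<ge> N" for i \<tau>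
  proof (rule LIMSEQ_le_const2)
    show "(\<lambda>j. cmod (s i \<tau> - s j \<tau>)) \<longlonglongrightarrow> cmod (s i \<tau> - lim (\<lambda>j. s j \<tau>))"
      by (intro tendsto_intros lim)
    have "cmod (s i \<tau> - s j \<tau>) \<le> e * fact (deg \<tau>) powr \<epsilon>" if j: "j \<ge> N" for j
    proof -
      have "subfactorial_norm \<epsilon> (s i - s j) * fact (deg \<tau>) powr \<epsilon> \<le> e * fact (deg \<tau>) powr \<epsilon>"
        using N i j by (intro mult_right_mono) (auto intro: less_imp_le)
      then show ?thesis using pt[of i \<tau> j] by linarith
    qed
    then show "\<exists>N. \<forall>n\<ge>N. cmod (s i \<tau> - s n \<tau>) \<le> e * fact (deg \<tau>) powr \<epsilon>" by blast
  qed
  then show "\<exists>N. \<forall>i\<ge>N. \<forall>\<tau>. cmod (s i \<tau> - lim (\<lambda>j. s j \<tau>)) \<le> e * fact (deg \<tau>) powr \<epsilon>" by blast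
qed

abbreviation koethe_norms :: "(('n::finite triple \<Rightarrow> complex) \<Rightarrow> real) set" where
  "koethe_norms \<equiv> subfactorial_norm ` {0<..<1}"

lemma koethe_separates:
  assumes "a \<in> subfactorial_growth" "subfactorial_norm (1/2) a = 0"
  shows "a = 0"
  using norm_le_subfactorial_norm[OF assms(1), of "1/2"] assms(2)
  by (auto simp: fun_eq_iff pointwise)

lemma half_in_koethe: "subfactorial_norm (1/2) \<in> koethe_norms"
  by (rule imageI) simp

text \<open>
  The index starts at \<open>1/2\<close> in order to stay below 1.
\<close>

lemma koethe_countable_family:
  "koethe_top = seminorm_topology subfactorial_growth (range (\<lambda>k. subfactorial_norm (1 / real (k + 2))))"
  unfolding koethe_top_def
proof (rule seminorm_topology_eqI[OF subfactorial_subspace])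
  fix p :: "('a triple \<Rightarrow> complex) \<Rightarrow> real" assume "p \<in> koethe_norms"
  then obtain \<epsilon> where e: "p = subfactorial_norm \<epsilon>" "0 < \<epsilon>" by auto
  obtain k where "1 / real (Suc k) < \<epsilon>" using nat_approx_posE[OF e(2)] by blast
  moreover have "1 / real (k + 2) \<le> 1 / real (Suc k)" by (simp add: frac_le)
  ultimately have "1 / real (k + 2) \<le> \<epsilon>" by linarith
  then have "\<forall>a\<in>subfactorial_growth. p a \<le> 1 * subfactorial_norm (1 / real (k + 2)) a"
    unfolding e by (auto intro!: subfactorial_norm_antimono)
  then show "\<exists>q\<in>range (\<lambda>k. subfactorial_norm (1 / real (k + 2))). \<exists>C>0. \<forall>a\<in>subfactorial_growth. p a \<le> C * q a"
    by (intro bexI[of _ "subfactorial_norm (1 / real (k + 2))"] exI[of _ 1]) auto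
next
  fix p :: "('a triple \<Rightarrow> complex) \<Rightarrow> real" assume "p \<in> range (\<lambda>k. subfactorial_norm (1 / real (k + 2)))"
  then have "p \<in> koethe_norms" by auto
  then show "\<exists>q\<in>koethe_norms. \<exists>C>0. \<forall>a\<in>subfactorial_growth. p a \<le> C * q a"
    by (intro bexI[of _ p] exI[of _ 1]) auto
qed

text \<open>
  The limit is taken coefficientwise; uniform closeness in the weight of \<open>\<epsilon>\<close> then gives the growth of the limit and
  convergence in the norm at the same time.
\<close>

lemma koethe_complete:
  fixes s :: "nat \<Rightarrow> 'n::finite triple \<Rightarrow> complex"
  assumes "lc_cauchy subfactorial_growth koethe_top s"
  shows "\<exists>a. limitin koethe_top s a sequentially"
proof -
  interpret K: seminormed_space subfactorial_growth "koethe_norms :: (('n triple \<Rightarrow> complex) \<Rightarrow> real) set"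
    by (rule koethe_seminormed)
  have s: "s j \<in> subfactorial_growth" for j using assms by (simp add: lc_cauchy_def)
  have cauchy: "\<exists>N. \<forall>i\<ge>N. \<forall>j\<ge>N. subfactorial_norm \<epsilon> (s i - s j) < e" if "\<epsilon> \<in> {0<..<1}" "e > 0" for \<epsilon> e
    using K.continuous_seminorm_member[of "subfactorial_norm \<epsilon>" 1] assms that
    unfolding lc_cauchy_def koethe_top_def by (simp add: imageI)
  define a where "a = (\<lambda>\<tau>. lim (\<lambda>j. s j \<tau>))"
  have close: "\<exists>N. \<forall>i\<ge>N. \<forall>\<tau>. cmod (s i \<tau> - a \<tau>) \<le> e * fact (deg \<tau>) powr \<epsilon>" if "\<epsilon> \<in> {0<..<1}" "e > 0" for \<epsilon> e
    unfolding a_def using subfactorial_cauchy_limit(2)[OF s _ cauchy, of \<epsilon> e] that by auto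
  have "a \<in> subfactorial_growth"
  proof (rule subfactorial_growthI)
    fix \<epsilon> :: real assume e: "\<epsilon> > 0"
    define \<eta> where "\<eta> = min \<epsilon> (1/2)"
    have \<eta>: "\<eta> \<in> {0<..<1}" "0 < \<eta>" "\<eta> \<le> \<epsilon>" using e by (auto simp: \<eta>_def)
    obtain N where N: "\<forall>i\<ge>N. \<forall>\<tau>. cmod (s i \<tau> - a \<tau>) \<le> 1 * fact (deg \<tau>) powr \<eta>" using close[OF \<eta>(1), of 1] by auto
    have "cmod (a \<tau>) \<le> (subfactorial_norm \<eta> (s N) + 1) * fact (deg \<tau>) powr \<epsilon>" for \<tau>
    proof -
      have "cmod (a \<tau>) \<le> cmod (s N \<tau>) + cmod (s N \<tau> - a \<tau>)" by (metis norm_minus_commute norm_triangle_sub)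
      also have "\<dots> \<le> (subfactorial_norm \<eta> (s N) + 1) * fact (deg \<tau>) powr \<eta>"
        using norm_le_subfactorial_norm[OF s \<eta>(2), of N \<tau>] N by (simp add: distrib_right add_mono)
      also have "\<dots> \<le> (subfactorial_norm \<eta> (s N) + 1) * fact (deg \<tau>) powr \<epsilon>"
        using \<eta> subfactorial_norm_nonneg[OF s \<eta>(2), of N] by (intro mult_left_mono powr_mono) (auto simp: fact_ge_1)
      finally show ?thesis .
    qed
    then show "\<exists>c. \<forall>\<tau>. cmod (a \<tau>) \<le> c * fact (deg \<tau>) powr \<epsilon>" by blast
  qed
  moreover have "\<forall>\<^sub>F i in sequentially. s i \<in> subfactorial_growth \<and> p (s i - a) < e" if p: "p \<in> koethe_norms" "e > 0" for p e
  proof -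
    obtain \<epsilon> where \<epsilon>: "p = subfactorial_norm \<epsilon>" "\<epsilon> \<in> {0<..<1}" using p by auto
    obtain N where N: "\<forall>i\<ge>N. \<forall>\<tau>. cmod (s i \<tau> - a \<tau>) \<le> e / 2 * fact (deg \<tau>) powr \<epsilon>"
      using close[OF \<epsilon>(2), of "e / 2"] p(2) by auto
    have "p (s i - a) \<le> e / 2" if "i \<ge> N" for i
      unfolding \<epsilon>(1) using N that by (intro subfactorial_norm_le) (simp add: pointwise)
    then show ?thesis using s p(2) by (intro eventually_sequentiallyI[of N]) fastforce
  qed
  ultimately have "limitin koethe_top s a sequentially"
    unfolding koethe_top_def K.limitin_iff by blast
  then show ?thesis by blast
qed

lemma koethe_Hausdorff: "Hausdorff_space (koethe_top :: ('n::finite triple \<Rightarrow> complex) topology)"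
proof -
  interpret K: seminormed_space subfactorial_growth "koethe_norms :: (('n triple \<Rightarrow> complex) \<Rightarrow> real) set"
    by (rule koethe_seminormed)
  show ?thesis unfolding koethe_top_def
    using half_in_koethe by (intro K.Hausdorff) (blast intro: koethe_separates)
qed

lemma koethe_frechet: "frechet_space subfactorial_growth (koethe_top :: ('n::finite triple \<Rightarrow> complex) topology)"
proof -
  have "\<exists>P. countable P \<and> (\<forall>p\<in>P. seminorm_on subfactorial_growth p) \<and>
      (koethe_top :: ('n triple \<Rightarrow> complex) topology) = seminorm_topology subfactorial_growth P"
    by (intro exI[of _ "range (\<lambda>k. subfactorial_norm (1 / real (k + 2)))"] conjI koethe_countable_family)
       (auto intro!: subfactorial_seminorm)
  then show ?thesis
    unfolding frechet_space_def using subfactorial_subspace koethe_Hausdorff koethe_complete by blast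
qed

lemma coeff_mul_koethe_bound:
  assumes "p \<in> koethe_norms"
  shows "\<exists>q\<in>koethe_norms. \<exists>C>0. \<forall>a\<in>subfactorial_growth. \<forall>b\<in>subfactorial_growth.
    p (coeff_mul a b) \<le> C * q a * q (b :: 'n::finite triple \<Rightarrow> complex)"
proof -
  obtain \<epsilon> where e: "p = subfactorial_norm \<epsilon>" "0 < \<epsilon>" "\<epsilon> < 1" using assms by auto
  obtain C where C: "C > 0" "\<forall>a\<in>subfactorial_growth. \<forall>b\<in>subfactorial_growth.
      \<forall>\<rho> :: 'n triple. cmod (coeff_mul a b \<rho>) \<le> C * subfactorial_norm (\<epsilon>/3) a * subfactorial_norm (\<epsilon>/3) b * fact (deg \<rho>) powr \<epsilon>"
    using coeff_mul_norm_bound[OF e(2)] by blast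
  show ?thesis
  proof (intro bexI[of _ "subfactorial_norm (\<epsilon>/3)"] exI[of _ C] conjI ballI)
    show "p (coeff_mul a b) \<le> C * subfactorial_norm (\<epsilon>/3) a * subfactorial_norm (\<epsilon>/3) b"
      if "a \<in> subfactorial_growth" "b \<in> subfactorial_growth" for a b :: "'n triple \<Rightarrow> complex"
      unfolding e using C(2) that by (intro subfactorial_norm_le) blast
  qed (use C e in auto)
qed

lemma coeff_mul_add: "coeff_mul (a + a') b = coeff_mul a b + coeff_mul a' b" "coeff_mul b (a + a') = coeff_mul b a + coeff_mul b a'"
  using coeff_mul_left[of 1 a a' b] coeff_mul_right[of b 1 a a'] by simp_all

lemma coeff_mul_scale: "coeff_mul (cscale k a) b = cscale k (coeff_mul a b)" "coeff_mul b (cscale k a) = cscale k (coeff_mul b a)"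
proof -
  have "coeff_mul 0 b = 0" "coeff_mul b 0 = 0" by (simp_all add: fun_eq_iff coeff_mul_def pointwise)
  then show "coeff_mul (cscale k a) b = cscale k (coeff_mul a b)" "coeff_mul b (cscale k a) = cscale k (coeff_mul b a)"
    using coeff_mul_left[of k a 0 b] coeff_mul_right[of b k a 0] by simp_all
qed

lemma coeff_mul_algebra: "algebra_product subfactorial_growth (coeff_mul :: ('n::finite triple \<Rightarrow> complex) \<Rightarrow> _)"
  unfolding algebra_product_def linear_map_on_def
  by (simp add: coeff_mul_add coeff_mul_scale coeff_mul_assoc coeff_mul_subfactorial)

lemma koethe_algebra: "locally_convex_algebra subfactorial_growth koethe_top (coeff_mul :: ('n::finite triple \<Rightarrow> complex) \<Rightarrow> _)"
proof -
  interpret K: seminormed_space subfactorial_growth "koethe_norms :: (('n triple \<Rightarrow> complex) \<Rightarrow> real) set"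
    by (rule koethe_seminormed)
  show ?thesis
    unfolding locally_convex_algebra_def locally_convex_space_def koethe_top_def
    using K.continuous_map_bilinear[OF coeff_mul_algebra coeff_mul_koethe_bound] K.seminorm subfactorial_subspace coeff_mul_algebra
    by blast
qed

lemma A_hat_top_eq:
  assumes hb: "hb \<noteq> 0"
  shows "A_hat_top hb = (koethe_top :: ('n::finite triple \<Rightarrow> complex) topology)"
  unfolding A_hat_top_def A_hat_eq[OF hb] koethe_top_def
proof (rule seminorm_topology_eqI[OF subfactorial_subspace])
  fix p :: "('n triple \<Rightarrow> complex) \<Rightarrow> real" assume "p \<in> (\<lambda>N a. enn2real (N a)) ` snorms hb"
  then obtain N where N: "p = (\<lambda>a. enn2real (N a))" "N \<in> snorms hb" by blast
  obtain \<epsilon> C where "\<epsilon> \<in> {0<..<1}" "C > 0" "\<forall>a\<in>subfactorial_growth. N a < \<infinity> \<and> enn2real (N a) \<le> C * subfactorial_norm \<epsilon> a"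
    using snorms_upper[OF hb N(2)] by blast
  then show "\<exists>q\<in>koethe_norms. \<exists>C>0. \<forall>a\<in>subfactorial_growth. p a \<le> C * q a"
    unfolding N by (intro bexI[of _ "subfactorial_norm \<epsilon>"] exI[of _ C]) auto
next
  fix p :: "('n triple \<Rightarrow> complex) \<Rightarrow> real" assume "p \<in> koethe_norms"
  then obtain \<epsilon> where e: "p = subfactorial_norm \<epsilon>" "0 < \<epsilon>" by auto
  obtain N C where N: "N \<in> snorms hb" "C > 0" "\<And>a :: 'n triple \<Rightarrow> complex. N a < \<infinity> \<Longrightarrow>
     (\<forall>\<rho>. cmod (a \<rho>) \<le> C * enn2real (N a) * fact (deg \<rho>) powr \<epsilon>)"
    using snorms_lower[OF hb e(2), where 'n='n] by blast
  have "p a \<le> C * enn2real (N a)" if "a \<in> subfactorial_growth" for a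
  proof -
    have "N a < \<infinity>" using that N(1) unfolding A_hat_eq[OF hb, symmetric] A_hat_def by blast
    then show ?thesis unfolding e using N(3) by (intro subfactorial_norm_le) blast
  qed
  then show "\<exists>q\<in>(\<lambda>N a. enn2real (N a)) ` snorms hb. \<exists>C>0. \<forall>a\<in>subfactorial_growth. p a \<le> C * q a"
    using N by (intro bexI[of _ "\<lambda>a. enn2real (N a)"] exI[of _ C]) auto
qed

section \<open>The algebra on the cone\<close>

text \<open>
  The norms of the Koethe space, read on functions. They define the topology of the algebra (\<open>A_top_eq\<close>),
  which makes \<open>f_coeff\<close> a topological embedding.
\<close>

definition cone_norms :: "complex \<Rightarrow> (('n::finite pt \<Rightarrow> complex) \<Rightarrow> real) set" where
  "cone_norms hb = (\<lambda>p a. p (f_coeff hb a)) ` koethe_norms"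

lemma A_space_cases:
  assumes "hb \<noteq> 0" "x \<in> A_space hb"
  obtains a where "a \<in> finsupp" "x = lincomb (f_fun hb) a" "f_coeff hb x = a"
  using lincomb_f_coeff[OF assms] by metis

lemma A_space_subspace: "cfun.subspace (A_space hb)"
  unfolding A_space_def by (rule cfun.subspace_span)

lemma
  assumes hb: "hb \<noteq> 0" and x: "x \<in> A_space hb"
  shows f_coeff_scale: "f_coeff hb (cscale c x) = cscale c (f_coeff hb x)"
    and f_coeff_add: "y \<in> A_space hb \<Longrightarrow> f_coeff hb (x + y) = f_coeff hb x + f_coeff hb y"
proof -
  obtain a where a: "a \<in> finsupp" "x = lincomb (f_fun hb) a" "f_coeff hb x = a" using A_space_cases[OF hb x] .
  show "f_coeff hb (cscale c x) = cscale c (f_coeff hb x)"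
    using f_coeff_lincomb[OF hb finsupp_scale[OF a(1)], of c] a by (simp add: lincomb_scale)
  assume y: "y \<in> A_space hb"
  obtain b where b: "b \<in> finsupp" "y = lincomb (f_fun hb) b" "f_coeff hb y = b" using A_space_cases[OF hb y] .
  show "f_coeff hb (x + y) = f_coeff hb x + f_coeff hb y"
    using f_coeff_lincomb[OF hb finsupp_add[OF a(1) b(1)]] a b by (simp add: lincomb_add)
qed

lemma f_coeff_subfactorial: "hb \<noteq> 0 \<Longrightarrow> x \<in> A_space hb \<Longrightarrow> f_coeff hb x \<in> subfactorial_growth"
  using lincomb_f_coeff(1) finsupp_subfactorial by blast

lemma cone_seminormed:
  assumes hb: "hb \<noteq> 0"
  shows "seminormed_space (A_space hb) (cone_norms hb :: (('n::finite pt \<Rightarrow> complex) \<Rightarrow> real) set)"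
proof -
  interpret K: seminormed_space subfactorial_growth "koethe_norms :: (('n triple \<Rightarrow> complex) \<Rightarrow> real) set"
    by (rule koethe_seminormed)
  note co = f_coeff_subfactorial[OF hb]
  show ?thesis
  proof
    fix p assume "p \<in> (cone_norms hb :: (('n pt \<Rightarrow> complex) \<Rightarrow> real) set)"
    then obtain p' where p: "p' \<in> koethe_norms" "p = (\<lambda>a. p' (f_coeff hb a))" by (auto simp: cone_norms_def)
    show "seminorm_on (A_space hb) p"
      unfolding seminorm_on_def p(2)
    proof (intro conjI ballI allI)
      fix x y :: "'n pt \<Rightarrow> complex" and c assume x: "x \<in> A_space hb"
      show "0 \<le> p' (f_coeff hb x)" by (rule K.nonneg[OF p(1) co[OF x]])
      show "p' (f_coeff hb (cscale c x)) = cmod c * p' (f_coeff hb x)"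
        unfolding f_coeff_scale[OF hb x] by (rule K.scale[OF p(1) co[OF x]])
      assume y: "y \<in> A_space hb"
      show "p' (f_coeff hb (x + y)) \<le> p' (f_coeff hb x) + p' (f_coeff hb y)"
        unfolding f_coeff_add[OF hb x y] by (rule K.triangle[OF p(1) co[OF x] co[OF y]])
    qed
  next
    fix p q assume "p \<in> (cone_norms hb :: (('n pt \<Rightarrow> complex) \<Rightarrow> real) set)" "q \<in> (cone_norms hb :: (('n pt \<Rightarrow> complex) \<Rightarrow> real) set)"
    then obtain p' q' where p: "p' \<in> koethe_norms" "p = (\<lambda>a. p' (f_coeff hb a))" and q: "q' \<in> koethe_norms" "q = (\<lambda>a. q' (f_coeff hb a))"
      by (auto simp: cone_norms_def)
    obtain r where r: "r \<in> koethe_norms" "\<forall>a\<in>subfactorial_growth. p' a \<le> r a \<and> q' a \<le> r a"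
      using K.directed[OF p(1) q(1)] by blast
    show "\<exists>r\<in>cone_norms hb. \<forall>a\<in>A_space hb. p a \<le> r a \<and> q a \<le> r a"
      unfolding p q cone_norms_def using r co by (intro bexI[of _ "\<lambda>a. r (f_coeff hb a)"] imageI) auto
  next
    show "cone_norms hb \<noteq> ({} :: (('n pt \<Rightarrow> complex) \<Rightarrow> real) set)" using K.nonempty by (simp add: cone_norms_def)
  qed (rule A_space_subspace)
qed

lemma A_top_eq:
  assumes hb: "hb \<noteq> 0"
  shows "A_top hb = seminorm_topology (A_space hb) (cone_norms hb :: (('n::finite pt \<Rightarrow> complex) \<Rightarrow> real) set)"
  unfolding A_top_def
proof (rule seminorm_topology_eqI[OF A_space_subspace])
  note co = f_coeff_subfactorial[OF hb]
  fix p :: "('n pt \<Rightarrow> complex) \<Rightarrow> real" assume "p \<in> (\<lambda>N a. enn2real (N (f_coeff hb a))) ` snorms hb"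
  then obtain N where N: "p = (\<lambda>a. enn2real (N (f_coeff hb a)))" "N \<in> snorms hb" by blast
  obtain \<epsilon> C where e: "\<epsilon> \<in> {0<..<1}" "C > 0" "\<forall>a\<in>subfactorial_growth. N a < \<infinity> \<and> enn2real (N a) \<le> C * subfactorial_norm \<epsilon> a"
    using snorms_upper[OF hb N(2)] by blast
  show "\<exists>q\<in>cone_norms hb. \<exists>C>0. \<forall>a\<in>A_space hb. p a \<le> C * q a"
    unfolding N cone_norms_def using e co by (intro bexI[of _ "\<lambda>a. subfactorial_norm \<epsilon> (f_coeff hb a)"] exI[of _ C]) auto
next
  note co = f_coeff_subfactorial[OF hb]
  fix p :: "('n pt \<Rightarrow> complex) \<Rightarrow> real" assume "p \<in> cone_norms hb"
  then obtain \<epsilon> where e: "p = (\<lambda>a. subfactorial_norm \<epsilon> (f_coeff hb a))" "0 < \<epsilon>" by (auto simp: cone_norms_def)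
  obtain N C where N: "N \<in> snorms hb" "C > 0" "\<And>a :: 'n triple \<Rightarrow> complex. N a < \<infinity> \<Longrightarrow>
     (\<forall>\<rho>. cmod (a \<rho>) \<le> C * enn2real (N a) * fact (deg \<rho>) powr \<epsilon>)"
    using snorms_lower[OF hb e(2), where 'n='n] by blast
  have "subfactorial_norm \<epsilon> a \<le> C * enn2real (N a)" if "a \<in> subfactorial_growth" for a
  proof -
    have "N a < \<infinity>" using that N(1) unfolding A_hat_eq[OF hb, symmetric] A_hat_def by blast
    then show ?thesis using N(3) by (intro subfactorial_norm_le) blast
  qed
  then show "\<exists>q\<in>(\<lambda>N a. enn2real (N (f_coeff hb a))) ` snorms hb. \<exists>C>0. \<forall>a\<in>A_space hb. p a \<le> C * q a"
    unfolding e using N co by (intro bexI[of _ "\<lambda>a. enn2real (N (f_coeff hb a))"] exI[of _ C]) auto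
qed

lemma f_coeff_star_tilde:
  assumes hb: "hb \<noteq> 0" and x: "x \<in> A_space hb" and y: "y \<in> A_space hb"
  shows "star_tilde hb x y \<in> A_space hb" "f_coeff hb (star_tilde hb x y) = coeff_mul (f_coeff hb x) (f_coeff hb y)"
proof -
  obtain a where a: "a \<in> finsupp" "x = lincomb (f_fun hb) a" "f_coeff hb x = a" using A_space_cases[OF hb x] .
  obtain b where b: "b \<in> finsupp" "y = lincomb (f_fun hb) b" "f_coeff hb y = b" using A_space_cases[OF hb y] .
  have eq: "star_tilde hb x y = lincomb (f_fun hb) (coeff_mul a b)"
    unfolding a(2) b(2) by (rule star_tilde_lincomb[OF hb a(1) b(1)])
  show "star_tilde hb x y \<in> A_space hb" unfolding eq A_space_eq by (intro imageI coeff_mul_finsupp a b)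
  show "f_coeff hb (star_tilde hb x y) = coeff_mul (f_coeff hb x) (f_coeff hb y)"
    unfolding eq a(3) b(3) by (rule f_coeff_lincomb[OF hb coeff_mul_finsupp[OF a(1) b(1)]])
qed

lemma f_coeff_inj:
  assumes hb: "hb \<noteq> 0" and "x \<in> A_space hb" "y \<in> A_space hb" "f_coeff hb x = f_coeff hb y"
  shows "x = y"
  using assms lincomb_f_coeff(2)[OF hb] by metis

lemma star_tilde_algebra:
  assumes hb: "hb \<noteq> 0"
  shows "algebra_product (A_space hb :: ('n::finite pt \<Rightarrow> complex) set) (star_tilde hb)"
proof -
  note st = f_coeff_star_tilde[OF hb]
  have in_A: "x + y \<in> A_space hb" "cscale c x \<in> A_space hb" if "x \<in> A_space hb" "y \<in> A_space hb" for x y :: "'n pt \<Rightarrow> complex" and c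
    using that A_space_subspace by (auto intro: cfun.subspace_add cfun.subspace_scale)
  show ?thesis
    unfolding algebra_product_def linear_map_on_def
  proof (intro conjI ballI allI)
    fix x y :: "'n pt \<Rightarrow> complex" assume x: "x \<in> A_space hb" and y: "y \<in> A_space hb"
    show "star_tilde hb x y \<in> A_space hb" by (rule st(1)[OF x y])
    fix z :: "'n pt \<Rightarrow> complex" assume z: "z \<in> A_space hb"
    show "star_tilde hb x (y + z) = star_tilde hb x y + star_tilde hb x z"
      using x y z by (intro f_coeff_inj[OF hb]) (simp_all add: st in_A f_coeff_add[OF hb] coeff_mul_add)
    show "star_tilde hb (y + z) x = star_tilde hb y x + star_tilde hb z x"
      using x y z by (intro f_coeff_inj[OF hb]) (simp_all add: st in_A f_coeff_add[OF hb] coeff_mul_add)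
    show "star_tilde hb (star_tilde hb x y) z = star_tilde hb x (star_tilde hb y z)"
      using x y z by (intro f_coeff_inj[OF hb]) (simp_all add: st coeff_mul_assoc)
  next
    fix x y :: "'n pt \<Rightarrow> complex" and c assume x: "x \<in> A_space hb" and y: "y \<in> A_space hb"
    show "star_tilde hb x (cscale c y) = cscale c (star_tilde hb x y)"
      using x y by (intro f_coeff_inj[OF hb]) (simp_all add: st in_A f_coeff_scale[OF hb] coeff_mul_scale)
    show "star_tilde hb (cscale c y) x = cscale c (star_tilde hb y x)"
      using x y by (intro f_coeff_inj[OF hb]) (simp_all add: st in_A f_coeff_scale[OF hb] coeff_mul_scale)
  qed
qed

lemma cone_Hausdorff:
  assumes hb: "hb \<noteq> 0"
  shows "Hausdorff_space (A_top hb :: ('n::finite pt \<Rightarrow> complex) topology)"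
proof -
  interpret A: seminormed_space "A_space hb" "cone_norms hb :: (('n pt \<Rightarrow> complex) \<Rightarrow> real) set"
    by (rule cone_seminormed[OF hb])
  show ?thesis unfolding A_top_eq[OF hb]
  proof (rule A.Hausdorff)
    fix x :: "'n pt \<Rightarrow> complex" assume x: "x \<in> A_space hb" and z: "\<And>p. p \<in> cone_norms hb \<Longrightarrow> p x = 0"
    have "subfactorial_norm (1/2) (f_coeff hb x) = 0"
      using z[of "\<lambda>a. subfactorial_norm (1/2) (f_coeff hb a)"] half_in_koethe by (auto simp: cone_norms_def)
    then have "f_coeff hb x = 0" by (rule koethe_separates[OF f_coeff_subfactorial[OF hb x]])
    then show "x = 0" using lincomb_f_coeff(2)[OF hb x] by simp
  qed
qed

lemma cone_algebra:
  assumes hb: "hb \<noteq> 0"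
  shows "locally_convex_algebra (A_space hb :: ('n::finite pt \<Rightarrow> complex) set) (A_top hb) (star_tilde hb)"
proof -
  interpret A: seminormed_space "A_space hb" "cone_norms hb :: (('n pt \<Rightarrow> complex) \<Rightarrow> real) set"
    by (rule cone_seminormed[OF hb])
  have "\<exists>q\<in>cone_norms hb. \<exists>C>0. \<forall>x\<in>A_space hb. \<forall>y\<in>A_space hb. p (star_tilde hb x y) \<le> C * q x * q y"
    if "p \<in> cone_norms hb" for p :: "('n pt \<Rightarrow> complex) \<Rightarrow> real"
  proof -
    obtain p' where p: "p' \<in> koethe_norms" "p = (\<lambda>a. p' (f_coeff hb a))" using \<open>p \<in> cone_norms hb\<close> by (auto simp: cone_norms_def)
    obtain q C where q: "q \<in> koethe_norms" "C > 0"
      "\<forall>a\<in>subfactorial_growth. \<forall>b\<in>subfactorial_growth. p' (coeff_mul a b) \<le> C * q a * q b"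
      using coeff_mul_koethe_bound[OF p(1)] by blast
    show ?thesis
      unfolding cone_norms_def p using q f_coeff_subfactorial[OF hb]
      by (intro bexI[of _ "\<lambda>a. q (f_coeff hb a)"] exI[of _ C]) (auto simp: f_coeff_star_tilde[OF hb])
  qed
  from A.continuous_map_bilinear[OF star_tilde_algebra[OF hb] this] show ?thesis
    unfolding locally_convex_algebra_def locally_convex_space_def A_top_eq[OF hb]
    using A.seminorm A_space_subspace star_tilde_algebra[OF hb] by blast
qed

section \<open>Evaluation functionals\<close>

lemma evaluate_diff:
  assumes "a \<in> subfactorial_growth" "b \<in> subfactorial_growth"
  shows "evaluate hb w (b - a) = evaluate hb w b - evaluate hb w a"
proof -
  have "b - a = cscale (-1) a + b" by (simp add: fun_eq_iff cscale_def pointwise)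
  then show ?thesis using evaluate_combination[OF assms, of hb w "-1"] by simp
qed

lemma evaluate_continuous: "continuous_map (koethe_top :: ('n::finite triple \<Rightarrow> complex) topology) euclidean (evaluate hb w)"
proof -
  interpret K: seminormed_space subfactorial_growth "koethe_norms :: (('n triple \<Rightarrow> complex) \<Rightarrow> real) set"
    by (rule koethe_seminormed)
  obtain L where L: "L \<ge> 0" "\<And>\<tau>. cmod (f_fun hb \<tau> w) \<le> L ^ deg \<tau> / fact (deg \<tau>)"
    using f_fun_point_bound[of hb w] by blast
  show ?thesis unfolding koethe_top_def
    by (rule K.continuous_map_functional[OF evaluate_diff half_in_koethe evaluate_bound[OF _ L]])
qed

lemma evaluate_f_coeff:
  assumes hb: "hb \<noteq> 0" and x: "x \<in> A_space hb"
  shows "evaluate hb w (f_coeff hb x) = x w"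
  using evaluate_finsupp[OF lincomb_f_coeff(1)[OF hb x]] lincomb_f_coeff(2)[OF hb x] by simp

lemma cone_evaluation_continuous:
  assumes hb: "hb \<noteq> 0"
  shows "continuous_map (A_top hb :: ('n::finite pt \<Rightarrow> complex) topology) euclidean (\<lambda>x. x w)"
proof -
  interpret A: seminormed_space "A_space hb" "cone_norms hb :: (('n pt \<Rightarrow> complex) \<Rightarrow> real) set"
    by (rule cone_seminormed[OF hb])
  obtain L where L: "L \<ge> 0" "\<And>\<tau>. cmod (f_fun hb \<tau> w) \<le> L ^ deg \<tau> / fact (deg \<tau>)"
    using f_fun_point_bound[of hb w] by blast
  show ?thesis unfolding A_top_eq[OF hb]
  proof (rule A.continuous_map_functional)
    show "(\<lambda>x. subfactorial_norm (1/2) (f_coeff hb x)) \<in> cone_norms hb"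
      unfolding cone_norms_def using half_in_koethe by (rule image_eqI[rotated]) simp
    show "cmod (x w) \<le> weight_sum TYPE('n) L * subfactorial_norm (1/2) (f_coeff hb x)" if "x \<in> A_space hb" for x
      using evaluate_bound[OF f_coeff_subfactorial[OF hb that] L] evaluate_f_coeff[OF hb that, of w] by simp
  qed (simp add: pointwise)
qed

lemma truncate_approx:
  fixes a :: "'n::finite triple \<Rightarrow> complex"
  assumes a: "a \<in> subfactorial_growth" and "\<epsilon> > 0" "e > 0"
  shows "\<exists>d. \<forall>n\<ge>d. subfactorial_norm \<epsilon> (truncate n a - a) \<le> e"
proof -
  have "\<exists>d. \<forall>\<tau>. d < deg \<tau> \<longrightarrow> cmod (a \<tau>) \<le> e * fact (deg \<tau>) powr \<epsilon>"
    using subfactorial_tail[OF norm_le_subfactorial_norm[OF a, of "\<epsilon>/2"], of \<epsilon> e] assms by simp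
  then obtain d where d: "\<And>\<tau>. d < deg \<tau> \<Longrightarrow> cmod (a \<tau>) \<le> e * fact (deg \<tau>) powr \<epsilon>" by blast
  have "subfactorial_norm \<epsilon> (truncate n a - a) \<le> e" if "n \<ge> d" for n
  proof (rule subfactorial_norm_le)
    fix \<tau>
    show "cmod ((truncate n a - a) \<tau>) \<le> e * fact (deg \<tau>) powr \<epsilon>"
      using d[of \<tau>] that assms(3) by (auto simp: truncate_def pointwise)
  qed
  then show ?thesis by blast
qed

lemma truncate_subfactorial: "truncate d a \<in> subfactorial_growth"
  using truncate_finsupp finsupp_subfactorial by blast

text \<open>
  On a compact ball inside the cone the evaluations of the truncated series converge uniformly, because the
  bound of \<open>f_fun_bound\<close> is uniform there.
\<close>

lemma evaluate_continuous_point: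
  fixes a :: "'n::finite triple \<Rightarrow> complex"
  assumes a: "a \<in> subfactorial_growth"
  shows "continuous_on C_plus (\<lambda>w. evaluate hb w a)"
  unfolding continuous_on_eq_continuous_at[OF open_C_plus]
proof
  fix w0 :: "'n pt" assume w0: "w0 \<in> C_plus"
  then obtain r where r: "r > 0" "cball w0 r \<subseteq> C_plus"
    using open_C_plus open_contains_cball by blast
  obtain L where L: "L \<ge> 0" "\<forall>w\<in>cball w0 r. \<forall>\<tau>. cmod (f_fun hb \<tau> w) \<le> L ^ deg \<tau> / fact (deg \<tau>)"
    using f_fun_bound[OF compact_cball r(2), of hb] by blast
  let ?W = "weight_sum TYPE('n) L"
  have W: "?W \<ge> 0" unfolding weight_sum_def using L(1) by (intro infsum_nonneg) auto
  have unif: "uniform_limit (cball w0 r) (\<lambda>n w. evaluate hb w (truncate n a)) (\<lambda>w. evaluate hb w a) sequentially"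
  proof (rule uniform_limitI)
    fix e :: real assume e: "e > 0"
    obtain d where d: "\<forall>n\<ge>d. subfactorial_norm (1/2) (truncate n a - a) \<le> e / (2 * (?W + 1))"
      using truncate_approx[OF a, of "1/2" "e / (2 * (?W + 1))"] e W by auto
    have "dist (evaluate hb w (truncate n a)) (evaluate hb w a) < e" if "n \<ge> d" "w \<in> cball w0 r" for n w
    proof -
      have Lw: "cmod (f_fun hb \<tau> w) \<le> L ^ deg \<tau> / fact (deg \<tau>)" for \<tau> using L(2) that(2) by blast
      have sub: "truncate n a - a \<in> subfactorial_growth"
        by (intro cfun.subspace_diff[OF subfactorial_subspace] truncate_subfactorial a)
      have "dist (evaluate hb w (truncate n a)) (evaluate hb w a) = cmod (evaluate hb w (truncate n a - a))"
        by (simp add: dist_norm evaluate_diff[OF a truncate_subfactorial])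
      also have "\<dots> \<le> ?W * subfactorial_norm (1/2) (truncate n a - a)"
        by (rule evaluate_bound[OF sub L(1) Lw])
      also have "\<dots> \<le> ?W * (e / (2 * (?W + 1)))" using d that(1) W by (intro mult_left_mono) auto
      also have "\<dots> < e"
      proof -
        have "?W * e < (2 * (?W + 1)) * e" using e W by (intro mult_strict_right_mono) auto
        then show ?thesis using W by (simp add: divide_less_eq mult_ac)
      qed
      finally show ?thesis .
    qed
    then show "\<forall>\<^sub>F n in sequentially. \<forall>w\<in>cball w0 r. dist (evaluate hb w (truncate n a)) (evaluate hb w a) < e"
      by (intro eventually_sequentiallyI[of d]) blast
  qed
  have "continuous_on (cball w0 r) (\<lambda>w. evaluate hb w (truncate n a))" for n
    unfolding evaluate_finsupp[OF truncate_finsupp] lincomb_def sum_fun_apply cscale_def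
    by (intro continuous_intros continuous_on_subset[OF cont_f_fun r(2)])
  then have "continuous_on (cball w0 r) (\<lambda>w. evaluate hb w a)"
    by (intro uniform_limit_theorem[OF _ unif] always_eventually) auto
  then show "isCont (\<lambda>w. evaluate hb w a) w0"
    using r(1) by (intro continuous_on_interior[of "cball w0 r"]) auto
qed

text \<open>
  Extended by zero outside the cone, as elements of \<open>C0_plus\<close> are.
\<close>

definition sum_function :: "complex \<Rightarrow> ('n::finite triple \<Rightarrow> complex) \<Rightarrow> 'n pt \<Rightarrow> complex" where
  "sum_function hb a = (\<lambda>w. if w \<in> C_plus then evaluate hb w a else 0)"

lemma sum_function_linear: "linear_map_on subfactorial_growth (sum_function hb)"
  unfolding linear_map_on_def
proof (intro conjI ballI allI)
  fix a b :: "'a triple \<Rightarrow> complex" and c assume a: "a \<in> subfactorial_growth"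
  have e0: "evaluate hb w 0 = 0" for w :: "'a pt" by (simp add: evaluate_def pointwise)
  show "sum_function hb (cscale c a) = cscale c (sum_function hb a)"
    using evaluate_combination[OF a subfactorial_zero, of hb _ c]
    by (simp add: fun_eq_iff sum_function_def cscale_def[of c "\<lambda>_. _"] e0) (simp add: cscale_def)
  assume "b \<in> subfactorial_growth"
  then show "sum_function hb (a + b) = sum_function hb a + sum_function hb b"
    using evaluate_combination[OF a, of b hb _ 1] by (simp add: fun_eq_iff sum_function_def pointwise)
qed

lemma sum_function_inj:
  assumes hb: "hb \<noteq> 0"
  shows "inj_on (sum_function hb) subfactorial_growth"
proof (rule inj_onI)
  fix a b :: "'a triple \<Rightarrow> complex"
  assume ab: "a \<in> subfactorial_growth" "b \<in> subfactorial_growth" "sum_function hb a = sum_function hb b"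
  have "b - a = 0"
  proof (rule evaluate_injective[OF hb])
    show "b - a \<in> subfactorial_growth" by (intro cfun.subspace_diff[OF subfactorial_subspace] ab)
    fix w :: "'a pt" assume "w \<in> C_plus"
    then show "evaluate hb w (b - a) = 0"
      using fun_cong[OF ab(3), of w] evaluate_diff[OF ab(1,2), of hb w] by (simp add: sum_function_def)
  qed
  then show "a = b" by simp
qed

lemma sum_function_continuous:
  "continuous_map koethe_top C0_plus_top (sum_function hb :: ('n::finite triple \<Rightarrow> complex) \<Rightarrow> _)"
proof -
  interpret K: seminormed_space subfactorial_growth "koethe_norms :: (('n triple \<Rightarrow> complex) \<Rightarrow> real) set"
    by (rule koethe_seminormed)
  show ?thesis unfolding koethe_top_def C0_plus_top_def
  proof (rule K.continuous_map_linear[OF sum_function_linear])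
    show "sum_function hb ` subfactorial_growth \<subseteq> (C0_plus :: ('n pt \<Rightarrow> complex) set)"
    proof
      fix g :: "'n pt \<Rightarrow> complex" assume "g \<in> sum_function hb ` subfactorial_growth"
      then obtain a where a: "a \<in> subfactorial_growth" "g = sum_function hb a" by blast
      have "continuous_on C_plus g"
        by (rule continuous_on_eq[OF evaluate_continuous_point[OF a(1), of hb]]) (simp add: a(2) sum_function_def)
      then show "g \<in> C0_plus" by (simp add: C0_plus_def a(2) sum_function_def)
    qed
    fix q assume "q \<in> {\<lambda>g :: 'n pt \<Rightarrow> complex. SUP w\<in>K. cmod (g w) | K. compact K \<and> K \<noteq> {} \<and> K \<subseteq> C_plus}"
    then obtain K where K: "q = (\<lambda>g. SUP w\<in>K. cmod (g w))" "compact K" "K \<noteq> {}" "K \<subseteq> (C_plus :: 'n pt set)" by blast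
    obtain L where L: "L \<ge> 0" "\<forall>w\<in>K. \<forall>\<tau>. cmod (f_fun hb \<tau> w) \<le> L ^ deg \<tau> / fact (deg \<tau>)"
      using f_fun_bound[OF K(2,4), of hb] by blast
    let ?C = "weight_sum TYPE('n) L + 1"
    have W: "weight_sum TYPE('n) L \<ge> 0" unfolding weight_sum_def using L(1) by (intro infsum_nonneg) auto
    have "q (sum_function hb a) \<le> ?C * subfactorial_norm (1/2) a" if a: "a \<in> subfactorial_growth" for a
      unfolding K(1)
    proof (rule cSUP_least[OF K(3)])
      fix w assume w: "w \<in> K"
      have "cmod (evaluate hb w a) \<le> weight_sum TYPE('n) L * subfactorial_norm (1/2) a"
        using L(2) w by (intro evaluate_bound[OF a L(1)]) blast
      also have "\<dots> \<le> ?C * subfactorial_norm (1/2) a"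
        using subfactorial_norm_nonneg[OF a, of "1/2"] by (intro mult_right_mono) auto
      finally show "cmod (sum_function hb a w) \<le> ?C * subfactorial_norm (1/2) a"
        using K(4) w by (auto simp: sum_function_def)
    qed
    then show "\<exists>p\<in>koethe_norms. \<exists>C>0. \<forall>a\<in>subfactorial_growth. q (sum_function hb a) \<le> C * p a"
      using W by (intro bexI[OF _ half_in_koethe] exI[of _ ?C]) auto
  qed
qed

section \<open>The completion\<close>

text \<open>
  The image consists of the finitely supported families. On it the inverse is \<open>lincomb\<close>, and it is dense because
  truncations approximate every family of sub-factorial growth.
\<close>

lemma f_coeff_dense_embedding:
  assumes hb: "hb \<noteq> 0"
  shows "dense_embedding (A_space hb :: ('n::finite pt \<Rightarrow> complex) set) (A_top hb) koethe_top (f_coeff hb)"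
proof -
  interpret K: seminormed_space subfactorial_growth "koethe_norms :: (('n triple \<Rightarrow> complex) \<Rightarrow> real) set"
    by (rule koethe_seminormed)
  interpret A: seminormed_space "A_space hb" "cone_norms hb :: (('n pt \<Rightarrow> complex) \<Rightarrow> real) set"
    by (rule cone_seminormed[OF hb])
  interpret F: seminormed_space finsupp "koethe_norms :: (('n triple \<Rightarrow> complex) \<Rightarrow> real) set"
  proof
    fix p :: "('n triple \<Rightarrow> complex) \<Rightarrow> real" assume "p \<in> koethe_norms"
    from K.seminorm[OF this] show "seminorm_on finsupp p"
      using finsupp_subfactorial unfolding seminorm_on_def by blast
  next
    fix p q :: "('n triple \<Rightarrow> complex) \<Rightarrow> real" assume "p \<in> koethe_norms" "q \<in> koethe_norms"
    from K.directed[OF this] show "\<exists>r\<in>koethe_norms. \<forall>a\<in>finsupp. p a \<le> r a \<and> q a \<le> r a"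
      using finsupp_subfactorial by blast
  qed (rule finsupp_subspace, rule K.nonempty)
  let ?A = "A_space hb :: ('n pt \<Rightarrow> complex) set"
  have img: "f_coeff hb ` ?A = finsupp"
  proof (intro equalityI subsetI)
    fix a :: "'n triple \<Rightarrow> complex" assume a: "a \<in> finsupp"
    show "a \<in> f_coeff hb ` ?A"
      using f_coeff_lincomb[OF hb a] a by (intro image_eqI[of _ _ "lincomb (f_fun hb) a"]) (auto simp: A_space_eq)
  qed (auto simp: lincomb_f_coeff[OF hb])
  have lin: "linear_map_on ?A (f_coeff hb)"
    unfolding linear_map_on_def by (simp add: f_coeff_add[OF hb] f_coeff_scale[OF hb])
  have lin': "linear_map_on finsupp (lincomb (f_fun hb :: 'n triple \<Rightarrow> _))"
    unfolding linear_map_on_def by (simp add: lincomb_add lincomb_scale)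
  have "homeomorphic_maps A.T F.T (f_coeff hb) (lincomb (f_fun hb))"
    unfolding homeomorphic_maps_def
  proof (intro conjI ballI)
    show "continuous_map A.T F.T (f_coeff hb)"
    proof (rule A.continuous_map_linear[OF lin])
      show "f_coeff hb ` ?A \<subseteq> finsupp" using img by simp
      fix q :: "('n triple \<Rightarrow> complex) \<Rightarrow> real" assume "q \<in> koethe_norms"
      then show "\<exists>p\<in>cone_norms hb. \<exists>C>0. \<forall>a\<in>?A. q (f_coeff hb a) \<le> C * p a"
        unfolding cone_norms_def by (intro bexI[of _ "\<lambda>a. q (f_coeff hb a)"] exI[of _ 1]) auto
    qed
    show "continuous_map F.T A.T (lincomb (f_fun hb))"
    proof (rule F.continuous_map_linear[OF lin'])
      show "lincomb (f_fun hb) ` finsupp \<subseteq> ?A" by (simp add: A_space_eq)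
      fix q :: "('n pt \<Rightarrow> complex) \<Rightarrow> real" assume "q \<in> cone_norms hb"
      then obtain p where "p \<in> koethe_norms" "q = (\<lambda>a. p (f_coeff hb a))" by (auto simp: cone_norms_def)
      then show "\<exists>p\<in>koethe_norms. \<exists>C>0. \<forall>a\<in>finsupp. q (lincomb (f_fun hb) a) \<le> C * p a"
        by (intro bexI[of _ p] exI[of _ 1]) (auto simp: f_coeff_lincomb[OF hb])
    qed
  qed (auto simp: lincomb_f_coeff[OF hb] f_coeff_lincomb[OF hb])
  then have "embedding_map A.T K.T (f_coeff hb)"
    unfolding embedding_map_def homeomorphic_map_maps using K.subtopology_subspace[OF finsupp_subfactorial] img by auto
  moreover have "K.T closure_of finsupp = topspace K.T"
  proof (intro equalityI subsetI)
    fix a :: "'n triple \<Rightarrow> complex" assume "a \<in> topspace K.T"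
    then have a: "a \<in> subfactorial_growth" by simp
    show "a \<in> K.T closure_of finsupp"
      unfolding in_closure_of
    proof (intro conjI allI impI)
      fix U assume U: "a \<in> U \<and> openin K.T U"
      then obtain p e where p: "p \<in> koethe_norms" "e > 0" "{b\<in>subfactorial_growth. p (b - a) < e} \<subseteq> U"
        unfolding K.openin_iff by meson
      obtain \<epsilon> where \<epsilon>: "p = subfactorial_norm \<epsilon>" "\<epsilon> > 0" using p(1) by auto
      obtain d where "\<forall>n\<ge>d. p (truncate n a - a) \<le> e / 2"
        using truncate_approx[OF a \<epsilon>(2), of "e/2"] p(2) unfolding \<epsilon>(1) by auto
      then have "p (truncate d a - a) \<le> e / 2" by simp
      then have "truncate d a \<in> U" using p truncate_subfactorial[of d a] by auto
      then show "\<exists>y. y \<in> finsupp \<and> y \<in> U" using truncate_finsupp by blast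
    qed (use a in simp)
  qed (metis closure_of_subset_topspace subsetD)
  ultimately show ?thesis
    unfolding dense_embedding_def koethe_top_def A_top_eq[OF hb] img using lin by simp
qed

section \<open>The absolute Schauder basis\<close>

lemma unit_fam_subfactorial: "unit_fam \<tau> \<in> subfactorial_growth"
  by (rule subsetD[OF finsupp_subfactorial unit_fam_finsupp])

lemma unit_fam_norm_le:
  "subfactorial_norm \<epsilon> (unit_fam \<tau>) \<le> 1 / fact (deg \<tau>) powr \<epsilon>"
  by (rule subfactorial_norm_le) (auto simp: unit_fam_def)

lemma sum_unit_fam:
  assumes "finite F"
  shows "(\<Sum>\<tau>\<in>F. cscale (c \<tau>) (unit_fam \<tau>)) \<sigma> = (if \<sigma> \<in> F then c \<sigma> else 0)"
proof -
  have "(\<Sum>\<tau>\<in>F. cscale (c \<tau>) (unit_fam \<tau>)) \<sigma> = (\<Sum>\<tau>\<in>F. if \<sigma> = \<tau> then c \<sigma> else 0)"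
    unfolding sum_fun_apply by (intro sum.cong) (auto simp: cscale_def unit_fam_def)
  then show ?thesis using assms by simp
qed

text \<open>
  Coefficientwise comparison forces \<open>c = a\<close>. Conversely, once \<open>F\<close> contains all triples of degree at most
  \<open>d\<close>, the rest of the series lies in the tail estimated by \<open>subfactorial_tail\<close>.
\<close>

lemma koethe_expansion:
  fixes a :: "'n::finite triple \<Rightarrow> complex"
  assumes a: "a \<in> subfactorial_growth"
  shows "unordered_expansion koethe_top unit_fam c a \<longleftrightarrow> c = a"
proof -
  interpret K: seminormed_space subfactorial_growth "koethe_norms :: (('n triple \<Rightarrow> complex) \<Rightarrow> real) set"
    by (rule koethe_seminormed)
  let ?S = "\<lambda>F. \<Sum>\<tau>\<in>F. cscale (c \<tau>) (unit_fam \<tau>)"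
  have S: "?S F \<in> subfactorial_growth" for F
    by (rule cfun.subspace_sum[OF subfactorial_subspace],
        rule cfun.subspace_scale[OF subfactorial_subspace unit_fam_subfactorial])
  show ?thesis
    unfolding unordered_expansion_def koethe_top_def K.limitin_iff
  proof
    assume R: "a \<in> subfactorial_growth \<and> (\<forall>p\<in>koethe_norms. \<forall>e>0.
       \<forall>\<^sub>F F in finite_subsets_at_top UNIV. ?S F \<in> subfactorial_growth \<and> p (?S F - a) < e)"
    show "c = a"
    proof (rule ext, rule ccontr)
      fix \<tau> assume ne: "c \<tau> \<noteq> a \<tau>"
      define e where "e = cmod (c \<tau> - a \<tau>) / fact (deg \<tau>) powr (1/2)"
      have "e > 0" using ne by (simp add: e_def)
      then have "\<forall>\<^sub>F F in finite_subsets_at_top UNIV. ?S F \<in> subfactorial_growth \<and> subfactorial_norm (1/2) (?S F - a) < e"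
        using R half_in_koethe by blast
      moreover have "\<forall>\<^sub>F F in finite_subsets_at_top UNIV. finite F \<and> \<tau> \<in> F"
        unfolding eventually_finite_subsets_at_top by (intro exI[of _ "{\<tau>}"]) auto
      ultimately have "\<forall>\<^sub>F F in finite_subsets_at_top UNIV. subfactorial_norm (1/2) (?S F - a) < e \<and> finite F \<and> \<tau> \<in> F"
        by eventually_elim blast
      then obtain F where F: "subfactorial_norm (1/2) (?S F - a) < e" "finite F" "\<tau> \<in> F"
        using eventually_happens' finite_subsets_at_top_neq_bot by blast
      have "cmod ((?S F - a) \<tau>) \<le> subfactorial_norm (1/2) (?S F - a) * fact (deg \<tau>) powr (1/2)"
        by (intro norm_le_subfactorial_norm cfun.subspace_diff[OF subfactorial_subspace] S a) simp
      moreover have "(?S F - a) \<tau> = c \<tau> - a \<tau>" using sum_unit_fam[OF F(2), of c \<tau>] F(3) by (simp add: pointwise)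
      moreover have "subfactorial_norm (1/2) (?S F - a) * fact (deg \<tau>) powr (1/2) < e * fact (deg \<tau>) powr (1/2)"
        using F(1) by (intro mult_strict_right_mono) auto
      ultimately show False by (simp add: e_def)
    qed
  next
    assume c: "c = a"
    show "a \<in> subfactorial_growth \<and> (\<forall>p\<in>koethe_norms. \<forall>e>0.
       \<forall>\<^sub>F F in finite_subsets_at_top UNIV. ?S F \<in> subfactorial_growth \<and> p (?S F - a) < e)"
    proof (intro conjI ballI allI impI a)
      fix p :: "('n triple \<Rightarrow> complex) \<Rightarrow> real" and e :: real assume p: "p \<in> koethe_norms" and e: "e > 0"
      obtain \<epsilon> where \<epsilon>: "p = subfactorial_norm \<epsilon>" "\<epsilon> > 0" using p by auto
      have "\<exists>d. \<forall>\<tau>. d < deg \<tau> \<longrightarrow> cmod (a \<tau>) \<le> e / 2 * fact (deg \<tau>) powr \<epsilon>"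
        using subfactorial_tail[OF norm_le_subfactorial_norm[OF a, of "\<epsilon>/2"], of \<epsilon> "e/2"] \<epsilon>(2) e by simp
      then obtain d where d: "\<And>\<tau>. d < deg \<tau> \<Longrightarrow> cmod (a \<tau>) \<le> e / 2 * fact (deg \<tau>) powr \<epsilon>" by blast
      have "p (?S F - a) < e" if F: "finite F" "degs_upto d \<subseteq> F" for F
      proof -
        have "p (?S F - a) \<le> e / 2"
          unfolding \<epsilon>(1)
        proof (rule subfactorial_norm_le)
          fix \<tau>
          have "(?S F - a) \<tau> = (if \<tau> \<in> F then 0 else - a \<tau>)"
            using sum_unit_fam[OF F(1), of c \<tau>] c by (simp add: pointwise)
          moreover have "\<tau> \<notin> F \<Longrightarrow> d < deg \<tau>" using F(2) by (force simp: degs_upto_def)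
          ultimately show "cmod ((?S F - a) \<tau>) \<le> e / 2 * fact (deg \<tau>) powr \<epsilon>"
            using d[of \<tau>] e by auto
        qed
        then show ?thesis using e by simp
      qed
      then show "\<forall>\<^sub>F F in finite_subsets_at_top UNIV. ?S F \<in> subfactorial_growth \<and> p (?S F - a) < e"
        unfolding eventually_finite_subsets_at_top using S card_degs_upto(1)
        by (intro exI[of _ "degs_upto d"]) auto
    qed
  qed
qed

lemma koethe_coeff: "a \<in> subfactorial_growth \<Longrightarrow> schauder_coeff koethe_top unit_fam a = a"
  unfolding schauder_coeff_def by (rule the_equality) (simp_all add: koethe_expansion)

text \<open>
  The unit family at \<open>\<tau>\<close> has norm at most \<open>(deg \<tau>)!\<close> to the power \<open>-\<epsilon>\<close>, and the coefficient costs the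
  power \<open>\<epsilon>/2\<close>; the remaining power \<open>-\<epsilon>/2\<close> is summable.
\<close>

lemma koethe_schauder: "absolute_schauder_basis subfactorial_growth koethe_top (unit_fam :: 'n::finite triple \<Rightarrow> _)"
  unfolding absolute_schauder_basis_def schauder_basis_def
proof (intro conjI allI ballI impI)
  interpret K: seminormed_space subfactorial_growth "koethe_norms :: (('n triple \<Rightarrow> complex) \<Rightarrow> real) set"
    by (rule koethe_seminormed)
  show "unit_fam \<tau> \<in> subfactorial_growth" for \<tau> :: "'n triple"
    by (rule unit_fam_subfactorial)
  show "\<exists>!c. unordered_expansion koethe_top unit_fam c a" if "a \<in> subfactorial_growth" for a :: "'n triple \<Rightarrow> complex"
    using koethe_expansion[OF that] by simp
  show "continuous_map koethe_top euclidean (\<lambda>a. schauder_coeff koethe_top unit_fam a \<tau>)" for \<tau> :: "'n triple"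
  proof (rule continuous_map_eq)
    have "continuous_map K.T euclidean (\<lambda>a. a \<tau>)"
    proof (rule K.continuous_map_functional[OF _ half_in_koethe])
      show "cmod (a \<tau>) \<le> fact (deg \<tau>) powr (1/2) * subfactorial_norm (1/2) a" if "a \<in> subfactorial_growth" for a
        using norm_le_subfactorial_norm[OF that, of "1/2" \<tau>] by (simp add: mult.commute)
    qed (simp add: pointwise)
    then show "continuous_map koethe_top euclidean (\<lambda>a. a \<tau>)" by (simp add: koethe_top_def)
  qed (simp add: koethe_top_def koethe_coeff[unfolded koethe_top_def])
  fix p :: "('n triple \<Rightarrow> complex) \<Rightarrow> real" assume "continuous_seminorm subfactorial_growth koethe_top p"
  then obtain p' C where C: "p' \<in> koethe_norms" "C > 0" "\<forall>a\<in>subfactorial_growth. p a \<le> C * p' a"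
    and sn: "seminorm_on subfactorial_growth p"
    using K.continuous_seminorm_bound[of p] unfolding koethe_top_def continuous_seminorm_def by blast
  obtain \<epsilon> where \<epsilon>: "p' = subfactorial_norm \<epsilon>" "0 < \<epsilon>" "\<epsilon> < 1" using C(1) by auto
  define W where "W = (\<Sum>\<^sub>\<infinity>\<tau> :: 'n triple. 1 ^ deg \<tau> / fact (deg \<tau>) powr (\<epsilon>/2) :: real)"
  define q where "q = (\<lambda>a. (C * W) * subfactorial_norm (\<epsilon>/2) (a :: 'n triple \<Rightarrow> complex))"
  have W: "W \<ge> 0" unfolding W_def by (intro infsum_nonneg) auto
  have "continuous_seminorm subfactorial_growth koethe_top q"
    unfolding q_def koethe_top_def using C(2) W \<epsilon> by (intro K.continuous_seminorm_member) auto
  moreover have "(\<lambda>\<tau>. cmod (schauder_coeff koethe_top unit_fam a \<tau>) * p (unit_fam \<tau>)) summable_on UNIV \<and>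
      (\<Sum>\<^sub>\<infinity>\<tau>. cmod (schauder_coeff koethe_top unit_fam a \<tau>) * p (unit_fam \<tau>)) \<le> q a"
    if a: "a \<in> subfactorial_growth" for a
  proof -
    let ?s = "subfactorial_norm (\<epsilon>/2) a"
    have s: "?s \<ge> 0" using subfactorial_norm_nonneg[OF a] \<epsilon>(2) by simp
    note unit = unit_fam_subfactorial
    have p0: "0 \<le> p (unit_fam \<tau>)" for \<tau> using sn unit[of \<tau>] unfolding seminorm_on_def by blast
    have le: "cmod (a \<tau>) * p (unit_fam \<tau>) \<le> (C * ?s) * (1 ^ deg \<tau> / fact (deg \<tau>) powr (\<epsilon>/2))" for \<tau>
    proof -
      define G where "G = (fact (deg \<tau>) :: real) powr (\<epsilon>/2)"
      have G: "G > 0" "fact (deg \<tau>) powr \<epsilon> = G * G" by (simp_all add: G_def flip: powr_add)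
      have "p (unit_fam \<tau>) \<le> C * p' (unit_fam \<tau>)" using C(3) unit by blast
      also have "\<dots> \<le> C * (1 / fact (deg \<tau>) powr \<epsilon>)"
        unfolding \<epsilon>(1) using C(2) unit_fam_norm_le[of \<epsilon> \<tau>] by (intro mult_left_mono) auto
      finally have "p (unit_fam \<tau>) \<le> C * (1 / (G * G))" unfolding G(2) .
      moreover have "cmod (a \<tau>) \<le> ?s * G" unfolding G_def using norm_le_subfactorial_norm[OF a, of "\<epsilon>/2" \<tau>] \<epsilon>(2) by simp
      ultimately have "cmod (a \<tau>) * p (unit_fam \<tau>) \<le> (?s * G) * (C * (1 / (G * G)))"
        using s G(1) p0 by (intro mult_mono) auto
      also have "\<dots> = (C * ?s) * (1 / G)" using G(1) by (simp add: field_simps)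
      finally show ?thesis by (simp add: G_def)
    qed
    have sum: "(\<lambda>\<tau> :: 'n triple. (C * ?s) * (1 ^ deg \<tau> / fact (deg \<tau>) powr (\<epsilon>/2))) summable_on UNIV"
      using \<epsilon>(2) by (intro summable_on_cmult_right summable_on_power_fact) auto
    have sa: "(\<lambda>\<tau>. cmod (a \<tau>) * p (unit_fam \<tau>)) summable_on UNIV"
      by (rule summable_on_comparison_test[OF sum le]) (simp add: p0)
    have "(\<Sum>\<^sub>\<infinity>\<tau>. cmod (a \<tau>) * p (unit_fam \<tau>)) \<le> (\<Sum>\<^sub>\<infinity>\<tau> :: 'n triple. (C * ?s) * (1 ^ deg \<tau> / fact (deg \<tau>) powr (\<epsilon>/2)))"
      by (rule infsum_mono[OF sa sum le])
    also have "\<dots> = (C * ?s) * W"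
      unfolding W_def using \<epsilon>(2) by (intro infsum_cmult_right summable_on_power_fact) auto
    finally show ?thesis using sa by (simp add: koethe_coeff[OF a] q_def mult_ac)
  qed
  ultimately show "\<exists>q. continuous_seminorm subfactorial_growth koethe_top q \<and>
     (\<forall>a\<in>subfactorial_growth. (\<lambda>\<tau>. cmod (schauder_coeff koethe_top unit_fam a \<tau>) * p (unit_fam \<tau>)) summable_on UNIV \<and>
       (\<Sum>\<^sub>\<infinity>\<tau>. cmod (schauder_coeff koethe_top unit_fam a \<tau>) * p (unit_fam \<tau>)) \<le> q a)"
    by blast
qed

section \<open>Strong nuclearity\<close>

lemma lim_seminorm_tendsto:
  assumes sn: "seminorm_on V p" and V: "cfun.subspace V" and x: "x \<in> cauchy_seqs V p"
  shows "(\<lambda>j. p (x j)) \<longlonglongrightarrow> lim_seminorm p x"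
proof -
  have xV: "x j \<in> V" for j using x by (simp add: cauchy_seqs_def)
  have dV: "x i - x j \<in> V" for i j by (intro cfun.subspace_diff[OF V] xV)
  have tri: "p (a + b) \<le> p a + p b" if "a \<in> V" "b \<in> V" for a b using sn that by (simp add: seminorm_on_def)
  have le: "p (x i) - p (x j) \<le> p (x i - x j)" for i j
    using tri[OF dV[of i j] xV[of j]] by simp
  have "Cauchy (\<lambda>j. p (x j))"
  proof (rule CauchyI)
    fix e :: real assume "e > 0"
    then obtain N where N: "\<forall>i\<ge>N. \<forall>j\<ge>N. p (x i - x j) < e" using x by (auto simp: cauchy_seqs_def)
    have "norm (p (x i) - p (x j)) < e" if "i \<ge> N" "j \<ge> N" for i j
    proof -
      have "p (x i - x j) < e" "p (x j - x i) < e" using N that by auto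
      then show ?thesis using le[of i j] le[of j i] by (simp add: abs_less_iff)
    qed
    then show "\<exists>M. \<forall>m\<ge>M. \<forall>n\<ge>M. norm (p (x m) - p (x n)) < e" by blast
  qed
  then show ?thesis unfolding lim_seminorm_def by (simp add: Cauchy_convergent_iff convergent_LIMSEQ_iff)
qed

lemma constant_cauchy_seqs:
  assumes sn: "seminorm_on V p" and V: "cfun.subspace V" and a: "a \<in> V"
  shows "(\<lambda>_. a) \<in> cauchy_seqs V p" "lim_seminorm p (\<lambda>_. a) = p a"
proof -
  have "p (cscale 0 a) = cmod 0 * p a" using sn a unfolding seminorm_on_def by blast
  then have "p 0 = 0" by simp
  then show "(\<lambda>_. a) \<in> cauchy_seqs V p" using a by (auto simp: cauchy_seqs_def)
  show "lim_seminorm p (\<lambda>_. a) = p a" by (simp add: lim_seminorm_def)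
qed

text \<open>
  With the weight \<open>wt = (deg \<tau>)!\<close> to the power \<open>\<epsilon>/2\<close> the term \<open>a\<^sub>\<tau> unit\<^sub>\<tau>\<close> is written as
  \<open>(1 / wt) (a\<^sub>\<tau> / wt) (wt\<^sup>2 unit\<^sub>\<tau>)\<close>. The functional is bounded for the norm at \<open>\<epsilon>/2\<close>, the vector is bounded for the norm at
  \<open>\<epsilon>\<close>, and \<open>1 / wt\<close> is rapidly decreasing along \<open>graded_enumeration\<close>, where the number of a triple is at most
  exponential in its degree. An element of the completion for \<open>q\<close> is a Cauchy sequence, whose
  coefficients are the limits of the coefficients.
\<close>

lemma koethe_nuclear_map:
  fixes p :: "('n::finite triple \<Rightarrow> complex) \<Rightarrow> real"
  assumes sn: "seminorm_on subfactorial_growth p" and \<epsilon>: "0 < \<epsilon>" and C: "C > 0"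
    and p: "\<And>a. a \<in> subfactorial_growth \<Longrightarrow> p a \<le> C * subfactorial_norm \<epsilon> a"
  shows "strongly_nuclear_canonical_map subfactorial_growth (\<lambda>a. C * subfactorial_norm (\<epsilon>/2) a) p"
proof -
  let ?V = "subfactorial_growth :: ('n triple \<Rightarrow> complex) set"
  define \<delta> where "\<delta> = \<epsilon> / 2"
  have \<delta>: "\<delta> > 0" "\<epsilon> = \<delta> + \<delta>" using \<epsilon> by (auto simp: \<delta>_def)
  define q where "q = (\<lambda>a :: 'n triple \<Rightarrow> complex. C * subfactorial_norm \<delta> a)"
  define wt where "wt = (\<lambda>\<tau> :: 'n triple. (fact (deg \<tau>) :: real) powr \<delta>)"
  have wt: "wt \<tau> > 0" "fact (deg \<tau>) powr \<epsilon> = wt \<tau> * wt \<tau>" for \<tau>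
    unfolding wt_def \<delta>(2) powr_add by simp_all
  have sub: "cfun.subspace ?V" by (rule subfactorial_subspace)
  have qsn: "seminorm_on ?V q"
    using subfactorial_seminorm[OF \<delta>(1)] C unfolding q_def seminorm_on_def
    by (auto simp: mult.left_commute simp flip: distrib_left intro!: mult_left_mono)
  have pq: "p a \<le> q a" if "a \<in> ?V" for a
  proof -
    have "subfactorial_norm \<epsilon> a \<le> subfactorial_norm \<delta> a"
      using that \<delta> by (intro subfactorial_norm_antimono) auto
    then have "C * subfactorial_norm \<epsilon> a \<le> C * subfactorial_norm \<delta> a" using C by (intro mult_left_mono) auto
    then show ?thesis unfolding q_def using p[OF that] by linarith
  qed
  obtain idx :: "'n triple \<Rightarrow> nat" where idx: "inj idx" "\<And>\<tau>. idx \<tau> < level_base TYPE('n) ^ deg \<tau>"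
    using graded_enumeration by blast
  define T where "T = (\<lambda>k. inv idx k)"
  have T: "T (idx \<tau>) = \<tau>" for \<tau> using idx(1) by (simp add: T_def)
  \<comment> \<open>The enumeration need not be surjective; numbers that it misses contribute zero.\<close>
  define lam where "lam = (\<lambda>k. if k \<in> range idx then complex_of_real (1 / wt (T k)) else 0)"
  define \<phi> where "\<phi> = (\<lambda>k x. if k \<in> range idx then lim (\<lambda>j. x j (T k)) / of_real (wt (T k)) else (0 :: complex))"
  define y where "y = (\<lambda>k (j :: nat). if k \<in> range idx then cscale (of_real (wt (T k) * wt (T k))) (unit_fam (T k)) else 0)"
  have c: "\<exists>N. \<forall>i\<ge>N. \<forall>j\<ge>N. subfactorial_norm \<delta> (x i - x j) < e" if x: "x \<in> cauchy_seqs ?V q" and e: "e > 0" for x e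
  proof -
    have "C * e > 0" using C e by simp
    then obtain N where "\<forall>i\<ge>N. \<forall>j\<ge>N. q (x i - x j) < C * e" using x unfolding cauchy_seqs_def by blast
    then show ?thesis using C by (auto simp: q_def)
  qed
  have seq_in: "x j \<in> ?V" if "x \<in> cauchy_seqs ?V q" for x j using that by (simp add: cauchy_seqs_def)
  have xlim: "(\<lambda>j. x j \<tau>) \<longlonglongrightarrow> lim (\<lambda>j. x j \<tau>)" if "x \<in> cauchy_seqs ?V q" for x \<tau>
    by (rule subfactorial_cauchy_limit(1)[OF seq_in[OF that] \<delta>(1) c[OF that]])
  have xclose: "\<exists>N. \<forall>i\<ge>N. \<forall>\<tau>. cmod (x i \<tau> - lim (\<lambda>j. x j \<tau>)) \<le> e * wt \<tau>"
    if "x \<in> cauchy_seqs ?V q" "e > 0" for x e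
    unfolding wt_def by (rule subfactorial_cauchy_limit(2)[OF seq_in[OF that(1)] \<delta>(1) c[OF that(1)] that(2)])
  have "rapidly_decreasing lam"
    unfolding rapidly_decreasing_def
  proof
    fix m
    let ?B = "real (level_base TYPE('n)) ^ m"
    obtain c where c: "c > 0" "\<And>d. ?B ^ d \<le> c * fact d powr \<delta>"
      using power_le_fact_powr[of ?B \<delta>] \<delta>(1) by auto
    have "cmod (lam k) * real (k + 1) ^ m \<le> c" for k
    proof (cases "k \<in> range idx")
      case True
      then obtain \<tau> where \<tau>: "k = idx \<tau>" by blast
      have "real (k + 1) \<le> real (level_base TYPE('n)) ^ deg \<tau>"
        using of_nat_mono[OF Suc_leI[OF idx(2)[of \<tau>]], where 'a=real] by (simp add: \<tau>)
      then have "real (k + 1) ^ m \<le> (real (level_base TYPE('n)) ^ deg \<tau>) ^ m" by (intro power_mono) auto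
      also have "\<dots> = ?B ^ deg \<tau>" by (rule power_commuting_exponents)
      also have "\<dots> \<le> c * wt \<tau>" using c(2) by (simp add: wt_def)
      finally have "real (k + 1) ^ m \<le> c * wt \<tau>" .
      moreover have "cmod (lam k) = 1 / wt \<tau>" using wt(1)[of \<tau>] by (simp add: lam_def \<tau> T norm_divide)
      ultimately show ?thesis using wt(1)[of \<tau>] by (simp add: divide_le_eq mult.commute)
    next
      case False
      then show ?thesis using c(1) by (simp add: lam_def)
    qed
    then show "\<exists>C. \<forall>k. cmod (lam k) * real (k + 1) ^ m \<le> C" by blast
  qed
  \<comment> \<open>The functionals are bounded by \<open>1 / C\<close> and the vectors by \<open>C\<close>; the sum serves for both.\<close>
  moreover have "bounded_functional ?V q (C + 1 / C) (\<phi> k)" for k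
    unfolding bounded_functional_def
  proof (intro conjI ballI allI)
    fix x c assume x: "x \<in> cauchy_seqs ?V q"
    note L = xlim[OF x]
    show "\<phi> k (\<lambda>j. cscale c (x j)) = c * \<phi> k x"
      using limI[OF tendsto_mult_left[OF L[of "T k"], of c]] by (simp add: \<phi>_def cscale_def)
    show "\<phi> k (\<lambda>j. x j + y j) = \<phi> k x + \<phi> k y" if y: "y \<in> cauchy_seqs ?V q" for y
      using limI[OF tendsto_add[OF L[of "T k"] xlim[OF y, of "T k"]]] by (simp add: \<phi>_def pointwise add_divide_distrib)
    have xV: "x j \<in> ?V" for j using x by (simp add: cauchy_seqs_def)
    have q0: "0 \<le> q (x j)" for j using qsn xV by (simp add: seminorm_on_def)
    have lq: "(\<lambda>j. q (x j)) \<longlonglongrightarrow> lim_seminorm q x" by (rule lim_seminorm_tendsto[OF qsn sub x])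
    then have nn: "0 \<le> lim_seminorm q x" using q0 by (intro LIMSEQ_le_const) auto
    show "cmod (\<phi> k x) \<le> (C + 1 / C) * lim_seminorm q x"
    proof (cases "k \<in> range idx")
      case True
      have "cmod (lim (\<lambda>j. x j (T k))) \<le> (wt (T k) / C) * lim_seminorm q x"
      proof (rule LIMSEQ_le[OF tendsto_norm[OF L] tendsto_mult_left[OF lq]])
        have "cmod (x j (T k)) \<le> wt (T k) / C * q (x j)" for j
          using norm_le_subfactorial_norm[OF xV \<delta>(1), of j "T k"] C by (simp add: q_def wt_def mult.commute)
        then show "\<exists>N. \<forall>n\<ge>N. cmod (x n (T k)) \<le> wt (T k) / C * q (x n)" by blast
      qed
      then have "cmod (\<phi> k x) \<le> (1 / C) * lim_seminorm q x"
        using True wt(1)[of "T k"] by (simp add: \<phi>_def norm_divide divide_le_eq mult_ac)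
      also have "\<dots> \<le> (C + 1 / C) * lim_seminorm q x" using nn C by (intro mult_right_mono) auto
      finally show ?thesis .
    next
      case False
      then show ?thesis using nn C by (simp add: \<phi>_def)
    qed
  qed
  moreover have "y k \<in> cauchy_seqs ?V p \<and> lim_seminorm p (y k) \<le> C + 1 / C" for k
  proof -
    define a where "a = (if k \<in> range idx then cscale (of_real (wt (T k) * wt (T k))) (unit_fam (T k)) else 0)"
    have a: "a \<in> ?V"
      by (simp add: a_def cfun.subspace_scale[OF sub] unit_fam_subfactorial subfactorial_zero)
    have yk: "y k = (\<lambda>_. a)" by (simp add: y_def a_def)
    have "subfactorial_norm \<epsilon> a \<le> 1"
    proof (rule subfactorial_norm_le)
      fix \<sigma>
      have "0 \<le> wt (T k) * wt (T k)" using wt(1)[of "T k"] by simp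
      then show "cmod (a \<sigma>) \<le> 1 * fact (deg \<sigma>) powr \<epsilon>"
        unfolding wt(2) by (auto simp: a_def cscale_def unit_fam_def norm_mult pointwise)
    qed
    then have "p a \<le> C" using p[OF a] C mult_left_mono[of "subfactorial_norm \<epsilon> a" 1 C] by linarith
    moreover have "0 < 1 / C" using C by simp
    ultimately have "p a \<le> C + 1 / C" by linarith
    then show ?thesis unfolding yk using constant_cauchy_seqs[OF sn sub a] by simp
  qed
  moreover have "(\<lambda>N. lim_seminorm p (\<lambda>j. x j - (\<Sum>k<N. cscale (lam k * \<phi> k x) (y k j)))) \<longlonglongrightarrow> 0"
    if x: "x \<in> cauchy_seqs ?V q" for x
  proof -
    define X where "X = (\<lambda>\<tau>. lim (\<lambda>j. x j \<tau>))"
    \<comment> \<open>The partial sums of the representation are restrictions of the limit family \<open>X\<close>.\<close>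
    define P where "P = (\<lambda>N \<tau>. if idx \<tau> < N then X \<tau> else 0)"
    have xV: "x j \<in> ?V" for j using x by (simp add: cauchy_seqs_def)
    have part: "(\<Sum>k<N. cscale (lam k * \<phi> k x) (y k j)) = P N" for N j
    proof (rule ext)
      fix \<sigma>
      have "(lam k * \<phi> k x) * y k j \<sigma> = (if k = idx \<sigma> then X \<sigma> else 0)" for k
      proof (cases "k \<in> range idx")
        case True
        then obtain \<tau> where \<tau>: "k = idx \<tau>" by blast
        have ne: "(idx \<tau> = idx \<sigma>) = (\<tau> = \<sigma>)" using idx(1) by (auto dest: injD)
        show ?thesis using wt(1)[of \<tau>] unfolding \<tau> ne
          by (auto simp: lam_def \<phi>_def y_def T X_def cscale_def unit_fam_def)
      next
        case False
        then show ?thesis by (auto simp: lam_def)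
      qed
      then have "(\<Sum>k<N. cscale (lam k * \<phi> k x) (y k j)) \<sigma> = (\<Sum>k<N. if k = idx \<sigma> then X \<sigma> else 0)"
        by (simp add: sum_fun_apply cscale_def)
      then show "(\<Sum>k<N. cscale (lam k * \<phi> k x) (y k j)) \<sigma> = P N \<sigma>" by (simp add: P_def)
    qed
    have PV: "P N \<in> ?V" for N
    proof -
      have "finite {\<tau>. idx \<tau> < N}" using finite_vimageI[OF finite_lessThan idx(1), of N] by (simp add: vimage_def)
      then have "P N \<in> finsupp" by (rule finsuppI) (auto simp: P_def split: if_splits)
      then show ?thesis using finsupp_subfactorial by blast
    qed
    have XL: "\<exists>L. \<forall>\<tau>. cmod (X \<tau>) \<le> L * fact (deg \<tau>) powr \<delta>"
    proof -
      obtain N where N: "\<forall>i\<ge>N. \<forall>\<tau>. cmod (x i \<tau> - X \<tau>) \<le> 1 * wt \<tau>" using xclose[OF x, of 1] unfolding X_def by auto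
      have "cmod (X \<tau>) \<le> (subfactorial_norm \<delta> (x N) + 1) * wt \<tau>" for \<tau>
      proof -
        have "cmod (X \<tau>) \<le> cmod (x N \<tau>) + cmod (x N \<tau> - X \<tau>)" by (metis norm_minus_commute norm_triangle_sub)
        moreover have "cmod (x N \<tau>) \<le> subfactorial_norm \<delta> (x N) * wt \<tau>"
          using norm_le_subfactorial_norm[OF xV \<delta>(1)] by (simp add: wt_def)
        moreover have "cmod (x N \<tau> - X \<tau>) \<le> wt \<tau>" using N by simp
        ultimately show ?thesis by (simp add: distrib_right)
      qed
      then show ?thesis unfolding wt_def by blast
    qed
    show ?thesis unfolding part
    proof (rule LIMSEQ_I)
      fix r :: real assume r: "r > 0"
      \<comment> \<open>The distance of \<open>x j\<close> to \<open>X\<close> and the tail of \<open>X\<close> each cost \<open>C e\<close>.\<close>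
      define e where "e = r / (4 * C)"
      have e: "e > 0" "C * (2 * e) < r" using r C by (simp_all add: e_def)
      obtain L where L: "\<And>\<tau>. cmod (X \<tau>) \<le> L * fact (deg \<tau>) powr \<delta>" using XL by blast
      have "\<delta> < \<epsilon>" using \<delta> by simp
      from subfactorial_tail[OF L this e(1)] obtain d where d: "\<And>\<tau>. d < deg \<tau> \<Longrightarrow> cmod (X \<tau>) \<le> e * fact (deg \<tau>) powr \<epsilon>"
        by blast
      obtain J where J: "\<And>i \<tau>. i \<ge> J \<Longrightarrow> cmod (x i \<tau> - X \<tau>) \<le> e * wt \<tau>" using xclose[OF x e(1)] unfolding X_def by blast
      \<comment> \<open>From \<open>N0\<close> on, the partial sums contain all triples of degree at most \<open>d\<close>.\<close>
      define N0 where "N0 = Suc (Max (insert 0 (idx ` degs_upto d)))"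
      have N0: "idx \<tau> < N0" if "deg \<tau> \<le> d" for \<tau>
        unfolding N0_def less_Suc_eq_le using that card_degs_upto(1)[of d, where 'n='n]
        by (intro Max_ge) (auto simp: degs_upto_def)
      have small: "p (x j - P N) \<le> C * (2 * e)" if "j \<ge> J" "N \<ge> N0" for j N
      proof -
        have "subfactorial_norm \<epsilon> (x j - P N) \<le> 2 * e"
        proof (rule subfactorial_norm_le)
          fix \<tau>
          have w1: "wt \<tau> \<ge> 1" unfolding wt_def using \<delta>(1) by (intro fact_powr_ge_1) auto
          have 1: "cmod (x j \<tau> - X \<tau>) \<le> e * fact (deg \<tau>) powr \<epsilon>"
          proof -
            have "e * wt \<tau> * 1 \<le> e * wt \<tau> * wt \<tau>" using w1 e(1) by (intro mult_left_mono) auto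
            then show ?thesis unfolding wt(2) using J[OF that(1), of \<tau>] by simp
          qed
          have 2: "cmod (X \<tau> - P N \<tau>) \<le> e * fact (deg \<tau>) powr \<epsilon>"
          proof (cases "idx \<tau> < N")
            case True
            then show ?thesis using e(1) by (simp add: P_def)
          next
            case False
            then have "d < deg \<tau>" using N0[of \<tau>] that(2) by (meson le_trans linorder_not_less)
            then show ?thesis using False d by (simp add: P_def)
          qed
          have "cmod (x j \<tau> - P N \<tau>) \<le> cmod (x j \<tau> - X \<tau>) + cmod (X \<tau> - P N \<tau>)"
            using norm_triangle_ineq[of "x j \<tau> - X \<tau>" "X \<tau> - P N \<tau>"] by simp
          then show "cmod ((x j - P N) \<tau>) \<le> 2 * e * fact (deg \<tau>) powr \<epsilon>" using 1 2 by (simp add: pointwise)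
        qed
        then have "C * subfactorial_norm \<epsilon> (x j - P N) \<le> C * (2 * e)" using C by (intro mult_left_mono) auto
        then show ?thesis using p[OF cfun.subspace_diff[OF sub xV PV], of j N] by linarith
      qed
      have "norm (lim_seminorm p (\<lambda>j. x j - P N) - 0) < r" if N: "N \<ge> N0" for N
      proof -
        have cs: "(\<lambda>j. x j - P N) \<in> cauchy_seqs ?V p"
          unfolding cauchy_seqs_def
        proof (intro CollectI conjI allI impI)
          show "x j - P N \<in> ?V" for j by (intro cfun.subspace_diff[OF sub] xV PV)
          fix e :: real assume "e > 0"
          then obtain M where M: "\<forall>i\<ge>M. \<forall>j\<ge>M. q (x i - x j) < e" using x unfolding cauchy_seqs_def by blast
          have "p ((x i - P N) - (x j - P N)) < e" if "i \<ge> M" "j \<ge> M" for i j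
          proof -
            have "p (x i - x j) \<le> q (x i - x j)" by (intro pq cfun.subspace_diff[OF sub] xV)
            then show ?thesis using M that by (simp add: le_less_trans)
          qed
          then show "\<exists>N'. \<forall>i\<ge>N'. \<forall>j\<ge>N'. p ((x i - P N) - (x j - P N)) < e" by blast
        qed
        have lim: "(\<lambda>j. p (x j - P N)) \<longlonglongrightarrow> lim_seminorm p (\<lambda>j. x j - P N)"
          by (rule lim_seminorm_tendsto[OF sn sub cs])
        have "lim_seminorm p (\<lambda>j. x j - P N) \<le> C * (2 * e)"
          using small[OF _ N] by (intro LIMSEQ_le_const2[OF lim]) blast
        moreover have "0 \<le> p (x j - P N)" for j
          using sn cfun.subspace_diff[OF sub xV PV, of j N] unfolding seminorm_on_def by blast
        then have "0 \<le> lim_seminorm p (\<lambda>j. x j - P N)" by (intro LIMSEQ_le_const[OF lim]) blast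
        ultimately show ?thesis using e(2) by simp
      qed
      then show "\<exists>no. \<forall>n\<ge>no. norm (lim_seminorm p (\<lambda>j. x j - P n) - 0) < r" by blast
    qed
  qed
  ultimately show ?thesis
    unfolding strongly_nuclear_canonical_map_def q_def[symmetric] \<delta>_def[symmetric]
    by (intro exI[of _ lam] exI[of _ \<phi>] exI[of _ y] exI[of _ "C + 1 / C"]) blast
qed

lemma koethe_nuclear: "strongly_nuclear subfactorial_growth (koethe_top :: ('n::finite triple \<Rightarrow> complex) topology)"
  unfolding strongly_nuclear_def
proof (intro conjI allI impI)
  interpret K: seminormed_space subfactorial_growth "koethe_norms :: (('n triple \<Rightarrow> complex) \<Rightarrow> real) set"
    by (rule koethe_seminormed)
  show "locally_convex_space subfactorial_growth (koethe_top :: ('n triple \<Rightarrow> complex) topology)"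
    using koethe_algebra unfolding locally_convex_algebra_def by blast
  fix p :: "('n triple \<Rightarrow> complex) \<Rightarrow> real" assume "continuous_seminorm subfactorial_growth koethe_top p"
  then obtain p' C where C: "p' \<in> koethe_norms" "C > 0" "\<forall>a\<in>subfactorial_growth. p a \<le> C * p' a"
    and sn: "seminorm_on subfactorial_growth p"
    using K.continuous_seminorm_bound[of p] unfolding koethe_top_def continuous_seminorm_def by blast
  obtain \<epsilon> where \<epsilon>: "p' = subfactorial_norm \<epsilon>" "0 < \<epsilon>" "\<epsilon> < 1" using C(1) by auto
  let ?q = "\<lambda>a :: 'n triple \<Rightarrow> complex. C * subfactorial_norm (\<epsilon>/2) a"
  have "continuous_seminorm subfactorial_growth koethe_top ?q"
    unfolding koethe_top_def using C(2) \<epsilon> by (intro K.continuous_seminorm_member) auto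
  moreover have "p a \<le> ?q a" if "a \<in> subfactorial_growth" for a
  proof -
    have "C * subfactorial_norm \<epsilon> a \<le> ?q a"
      using C(2) \<epsilon> that by (intro mult_left_mono subfactorial_norm_antimono) auto
    then show ?thesis using C(3) that unfolding \<epsilon>(1) by fastforce
  qed
  moreover have "strongly_nuclear_canonical_map subfactorial_growth ?q p"
    using C(3) \<epsilon>(1) by (intro koethe_nuclear_map[OF sn \<epsilon>(2) C(2)]) blast
  ultimately show "\<exists>q. continuous_seminorm subfactorial_growth koethe_top q \<and>
      (\<forall>a\<in>subfactorial_growth. p a \<le> q a) \<and> strongly_nuclear_canonical_map subfactorial_growth q p"
    by blast
qed

section \<open>The star product algebra and its completion\<close>

lemma f_coeff_f_fun: "hb \<noteq> 0 \<Longrightarrow> f_coeff hb (f_fun hb \<tau>) = unit_fam \<tau>"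
  using f_coeff_lincomb[OF _ unit_fam_finsupp, of hb \<tau>] by (simp add: lincomb_unit_fam)

(* The six top-level conjuncts are (i)-(vi). In (iii), f_coeff embeds the algebra into its completion
   and mul is the continuous extension of the product; in (vi), \<delta> w is the continuous extension of
   the evaluation at w. *)
theorem theorem4p15:
  fixes hb :: complex
  assumes "hb \<noteq> 0"
  shows
    "(Hausdorff_space (A_top hb :: ('n::finite pt \<Rightarrow> complex) topology) \<and>
      locally_convex_algebra (A_space hb :: ('n pt \<Rightarrow> complex) set) (A_top hb) (star_tilde hb))
   \<and>
     (\<forall>w\<in>C_plus. continuous_map (A_top hb :: ('n pt \<Rightarrow> complex) topology) euclidean (\<lambda>a. a w))
   \<and>
     (dense_embedding (A_space hb :: ('n pt \<Rightarrow> complex) set) (A_top hb) (A_hat_top hb) (f_coeff hb) \<and>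
      (\<exists>mul.
         (\<forall>a \<in> (A_space hb :: ('n pt \<Rightarrow> complex) set). \<forall>b \<in> A_space hb.
            mul (f_coeff hb a) (f_coeff hb b) = f_coeff hb (star_tilde hb a b)) \<and>
         frechet_algebra (A_hat hb) (A_hat_top hb) mul))
   \<and>
     ((A_hat hb :: ('n triple \<Rightarrow> complex) set) = subfactorial_growth \<and>
      (\<forall>\<epsilon>\<in>{0<..<1}. seminorm_on (A_hat hb :: ('n triple \<Rightarrow> complex) set) (subfactorial_norm \<epsilon>)) \<and>
      (A_hat_top hb :: ('n triple \<Rightarrow> complex) topology) =
        seminorm_topology (A_hat hb) (subfactorial_norm ` {0<..<1}))
   \<and>
     ((\<exists>\<phi>. lc_isomorphism (A_hat hb :: ('n triple \<Rightarrow> complex) set) (A_hat_top hb)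
              (koethe_top :: ('n triple \<Rightarrow> complex) topology) \<phi>) \<and>
      strongly_nuclear (A_hat hb :: ('n triple \<Rightarrow> complex) set) (A_hat_top hb) \<and>
      absolute_schauder_basis (A_hat hb :: ('n triple \<Rightarrow> complex) set) (A_hat_top hb)
        (\<lambda>\<tau>. f_coeff hb (f_fun hb \<tau>)))
   \<and>
     (\<exists>\<delta> :: 'n pt \<Rightarrow> ('n triple \<Rightarrow> complex) \<Rightarrow> complex.
        (\<forall>w\<in>C_plus. continuous_map (A_hat_top hb) euclidean (\<delta> w) \<and>
                   (\<forall>a\<in>A_space hb. \<delta> w (f_coeff hb a) = a w)) \<and>
        (let \<iota> = (\<lambda>a w. if w \<in> C_plus then \<delta> w a else 0)
         in linear_map_on (A_hat hb) \<iota> \<and> inj_on \<iota> (A_hat hb) \<and>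
            continuous_map (A_hat_top hb) C0_plus_top \<iota>))"
proof (intro conjI)
  note AH = A_hat_eq[OF assms] and AT = A_hat_top_eq[OF assms]
  show "Hausdorff_space (A_top hb :: ('n pt \<Rightarrow> complex) topology)" by (rule cone_Hausdorff[OF assms])
  show "locally_convex_algebra (A_space hb :: ('n pt \<Rightarrow> complex) set) (A_top hb) (star_tilde hb)"
    by (rule cone_algebra[OF assms])
  show "\<forall>w\<in>C_plus. continuous_map (A_top hb :: ('n pt \<Rightarrow> complex) topology) euclidean (\<lambda>a. a w)"
    by (intro ballI cone_evaluation_continuous[OF assms])
  show "dense_embedding (A_space hb :: ('n pt \<Rightarrow> complex) set) (A_top hb) (A_hat_top hb) (f_coeff hb)"
    unfolding AT by (rule f_coeff_dense_embedding[OF assms])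
  show "\<exists>mul.
         (\<forall>a \<in> (A_space hb :: ('n pt \<Rightarrow> complex) set). \<forall>b \<in> A_space hb.
            mul (f_coeff hb a) (f_coeff hb b) = f_coeff hb (star_tilde hb a b)) \<and>
         frechet_algebra (A_hat hb) (A_hat_top hb) mul"
    unfolding AH AT frechet_algebra_def
    by (intro exI[of _ coeff_mul] conjI ballI koethe_frechet koethe_algebra)
       (simp add: f_coeff_star_tilde(2)[OF assms])
  show "(A_hat hb :: ('n triple \<Rightarrow> complex) set) = subfactorial_growth" by (rule AH)
  show "\<forall>\<epsilon>\<in>{0<..<1}. seminorm_on (A_hat hb :: ('n triple \<Rightarrow> complex) set) (subfactorial_norm \<epsilon>)"
    unfolding AH by (auto intro: subfactorial_seminorm)
  show "(A_hat_top hb :: ('n triple \<Rightarrow> complex) topology) =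
        seminorm_topology (A_hat hb) (subfactorial_norm ` {0<..<1})"
    unfolding AH AT koethe_top_def ..
  show "\<exists>\<phi>. lc_isomorphism (A_hat hb :: ('n triple \<Rightarrow> complex) set) (A_hat_top hb)
              (koethe_top :: ('n triple \<Rightarrow> complex) topology) \<phi>"
    unfolding AH AT lc_isomorphism_def
    by (intro exI[of _ id] conjI homeomorphic_map_id[THEN iffD2]) (auto simp: linear_map_on_def)
  show "strongly_nuclear (A_hat hb :: ('n triple \<Rightarrow> complex) set) (A_hat_top hb)"
    unfolding AH AT by (rule koethe_nuclear)
  show "absolute_schauder_basis (A_hat hb :: ('n triple \<Rightarrow> complex) set) (A_hat_top hb)
        (\<lambda>\<tau>. f_coeff hb (f_fun hb \<tau>))"
    unfolding AH AT f_coeff_f_fun[OF assms] by (rule koethe_schauder)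
  show "\<exists>\<delta> :: 'n pt \<Rightarrow> ('n triple \<Rightarrow> complex) \<Rightarrow> complex.
        (\<forall>w\<in>C_plus. continuous_map (A_hat_top hb) euclidean (\<delta> w) \<and>
                   (\<forall>a\<in>A_space hb. \<delta> w (f_coeff hb a) = a w)) \<and>
        (let \<iota> = (\<lambda>a w. if w \<in> C_plus then \<delta> w a else 0)
         in linear_map_on (A_hat hb) \<iota> \<and> inj_on \<iota> (A_hat hb) \<and>
            continuous_map (A_hat_top hb) C0_plus_top \<iota>)"
    unfolding AH AT Let_def
  proof (intro exI[of _ "evaluate hb"] conjI ballI)
    have \<iota>: "(\<lambda>a w. if w \<in> C_plus then evaluate hb w a else 0) = (sum_function hb :: ('n triple \<Rightarrow> complex) \<Rightarrow> _)"
      by (simp add: fun_eq_iff sum_function_def)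
    show "linear_map_on subfactorial_growth (\<lambda>(a :: 'n triple \<Rightarrow> complex) w. if w \<in> C_plus then evaluate hb w a else 0)"
      unfolding \<iota> by (rule sum_function_linear)
    show "inj_on (\<lambda>(a :: 'n triple \<Rightarrow> complex) w. if w \<in> C_plus then evaluate hb w a else 0) subfactorial_growth"
      unfolding \<iota> by (rule sum_function_inj[OF assms])
    show "continuous_map koethe_top C0_plus_top (\<lambda>(a :: 'n triple \<Rightarrow> complex) w. if w \<in> C_plus then evaluate hb w a else 0)"
      unfolding \<iota> by (rule sum_function_continuous)
  qed (auto intro: evaluate_continuous evaluate_f_coeff[OF assms])
qed

end
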